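(* Let $n\ge3$ and $1\le e<d<n$ be integers. Let $\mathcal L\subseteq\mathbb R^n$ be a lattice of rank $n$, and let $H$ be sufficiently large, more precisely $\lambda_n(\mathcal L)\ll_n H^{1/(nd)}$. Then the number of flags $\mathcal S^e\subseteq\mathcal S^d\subseteq\mathcal L$ of type $(e,d)$ such that $\mathcal S^e\cap\mathcal S^d_{d-e}=0$ and whose height twisted by $\mathcal L$ is at most $H$ is $$\frac{aH}{(\det\mathcal L)^d}\log\frac{H}{\varepsilon_e^d\,\varepsilon_d^{\,n-e}}+O\left(\sum_{j\in E_{n,e,d}}b_j(\mathcal L)H^{\gamma_j}\right),$$ where $\varepsilon_e=\min\{\det\mathcal X:\mathcal X\subseteq\mathcal L,\ \mathrm{rk}\,\mathcal X=e\}$ and $\varepsilon_d=\min\{\det\mathcal X:\mathcal X\subseteq\mathcal L,\ \mathrm{rk}\,\mathcal X=d\}$, $a$ is the constant depending only on $n,d,e$ specified in the context, the implied constant depends on $n$ only, $E_{n,e,d}$ is an index set of cardinality at most $3n^{3n+1}$, and each $j\in E_{n,e,d}$ is associated with a real number $\gamma_j\ge0$ and with $b_j(\mathcal L)=\prod_{i=1}^n(\det\mathcal L_i)^{-\beta_i}$ for some real $\beta_i\ge0$ (depending on $j$) satisfying $\sum_{i=1}^n i\beta_i=dn\gamma_j$. Furthermore, the largest $\gamma_j$ is $1$, and the next largest is either $$1-\frac{b(n,d)}{n},\qquad 1-\frac{b(d,e)(n-e)}{nd},\qquad\text{or}\qquad 1-\frac1n\left(1-\frac{2b(d,e)}{d}+\frac{1-b(d,e)}{n-e}\right);$$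 if $d\le n/2$, it is always $1-b(n,d)/n=1-1/(dn)$.
   Context: A flag of type $(e,d)$ of $\mathcal L$ is a pair of primitive sublattices $\mathcal S^e\subseteq\mathcal S^d\subseteq\mathcal L$ with $\mathrm{rk}\,\mathcal S^e=e$, $\mathrm{rk}\,\mathcal S^d=d$, where a sublattice $\mathcal A\subseteq\mathcal L$ is primitive if $\mathrm{span}_{\mathbb R}(\mathcal A)\cap\mathcal L=\mathcal A$. Its height twisted by $\mathcal L$ is $(\det\mathcal S^e)^d(\det\mathcal S^d)^{n-e}$, where the determinant of a lattice in $\mathbb R^n$ is its covolume within its real span. For a lattice $\mathcal M$ of rank $m$, the $i$-th successive minimum is $\lambda_i(\mathcal M)=\inf\{r>0:\dim\mathrm{span}_{\mathbb R}(\mathcal M\cap B(r))\ge i\}$, where $B(r)$ is the closed ball of radius $r$ about the origin. For each lattice $\mathcal M$ fix linearly independent $v_1,\dots,v_m\in\mathcal M$ with $\|v_i\|=\lambda_i(\mathcal M)$ and put $\mathcal M_i=\mathcal M\cap\mathrm{span}_{\mathbb R}(v_1,\dots,v_i)$; thus $\mathcal S^d_{d-e}=(\mathcal S^d)_{d-e}$ is the corresponding rank $d-e$ sublattice of $\mathcal S^d$. The notation $f\ll_n g$ means $f<Cg$ for a positive constant $C$ depending only on $n$. For integers $1\le k<m$, $b(m,k)=\max\left(\frac1k,\frac1{m-k}\right)$. The constant $a$ (an explicit constant depending only on $n,d,e$) is the one in the following theorem of Thunder: for $\mathcal L\subseteq\mathbb R^n$ a lattice of rank $n$ and $H$ sufficiently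 large, the number of flags $\mathcal S^e\subseteq\mathcal S^d\subseteq\mathcal L$ of type $(e,d)$ with $\mathcal S^i\cap\mathcal L_{n-i}=0$ for $i\in\{e,d\}$, $\mathcal S^e\cap\mathcal S^d_{d-e}=0$, and height twisted by $\mathcal L$ at most $H$, equals $$\frac{aH}{(\det\mathcal L)^d}\log\frac{H}{(\det\mathcal L)^d}+O\left(\frac{H}{(\det\mathcal L)^{d-b(n,d)(n-d)/n}(\det\mathcal L_{n-d})^{b(n,d)}}\right),$$ with implied constant depending only on $n$. *)

theory Defs
  imports "HOL-Analysis.Analysis"
begin

definition lattice_basis :: "'a::euclidean_space set \<Rightarrow> 'a set \<Rightarrow> bool" where
  "lattice_basis B M \<longleftrightarrow> independent B \<and> M = {\<Sum>b\<in>B. of_int (z b) *\<^sub>R b | z :: 'a \<Rightarrow> int. True}"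

text \<open>Lattices need not have full rank; the rank of a lattice \<open>M\<close> is \<open>dim M\<close>, the
  dimension of its real span.\<close>

definition is_lattice :: "'a::euclidean_space set \<Rightarrow> bool" where
  "is_lattice M \<longleftrightarrow> (\<exists>B. lattice_basis B M)"

definition sublattice :: "'a::euclidean_space set \<Rightarrow> 'a set \<Rightarrow> bool" where
  "sublattice A L \<longleftrightarrow> is_lattice A \<and> A \<subseteq> L"

definition primitive_sublattice :: "'a::euclidean_space set \<Rightarrow> 'a set \<Rightarrow> bool" where
  "primitive_sublattice A L \<longleftrightarrow> sublattice A L \<and> span A \<inter> L = A"

definition orthonormal_basis :: "'a::euclidean_space set \<Rightarrow> 'a set \<Rightarrow> bool" where
  "orthonormal_basis U V \<longleftrightarrow> pairwise orthogonal U \<and> (\<forall>u\<in>U. norm u = 1) \<and> span U = V"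

text \<open>The Lebesgue measure of a linear subspace \<open>V\<close>, as a measure on the ambient space
  concentrated on \<open>V\<close>: the product Lebesgue measure on coordinates with respect to an
  orthonormal basis of \<open>V\<close>. It does not depend on the basis.\<close>

definition subspace_lborel :: "'a::euclidean_space set \<Rightarrow> 'a measure" where
  "subspace_lborel V = (let U = (SOME U. orthonormal_basis U V) in
     distr (PiM U (\<lambda>_. lborel :: real measure)) borel (\<lambda>c. \<Sum>u\<in>U. c u *\<^sub>R u))"

definition fundamental_parallelepiped :: "'a::euclidean_space set \<Rightarrow> 'a set" where
  "fundamental_parallelepiped B = {\<Sum>b\<in>B. t b *\<^sub>R b | t. \<forall>b\<in>B. 0 \<le> t b \<and> t b < 1}"

text \<open>The covolume of \<open>M\<close> in its real span; it does not depend on the chosen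
  \<open>\<int>\<close>-basis.\<close>

definition lattice_det :: "'a::euclidean_space set \<Rightarrow> real" where
  "lattice_det M = measure (subspace_lborel (span M))
     (fundamental_parallelepiped (SOME B. lattice_basis B M))"

definition succ_min :: "nat \<Rightarrow> 'a::euclidean_space set \<Rightarrow> real" where
  "succ_min i M = Inf {r. r > 0 \<and> i \<le> dim (M \<inter> cball 0 r)}"

definition minimal_vectors :: "'a::euclidean_space set \<Rightarrow> (nat \<Rightarrow> 'a) \<Rightarrow> bool" where
  "minimal_vectors M v \<longleftrightarrow>
     (\<forall>i\<in>{1..dim M}. v i \<in> M \<and> norm (v i) = succ_min i M) \<and>
     inj_on v {1..dim M} \<and> independent (v ` {1..dim M})"

text \<open>\<open>chosen_minimal_vectors M\<close> is the family \<open>v\<^sub>1, \<dots>, v\<^sub>m\<close> fixed once and for all for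
  the lattice \<open>M\<close>, and \<open>minimal_sublattice M i\<close> is \<open>M\<^sub>i\<close>.\<close>

definition chosen_minimal_vectors :: "'a::euclidean_space set \<Rightarrow> nat \<Rightarrow> 'a" where
  "chosen_minimal_vectors M = (SOME v. minimal_vectors M v)"

definition minimal_sublattice :: "'a::euclidean_space set \<Rightarrow> nat \<Rightarrow> 'a set" where
  "minimal_sublattice M i = M \<inter> span (chosen_minimal_vectors M ` {1..i})"

definition flags :: "nat \<Rightarrow> nat \<Rightarrow> 'a::euclidean_space set \<Rightarrow> ('a set \<times> 'a set) set" where
  "flags e d L = {(A, B). primitive_sublattice A L \<and> primitive_sublattice B L \<and>
     A \<subseteq> B \<and> dim A = e \<and> dim B = d}"

fun twisted_height :: "'a::euclidean_space set \<Rightarrow> 'a set \<times> 'a set \<Rightarrow> real" where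
  "twisted_height L (A, B) = lattice_det A ^ dim B * lattice_det B ^ (dim L - dim A)"

text \<open>\<open>min_det i L\<close> is \<open>\<epsilon>\<^sub>i\<close>; the infimum is attained.\<close>

definition min_det :: "nat \<Rightarrow> 'a::euclidean_space set \<Rightarrow> real" where
  "min_det i L = Inf {lattice_det X | X. sublattice X L \<and> dim X = i}"

definition b_const :: "nat \<Rightarrow> nat \<Rightarrow> real" where
  "b_const m k = max (1 / real k) (1 / (real m - real k))"

definition counted_flags ::
    "nat \<Rightarrow> nat \<Rightarrow> 'a::euclidean_space set \<Rightarrow> real \<Rightarrow> ('a set \<times> 'a set) set" where
  "counted_flags e d L H = {(A, B) \<in> flags e d L.
     A \<inter> minimal_sublattice B (d - e) = {0} \<and> twisted_height L (A, B) \<le> H}"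

definition thunder_flags ::
    "nat \<Rightarrow> nat \<Rightarrow> 'a::euclidean_space set \<Rightarrow> real \<Rightarrow> ('a set \<times> 'a set) set" where
  "thunder_flags e d L H = {(A, B) \<in> counted_flags e d L H.
     A \<inter> minimal_sublattice L (dim L - e) = {0} \<and>
     B \<inter> minimal_sublattice L (dim L - d) = {0}}"

text \<open>Thunder's asymptotic formula in dimension \<open>n = DIM('a)\<close> with leading constant \<open>a\<close>.\<close>

definition thunder_asymptotics :: "'a::euclidean_space itself \<Rightarrow> nat \<Rightarrow> nat \<Rightarrow> real \<Rightarrow> bool" where
  "thunder_asymptotics _ d e a \<longleftrightarrow> (let n = DIM('a); b = b_const n d in
     \<exists>C>0. \<forall>L :: 'a set. is_lattice L \<and> dim L = n \<longrightarrow>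
       (\<forall>\<^sub>F H in at_top.
          \<bar>real (card (thunder_flags e d L H))
             - a * H / lattice_det L ^ d * ln (H / lattice_det L ^ d)\<bar>
          \<le> C * (H / (lattice_det L powr (real d - b * (real n - real d) / real n)
                     * lattice_det (minimal_sublattice L (n - d)) powr b))))"

text \<open>The formula determines \<open>a\<close>, since for fixed \<open>L\<close> its error term is \<open>O(H)\<close>.\<close>

definition thunder_const :: "'a::euclidean_space itself \<Rightarrow> nat \<Rightarrow> nat \<Rightarrow> real" where
  "thunder_const T d e = (THE a. thunder_asymptotics T d e a)"

end

theory Submission
  imports Defs "HOL-Real_Asymp.Real_Asymp"
begin

text \<open>Normalise to \<open>\<lambda>\<^sub>1(L) = 1\<close>. The number of primitive sublattices of rank \<open>k\<close> and determinant at most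
 \<open>T\<close> is \<open>c(k) (det L)\<^sup>-\<^sup>k T\<^sup>n\<close> up to a power saving. This goes by induction on \<open>k\<close>: pairs \<open>A \<subset> B\<close> of ranks \<open>k\<close>,
 \<open>k + 1\<close> are counted twice, for fixed \<open>A\<close> in the quotient lattice and for fixed \<open>B\<close> in the dual lattice.

 Flags are counted by their upper member \<open>B\<close>. With \<open>X = H / (det B)\<^sup>n\<close>, the number of admissible \<open>A\<close> in \<open>B\<close>
 is \<open>c X + O(X\<^sup>1\<^sup>-\<^sup>\<eta>)\<close> if \<open>X \<ge> 1\<close> and, since \<open>A \<inter> B\<^sub>d\<^sub>-\<^sub>e = 0\<close> excludes the sublattices of small determinant,
 \<open>O(X\<^sup>1\<^sup>+\<^sup>\<eta>)\<close> if \<open>X < 1\<close>, both up to a weight that is bounded on average over \<open>B\<close>. Abel summation over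
 \<open>B\<close> turns this into \<open>c c' H / (det L)\<^sup>d ln H + O(H)\<close>. Replacing \<open>H\<close> in the logarithm by \<open>H / (\<epsilon>\<^sub>e\<^sup>d \<epsilon>\<^sub>d\<^sup>n\<^sup>-\<^sup>e)\<close>
 costs \<open>O(H)\<close> again, and undoing the normalisation makes the error \<open>O(H / (det L\<^sub>1)\<^sup>n\<^sup>d)\<close>: a single term with
 exponent \<open>1\<close>. The same count restricted to flags in general position with respect to the \<open>L\<^sub>n\<^sub>-\<^sub>i\<close>
 identifies \<open>a = c c'\<close>.\<close>

section \<open>Discrete subgroups and orthogonal boxes\<close>

text \<open>The obstacle is uniformity: the error in counting sublattices of \<open>B\<close>
  depends on the shape of \<open>B\<close> and not only on \<open>ldet B\<close>. Here the shape
  enters through one number, the least determinant \<open>hmin B\<close> of a hyperplane sublattice,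
  and single errors are replaced by averages of negative powers of \<open>hmin B\<close> over all
  \<open>B\<close>. These averages are under control for exponents below the rank of
  \<open>B\<close>, because sorting the \<open>B\<close> by a minimal hyperplane \<open>mu B\<close>
  reduces them to counts one rank lower. The same sorting gives the crude upper bounds and the
  savings for sublattices in special position.

  The trivial intersection required of \<open>A\<close> yields a bound \<open>O(X)\<close> for the
  number of \<open>A\<close> that has no error term and holds for all \<open>X\<close>, however skew
  \<open>B\<close> is (\<open>restricted_bound\<close>).

  The constant \<open>a\<close> is given only as the unique number that satisfies Thunder's formula.
  Hence that formula has to be established too, with its explicit dependence on \<open>L\<close>:
  the threshold for \<open>H\<close> may depend on \<open>L\<close>, the constant in the error may
  not. The logarithms of \<open>ldet L\<close> that arise on the way are absorbed by a positive
  power of the ratio \<open>Delta\<close>.\<close>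

abbreviation (input) lev :: "('i => real) => 'i set => real => 'i set" where
 "lev h J t == {j : J. h j <= t}"

abbreviation (input) lay :: "('i => real) => 'i set => real => real => 'i set" where
 "lay h J s t == {j : J. s < h j & h j <= t}"

abbreviation (input) "ldet == lattice_det"

abbreviation (input) "dlev == lev ldet"

abbreviation (input) "dlay == lay ldet"

abbreviation (input) "rcard A == real (card A)"

abbreviation (input) "ubv k == unit_ball_vol (real k)"

text \<open>Discrete subgroups described without a basis: in this form intersections with subspaces,
  kernels and projections are handled directly. The equivalence with lattices given by a basis is
  \<open>latt_iff_is_lattice\<close>.\<close>

definition latt :: "'a::euclidean_space set => bool" where
 "latt M \<longleftrightarrow> 0 : M & (ALL x:M. ALL y:M. x - y : M) & (EX ep>0. ALL x:M. x ~= 0 --> ep <= norm x)"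

lemma latt_0 [simp]: "latt M ==> 0 : M" by (auto simp: latt_def)

lemma latt_diff: "latt M ==> x : M ==> y : M ==> x - y : M" by (auto simp: latt_def)

lemma latt_minus: "latt M ==> x : M ==> - x : M" using latt_diff[of M 0 x] by auto

lemma latt_add: "latt M ==> x : M ==> y : M ==> x + y : M" using latt_diff[of M x "-y"] latt_minus[of M y] by auto

lemma latt_scale_nat: "latt M ==> x : M ==> real n *\<^sub>R x : M" by (induction n) (auto simp: scaleR_add_left algebra_simps intro: latt_add)

lemma latt_scale: "latt M ==> x : M ==> of_int n *\<^sub>R x : M"
proof (cases "n >= 0")
 case True
 assume "latt M" "x : M"
 thus ?thesis using latt_scale_nat[of M x "nat n"] True by simp
next
 case False
 assume "latt M" "x : M"
 thus ?thesis using latt_scale_nat[of M "-x" "nat (-n)"] False latt_minus[of M x] by simp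
qed

lemma latt_sum: "latt M ==> (!!i. i : I ==> f i : M) ==> sum f I : M" by (induction I rule: infinite_finite_induct) (auto intro: latt_add)

lemma latt_subset:
 assumes "latt M" "A <= M" "0 : A" "!!x y. x : A ==> y : A ==> x - y : A"
 shows "latt A" using assms unfolding latt_def by blast

lemma latt_Int_subspace: "latt M ==> subspace V ==> latt (M Int V)" by (rule latt_subset[of M]) (auto simp: subspace_0 latt_diff subspace_diff)

lemma latt_Int_span: "latt M ==> latt (M Int span V)" by (simp add: latt_Int_subspace)

text \<open>Distinct points differ by a nonzero element of \<open>M\<close>, so they are at least
  \<open>e\<close> apart, and a bounded uniformly discrete set is finite.\<close>

lemma latt_finite:
 assumes "latt M" shows "finite (M Int cball 0 r)"
proof -
 from assms obtain e where e: "e > 0" "!!x. x : M ==> x ~= 0 ==> e <= norm x" by (auto simp: latt_def)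
 have "uniform_discrete (M Int cball 0 r)" unfolding uniform_discrete_def
 proof (intro exI[of _ e] conjI ballI impI)
  fix x y assume "x : M Int cball 0 r" "y : M Int cball 0 r" "dist x y < e"
  thus "x = y" using e(2)[of "x - y"] latt_diff[OF assms, of x y] by (force simp: dist_norm)
 qed (use e in auto)
 moreover have "bounded (M Int cball 0 r)" by (meson bounded_Int bounded_cball)
 ultimately show ?thesis using uniform_discrete_finite_iff by blast
qed

definition onb :: "'a::euclidean_space set => bool" where
 "onb U \<longleftrightarrow> finite U & pairwise orthogonal U & (ALL u:U. norm u = 1)"

lemma onb_independent: "onb U ==> independent U" unfolding onb_def using pairwise_orthogonal_independent[of U] by force

lemma onb_card: "onb U ==> card U = dim (span U)" using onb_independent dim_span_eq_card_independent by metis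

lemma onb_expand: "onb U ==> v : span U ==> (SUM u:U. (v \<bullet> u) *\<^sub>R u) = v" using orthonormal_basis_expand[of U v] by (auto simp: onb_def)

lemma onb_inner: "onb U ==> u : U ==> w : U ==> u \<bullet> w = (if u = w then 1 else 0)"
 by (auto simp: onb_def pairwise_def orthogonal_def norm_eq_1)

lemma onb_sum_inner: "onb U ==> w : U ==> (SUM u:U. f u *\<^sub>R u) \<bullet> w = f w"
proof -
 assume U: "onb U" "w : U"
 have "(SUM u:U. f u *\<^sub>R u) \<bullet> w = (SUM u:U. if u = w then f w else 0)" unfolding inner_sum_left using U by (intro sum.cong) (auto simp: onb_inner)
 thus ?thesis using U by (simp add: onb_def sum.delta)
qed

lemma onb_norm_sum: assumes "onb U" shows "norm (SUM u:U. f u *\<^sub>R u) = sqrt (SUM u:U. (f u)\<^sup>2)"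
proof -
 let ?x = "SUM u:U. f u *\<^sub>R u"
 have "?x \<bullet> ?x = (SUM w:U. ?x \<bullet> (f w *\<^sub>R w))" by (rule inner_sum_right)
 also have "... = (SUM w:U. (f w)\<^sup>2)" by (intro sum.cong refl) (simp add: onb_sum_inner[OF assms] power2_eq_square)
 finally show ?thesis by (simp add: norm_eq_sqrt_inner)
qed

lemma onb_norm_le: assumes "onb U" "v : span U" "!!u. u : U ==> abs (v \<bullet> u) <= c u"
 shows "norm v <= sum c U"
proof -
 have "norm v = norm (SUM u:U. (v \<bullet> u) *\<^sub>R u)" using onb_expand[OF assms(1,2)] by simp
 also have "... <= (SUM u:U. norm ((v \<bullet> u) *\<^sub>R u))" by (rule norm_sum)
 also have "... <= sum c U" using assms by (intro sum_mono) (auto simp: onb_def)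
 finally show ?thesis .
qed

lemma onb_insert:
 assumes "onb U" "norm u = 1" "!!a. a : span U ==> a \<bullet> u = 0"
 shows "onb (insert u U)" "u ~: U"
proof -
 show "u ~: U" using assms(2) assms(3)[of u] by (auto simp: span_base norm_eq_1)
 show "onb (insert u U)" using assms by (auto simp: onb_def pairwise_insert orthogonal_def span_base inner_commute)
qed

lemma span_insert_orth:
 assumes "onb (insert u U)" "u ~: U" "v : span (insert u U)" "v \<bullet> u = 0"
 shows "v : span U"
proof -
 have "v = (SUM w:insert u U. (v \<bullet> w) *\<^sub>R w)" using onb_expand assms by metis
 also have "... = (SUM w:U. (v \<bullet> w) *\<^sub>R w)" using assms by (simp add: onb_def)
 also have "... : span U" by (intro span_sum span_scale span_base)
 finally show ?thesis .
qed

text \<open>The box with orthonormal edge directions \<open>u \<in> U\<close> and edge lengths \<open>c u\<close> is a fundamental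
  domain of \<open>A\<close>. Unlike the fundamental parallelepiped of a basis it has an evident volume.\<close>

definition ofd :: "'a::euclidean_space set => 'a set => ('a => real) => bool" where
 "ofd A U c \<longleftrightarrow> onb U & (ALL u:U. 0 < c u) & span U = span A &
  (ALL v:span A. EX! z. z : A & (ALL u:U. 0 <= (v - z) \<bullet> u & (v - z) \<bullet> u < c u))"

lemma ofd_cover:
 assumes "ofd A U c" "v : span A"
 obtains z where "z : A" "norm (v - z) <= sum c U"
  "!!u. u : U ==> 0 <= (v - z) \<bullet> u" "!!u. u : U ==> (v - z) \<bullet> u < c u"
proof -
 from assms obtain z where z: "z : A" "!!u. u : U ==> 0 <= (v - z) \<bullet> u" "!!u. u : U ==> (v - z) \<bullet> u < c u"
  unfolding ofd_def by metis
 have "v - z : span U" using assms z(1) by (auto simp: ofd_def span_base intro: span_diff)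
 hence "norm (v - z) <= sum c U" using z assms(1) by (intro onb_norm_le) (auto simp: ofd_def less_imp_le)
 with z that show ?thesis by blast
qed

text \<open>If every edge were longer than \<open>x\<close>, the vector \<open>v\<close> formed from
  the positive coordinates of \<open>x\<close> would have two representatives, since both
  \<open>v\<close> and \<open>v - x\<close> lie in the box.\<close>

lemma ofd_norm_ge:
 assumes "ofd A U c" "latt A" "x : A" "x ~= 0" shows "EX u:U. c u <= norm x"
proof (rule ccontr)
 assume "~ ?thesis"
 hence lt: "!!u. u : U ==> norm x < c u" by force
 define v where "v = (SUM u:U. max 0 (x \<bullet> u) *\<^sub>R u)"
 have U: "onb U" "span U = span A" using assms by (auto simp: ofd_def)
 have v: "v : span A" unfolding v_def U(2)[symmetric] by (intro span_sum span_scale span_base)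
 have vu: "v \<bullet> u = max 0 (x \<bullet> u)" if "u : U" for u unfolding v_def using onb_sum_inner[OF U(1) that] by simp
 have ab: "abs (x \<bullet> u) < c u" if "u : U" for u using Cauchy_Schwarz_ineq2[of x u] lt[OF that] U(1) that by (auto simp: onb_def)
 have "EX! z. z : A & (ALL u:U. 0 <= (v - z) \<bullet> u & (v - z) \<bullet> u < c u)" using assms(1) v by (auto simp: ofd_def)
 moreover have "0 : A & (ALL u:U. 0 <= (v - 0) \<bullet> u & (v - 0) \<bullet> u < c u)" using assms(2) vu ab by (force simp: max_def)
 moreover have "x : A & (ALL u:U. 0 <= (v - x) \<bullet> u & (v - x) \<bullet> u < c u)" using assms(3) vu ab by (force simp: max_def inner_diff_left)
 ultimately show False using assms(4) by blast
qed

text \<open>The new edge points along the unit normal \<open>u\<close> of \<open>A\<close> in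
  \<open>M\<close>, and its length \<open>h\<close> is the least positive height
  \<open>x \<bullet> u\<close>. That a least height exists is the point: every \<open>x\<close> can
  be moved by \<open>A\<close>, without changing its height, to norm at most
  \<open>abs (x \<bullet> u) + sum c U\<close>, so bounded heights come from finitely many
  points.\<close>

lemma hyperplane_step:
 assumes M: "latt M" and A: "A = M Int span A" and dim: "dim M = Suc (dim A)" and box: "ofd A U c"
 obtains u h y where "norm u = 1" "!!a. a : span A ==> a \<bullet> u = 0" "u ~: U" "u : span M" "y : M" "y \<bullet> u = h" "h > 0"
  "!!x. x : M ==> EX n::int. x - of_int n *\<^sub>R y : A & x \<bullet> u = of_int n * h"
  "ofd M (insert u U) (c(u := h))"
proof -
 have U: "onb U" "span U = span A" "!!u. u : U ==> c u > 0" using box by (auto simp: ofd_def)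
 have AM: "A <= M" using A by blast
 have "~ M <= span A"
 proof
  assume "M <= span A"
  hence "dim M <= dim A" by (metis dim_subset dim_span)
  thus False using dim by simp
 qed
 then obtain x0 where x0: "x0 : M" "x0 ~: span A" by blast
 obtain a z where az: "a : span A" "!!w. w : span A ==> orthogonal z w" "x0 = a + z" using orthogonal_subspace_decomp_exists by metis
 have z0: "z ~= 0" using x0 az by auto
 define u where "u = z /\<^sub>R norm z"
 have nu: "norm u = 1" using z0 by (simp add: u_def)
 have orth: "w \<bullet> u = 0" if "w : span A" for w using az(2)[OF that] by (simp add: u_def orthogonal_def inner_commute)
 have I: "onb (insert u U)" "u ~: U" using onb_insert[OF U(1) nu] orth U(2) by auto
 have zM: "z : span M"
 proof -
  have "a : span M" using az(1) AM span_mono by blast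
  thus ?thesis using az(3) x0(1) by (metis add_diff_cancel_left' span_base span_diff)
 qed
 hence uM: "u : span M" by (simp add: u_def span_scale)
 have UM: "insert u U <= span M" using uM U(2) span_mono[OF AM] span_superset[of U] by auto
 have spM: "span (insert u U) = span M"
 proof -
  have "dim (insert u U) = dim M" using onb_card[OF I(1)] onb_card[OF U(1)] I dim U by (simp add: onb_def)
  hence "dim (span M) <= dim (insert u U)" by simp
  thus ?thesis using subspace_span UM by (metis dim_eq_span span_span)
 qed
 have x0u: "x0 \<bullet> u ~= 0"
 proof -
  have "x0 \<bullet> u = z \<bullet> u" using az orth by (simp add: inner_add_left)
  also have "... = norm z" using z0 by (simp add: u_def norm_eq_sqrt_inner divide_simps power2_eq_square flip: real_sqrt_mult)
  finally show ?thesis using z0 by simp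
 qed
 define x1 where "x1 = (if x0 \<bullet> u > 0 then x0 else - x0)"
 have x1: "x1 : M" "x1 \<bullet> u > 0" using x0 x0u M by (auto simp: x1_def latt_minus)
 define S where "S = {x \<bullet> u |x. x : M & 0 < x \<bullet> u & x \<bullet> u <= x1 \<bullet> u}"
 have lift: "EX a:A. norm (x - a) <= abs (x \<bullet> u) + sum c U" if "x : M" for x
 proof -
  define p where "p = x - (x \<bullet> u) *\<^sub>R u"
  have "p : span (insert u U)" unfolding p_def spM using that uM by (simp add: span_base span_diff span_scale)
  moreover have "p \<bullet> u = 0" using nu by (simp add: p_def inner_diff_left norm_eq_1)
  ultimately have "p : span A" using span_insert_orth[OF I] U by blast
  then obtain z where z: "z : A" "norm (p - z) <= sum c U" using ofd_cover[OF box] by metis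
  have "norm (x - z) = norm ((p - z) + (x \<bullet> u) *\<^sub>R u)" by (simp add: p_def)
  also have "... <= norm (p - z) + norm ((x \<bullet> u) *\<^sub>R u)" by (rule norm_triangle_ineq)
  finally show ?thesis using z nu by (intro bexI[of _ z]) auto
 qed
 have "S <= (%x. x \<bullet> u) ` (M Int cball 0 (x1 \<bullet> u + sum c U))"
 proof
  fix s assume "s : S"
  then obtain x where x: "x : M" "s = x \<bullet> u" "0 < x \<bullet> u" "x \<bullet> u <= x1 \<bullet> u" by (auto simp: S_def)
  obtain a where a: "a : A" "norm (x - a) <= abs (x \<bullet> u) + sum c U" using lift[OF x(1)] by blast
  have "(x - a) \<bullet> u = s" using orth[of a] a x by (simp add: inner_diff_left span_base)
  moreover have "x - a : M Int cball 0 (x1 \<bullet> u + sum c U)" using a x AM latt_diff[OF M] by auto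
  ultimately show "s : (%x. x \<bullet> u) ` (M Int cball 0 (x1 \<bullet> u + sum c U))" by force
 qed
 hence finS: "finite S" using latt_finite[OF M] finite_surj by metis
 have neS: "S ~= {}" using x1 by (auto simp: S_def)
 define h where "h = Min S"
 have "h : S" using Min_in finS neS by (simp add: h_def)
 then obtain y where y: "y : M" "y \<bullet> u = h" "h > 0" "h <= x1 \<bullet> u" by (auto simp: S_def)
 have hmin: "h <= x \<bullet> u" if "x : M" "x \<bullet> u > 0" for x
 proof (cases "x \<bullet> u <= x1 \<bullet> u")
  case True
  hence "x \<bullet> u : S" using that by (auto simp: S_def)
  thus ?thesis using finS by (simp add: h_def)
 qed (use y in simp)
 have A_iff: "x : A" if "x : M" "x \<bullet> u = 0" for x using span_insert_orth[OF I, of x] that spM U(2) A by (auto simp: span_base)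
 have int: "EX n::int. x - of_int n *\<^sub>R y : A & x \<bullet> u = of_int n * h" if "x : M" for x
 proof -
  define n where "n = \<lfloor>(x \<bullet> u) / h\<rfloor>"
  have xy: "x - of_int n *\<^sub>R y : M" using that y M by (simp add: latt_diff latt_scale)
  have e: "(x - of_int n *\<^sub>R y) \<bullet> u = x \<bullet> u - of_int n * h" using y by (simp add: inner_diff_left)
  have "of_int n <= (x \<bullet> u) / h" "(x \<bullet> u) / h < of_int n + 1" unfolding n_def by linarith+
  hence "0 <= (x - of_int n *\<^sub>R y) \<bullet> u" "(x - of_int n *\<^sub>R y) \<bullet> u < h" using y(3) e by (auto simp: field_simps)
  hence "(x - of_int n *\<^sub>R y) \<bullet> u = 0" using hmin[OF xy] by force
  thus ?thesis using A_iff[OF xy] e by auto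
 qed
 have "ofd M (insert u U) (c(u := h))" unfolding ofd_def
 proof (intro conjI ballI)
  fix v assume v: "v : span M"
  define n where "n = \<lfloor>(v \<bullet> u) / h\<rfloor>"
  define w where "w = v - of_int n *\<^sub>R y"
  have wu: "w \<bullet> u = v \<bullet> u - of_int n * h" using y by (simp add: w_def inner_diff_left)
  have n: "of_int n <= (v \<bullet> u) / h" "(v \<bullet> u) / h < of_int n + 1" unfolding n_def by linarith+
  hence wu2: "0 <= w \<bullet> u" "w \<bullet> u < h" using y(3) wu by (auto simp: field_simps)
  define p where "p = w - (w \<bullet> u) *\<^sub>R u"
  have "p : span (insert u U)" unfolding p_def w_def spM using v y uM by (simp add: span_base span_diff span_scale)
  moreover have "p \<bullet> u = 0" using nu by (simp add: p_def inner_diff_left norm_eq_1)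
  ultimately have pA: "p : span A" using span_insert_orth[OF I] U by blast
  hence ex1: "EX! z. z : A & (ALL u:U. 0 <= (p - z) \<bullet> u & (p - z) \<bullet> u < c u)" using box by (auto simp: ofd_def)
  have pu: "p \<bullet> u' = w \<bullet> u'" if "u' : U" for u' using onb_inner[OF I(1), of u u'] that I(2) by (auto simp: p_def inner_diff_left)
  from ex1 obtain z where z: "z : A" "!!u. u : U ==> 0 <= (p - z) \<bullet> u & (p - z) \<bullet> u < c u"
   and zu: "!!z'. z' : A ==> (!!u. u : U ==> 0 <= (p - z') \<bullet> u & (p - z') \<bullet> u < c u) ==> z' = z" by metis
  show "EX! z. z : M & (ALL ua:insert u U. 0 <= (v - z) \<bullet> ua & (v - z) \<bullet> ua < (c(u := h)) ua)"
  proof (intro ex1I[of _ "z + of_int n *\<^sub>R y"] conjI ballI)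
   show "z + of_int n *\<^sub>R y : M" using z y AM M by (auto intro: latt_add latt_scale)
  next
   fix ua assume ua: "ua : insert u U"
   have e: "v - (z + of_int n *\<^sub>R y) = w - z" by (simp add: w_def)
   have "z \<bullet> u = 0" using orth z by (simp add: span_base)
   thus "0 <= (v - (z + of_int n *\<^sub>R y)) \<bullet> ua" "(v - (z + of_int n *\<^sub>R y)) \<bullet> ua < (c(u := h)) ua"
    unfolding e using ua z pu wu2 I(2) by (auto simp: inner_diff_left)
  next
   fix z' assume z': "z' : M & (ALL ua:insert u U. 0 <= (v - z') \<bullet> ua & (v - z') \<bullet> ua < (c(u := h)) ua)"
   \<comment> \<open>Uniqueness: the height fixes the multiple of \<open>y\<close>, and what remains
     lies in \<open>A\<close>, where the representative is known to be unique.\<close>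
   obtain m :: int where m: "z' - of_int m *\<^sub>R y : A" "z' \<bullet> u = of_int m * h" using int z' by blast
   have "0 <= v \<bullet> u - of_int m * h" "v \<bullet> u - of_int m * h < h" using z' m(2) by (auto simp: inner_diff_left)
   hence "of_int m <= (v \<bullet> u) / h" "(v \<bullet> u) / h < of_int m + 1" using y(3) by (auto simp: field_simps)
   hence mn: "m = n" unfolding n_def by linarith
   have "z' - of_int m *\<^sub>R y = z"
   proof (rule zu[OF m(1)])
    fix ua assume ua: "ua : U"
    hence "ua ~= u" using I(2) by blast
    hence "0 <= (v - z') \<bullet> ua & (v - z') \<bullet> ua < c ua" using z' ua by (metis fun_upd_other insertCI)
    moreover have "(p - (z' - of_int m *\<^sub>R y)) \<bullet> ua = (v - z') \<bullet> ua" using pu[OF ua] mn by (simp add: inner_diff_left w_def)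
    ultimately show "0 <= (p - (z' - of_int m *\<^sub>R y)) \<bullet> ua & (p - (z' - of_int m *\<^sub>R y)) \<bullet> ua < c ua" by simp
   qed
   thus "z' = z + of_int n *\<^sub>R y" using mn by (metis diff_add_cancel)
  qed
 qed (use I y U spM in auto)
 with that[of u y h] nu orth I(2) uM y int show thesis by blast
qed

section \<open>Existence of boxes and of lattice bases\<close>

lemma exists_hyperplane:
 assumes "latt M" "dim M = Suc k"
 obtains A where "A = M Int span A" "dim A = k"
proof -
 obtain B where B: "B <= M" "independent B" "M <= span B" "card B = dim M" using basis_exists by metis
 have finB: "finite B" using B by (simp add: independent_imp_finite)
 obtain b where b: "b : B" using B assms finB by (metis card.empty ex_in_conv nat.distinct(1))
 define A where "A = M Int span (B - {b})"
 have sp: "span A = span (B - {b})"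
 proof (rule span_eq[THEN iffD2], intro conjI)
  show "B - {b} <= span A" using B(1) by (auto simp: A_def span_base intro!: span_base[of _ "M Int span (B - {b})"])
 qed (auto simp: A_def)
 have ind: "independent (B - {b})" using B(2) independent_mono by blast
 hence "dim (span (B - {b})) = card (B - {b})" by (rule dim_span_eq_card_independent)
 hence "dim A = k" using sp B(4) assms(2) b finB by (metis card_Diff_singleton diff_Suc_1 dim_span)
 with that[of A] sp show ?thesis by (simp add: A_def)
qed

lemma latt_dim0: "latt M ==> dim M = 0 ==> M = {0}" using latt_0 by (fastforce simp: dim_eq_0)

lemma latt_zero: "latt {0}" by (auto simp: latt_def intro: exI[of _ 1])

lemma ofd_zero: "ofd {0} {} c" by (auto simp: ofd_def onb_def)

lemma lattice_basis_subset:
 assumes "lattice_basis B M" shows "B <= M"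
proof
 have B: "finite B" "M = {SUM b:B. of_int (z b) *\<^sub>R b |z. True}" using assms by (auto simp: lattice_basis_def independent_imp_finite)
 fix b assume b: "b : B"
 have "(SUM b':B. of_int (if b' = b then 1 else 0) *\<^sub>R b') = (SUM b':B. if b' = b then b' else 0)" by (intro sum.cong) auto
 thus "b : M" unfolding B(2) using b B(1) by (intro CollectI exI[of _ "%b'. if b' = b then 1 else 0"]) simp
qed

text \<open>Both conclusions grow along the same chain of hyperplanes: the vector \<open>y\<close>
  of least height that extends the box also extends a basis over the integers.\<close>

lemma ofd_exists_basis:
 assumes "latt M" shows "EX U c. ofd M U c & is_lattice M" using assms
proof (induction "dim M" arbitrary: M)
 case 0
 hence "M = {0}" using latt_dim0 by metis
 moreover have "is_lattice {0::'a}" unfolding is_lattice_def lattice_basis_def by (rule exI[of _ "{}"]) (auto simp: independent_empty)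
 ultimately show ?case using ofd_zero by blast
next
 case (Suc k)
 obtain A where A: "A = M Int span A" "dim A = k" using exists_hyperplane Suc by metis
 have lA: "latt A" using A(1) latt_Int_span[OF Suc(3), of A] by simp
 then obtain U c where Uc: "ofd A U c" and "is_lattice A" using Suc(1) A(2) by metis
 then obtain B where B: "lattice_basis B A" by (auto simp: is_lattice_def)
 obtain u h y where s: "norm u = 1" "!!a. a : span A ==> a \<bullet> u = 0" "y : M" "y \<bullet> u = h" "h > 0"
  "!!x. x : M ==> EX n::int. x - of_int n *\<^sub>R y : A & x \<bullet> u = of_int n * h"
  "ofd M (insert u U) (c(u := h))" using hyperplane_step[OF Suc(3) A(1) _ Uc] Suc(2) A(2) by (metis)
 let ?x = "{SUM b:insert y B. of_int (z b) *\<^sub>R b |z. True}"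
 have indB: "independent B" and AB: "A = {SUM b:B. of_int (z b) *\<^sub>R b |z. True}" using B by (auto simp: lattice_basis_def)
 have finB: "finite B" using indB by (simp add: independent_imp_finite)
 have "B <= A" by (rule lattice_basis_subset[OF B])
 hence "span B <= span A" by (rule span_mono)
 hence "y ~: span B" using s(2)[of y] s(4,5) by auto
 hence ind: "independent (insert y B)" "y ~: B" using indB by (auto simp: independent_insert span_base)
 have "M = ?x"
 proof (intro equalityI subsetI)
  fix x assume "x : M"
  then obtain n :: int where "x - of_int n *\<^sub>R y : A" using s(6) by blast
  then obtain z where z: "x - of_int n *\<^sub>R y = (SUM b:B. of_int (z b) *\<^sub>R b)" unfolding AB by blast
  have "(SUM b:insert y B. of_int ((z(y := n)) b) *\<^sub>R b) = of_int n *\<^sub>R y + (SUM b:B. of_int (z b) *\<^sub>R b)"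
  proof -
   have "(SUM b:B. of_int ((z(y := n)) b) *\<^sub>R b) = (SUM b:B. of_int (z b) *\<^sub>R b)" using ind(2) by (intro sum.cong) auto
   thus ?thesis using finB ind(2) by simp
  qed
  also have "... = x" using z by (metis add_diff_cancel_left' add_diff_eq)
  finally show "x : ?x" by (intro CollectI exI[of _ "z(y := n)"]) simp
 next
  fix x assume "x : {SUM b:insert y B. of_int (z b) *\<^sub>R b |z::'a=>int. True}"
  thus "x : M" using Suc(3) s(3) \<open>B <= A\<close> A(1) by (auto intro!: latt_sum latt_scale)
 qed
 hence "is_lattice M" using ind(1) by (auto simp: is_lattice_def lattice_basis_def)
 thus ?case using s(7) by blast
qed

lemma lattice_basis_functional:
 fixes B :: "'a::euclidean_space set"
 assumes "independent B"
 obtains ph :: "'a => 'a => real" where "!!b. linear (ph b)"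
  "!!b t. b : B ==> ph b (SUM b':B. t b' *\<^sub>R b') = t b"
  "!!v. v : span B ==> v = (SUM b':B. ph b' v *\<^sub>R b')"
proof -
 have fin: "finite B" using assms by (simp add: independent_imp_finite)
 have "EX g::'a => real. linear g & (ALL x:B. g x = (if x = b then 1 else 0))" for b by (rule linear_independent_extend[OF assms])
 then obtain ph :: "'a => 'a => real" where p: "!!b. linear (ph b)" "!!b x. x : B ==> ph b x = (if x = b then 1 else 0)" by metis
 have e: "ph b (SUM b':B. t b' *\<^sub>R b') = t b" if "b : B" for b t
 proof -
  have "ph b (SUM b':B. t b' *\<^sub>R b') = (SUM b':B. t b' * ph b b')" using p(1)[of b] by (simp add: linear_sum linear_scale)
  also have "... = (SUM b':B. if b' = b then t b' else 0)" using p(2) by (intro sum.cong) auto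
  finally show ?thesis using that fin by simp
 qed
 moreover have "v = (SUM b':B. ph b' v *\<^sub>R b')" if v: "v : span B" for v
 proof -
  obtain t where "v = (SUM b':B. t b' *\<^sub>R b')" using v span_finite[OF fin] by (auto simp: image_iff)
  thus ?thesis using e by (metis (mono_tags, lifting) sum.cong)
 qed
 ultimately show ?thesis using that p(1) by blast
qed

text \<open>A nonzero point has some coordinate of absolute value at least one, and the coordinate
  functionals are bounded.\<close>

lemma is_lattice_imp_latt:
 fixes M :: "'a::euclidean_space set"
 assumes "is_lattice M" shows "latt M"
proof -
 obtain B where ind: "independent B" and MB: "M = {SUM b:B. of_int (z b) *\<^sub>R b | z. True}" using assms by (auto simp: is_lattice_def lattice_basis_def)
 have fin: "finite B" using ind by (simp add: independent_imp_finite)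
 obtain ph :: "'a => 'a => real" where p: "!!b. linear (ph b)"
  "!!b t. b : B ==> ph b (SUM b':B. t b' *\<^sub>R b') = t b"
  "!!v. v : span B ==> v = (SUM b':B. ph b' v *\<^sub>R b')" using lattice_basis_functional[OF ind] by blast
 have "EX K>0. ALL x. norm (ph b x) <= norm x * K" for b using p(1)[of b] bounded_linear.pos_bounded linear_conv_bounded_linear by blast
 then obtain K where K: "!!b. K b > 0" "!!b x. norm (ph b x) <= norm x * K b" by metis
 define e where "e = 1 / (1 + sum K B)"
 have sK: "sum K B >= 0" using K by (simp add: sum_nonneg less_imp_le)
 have "e <= norm x" if x: "x : M" "x ~= 0" for x
 proof -
  obtain z where z: "x = (SUM b:B. of_int (z b) *\<^sub>R b)" using x(1) unfolding MB by blast
  obtain b where b: "b : B" "z b ~= 0" using z x(2) by (metis (no_types, lifting) of_int_0 scale_eq_0_iff sum.neutral)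
  have "ph b x = of_int (z b)" unfolding z by (rule p(2)[OF b(1)])
  hence "1 <= norm (ph b x)" using b(2) by simp
  also have "... <= norm x * K b" by (rule K)
  also have "... <= norm x * (1 + sum K B)" using member_le_sum[OF b(1), of K] K(1) fin by (intro mult_left_mono) (auto simp: less_imp_le)
  finally show ?thesis using sK by (simp add: e_def field_simps)
 qed
 moreover have "e > 0" using sK by (simp add: e_def)
 moreover have "0 : M" unfolding MB by (rule CollectI, rule exI[of _ "%_. 0"]) simp
 moreover have "x - y : M" if xy: "x : M" "y : M" for x y
 proof -
  obtain z w where "x = (SUM b:B. of_int (z b) *\<^sub>R b)" "y = (SUM b:B. of_int (w b) *\<^sub>R b)" using xy unfolding MB by blast
  hence "x - y = (SUM b:B. of_int (z b - w b) *\<^sub>R b)" by (simp add: sum_subtractf scaleR_diff_left)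
  thus ?thesis unfolding MB by (intro CollectI exI[of _ "%b. z b - w b"]) simp
 qed
 ultimately show ?thesis unfolding latt_def by blast
qed

lemma latt_iff_is_lattice: "is_lattice M \<longleftrightarrow> latt M" using is_lattice_imp_latt ofd_exists_basis by blast

lemma ofd_exists: "latt M ==> EX U c. ofd M U c" using ofd_exists_basis by blast

section \<open>Counting points by volume\<close>

text \<open>Abstracts from the shape of the domain, so that the half-open parallelepiped of a basis
  and the orthogonal box can be compared through point counts alone.\<close>

definition fundom :: "'a::euclidean_space set => 'a set => real => bool" where
 "fundom A D rh \<longleftrightarrow> D : sets borel & D <= span A & (ALL x:D. norm x <= rh) &
  (ALL v:span A. EX! z. z : A & v - z : D)"

abbreviation coord_lborel :: "'a set => ('a => real) measure" where
 "coord_lborel U == Pi\<^sub>M U (%_. lborel)"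

definition comb :: "'a::euclidean_space set => ('a => real) => 'a" where
 "comb U f = (SUM u:U. f u *\<^sub>R u)"

lemma comb_measurable: "comb U : borel_measurable (coord_lborel U)" unfolding comb_def by measurable

lemma comb_span: "comb U f : span U" unfolding comb_def by (intro span_sum span_scale span_base)

text \<open>A product measure is determined by its values on rectangles, where translation
  invariance reduces to single coordinates.\<close>

lemma coord_lborel_shift:
 fixes a :: "'a => real"
 assumes "finite U"
 shows "distr (coord_lborel U) (coord_lborel U) (%f. \<lambda>u\<in>U. f u - a u) = coord_lborel U"
proof -
 let ?y = "%f. \<lambda>u\<in>U. f u - a u"
 interpret product_sigma_finite "%_::'a. lborel :: real measure" by standard
 have m: "?y : measurable (coord_lborel U) (coord_lborel U)" by measurable
 show ?thesis
 proof (rule PiM_eqI[OF assms])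
  let ?x = "distr (coord_lborel U) (coord_lborel U) ?y"
  show "sets ?x = sets (coord_lborel U)" by simp
  fix A :: "'a => real set" assume A: "!!i. i : U ==> A i : sets lborel"
  have "?y -` Pi\<^sub>E U A Int space (coord_lborel U) = Pi\<^sub>E U (%u. (%x. x - a u) -` A u)" by (auto simp: space_PiM PiE_iff)
  hence "emeasure ?x (Pi\<^sub>E U A)
    = emeasure (coord_lborel U) (Pi\<^sub>E U (%u. (%x. x - a u) -` A u))" using A assms by (subst emeasure_distr[OF m]) (auto intro!: sets_PiM_I_finite)
  also have "... = (PROD u:U. emeasure lborel ((%x. x - a u) -` A u))"
  proof (rule emeasure_PiM[OF assms])
   fix u assume "u : U"
   hence "A u : sets borel" using A by simp
   thus "(%x. x - a u) -` A u : sets lborel" using measurable_sets_borel[of "%x. x - a u" borel "A u"] by simp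
  qed
  also have "... = (PROD u:U. emeasure lborel (A u))"
  proof (intro prod.cong refl)
   fix u assume u: "u : U"
   have "emeasure lborel (A u) = emeasure (distr lborel borel ((+) (- a u))) (A u)" by (simp add: lborel_distr_plus)
   also have "... = emeasure lborel ((+) (- a u) -` A u Int space lborel)" using A[OF u] by (intro emeasure_distr) auto
   also have "(+) (- a u) -` A u Int space lborel = (%x. x - a u) -` A u" by auto
   finally show "emeasure lborel ((%x. x - a u) -` A u) = emeasure lborel (A u)" by simp
  qed
  finally show "emeasure ?x (Pi\<^sub>E U A) = (PROD i:U. emeasure lborel (A i))" .
 qed
qed

text \<open>Volume inside \<open>span U\<close>, in the coordinates of \<open>U\<close>. The
  orthonormal set is a parameter here, where \<open>subspace_lborel\<close> chooses one.\<close>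

definition vol :: "'a::euclidean_space set => 'a set => ennreal" where
 "vol U D = emeasure (coord_lborel U) {f : space (coord_lborel U). comb U f : D}"

lemma comb_sets: "D : sets borel ==> {f : space (coord_lborel U). comb U f : D} : sets (coord_lborel U)"
 using measurable_sets[OF comb_measurable, of D U] by (simp add: vimage_def Int_def conj_commute)

lemma vol_shift:
 assumes U: "onb U" and z: "z : span U" and D: "D : sets borel"
 shows "emeasure (coord_lborel U) {f : space (coord_lborel U). comb U f - z : D} = vol U D"
proof -
 let ?y = "{f : space (coord_lborel U). comb U f : D}"
 let ?x = "%f. \<lambda>u\<in>U. f u - z \<bullet> u"
 have m: "?x : measurable (coord_lborel U) (coord_lborel U)" by measurable
 have fin: "finite U" using U by (simp add: onb_def)
 have e: "comb U (\<lambda>u\<in>U. f u - z \<bullet> u) = comb U f - z" for f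
 proof -
  have "comb U (\<lambda>u\<in>U. f u - z \<bullet> u) = comb U f - (SUM u:U. (z \<bullet> u) *\<^sub>R u)" by (simp add: comb_def scaleR_diff_left sum_subtractf)
  thus ?thesis using onb_expand[OF U z] by simp
 qed
 have "vol U D = emeasure (distr (coord_lborel U) (coord_lborel U) ?x) ?y" unfolding vol_def coord_lborel_shift[OF fin] ..
 also have "... = emeasure (coord_lborel U) (?x -` ?y Int space (coord_lborel U))" by (rule emeasure_distr[OF m comb_sets[OF D]])
 also have "?x -` ?y Int space (coord_lborel U)
  = {f : space (coord_lborel U). comb U f - z : D}" using e by (auto simp: space_PiM)
 finally show ?thesis by simp
qed

lemma vol_cball:
 assumes "onb U" "r > 0"
 shows "vol U (cball 0 r) = ennreal (unit_ball_vol (rcard U) * r ^ card U)"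
proof -
 have "{f : space (coord_lborel U). comb U f : cball 0 r} = {f. sqrt (SUM i:U. (f i)\<^sup>2) <= r} Int space (coord_lborel U)"
  using onb_norm_sum[OF assms(1)] by (auto simp: comb_def)
 thus ?thesis using emeasure_cball_aux[of U r] assms by (simp add: vol_def onb_def)
qed

lemma vol_translates:
 assumes U: "onb U" "span U = span A" and D: "D : sets borel" and Z: "finite Z" "Z <= span A"
  and disj: "!!z w v. z : Z ==> w : Z ==> v : span A ==> v - z : D ==> v - w : D ==> z = w"
 shows "of_nat (card Z) * vol U D = emeasure (coord_lborel U) (UN z:Z. {f : space (coord_lborel U). comb U f - z : D})"
proof -
 let ?S = "%z. {f : space (coord_lborel U). comb U f - z : D}"
 have m: "?S z : sets (coord_lborel U)" for z
 proof -
  have "(%f. comb U f - z) : borel_measurable (coord_lborel U)" using comb_measurable by measurable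
  from measurable_sets[OF this D] show ?thesis by (simp add: vimage_def Int_def conj_commute)
 qed
 have "disjoint_family_on ?S Z" unfolding disjoint_family_on_def
 proof (intro ballI impI)
  fix z w assume "z : Z" "w : Z" "z ~= w"
  thus "?S z Int ?S w = {}" using disj comb_span[of U] U(2) by blast
 qed
 hence "emeasure (coord_lborel U) (UN z:Z. ?S z) = (SUM z:Z. emeasure (coord_lborel U) (?S z))" using m Z by (intro sum_emeasure[symmetric]) auto
 also have "... = (SUM z:Z. vol U D)" using Z U D by (intro sum.cong refl vol_shift) auto
 finally show ?thesis by simp
qed

text \<open>Disjoint translates of \<open>D\<close> by points of norm at most \<open>t\<close> fit
  into a ball of radius \<open>t + rh\<close>. Stated for arbitrary packings because it is applied
  to fundamental domains and to small balls.\<close>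

lemma packing_upper:
 assumes U: "onb U" "span U = span A" and D: "D : sets borel" "!!x. x : D ==> norm x <= rh"
  and Z: "finite Z" "Z <= span A Int cball 0 t" and t: "0 < t + rh"
  and disj: "!!z w v. z : Z ==> w : Z ==> v : span A ==> v - z : D ==> v - w : D ==> z = w"
 shows "of_nat (card Z) * vol U D <= ennreal (unit_ball_vol (rcard U) * (t + rh) ^ card U)"
proof -
 let ?x = "UN z:Z. {f : space (coord_lborel U). comb U f - z : D}"
 have "of_nat (card Z) * vol U D = emeasure (coord_lborel U) ?x" using Z by (intro vol_translates[OF U D(1) _ _ disj]) auto
 also have "... <= vol U (cball 0 (t + rh))" unfolding vol_def
 proof (intro emeasure_mono comb_sets subsetI)
  fix f assume "f : ?x"
  then obtain z where z: "z : Z" "f : space (coord_lborel U)" "comb U f - z : D" by blast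
  have "norm (comb U f) <= norm (comb U f - z) + norm z" using norm_triangle_ineq[of "comb U f - z" z] by simp
  also have "... <= rh + t" using D(2)[OF z(3)] Z z(1) by force
  finally show "f : {f : space (coord_lborel U). comb U f : cball 0 (t + rh)}" using z(2) by simp
 qed simp
 finally show ?thesis using vol_cball[OF U(1) t] by simp
qed

lemma fundom_count_upper:
 assumes A: "latt A" and U: "onb U" "span U = span A" and D: "fundom A D rh" and t: "0 < t + rh"
 shows "of_nat (card (A Int cball 0 t)) * vol U D <= ennreal (unit_ball_vol (rcard U) * (t + rh) ^ card U)"
proof (rule packing_upper[OF U])
 show "finite (A Int cball 0 t)" by (rule latt_finite[OF A])
 show "A Int cball 0 t <= span A Int cball 0 t" by (auto simp: span_base)
qed (use D t in \<open>auto simp: fundom_def\<close>)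

lemma fundom_count_lower:
 assumes A: "latt A" and U: "onb U" "span U = span A" and D: "fundom A D rh" and t: "rh < t"
 shows "ennreal (unit_ball_vol (rcard U) * (t - rh) ^ card U) <= of_nat (card (A Int cball 0 t)) * vol U D"
proof -
 let ?x = "UN z:A Int cball 0 t. {f : space (coord_lborel U). comb U f - z : D}"
 have Db: "D : sets borel" using D by (auto simp: fundom_def)
 have "ennreal (unit_ball_vol (rcard U) * (t - rh) ^ card U) = vol U (cball 0 (t - rh))" using vol_cball[OF U(1), of "t - rh"] t by simp
 also have "... <= emeasure (coord_lborel U) ?x" unfolding vol_def
 proof (intro emeasure_mono subsetI)
  fix f assume f: "f : {f : space (coord_lborel U). comb U f : cball 0 (t - rh)}"
  then obtain z where z: "z : A" "comb U f - z : D" using D comb_span[of U f] U by (auto simp: fundom_def)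
  have "norm z <= norm (comb U f) + norm (comb U f - z)" using norm_triangle_ineq4[of "comb U f" "comb U f - z"] by simp
  also have "... <= (t - rh) + rh" using f D z by (intro add_mono) (auto simp: fundom_def)
  finally show "f : ?x" using z f by auto
 next
  have "(%f. comb U f - z) : borel_measurable (coord_lborel U)" for z using comb_measurable by measurable
  from measurable_sets[OF this Db]
  have "{f : space (coord_lborel U). comb U f - z : D} : sets (coord_lborel U)" for z by (simp add: vimage_def Int_def conj_commute)
  thus "?x : sets (coord_lborel U)" using latt_finite[OF A] by (intro sets.finite_UN) auto
 qed
 also have "... = of_nat (card (A Int cball 0 t)) * vol U D" using latt_finite[OF A] D by (intro vol_translates[OF U Db, symmetric]) (auto simp: fundom_def span_base)
 finally show ?thesis .
qed

lemma card_cball_ge1: "latt A ==> 0 <= t ==> 1 <= card (A Int cball 0 t)"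
 using latt_finite[of A t] by (simp add: Suc_le_eq card_gt_0_iff) (metis Int_iff centre_in_cball empty_iff latt_0)

lemma fundom_vol_finite:
 assumes "latt A" "onb U" "span U = span A" "fundom A D rh"
 shows "vol U D < \<infinity>"
proof -
 let ?x = "card (A Int cball 0 (abs rh + 1))"
 have "of_nat ?x * vol U D < \<infinity>" by (rule le_less_trans[OF fundom_count_upper[OF assms]]) auto
 moreover have "1 * vol U D <= of_nat ?x * vol U D" using card_cball_ge1[OF assms(1), of "abs rh + 1"] by (intro mult_right_mono) auto
 ultimately show ?thesis by (simp add: le_less_trans)
qed

text \<open>The number of points in a ball of radius \<open>t\<close> is bounded above through the
  first domain and below through the second, by ball volumes whose ratio tends to one. Allowing two
  orthonormal sets shows at the same time that the coordinates do not matter.\<close>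

lemma fundom_vol_le:
 assumes A: "latt A" and U1: "onb U1" "span U1 = span A" and D1: "fundom A D1 rh1"
  and U2: "onb U2" "span U2 = span A" and D2: "fundom A D2 rh2"
 shows "enn2real (vol U1 D1) <= enn2real (vol U2 D2)"
proof -
 define k where "k = card U1"
 have k2: "card U2 = k" using onb_card[OF U1(1)] onb_card[OF U2(1)] U1(2) U2(2) by (simp add: k_def)
 define V where "V = ubv k"
 have V: "V > 0" by (simp add: V_def)
 define m1 where "m1 = enn2real (vol U1 D1)"
 define m2 where "m2 = enn2real (vol U2 D2)"
 have e1: "vol U1 D1 = ennreal m1" using fundom_vol_finite[OF A U1 D1] by (simp add: m1_def less_top)
 have e2: "vol U2 D2 = ennreal m2" using fundom_vol_finite[OF A U2 D2] by (simp add: m2_def less_top)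
 have nn: "m1 >= 0" "m2 >= 0" by (auto simp: m1_def m2_def)
 define N where "N = (%t. rcard (A Int cball 0 t))"
 have up: "N t * m1 <= V * (t + rh1) ^ k" if "0 < t + rh1" for t
 proof -
  have "ennreal (N t * m1) <= ennreal (V * (t + rh1) ^ k)" using fundom_count_upper[OF A U1 D1 that] nn by (simp add: N_def V_def k_def e1 ennreal_mult ennreal_of_nat_eq_real_of_nat)
  thus ?thesis using that V by (simp add: ennreal_le_iff)
 qed
 have lo: "V * (t - rh2) ^ k <= N t * m2" if "rh2 < t" for t
 proof -
  have "ennreal (V * (t - rh2) ^ k) <= ennreal (N t * m2)" using fundom_count_lower[OF A U2 D2 that] nn by (simp add: N_def V_def k2 e2 ennreal_mult ennreal_of_nat_eq_real_of_nat)
  thus ?thesis using nn by (simp add: ennreal_le_iff N_def)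
 qed
 have "m1 * (t - rh2) ^ k <= m2 * (t + rh1) ^ k" if "t > (abs (rh1)) + abs (rh2)" for t
 proof -
  have "V * (t - rh2) ^ k * m1 <= N t * m2 * m1" using lo[of t] that nn by (intro mult_right_mono) auto
  also have "... = (N t * m1) * m2" by simp
  also have "... <= V * (t + rh1) ^ k * m2" using up[of t] that nn by (intro mult_right_mono) auto
  finally have "V * (m1 * (t - rh2) ^ k) <= V * (m2 * (t + rh1) ^ k)" by (simp add: algebra_simps)
  thus ?thesis using V by simp
 qed
 hence ev: "eventually (%t. m1 * ((t - rh2) / (t + rh1)) ^ k <= m2) at_top"
  by (intro eventually_at_top_linorderI[of "abs (rh1) + abs (rh2) + 1"]) (simp add: power_divide divide_simps)
 have "((%t. (t - rh2) / (t + rh1)) \<longlongrightarrow> 1) at_top" by real_asymp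
 hence "((%t. m1 * ((t - rh2) / (t + rh1)) ^ k) \<longlongrightarrow> m1 * 1 ^ k) at_top" by (intro tendsto_intros)
 from tendsto_upperbound[OF this ev] show ?thesis by (simp add: m1_def m2_def)
qed

lemma fundom_functional:
 fixes ph :: "'i => 'a::euclidean_space => real"
 assumes "finite I" "!!i. i : I ==> linear (ph i)"
 shows "{v : span A. ALL i:I. 0 <= ph i v & ph i v < 1} : sets borel"
proof -
 have m: "ph i : borel_measurable borel" if "i : I" for i using assms(2)[OF that] by (intro borel_measurable_continuous_onI linear_continuous_on) (simp add: linear_conv_bounded_linear)
 have "{v : span A. ALL i:I. 0 <= ph i v & ph i v < 1} = span A Int (INT i : I. ph i -` {0..<1} Int space borel)" by auto
 also have "... : sets borel"
 proof (cases "I = {}")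
  case False
  thus ?thesis using m assms(1)  by (intro sets.Int sets.finite_INT measurable_sets[of _ borel borel]) (auto intro!: borel_closed closed_span)
 qed (auto intro!: borel_closed closed_span)
 finally show ?thesis .
qed

definition obox :: "'a::euclidean_space set => ('a => real) => 'a set" where
 "obox U c = {v : span U. ALL u:U. 0 <= v \<bullet> u & v \<bullet> u < c u}"

lemma fundom_obox:
 assumes "ofd A U c" shows "fundom A (obox U c) (sum c U)"
proof -
 have U: "onb U" "span U = span A" "!!u. u : U ==> c u > 0" using assms by (auto simp: ofd_def)
 have "obox U c = {v : span A. ALL u:U. 0 <= (v \<bullet> u) / c u & (v \<bullet> u) / c u < 1}"
 proof -
  have "0 <= v \<bullet> u & v \<bullet> u < c u \<longleftrightarrow> 0 <= (v \<bullet> u) / c u & (v \<bullet> u) / c u < 1" if "u : U" for v u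
   using U(3)[OF that] by (auto simp: field_simps)
  thus ?thesis unfolding obox_def U(2) by blast
 qed
 also have "... : sets borel"
 proof (rule fundom_functional)
  show "finite U" using U by (simp add: onb_def)
  show "linear (%v. (v \<bullet> u) / c u)" for u by (rule linearI) (simp_all add: inner_add_left add_divide_distrib)
 qed
 finally have b: "obox U c : sets borel" .
 show ?thesis unfolding fundom_def
 proof (intro conjI ballI)
  show "obox U c <= span A" using U by (auto simp: obox_def)
  show "norm x <= sum c U" if "x : obox U c" for x using that U by (intro onb_norm_le) (auto simp: obox_def less_imp_le)
  fix v assume v: "v : span A"
  have "z : A & v - z : obox U c \<longleftrightarrow> z : A & (ALL u:U. 0 <= (v - z) \<bullet> u & (v - z) \<bullet> u < c u)" for z
   using v U(2) by (auto simp: obox_def intro: span_diff span_base)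
  thus "EX! z. z : A & v - z : obox U c" using assms v unfolding ofd_def by presburger
 qed (rule b)
qed

lemma vol_obox:
 assumes "onb U" "!!u. u : U ==> c u > 0" shows "vol U (obox U c) = ennreal (PROD u:U. c u)"
proof -
 interpret product_sigma_finite "%_::'a. lborel :: real measure" by standard
 have fin: "finite U" using assms by (simp add: onb_def)
 have "{f : space (coord_lborel U). comb U f : obox U c} = Pi\<^sub>E U (%u. {0..<c u})" using comb_span[of U] onb_sum_inner[OF assms(1)]
  by (auto simp: obox_def space_PiM PiE_iff comb_def extensional_def)
 hence "vol U (obox U c) = emeasure (coord_lborel U) (Pi\<^sub>E U (%u. {0..<c u}))" by (simp add: vol_def)
 also have "... = (PROD u:U. emeasure lborel {0..<c u})" using fin by (intro emeasure_PiM) auto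
 also have "... = (PROD u:U. ennreal (c u))" using assms by (intro prod.cong) (auto simp: less_imp_le)
 also have "... = ennreal (PROD u:U. c u)" using assms by (intro prod_ennreal) (auto simp: less_imp_le)
 finally show ?thesis .
qed

text \<open>Rounding down the coordinates with respect to \<open>B\<close> produces the unique
  representative.\<close>

lemma fundom_parallelepiped:
 assumes "lattice_basis B M"
 shows "EX rh. fundom M (fundamental_parallelepiped B) rh"
proof -
 have ind: "independent B" and MB: "M = {SUM b:B. of_int (z b) *\<^sub>R b | z. True}" using assms by (auto simp: lattice_basis_def)
 have fin: "finite B" using ind by (simp add: independent_imp_finite)
 obtain ph :: "'a => 'a => real" where p: "!!b. linear (ph b)"
  "!!b t. b : B ==> ph b (SUM b':B. t b' *\<^sub>R b') = t b"
  "!!v. v : span B ==> v = (SUM b':B. ph b' v *\<^sub>R b')" using lattice_basis_functional[OF ind] by blast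
 let ?x = "{v : span M. ALL b:B. 0 <= ph b v & ph b v < 1}"
 have sumB: "(SUM b:B. t b *\<^sub>R b) : span B" for t by (intro span_sum span_scale span_base)
 have "B <= M" by (rule lattice_basis_subset[OF assms])
 moreover have "M <= span B"
 proof
  fix x assume "x : M"
  then obtain z :: "'a => int" where "x = (SUM b:B. of_int (z b) *\<^sub>R b)" unfolding MB by blast
  thus "x : span B" using sumB by simp
 qed
 ultimately have sp: "span M = span B" by (metis span_mono span_span subset_antisym)
 have F: "fundamental_parallelepiped B = ?x"
 proof (intro equalityI subsetI)
  fix v assume "v : fundamental_parallelepiped B"
  then obtain t where "v = (SUM b:B. t b *\<^sub>R b)" "ALL b:B. 0 <= t b & t b < 1" by (auto simp: fundamental_parallelepiped_def)
  thus "v : ?x" using p(2) sumB sp by auto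
 next
  fix v assume "v : ?x"
  thus "v : fundamental_parallelepiped B" unfolding fundamental_parallelepiped_def using p(3)[of v] sp by (intro CollectI exI[of _ "%b. ph b v"]) auto
 qed
 show ?thesis unfolding fundom_def
 proof (intro exI[of _ "SUM b:B. norm b"] conjI ballI)
  show "fundamental_parallelepiped B : sets borel" unfolding F by (rule fundom_functional[OF fin p(1)])
  show "fundamental_parallelepiped B <= span M" unfolding F by auto
  fix x assume "x : fundamental_parallelepiped B"
  then obtain t where t: "x = (SUM b:B. t b *\<^sub>R b)" "ALL b:B. 0 <= t b & t b < 1" by (auto simp: fundamental_parallelepiped_def)
  have "norm x <= (SUM b:B. norm (t b *\<^sub>R b))" unfolding t(1) by (rule norm_sum)
  also have "... <= (SUM b:B. norm b)" using t(2) by (intro sum_mono) (auto simp: mult_left_le_one_le)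
  finally show "norm x <= (SUM b:B. norm b)" .
 next
  fix v assume v: "v : span M"
  define z where "z = (SUM b:B. of_int \<lfloor>ph b v\<rfloor> *\<^sub>R b)"
  have zM: "z : M" unfolding z_def MB by (intro CollectI exI[of _ "%b. \<lfloor>ph b v\<rfloor>"]) simp
  have zp: "ph b z = of_int \<lfloor>ph b v\<rfloor>" if "b : B" for b unfolding z_def by (rule p(2)[OF that])
  show "EX! z. z : M & v - z : fundamental_parallelepiped B"
  proof (intro ex1I[of _ z] conjI)
   have "v - z : span M" using v zM by (simp add: span_base span_diff)
   moreover have "0 <= ph b (v - z) & ph b (v - z) < 1" if "b : B" for b using zp[OF that] p(1)[of b] by (simp add: linear_diff) linarith
   ultimately show "v - z : fundamental_parallelepiped B" unfolding F by blast
  next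
   fix w assume w: "w : M & v - w : fundamental_parallelepiped B"
   then obtain s :: "'a => int" where s: "w = (SUM b:B. of_int (s b) *\<^sub>R b)" unfolding MB by blast
   have "s b = \<lfloor>ph b v\<rfloor>" if "b : B" for b
   proof -
    have "ph b w = of_int (s b)" unfolding s by (rule p(2)[OF that])
    moreover have "0 <= ph b (v - w) & ph b (v - w) < 1" using w that unfolding F by blast
    ultimately show ?thesis using p(1)[of b] by (simp add: linear_diff) linarith
   qed
   thus "w = z" unfolding s z_def by (intro sum.cong) auto
  qed (rule zM)
 qed
qed

text \<open>\<open>ldet\<close> is defined through an arbitrary basis and an arbitrary orthonormal
  set. The parallelepiped and the box are both fundamental domains, so the volume may be read off
  the box instead.\<close>

theorem lattice_det_box:
 fixes A :: "'a::euclidean_space set"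
 assumes A: "latt A" and box: "ofd A U c"
 shows "ldet A = (PROD u:U. c u)"
proof -
 define B where "B = (SOME B. lattice_basis B A)"
 have "EX B. lattice_basis B A" using A latt_iff_is_lattice is_lattice_def by blast
 hence B: "lattice_basis B A" unfolding B_def by (rule someI_ex)
 define W where "W = (SOME W. orthonormal_basis W (span A))"
 obtain W0 where "pairwise orthogonal W0" "!!x. x : W0 ==> norm x = 1" "span W0 = span A" using orthonormal_basis_subspace[of "span A"] by (metis subspace_span)
 hence "orthonormal_basis W0 (span A)" by (auto simp: orthonormal_basis_def)
 hence "orthonormal_basis W (span A)" unfolding W_def by (rule someI)
 hence W: "pairwise orthogonal W" "!!u. u : W ==> norm u = 1" "span W = span A" by (auto simp: orthonormal_basis_def)
 have "independent W" using W pairwise_orthogonal_independent by (metis norm_zero zero_neq_one)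
 hence onbW: "onb W" using W independent_imp_finite by (auto simp: onb_def)
 have U: "onb U" "span U = span A" "!!u. u : U ==> c u > 0" using box by (auto simp: ofd_def)
 obtain rh where F: "fundom A (fundamental_parallelepiped B) rh" using fundom_parallelepiped[OF B] by blast
 have "ldet A = enn2real (vol W (fundamental_parallelepiped B))"
 proof -
  have "subspace_lborel (span A) = distr (coord_lborel W) borel (comb W)" by (simp add: subspace_lborel_def W_def[symmetric] Let_def comb_def[abs_def])
  hence "ldet A = measure (distr (coord_lborel W) borel (comb W)) (fundamental_parallelepiped B)" by (simp add: lattice_det_def B_def)
  also have "... = measure (coord_lborel W) (comb W -` fundamental_parallelepiped B Int space (coord_lborel W))" using F by (intro measure_distr comb_measurable) (auto simp: fundom_def)
  also have "comb W -` fundamental_parallelepiped B Int space (coord_lborel W) = {f : space (coord_lborel W). comb W f : fundamental_parallelepiped B}" by auto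
  finally show ?thesis by (simp add: vol_def measure_def)
 qed
 also have "... = enn2real (vol U (obox U c))" using fundom_vol_le[OF A onbW W(3) F U(1,2) fundom_obox[OF box]]
   fundom_vol_le[OF A U(1,2) fundom_obox[OF box] onbW W(3) F] by linarith
 also have "... = (PROD u:U. c u)" using U by (simp add: vol_obox prod_nonneg less_imp_le)
 finally show ?thesis .
qed

section \<open>Primitive sublattices and determinants\<close>

text \<open>The fixed point equation forces \<open>A\<close> into \<open>M\<close>, and
  \<open>A\<close> inherits \<open>latt\<close> from \<open>M\<close>
  (\<open>prim_latt\<close>).\<close>

definition prim :: "nat => 'a::euclidean_space set => 'a set set" where
 "prim k M = {A. A = M Int span A & dim A = k}"

abbreviation (input) "plev k M == dlev (prim k M)"

abbreviation pc :: "nat => 'a::euclidean_space set => real => real" where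
 "pc k M T == rcard (plev k M T)"

lemma primD: "A : prim k M ==> A = M Int span A" "A : prim k M ==> dim A = k" "A : prim k M ==> A <= M" unfolding prim_def by blast+

lemma prim_memI: "A : prim k M ==> x : M ==> x : span A ==> x : A" unfolding prim_def by blast

lemma prim_latt: "latt M ==> A : prim k M ==> latt A" using latt_Int_span[of M A] primD(1)[of A k M] by simp

lemma prim_trans: "A : prim j B ==> B : prim k M ==> A : prim j M"
proof -
 assume A: "A : prim j B" and B: "B : prim k M"
 have "span A <= span B" using primD(3)[OF A] by (rule span_mono)
 thus ?thesis using A B unfolding prim_def by blast
qed

lemma prim_down: "A : prim j M ==> A <= B ==> B <= M ==> A : prim j B" using span_superset[of A] unfolding prim_def by blast

lemma prim_span_inj: "A : prim j M ==> B : prim k M ==> span A = span B ==> A = B" by (metis primD(1))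

lemma prim_self: "M : prim (dim M) M" using span_superset[of M] unfolding prim_def by blast

lemma prim_top: assumes "A : prim (dim M) M" shows "A = M"
proof -
 have "span A = span M" using primD(3)[OF assms] primD(2)[OF assms] by (intro dim_eq_span) auto
 thus ?thesis using prim_span_inj[OF assms prim_self] by blast
qed

lemma prim_Int_span: "S <= M ==> M Int span S : prim (dim S) M"
proof -
 assume S: "S <= M"
 have "span (M Int span S) = span S" using S span_superset[of S] by (intro span_eq[THEN iffD2]) (auto intro: span_base)
 thus ?thesis unfolding prim_def by (metis (mono_tags) dim_span mem_Collect_eq)
qed

lemma prim_0: fixes M :: "'a::euclidean_space set" assumes "latt M" shows "prim 0 M = {{0}}"
proof -
 have 1: "A = {0}" if "A : prim 0 M" for A using latt_dim0[OF prim_latt[OF assms that] primD(2)[OF that]] .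
 have "M Int span {} : prim (dim ({}::'a set)) M" by (rule prim_Int_span) simp
 moreover have "M Int span {} = {0}" using latt_0[OF assms] by auto
 ultimately have "{0} : prim 0 M" by simp
 with 1 show ?thesis by blast
qed

lemma span_Int_span: "S <= M ==> span (M Int span S) = span S" using span_superset[of S] by (intro span_eq[THEN iffD2]) (auto intro: span_base)

lemma primitive_sublattice_iff:
 assumes "latt M" shows "primitive_sublattice A M & dim A = k \<longleftrightarrow> A : prim k M" using prim_latt[OF assms, of A k]
 unfolding primitive_sublattice_def sublattice_def latt_iff_is_lattice prim_def by blast

lemma det_pos: assumes "latt M" shows "ldet M > 0"
proof -
 obtain U c where "ofd M U c" using ofd_exists assms by blast
 thus ?thesis using lattice_det_box[OF assms] by (auto simp: ofd_def intro!: prod_pos)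
qed

lemma det_zero [simp]: "ldet {0::'a::euclidean_space} = 1" using lattice_det_box[OF latt_zero ofd_zero] by simp

text \<open>\<open>hyperplane_step\<close> with the height recognised as a quotient of determinants,
  since the box of \<open>M\<close> has one edge more than the box of \<open>A\<close>.\<close>

lemma det_step:
 assumes M: "latt M" and A: "A : prim k M" and dim: "dim M = Suc k" and box: "ofd A U c"
 obtains u h y where "norm u = 1" "!!a. a : span A ==> a \<bullet> u = 0" "u ~: U" "u : span M" "y : M" "y \<bullet> u = h" "h > 0"
  "!!x. x : M ==> EX n::int. x - of_int n *\<^sub>R y : A & x \<bullet> u = of_int n * h"
  "ofd M (insert u U) (c(u := h))" "h = ldet M / ldet A"
proof -
 have d: "dim M = Suc (dim A)" using dim primD(2)[OF A] by simp
 obtain u h y where s: "norm u = 1" "!!a. a : span A ==> a \<bullet> u = 0" "u ~: U" "u : span M" "y : M" "y \<bullet> u = h" "h > 0"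
  "!!x. x : M ==> EX n::int. x - of_int n *\<^sub>R y : A & x \<bullet> u = of_int n * h"
  "ofd M (insert u U) (c(u := h))" by (rule hyperplane_step[OF M primD(1)[OF A] d box]) blast
 have lA: "latt A" using prim_latt M A .
 have fin: "finite U" using box by (simp add: ofd_def onb_def)
 have "ldet M = h * (PROD w:U. (c(u := h)) w)" using lattice_det_box[OF M s(9)] fin s(3) by simp
 also have "(PROD w:U. (c(u := h)) w) = (PROD w:U. c w)" using s(3) by (intro prod.cong) auto
 also have "... = ldet A" using lattice_det_box[OF lA box] by simp
 finally have "h = ldet M / ldet A" using det_pos[OF lA] by simp
 with that s show thesis by blast
qed

text \<open>The component of \<open>x - p\<close> normal to \<open>A\<close> is a nonzero multiple
  of \<open>ldet M / ldet A\<close>, the distance between neighbouring translates of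
  \<open>span A\<close>.\<close>

lemma det_height_le:
 assumes M: "latt M" and A: "A : prim k M" and dim: "dim M = Suc k" and x: "x : M" "x ~: A" and p: "p : span A"
 shows "ldet M <= ldet A * norm (x - p)"
proof -
 have lA: "latt A" using prim_latt M A .
 obtain U c where box: "ofd A U c" using ofd_exists[OF lA] by blast
 obtain u h y where s: "norm u = 1" "!!a. a : span A ==> a \<bullet> u = 0" "h > 0"
  "!!x. x : M ==> EX n::int. x - of_int n *\<^sub>R y : A & x \<bullet> u = of_int n * h" "h = ldet M / ldet A" using det_step[OF M A dim box] by metis
 obtain n :: int where n: "x - of_int n *\<^sub>R y : A" "x \<bullet> u = of_int n * h" using s(4)[OF x(1)] by blast
 have "n ~= 0" using n x by auto
 hence "1 <= abs (real_of_int n)" by linarith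
 hence "h <= abs ((x - p) \<bullet> u)" using n s(2)[OF p] s(3) by (simp add: inner_diff_left abs_mult)
 also have "... <= norm (x - p)" using Cauchy_Schwarz_ineq2[of "x - p" u] s(1) by simp
 finally show ?thesis using s(5) det_pos[OF lA] by (simp add: field_simps)
qed

lemma prim_extend:
 assumes "latt M" "A : prim k M" "x : M" "x ~: A"
 shows "M Int span (insert x A) : prim (Suc k) M" "A : prim k (M Int span (insert x A))" "x : M Int span (insert x A)"
  "latt (M Int span (insert x A))" "dim (M Int span (insert x A)) = Suc k"
proof -
 let ?x = "M Int span (insert x A)"
 have "x ~: span A" using assms prim_memI by blast
 hence d: "dim (insert x A) = Suc k" using primD(2)[OF assms(2)] by (simp add: dim_insert)
 have s: "insert x A <= M" using assms primD(3) by auto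
 show 1: "M Int span (insert x A) : prim (Suc k) M" using prim_Int_span[OF s] d by simp
 show "A : prim k ?x"
 proof (rule prim_down[OF assms(2)])
  show "A <= M Int span (insert x A)" using primD(3)[OF assms(2)] span_superset[of "insert x A"] by blast
 qed simp
 show "x : M Int span (insert x A)" using assms by (auto intro: span_base)
 show "latt ?x" by (rule latt_Int_span[OF assms(1)])
 show "dim ?x = Suc k" using 1 primD by blast
qed

section \<open>Reduction theory: boxes with controlled edges\<close>

lemma chain_box:
 assumes Q: "latt Q" and "finite S" "S <= Q" "independent S" "!!x. x : S ==> norm x <= om"
 shows "EX U c. ofd (Q Int span S) U c & (ALL u:U. c u <= om)" using assms(2-)
proof (induction S rule: finite_induct)
 case empty
 have "Q Int span {} = {0}" using Q by auto
 thus ?case using ofd_zero by (metis empty_iff)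
next
 case (insert x S)
 define A where "A = Q Int span S"
 have iS: "independent S" using insert.prems(2) independent_mono by blast
 obtain U c where box: "ofd A U c" and cU: "!!u. u : U ==> c u <= om" using insert.IH insert.prems iS by (auto simp: A_def)
 have A: "A : prim (dim S) Q" using prim_Int_span insert.prems by (auto simp: A_def)
 have sA: "span A = span S" unfolding A_def using insert.prems(1) by (intro span_Int_span) auto
 have xA: "x ~: A" using insert.prems(2) insert.hyps(2) by (simp add: A_def independent_insert)
 have xQ: "x : Q" using insert.prems by auto
 have spi: "span (insert x A) = span (insert x S)" using sA by (simp add: span_insert)
 define B where "B = Q Int span (insert x S)"
 note E = prim_extend[OF Q A xQ xA, unfolded spi, folded B_def]
 have lA: "latt A" using Q A prim_latt by blast
 obtain u h y where s: "u ~: U" "ofd B (insert u U) (c(u := h))" "h = ldet B / ldet A" using det_step[OF E(4,2,5) box] by metis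
 \<comment> \<open>The new edge is at most the distance from \<open>x\<close> to any point of
   \<open>span A\<close>; the origin gives the bound \<open>norm x\<close>.\<close>
 have "ldet B <= ldet A * norm (x - 0)" by (rule det_height_le[OF E(4,2,5,3) xA]) (rule span_0)
 hence "h <= norm x" using s(3) det_pos[OF lA] by (simp add: pos_divide_le_eq mult.commute)
 hence "h <= om" using insert.prems(3)[of x] by simp
 hence "ALL w:insert u U. (c(u := h)) w <= om" using cU s(1) by auto
 thus ?case using s(2) B_def by blast
qed

text \<open>Otherwise some \<open>v\<close> of length \<open>2 * rh\<close> is orthogonal to all
  short points. A lattice point within \<open>rh\<close> of \<open>v\<close> has norm at most
  \<open>3 * rh\<close>, so it is itself orthogonal to \<open>v\<close>, which puts it at distance
  at least \<open>2 * rh\<close>.\<close>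

lemma ofd_span_cball:
 assumes box: "ofd A U c"
 shows "span (A Int cball 0 (3 * sum c U)) = span A"
proof (cases "U = {}")
 case True
 hence "span A = {0}" using box by (auto simp: ofd_def)
 thus ?thesis by (metis Int_lower1 span_0 span_mono subset_singletonD singletonD empty_iff)
next
 case False
 define rh where "rh = sum c U"
 have rh: "rh > 0" unfolding rh_def using False box by (intro sum_pos) (auto simp: ofd_def onb_def)
 let ?S = "A Int cball 0 (3 * rh)"
 have sub: "span ?S <= span A" by (intro span_mono) auto
 have "span ?S = span A"
 proof (rule ccontr)
  assume "~ ?thesis"
  hence "span ?S \<subset> span A" using sub by blast
  then obtain x where x: "x ~= 0" "x : span A" "!!y. y : span ?S ==> orthogonal x y" using orthogonal_to_subspace_exists_gen by blast
  define v where "v = (2 * rh / norm x) *\<^sub>R x"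
  have nv: "norm v = 2 * rh" using x rh by (simp add: v_def)
  have vA: "v : span A" using x by (simp add: v_def span_scale)
  obtain z where z: "z : A" "norm (v - z) <= rh" using ofd_cover[OF box vA] by (metis rh_def)
  have "norm z <= norm v + norm (v - z)" using norm_triangle_ineq4[of v "v - z"] by simp
  hence "z : ?S" using z nv by simp
  hence "orthogonal v z" using x(3)[of z] by (simp add: v_def orthogonal_def span_base)
  hence "(norm v)\<^sup>2 + (norm z)\<^sup>2 = (norm (v - z))\<^sup>2" by (simp add: power2_norm_eq_inner inner_diff_left inner_diff_right orthogonal_def inner_commute)
  also have "... <= rh\<^sup>2" using z(2) by (simp add: power_mono)
  finally have "(2 * rh)\<^sup>2 <= rh\<^sup>2" using nv by (smt (verit) zero_le_power2)
  thus False using rh by (simp add: power2_eq_square)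
 qed
 thus ?thesis by (simp add: rh_def)
qed

text \<open>The exchange argument of basis reduction. A vector \<open>y\<close> outside
  \<open>A\<close>, reduced modulo \<open>y1\<close>, spans together with \<open>A2\<close> a
  competing hyperplane. Minimality of \<open>A\<close> then bounds the square of the height
  \<open>h1\<close> over \<open>A2\<close> by \<open>h2\<^sup>2 + h1\<^sup>2 / 4\<close>.\<close>

lemma swap_step:
 assumes B: "latt B" "dim B = Suc (Suc k)" and A: "A : prim (Suc k) B" and A2: "A2 : prim k A"
  and mn: "!!A'. A' : prim (Suc k) B ==> ldet A <= ldet A'"
 shows "ldet A / ldet A2 <= 2 * (ldet B / ldet A)"
proof -
 have lA: "latt A" "latt A2" using B A A2 prim_latt by blast+
 have dA: "dim A = Suc k" using A primD by blast
 obtain U c where box: "ofd A2 U c" using ofd_exists lA by blast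
 obtain u1 h1 y1 where s1: "norm u1 = 1" "!!a. a : span A2 ==> a \<bullet> u1 = 0" "u1 ~: U" "u1 : span A" "y1 : A" "y1 \<bullet> u1 = h1" "h1 > 0"
  "!!x. x : A ==> EX n::int. x - of_int n *\<^sub>R y1 : A2 & x \<bullet> u1 = of_int n * h1"
  "ofd A (insert u1 U) (c(u1 := h1))" "h1 = ldet A / ldet A2" by (rule det_step[OF lA(1) A2 dA box]) blast
 obtain u2 h2 y2 where s2: "norm u2 = 1" "!!a. a : span A ==> a \<bullet> u2 = 0" "u2 : span B" "y2 : B" "y2 \<bullet> u2 = h2" "h2 > 0"
  "ofd B (insert u2 (insert u1 U)) ((c(u1 := h1))(u2 := h2))" "h2 = ldet B / ldet A" "u2 ~: insert u1 U" by (rule det_step[OF B(1) A B(2) s1(9)]) blast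
 \<comment> \<open>Rounding makes the component of \<open>y\<close> along \<open>u1\<close> at most
   half of \<open>h1\<close>, while its height over \<open>A\<close> remains
   \<open>h2\<close>.\<close>
 define n where "n = round ((y2 \<bullet> u1) / h1)"
 define y where "y = y2 - of_int n *\<^sub>R y1"
 have yB: "y : B" unfolding y_def using B(1) s2(4) s1(5) primD(3)[OF A] by (auto intro!: latt_diff latt_scale)
 have yu2: "y \<bullet> u2 = h2" using s2(2)[of y1] s1(5) s2(5) by (simp add: y_def inner_diff_left span_base)
 have yu1: "abs (y \<bullet> u1) <= h1 / 2"
 proof -
  have "abs (of_int n - (y2 \<bullet> u1) / h1) <= 1 / 2" unfolding n_def by (rule of_int_round_abs_le)
  moreover have "y \<bullet> u1 = - (of_int n - (y2 \<bullet> u1) / h1) * h1" using s1(6,7) by (simp add: y_def inner_diff_left field_simps)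
  ultimately show ?thesis using s1(7) by (simp add: abs_mult abs_minus_commute)
 qed
 have onbB: "onb (insert u2 (insert u1 U))" "span (insert u2 (insert u1 U)) = span B" using s2(7) by (auto simp: ofd_def)
 have fin: "finite U" using box by (auto simp: ofd_def onb_def)
 define p where "p = (SUM u:U. (y \<bullet> u) *\<^sub>R u)"
 have pA2: "p : span A2" unfolding p_def using box by (intro span_sum span_scale) (auto simp: ofd_def intro: span_base)
 have "y = (SUM u:insert u2 (insert u1 U). (y \<bullet> u) *\<^sub>R u)" using onb_expand[OF onbB(1)] yB onbB(2) by (metis span_base)
 hence yp: "y - p = (y \<bullet> u2) *\<^sub>R u2 + (y \<bullet> u1) *\<^sub>R u1" using fin s1(3) s2(9) by (simp add: p_def algebra_simps)
 have u12: "u2 \<bullet> u1 = 0" using s2(2)[OF s1(4)] by (simp add: inner_commute)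
 have "(norm (y - p))\<^sup>2 = (y \<bullet> u2)\<^sup>2 + (y \<bullet> u1)\<^sup>2" unfolding yp power2_norm_eq_inner using s1(1) s2(1) u12
  by (simp add: inner_add_left inner_add_right norm_eq_1 inner_commute power2_eq_square)
 also have "... <= h2\<^sup>2 + (h1 / 2)\<^sup>2" using yu2 power_mono[OF yu1, of 2] by simp
 finally have nyp: "(norm (y - p))\<^sup>2 <= h2\<^sup>2 + (h1 / 2)\<^sup>2" .
 have A2B: "A2 : prim k B" using prim_trans A2 A by blast
 have yA2: "y ~: A2"
 proof
  assume "y : A2"
  hence "y : span A" using primD(3)[OF A2] by (meson span_base subsetD)
  thus False using s2(2) yu2 s2(6) by force
 qed
 define A' where "A' = B Int span (insert y A2)"
 note E = prim_extend[OF B(1) A2B yB yA2, folded A'_def]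
 have "ldet A <= ldet A'" using mn E(1) by blast
 also have "... <= ldet A2 * norm (y - p)" by (rule det_height_le[OF E(4,2,5,3) yA2 pA2])
 finally have "h1 <= norm (y - p)" using s1(10) det_pos[OF lA(2)] by (simp add: pos_divide_le_eq mult.commute)
 hence "h1\<^sup>2 <= (norm (y - p))\<^sup>2" using s1(7) by (simp add: power_mono)
 hence "h1\<^sup>2 <= h2\<^sup>2 + (h1 / 2)\<^sup>2" using nyp by linarith
 hence "h1\<^sup>2 <= h2\<^sup>2 + h1\<^sup>2 / 4" by (simp add: power_divide)
 hence "h1\<^sup>2 <= 4 * h2\<^sup>2" using zero_le_power2[of h2] by linarith
 hence "h1\<^sup>2 <= (2 * h2)\<^sup>2" by (simp add: power_mult_distrib)
 hence "h1 <= 2 * h2" by (rule power2_le_imp_le) (use s2(6) in simp)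
 thus ?thesis using s1(10) s2(8) by simp
qed

definition mhyp :: "'a::euclidean_space set => 'a set => bool" where
 "mhyp A B \<longleftrightarrow> A : prim (dim B - 1) B & (ALL A':prim (dim B - 1) B. ldet A <= ldet A')"

text \<open>The claims are interlocked. A hyperplane of least determinant exists because only
  finitely many sublattices of rank \<open>k\<close> have bounded determinant. Conversely, edges
  bounded through a minimal hyperplane show that a sublattice of rank \<open>Suc k\<close> and
  bounded determinant is spanned by points of a fixed ball. \<open>swap_step\<close> costs a factor
  two per rank.\<close>

lemma good_box_aux:
 "(ALL M::'a::euclidean_space set. ALL T. latt M --> finite (plev k M T)) &
 (ALL B::'a set. latt B --> dim B = Suc k --> (EX A. mhyp A B) &
   (ALL A. mhyp A B --> (EX U c. ofd B U c & (ALL u:U. c u <= 2 ^ k * (ldet B / ldet A)))))"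
proof (induction k)
 case 0
 have "finite (plev 0 M T)" if "latt M" for M :: "'a set" and T using prim_0[OF that] by simp
 moreover have "(EX A. mhyp A B) &
   (ALL A. mhyp A B --> (EX U c. ofd B U c & (ALL u:U. c u <= 2 ^ 0 * (ldet B / ldet A))))" if B: "latt B" "dim B = Suc 0" for B :: "'a set"
 proof -
  have "prim (dim B - 1) B = {{0}}" using prim_0[OF B(1)] B(2) by simp
  hence "mhyp A B \<longleftrightarrow> A = {0}" for A by (cases "A = {0}") (simp_all add: mhyp_def)
  moreover have "EX U c. ofd B U c & (ALL u:U. c u <= 2 ^ 0 * (ldet B / ldet {0}))"
  proof -
   have "{0} : prim 0 B" using prim_0[OF B(1)] by simp
   then obtain u h y where "ofd B (insert u {}) ((%_. 1)(u := h))" "h = ldet B / ldet {0::'a}" using det_step[OF B(1) _ B(2) ofd_zero] by metis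
   thus ?thesis by (intro exI[of _ "insert u {}"] exI[of _ "(%_. 1)(u := h)"]) simp
  qed
  ultimately show ?thesis by auto
 qed
 ultimately show ?case by blast
next
 case (Suc k)
 have fin: "finite (plev k M T)" if "latt M" for M :: "'a set" and T using Suc.IH that by blast
 have gb: "EX A. mhyp A B"
  "!!A. mhyp A B ==> (EX U c. ofd B U c & (ALL u:U. c u <= 2 ^ k * (ldet B / ldet A)))" if "latt B" "dim B = Suc k" for B :: "'a set"
  using Suc.IH that by blast+
 have fin2: "finite (plev (Suc k) M T)" if M: "latt M" for M :: "'a set" and T
 proof -
  define F where "F = (plev k M 1)"
  have finF: "finite F" unfolding F_def by (rule fin[OF M])
  \<comment> \<open>A positive lower bound for all determinants of rank \<open>k\<close>; the
    inserted \<open>1\<close> serves those above the cutoff and the case of an empty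
    \<open>F\<close>.\<close>
  define dlt where "dlt = Min (insert 1 (ldet ` F))"
  have dlt: "dlt > 0" unfolding dlt_def using finF det_pos[OF prim_latt[OF M]] by (auto simp: F_def)
  have dltle: "dlt <= ldet A" if "A : prim k M" for A
  proof (cases "ldet A <= 1")
   case True
   thus ?thesis unfolding dlt_def using finF that by (intro Min_le) (auto simp: F_def)
  next
   case False
   have "dlt <= 1" unfolding dlt_def using finF by (intro Min_le) auto
   thus ?thesis using False by simp
  qed
  define R where "R = 3 * (real (Suc k) * (2 ^ k * (T / dlt)))"
  have "(plev (Suc k) M T) <= (%S. M Int span S) ` Pow (M Int cball 0 R)"
  proof
   fix A assume "A : plev (Suc k) M T"
   hence A: "A : prim (Suc k) M" "ldet A <= T" by auto
   have lA: "latt A" "dim A = Suc k" using A(1) M prim_latt primD by blast+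
   obtain A2 where A2: "mhyp A2 A" using gb(1)[OF lA] by blast
   obtain U c where box: "ofd A U c" "!!u. u : U ==> c u <= 2 ^ k * (ldet A / ldet A2)" using gb(2)[OF lA A2] by blast
   have "A2 : prim k M" using A2 lA A(1) by (auto simp: mhyp_def intro: prim_trans)
   hence d: "dlt <= ldet A2" by (rule dltle)
   have "ldet A / ldet A2 <= T / dlt" using d dlt A(2) det_pos[OF lA(1)] by (intro frac_le) auto
   hence "c u <= 2 ^ k * (T / dlt)" if "u : U" for u using box(2)[OF that] by (smt (verit) mult_left_mono zero_le_power)
   hence "sum c U <= rcard U * (2 ^ k * (T / dlt))" by (intro sum_bounded_above) auto
   moreover have "card U = Suc k" using box(1) lA(2) onb_card[of U] by (simp add: ofd_def)
   ultimately have "3 * sum c U <= R" by (simp add: R_def)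
   hence "A Int cball 0 (3 * sum c U) <= M Int cball 0 R" using primD(3)[OF A(1)] by auto
   moreover have "A = M Int span (A Int cball 0 (3 * sum c U))" using ofd_span_cball[OF box(1)] primD(1)[OF A(1)] by simp
   ultimately show "A : (%S. M Int span S) ` Pow (M Int cball 0 R)" by blast
  qed
  moreover have "finite ((%S. M Int span S) ` Pow (M Int cball 0 R))" by (intro finite_imageI finite_Pow_iff[THEN iffD2] latt_finite[OF M])
  ultimately show ?thesis by (rule finite_subset)
 qed
 have "(EX A. mhyp A B) & (ALL A. mhyp A B --> (EX U c. ofd B U c & (ALL u:U. c u <= 2 ^ Suc k * (ldet B / ldet A))))"
  if B: "latt B" "dim B = Suc (Suc k)" for B :: "'a set"
 proof
  obtain A0 where "A0 = B Int span A0" "dim A0 = Suc k" by (rule exists_hyperplane[OF B])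
  hence A0: "A0 : prim (Suc k) B" unfolding prim_def by blast
  define F where "F = (plev (Suc k) B (ldet A0))"
  have F: "finite F" "A0 : F" using fin2[OF B(1)] A0 by (auto simp: F_def)
  obtain A where "is_arg_min ldet (%A. A : F) A" using ex_is_arg_min_if_finite[OF F(1), of ldet] F(2) by blast
  hence A: "A : F" "!!A'. A' : F ==> ldet A <= ldet A'" unfolding is_arg_min_linorder by blast+
  have "ldet A <= ldet A'" if "A' : prim (Suc k) B" for A' using A(1) A(2)[of A'] that by (force simp: F_def)
  thus "EX A. mhyp A B" using A(1) B(2) by (auto simp: mhyp_def F_def)
  show "ALL A. mhyp A B --> (EX U c. ofd B U c & (ALL u:U. c u <= 2 ^ Suc k * (ldet B / ldet A)))"
  proof (intro allI impI)
   fix A assume "mhyp A B"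
   hence A: "A : prim (Suc k) B" "!!A'. A' : prim (Suc k) B ==> ldet A <= ldet A'" using B(2) by (auto simp: mhyp_def)
   have lA: "latt A" "dim A = Suc k" using A(1) B prim_latt primD by blast+
   obtain A2 where A2: "mhyp A2 A" using gb(1)[OF lA] by blast
   obtain U c where box: "ofd A U c" "!!u. u : U ==> c u <= 2 ^ k * (ldet A / ldet A2)" using gb(2)[OF lA A2] by blast
   have A2': "A2 : prim k A" using A2 lA by (simp add: mhyp_def)
   have sw: "ldet A / ldet A2 <= 2 * (ldet B / ldet A)" by (rule swap_step[OF B A(1) A2' A(2)])
   obtain u h y where s: "u ~: U" "h > 0" "ofd B (insert u U) (c(u := h))" "h = ldet B / ldet A" using det_step[OF B(1) A(1) B(2) box(1)] by metis
   have "c w <= 2 ^ Suc k * h" if "w : U" for w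
   proof -
    have "c w <= 2 ^ k * (2 * h)" using box(2)[OF that] sw s(4) by (smt (verit) mult_left_mono zero_le_power)
    thus ?thesis by simp
   qed
   moreover have "h <= 2 ^ Suc k * h" using s(2) mult_right_mono[of 1 "2 ^ Suc k" h] one_le_power[of "2::real" "Suc k"] by simp
   ultimately have "ALL w:insert u U. (c(u := h)) w <= 2 ^ Suc k * (ldet B / ldet A)" using s(1,4) by auto
   thus "EX U c. ofd B U c & (ALL u:U. c u <= 2 ^ Suc k * (ldet B / ldet A))" using s(3) by blast
  qed
 qed
 thus ?case using fin2 by blast
qed

lemma prim_finite: "latt M ==> finite (plev k M T)" using good_box_aux[of k] by blast

lemma fin_prim: "latt M ==> X <= (plev k M T) ==> finite X" by (rule finite_subset[OF _ prim_finite])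

lemma mhyp_exists: "latt B ==> dim B = Suc k ==> EX A. mhyp A B" using good_box_aux[of k] by blast

lemma good_box: "latt B ==> dim B = Suc k ==> mhyp A B ==> EX U c. ofd B U c & (ALL u:U. c u <= 2 ^ k * (ldet B / ldet A))"
 using good_box_aux[of k] by blast

text \<open>\<open>hmin B\<close> is the minimal determinant of a hyperplane sublattice, so that \<open>gap B\<close> is the
  largest distance between \<open>B\<close>-hyperplanes; up to constants it is the last successive minimum.\<close>

definition hmin :: "'a::euclidean_space set => real" where
 "hmin B = ldet (SOME A. mhyp A B)"

definition gap :: "'a::euclidean_space set => real" where
 "gap B = ldet B / hmin B"

lemma hmin_mhyp:
 assumes "mhyp A B" shows "hmin B = ldet A"
proof -
 have "mhyp (SOME A. mhyp A B) B" using assms by (rule someI)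
 thus ?thesis using assms unfolding hmin_def mhyp_def by (meson order_antisym)
qed

lemma gap_mhyp: "mhyp A B ==> gap B = ldet B / ldet A" by (simp add: gap_def hmin_mhyp)

lemma mhypD:
 assumes "mhyp A B" "latt B" "dim B = Suc k"
 shows "A : prim k B" "latt A" "dim A = k" "!!A'. A' : prim k B ==> ldet A <= ldet A'" using assms prim_latt primD(2) unfolding mhyp_def by (metis diff_Suc_1)+

lemma hmin_pos: "latt B ==> dim B = Suc k ==> hmin B > 0" using mhyp_exists[of B k] hmin_mhyp[of _ B] mhypD(2)[of _ B k] det_pos by force

lemma hmin_le: "latt B ==> dim B = Suc k ==> A : prim k B ==> hmin B <= ldet A"
 using mhyp_exists[of B k] hmin_mhyp[of _ B] mhypD(4)[of _ B k A] by force

lemma gap_pos: "latt B ==> dim B = Suc k ==> gap B > 0" by (simp add: gap_def hmin_pos det_pos)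

lemma good_box_gap:
 assumes "latt B" "dim B = Suc k"
 obtains U c where "ofd B U c" "!!u. u : U ==> c u <= 2 ^ k * gap B" "card U = Suc k" "finite U"
  "sum c U <= real (Suc k) * (2 ^ k * gap B)"
proof -
 obtain A where A: "mhyp A B" using mhyp_exists[OF assms] by blast
 obtain U c where box: "ofd B U c" "!!u. u : U ==> c u <= 2 ^ k * gap B" using good_box[OF assms A] gap_mhyp[OF A] by auto
 have "card U = Suc k" using box(1) assms(2) onb_card[of U] by (simp add: ofd_def)
 moreover have "sum c U <= rcard U * (2 ^ k * gap B)" using box(2) by (rule sum_bounded_above)
 ultimately show ?thesis using that[of U c] box by (auto simp: ofd_def onb_def)
qed

lemma det_le_gap:
 assumes "latt B" "dim B = Suc k" shows "ldet B <= (2 ^ k * gap B) ^ Suc k"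
proof -
 obtain U c where box: "ofd B U c" "!!u. u : U ==> c u <= 2 ^ k * gap B" "card U = Suc k" "finite U" using good_box_gap[OF assms] by metis
 have "ldet B = (PROD u:U. c u)" by (rule lattice_det_box[OF assms(1) box(1)])
 also have "... <= (PROD u:U. 2 ^ k * gap B)" using box by (intro prod_mono) (auto simp: ofd_def less_imp_le)
 finally show ?thesis using box(3) by simp
qed

text \<open>Some edge is at most \<open>norm x\<close> and all other edges are bounded by the gap;
  their product is the determinant.\<close>

lemma norm_ge_gap:
 assumes "latt B" "dim B = Suc k" "x : B" "x ~= 0" shows "ldet B <= norm x * (2 ^ k * gap B) ^ k"
proof -
 obtain U c where box: "ofd B U c" "!!u. u : U ==> c u <= 2 ^ k * gap B" "card U = Suc k" "finite U" using good_box_gap[OF assms(1,2)] by metis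
 obtain u where u: "u : U" "c u <= norm x" using ofd_norm_ge[OF box(1) assms(1,3,4)] by blast
 have "ldet B = c u * (PROD w:U - {u}. c w)" using lattice_det_box[OF assms(1) box(1)] u box(4) by (simp add: prod.remove)
 also have "... <= norm x * (PROD w:U - {u}. 2 ^ k * gap B)" using box u by (intro mult_mono prod_mono prod_nonneg) (auto simp: ofd_def less_imp_le)
 finally show ?thesis using box(3,4) u by simp
qed

lemma span_cball_gap:
 assumes "latt B" "dim B = Suc k" "r >= 3 * (real (Suc k) * (2 ^ k * gap B))"
 shows "span (B Int cball 0 r) = span B"
proof -
 obtain U c where box: "ofd B U c" "sum c U <= real (Suc k) * (2 ^ k * gap B)" using good_box_gap[OF assms(1,2)] by metis
 have "span B <= span (B Int cball 0 r)" unfolding ofd_span_cball[OF box(1), symmetric] using box(2) assms(3) by (intro span_mono) auto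
 moreover have "span (B Int cball 0 r) <= span B" by (intro span_mono) auto
 ultimately show ?thesis by blast
qed

text \<open>Minkowski's second theorem for any numbers \<open>mm i\<close> not exceeding the
  successive minima, so that it applies to norms of minimal vectors and to the constant one. The
  induction passes to a minimal hyperplane, whose minima are no smaller, and bounds the last factor
  by the gap.\<close>

lemma minkowski_second:
 "EX C>0. ALL (N::'a::euclidean_space set) mm. latt N --> dim N = k --> (ALL i:{1..k}. 0 <= mm i & (ALL r<mm i. dim (N Int cball 0 r) < i)) -->
  (\<Prod>i=1..k. mm i) <= C * ldet N"
proof (induction k)
 case 0
 have "ldet N = 1" if "latt N" "dim N = 0" for N :: "'a set" using latt_dim0[OF that] by simp
 thus ?case by (intro exI[of _ 1]) simp
next
 case (Suc k)
 then obtain C where C: "C > 0" "!!(N::'a set) mm. latt N ==> dim N = k ==> (ALL i:{1..k}. 0 <= mm i & (ALL r<mm i. dim (N Int cball 0 r) < i)) ==>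
  (\<Prod>i=1..k. mm i) <= C * ldet N" by blast
 define D where "D = 3 * (real (Suc k) * 2 ^ k)"
 have D: "D > 0" by (simp add: D_def)
 show ?case
 proof (intro exI[of _ "C * D"] conjI allI impI)
  show "0 < C * D" using C D by simp
  fix N :: "'a set" and mm :: "nat => real" assume N: "latt N" "dim N = Suc k" and mm: "ALL i:{1..Suc k}. 0 <= mm i & (ALL r<mm i. dim (N Int cball 0 r) < i)"
  obtain A where A: "mhyp A N" using mhyp_exists[OF N] by blast
  note A' = mhypD[OF A N]
  have "(\<Prod>i=1..k. mm i) <= C * ldet A"
  proof (rule C(2)[OF A'(2,3)], intro ballI conjI allI impI)
   fix i r assume i: "i : {1..k}" "r < mm i"
   have "dim (A Int cball 0 r) <= dim (N Int cball 0 r)" using primD(3)[OF A'(1)] by (intro dim_subset) auto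
   also have "... < i" using mm i by auto
   finally show "dim (A Int cball 0 r) < i" .
  qed (use mm in auto)
  moreover have "mm (Suc k) <= D * gap N"
  proof (rule ccontr)
   assume "~ ?thesis"
   hence "dim (N Int cball 0 (D * gap N)) < Suc k" using mm by auto
   moreover have "span (N Int cball 0 (D * gap N)) = span N" by (rule span_cball_gap[OF N]) (simp add: D_def)
   ultimately show False using N(2) by (metis dim_span less_irrefl)
  qed
  ultimately have "(\<Prod>i=1..k. mm i) * mm (Suc k) <= (C * ldet A) * (D * gap N)" using mm C(1) det_pos[OF A'(2)] by (intro mult_mono) (auto intro: prod_nonneg)
  also have "... = C * D * ldet N" using gap_mhyp[OF A] det_pos[OF A'(2)] by simp
  finally show "(\<Prod>i=1..Suc k. mm i) <= C * D * ldet N" by simp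
 qed
qed

section \<open>Quotient lattices\<close>

text \<open>The component of \<open>x\<close> orthogonal to \<open>span V\<close>; by
  \<open>perp_unique\<close> the choice is determined.\<close>

definition perp :: "'a::euclidean_space set => 'a => 'a" where
 "perp V x = (SOME z. (ALL w:span V. w \<bullet> z = 0) & x - z : span V)"

lemma perp_props: "w : span V ==> w \<bullet> perp V x = 0" "x - perp V x : span V"
proof -
 obtain y z where "y : span V" "!!w. w : span V ==> orthogonal z w" "x = y + z" using orthogonal_subspace_decomp_exists by metis
 hence "(ALL w:span V. w \<bullet> z = 0) & x - z : span V" by (auto simp: orthogonal_def inner_commute)
 hence "(ALL w:span V. w \<bullet> perp V x = 0) & x - perp V x : span V" unfolding perp_def by (rule someI)
 thus "w : span V ==> w \<bullet> perp V x = 0" "x - perp V x : span V" by auto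
qed

lemma perp_unique:
 assumes "!!w. w : span V ==> w \<bullet> z = 0" "x - z : span V" shows "perp V x = z"
proof -
 have "(x - z) - (x - perp V x) : span V" using assms(2) perp_props(2) by (rule span_diff)
 hence d: "perp V x - z : span V" by simp
 have "(perp V x - z) \<bullet> (perp V x - z) = (perp V x - z) \<bullet> perp V x - (perp V x - z) \<bullet> z" by (rule inner_diff_right)
 also have "... = 0" using perp_props(1)[OF d] assms(1)[OF d] by simp
 finally show ?thesis by simp
qed

lemma perp_diff: "perp V (x - y) = perp V x - perp V y"
proof (rule perp_unique)
 have "(x - perp V x) - (y - perp V y) : span V" by (intro span_diff perp_props)
 thus "x - y - (perp V x - perp V y) : span V" by (simp add: algebra_simps)
qed (simp add: inner_diff_right perp_props)

lemma perp_linear: "linear (perp V)"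
proof (rule linearI)
 show "perp V (x + y) = perp V x + perp V y" for x y
 proof (rule perp_unique)
  have "(x - perp V x) + (y - perp V y) : span V" by (intro span_add perp_props)
  thus "x + y - (perp V x + perp V y) : span V" by (simp add: algebra_simps)
 qed (simp add: inner_add_right perp_props)
 show "perp V (r *\<^sub>R x) = r *\<^sub>R perp V x" for r x
 proof (rule perp_unique)
  have "r *\<^sub>R (x - perp V x) : span V" by (intro span_scale perp_props)
  thus "r *\<^sub>R x - r *\<^sub>R perp V x : span V" by (simp add: algebra_simps)
 qed (simp add: perp_props)
qed

lemma perp_eq_0_iff: "perp V x = 0 \<longleftrightarrow> x : span V"
proof
 assume "perp V x = 0" then show "x : span V" using perp_props(2)[of x V] by simp
next
 assume "x : span V" then show "perp V x = 0" by (intro perp_unique) auto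
qed

lemma perp_eq_iff: "perp V x = perp V y \<longleftrightarrow> x - y : span V" using perp_eq_0_iff[of V "x - y"] by (simp add: perp_diff)

lemma perp_norm_le: "norm (perp V x) <= norm x"
proof -
 have "(norm x)\<^sup>2 = (norm ((x - perp V x) + perp V x))\<^sup>2" by simp
 also have "... = (norm (x - perp V x))\<^sup>2 + (norm (perp V x))\<^sup>2" using perp_props(1)[OF perp_props(2), of x V]
  by (simp only: power2_norm_eq_inner inner_add_left inner_add_right inner_commute[of "perp V x" "x - perp V x"])
 finally show ?thesis by (simp add: power2_le_imp_le)
qed

text \<open>A model of the quotient of \<open>M\<close> by \<open>A\<close> inside the same space,
  with the metric of the orthogonal complement.\<close>

definition quo :: "'a::euclidean_space set => 'a set => 'a set" where
 "quo M A = perp A ` M"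

lemma latt_if_finite:
 assumes "0 : M" "!!x y. x : M ==> y : M ==> x - y : M" "finite (M Int cball 0 1)"
 shows "latt M"
proof -
 let ?x = "insert 1 (norm ` (M Int cball 0 1 - {0}))"
 define ep where "ep = Min ?x"
 have fin: "finite ?x" using assms(3) by simp
 hence "ep > 0" unfolding ep_def by (subst Min_gr_iff) auto
 moreover have "ep <= norm x" if "x : M" "x ~= 0" for x
 proof (cases "norm x <= 1")
  case True
  thus ?thesis unfolding ep_def using fin that by (intro Min_le) auto
 next
  case False
  have "ep <= 1" unfolding ep_def using fin by (intro Min_le) auto
  thus ?thesis using False by simp
 qed
 ultimately show ?thesis using assms(1,2) unfolding latt_def by blast
qed

text \<open>Any preimage differs from \<open>z\<close> by a vector of \<open>span A\<close>, which a
  translation by \<open>A\<close> brings to bounded length.\<close>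

lemma quo_lift:
 assumes A: "A : prim j M" "latt M" and box: "ofd A U c" and z: "z : quo M A"
 obtains y where "y : M" "perp A y = z" "norm (y - z) <= sum c U"
proof -
 obtain x where x: "x : M" "z = perp A x" using z by (auto simp: quo_def)
 have "x - z : span A" using x perp_props(2) by simp
 then obtain a where a: "a : A" "norm (x - z - a) <= sum c U" using ofd_cover[OF box] by metis
 have "perp A (x - a) = z" using x a by (simp add: perp_diff perp_eq_0_iff span_base)
 moreover have "x - a : M" using x a A primD(3) latt_diff by blast
 ultimately show ?thesis using that[of "x - a"] a(2) by (simp add: algebra_simps)
qed

lemma quo_latt:
 assumes A: "A : prim j M" "latt M" shows "latt (quo M A)"
proof (rule latt_if_finite)
 show "0 : quo M A" unfolding quo_def using A perp_eq_0_iff[of A 0] by (intro image_eqI[of _ _ 0]) (auto simp: span_0)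
 show "x - y : quo M A" if xy: "x : quo M A" "y : quo M A" for x y
 proof -
  obtain p q where "p : M" "q : M" "x = perp A p" "y = perp A q" using xy by (auto simp: quo_def)
  thus ?thesis unfolding quo_def using A by (intro image_eqI[of _ _ "p - q"]) (simp_all add: perp_diff latt_diff)
 qed
 obtain U c where box: "ofd A U c" using ofd_exists prim_latt A by blast
 have "quo M A Int cball 0 1 <= perp A ` (M Int cball 0 (1 + sum c U))"
 proof
  fix z assume z: "z : quo M A Int cball 0 1"
  then obtain y where y: "y : M" "perp A y = z" "norm (y - z) <= sum c U" using quo_lift[OF A box] by blast
  have "norm y <= norm (y - z) + norm z" using norm_triangle_ineq[of "y - z" z] by simp
  thus "z : perp A ` (M Int cball 0 (1 + sum c U))" using y z by force
 qed
 thus "finite (quo M A Int cball 0 1)" using latt_finite[OF A(2)] finite_surj by blast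
qed

lemma span_quo: "span (quo M A) = perp A ` span M" unfolding quo_def using perp_linear by (rule linear_span_image)

text \<open>The two sets of edges are orthogonal to each other; a point is located first in the
  quotient and then in its fibre. Hence determinants multiply and ranks add.\<close>

lemma quo_box:
 assumes A: "A : prim j M" "latt M" and box: "ofd A U c" and boxQ: "ofd (quo M A) W d"
 shows "ofd M (U Un W) (%u. if u : U then c u else d u)" "U Int W = {}"
proof -
 have U: "onb U" "span U = span A" "!!u. u : U ==> c u > 0" using box by (auto simp: ofd_def)
 have W: "onb W" "span W = span (quo M A)" "!!u. u : W ==> d u > 0" using boxQ by (auto simp: ofd_def)
 have AM: "A <= M" using A primD by blast
 have orth: "a \<bullet> q = 0" if aq: "a : span A" "q : span (quo M A)" for a q
 proof -
  obtain x where "q = perp A x" using aq(2) unfolding span_quo by blast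
  thus ?thesis using perp_props(1)[OF aq(1)] by simp
 qed
 have orthUW: "u \<bullet> w = 0" if "u : U" "w : W" for u w using orth[of u w] that U(2) W(2) by (metis span_base)
 show disj: "U Int W = {}"
 proof (rule ccontr)
  assume "U Int W ~= {}"
  then obtain u where "u : U" "u : W" by blast
  thus False using orthUW[of u u] U(1) by (auto simp: onb_def)
 qed
 have onb: "onb (U Un W)"
 proof -
  have "w \<bullet> u = 0" if "u : U" "w : W" for u w using orthUW[OF that] by (simp add: inner_commute)
  thus ?thesis using U(1) W(1) orthUW unfolding onb_def pairwise_def orthogonal_def by auto
 qed
 have spQM: "span (quo M A) <= span M"
 proof
  fix q assume "q : span (quo M A)"
  then obtain x where x: "x : span M" "q = perp A x" unfolding span_quo by blast
  have "x - q : span M" using perp_props(2)[of x A] span_mono[OF AM] x by auto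
  from span_diff[OF x(1) this] show "q : span M" by simp
 qed
 have sp: "span (U Un W) = span M"
 proof (intro equalityI)
  have "U <= span M" using U(2) span_mono[OF AM] span_superset[of U] by blast
  moreover have "W <= span M" using W(2) spQM span_superset[of W] by blast
  ultimately show "span (U Un W) <= span M" by (intro span_minimal) auto
  show "span M <= span (U Un W)"
  proof
   fix x assume x: "x : span M"
   have "perp A x : span W" unfolding W(2) span_quo using x by blast
   moreover have "x - perp A x : span U" unfolding U(2) by (rule perp_props)
   ultimately have "(x - perp A x) + perp A x : span (U Un W)" using span_mono[of U "U Un W"] span_mono[of W "U Un W"] by (intro span_add) auto
   thus "x : span (U Un W)" by simp
  qed
 qed
 have inU: "x \<bullet> u = (x - perp A x) \<bullet> u" if "u : U" for x u
 proof -
  have "u : span A" using that U(2) span_base by metis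
  hence "perp A x \<bullet> u = 0" using perp_props(1)[of u A x] by (simp add: inner_commute)
  thus ?thesis by (simp add: inner_diff_left)
 qed
 have inW: "x \<bullet> w = perp A x \<bullet> w" if w: "w : W" for x w
 proof -
  have "(x - perp A x) \<bullet> w = 0" using orth[OF perp_props(2)] w W(2) by (metis span_base)
  thus ?thesis by (simp add: inner_diff_left)
 qed
 show "ofd M (U Un W) (%u. if u : U then c u else d u)" unfolding ofd_def
 proof (intro conjI ballI)
  show "0 < (if u : U then c u else d u)" if "u : U Un W" for u using that U W by auto
  fix v assume v: "v : span M"
  have "perp A v : span (quo M A)" unfolding span_quo using v by blast
  hence "EX! z. z : quo M A & (ALL u:W. 0 <= (perp A v - z) \<bullet> u & (perp A v - z) \<bullet> u < d u)" using boxQ unfolding ofd_def by blast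
  then obtain q where q: "q : quo M A" "ALL u:W. 0 <= (perp A v - q) \<bullet> u & (perp A v - q) \<bullet> u < d u"
   and qu: "!!q'. q' : quo M A ==> (ALL u:W. 0 <= (perp A v - q') \<bullet> u & (perp A v - q') \<bullet> u < d u) ==> q' = q" by metis
  obtain y where y: "y : M" "q = perp A y" using q(1) by (auto simp: quo_def)
  define w where "w = (v - y) - perp A (v - y)"
  have "w : span A" unfolding w_def by (rule perp_props)
  hence "EX! z. z : A & (ALL u:U. 0 <= (w - z) \<bullet> u & (w - z) \<bullet> u < c u)" using box unfolding ofd_def by blast
  then obtain a where a: "a : A" "ALL u:U. 0 <= (w - a) \<bullet> u & (w - a) \<bullet> u < c u"
   and au: "!!a'. a' : A ==> (ALL u:U. 0 <= (w - a') \<bullet> u & (w - a') \<bullet> u < c u) ==> a' = a" by metis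
  have wu: "(v - (y + b)) \<bullet> u = (w - b) \<bullet> u" if "u : U" "b : A" for u b using inU[OF that(1), of "v - y"] by (simp add: w_def inner_diff_left inner_add_left)
  have ww: "(v - (y + b)) \<bullet> u = (perp A v - q) \<bullet> u" if "u : W" "b : A" for u b
  proof -
   have "perp A (v - (y + b)) = perp A v - q" using that y linear_add[OF perp_linear, of A y b] by (simp add: perp_diff perp_eq_0_iff span_base)
   thus ?thesis using inW[OF that(1), of "v - (y + b)"] by simp
  qed
  show "EX! z. z : M & (ALL u:U Un W. 0 <= (v - z) \<bullet> u & (v - z) \<bullet> u < (if u : U then c u else d u))"
  proof (intro ex1I[of _ "y + a"] conjI ballI)
   show "y + a : M" using y a A AM latt_add by blast
   show "0 <= (v - (y + a)) \<bullet> u" if "u : U Un W" for u using that a q(2) wu[of u a] ww[of u a] by auto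
   show "(v - (y + a)) \<bullet> u < (if u : U then c u else d u)" if "u : U Un W" for u using that a q(2) wu[of u a] ww[of u a] by auto
  next
   fix z assume z: "z : M & (ALL u:U Un W. 0 <= (v - z) \<bullet> u & (v - z) \<bullet> u < (if u : U then c u else d u))"
   have "perp A z = q"
   proof (rule qu)
    show "perp A z : quo M A" using z by (auto simp: quo_def)
    show "ALL u:W. 0 <= (perp A v - perp A z) \<bullet> u & (perp A v - perp A z) \<bullet> u < d u"
    proof
     fix u assume u: "u : W"
     hence "u ~: U" using disj by blast
     hence "0 <= (v - z) \<bullet> u & (v - z) \<bullet> u < d u" using z u by (metis UnI2)
     thus "0 <= (perp A v - perp A z) \<bullet> u & (perp A v - perp A z) \<bullet> u < d u" using inW[OF u, of "v - z"] by (simp add: perp_diff)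
    qed
   qed
   hence zy: "z - y : span A" using y perp_eq_iff by metis
   hence zyA: "z - y : A" using prim_memI[OF A(1)] latt_diff[OF A(2)] z y by blast
   have "z - y = a"
   proof (rule au[OF zyA], intro ballI)
    fix u assume u: "u : U"
    hence "0 <= (v - z) \<bullet> u & (v - z) \<bullet> u < c u" using z u by (metis UnI1)
    thus "0 <= (w - (z - y)) \<bullet> u & (w - (z - y)) \<bullet> u < c u" using wu[OF u zyA] by simp
   qed
   thus "z = y + a" by (simp add: algebra_simps)
  qed
 qed (use onb sp in auto)
qed

lemma quo_det:
 assumes A: "A : prim j M" "latt M"
 shows "ldet M = ldet A * ldet (quo M A)" "dim M = j + dim (quo M A)"
proof -
 have lA: "latt A" and lQ: "latt (quo M A)" using prim_latt quo_latt A by blast+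
 obtain U c W d where box: "ofd A U c" "ofd (quo M A) W d" using ofd_exists lA lQ by metis
 let ?x = "PROD u:W. if u : U then c u else d u"
 note B = quo_box[OF A box]
 have fin: "finite U" "finite W" using box by (auto simp: ofd_def onb_def)
 have "ldet M = (PROD u:U. if u : U then c u else d u) * ?x" unfolding lattice_det_box[OF A(2) B(1)] using fin B(2) by (rule prod.union_disjoint)
 also have "?x = (PROD u:W. d u)" using B(2) by (intro prod.cong) auto
 finally show "ldet M = ldet A * ldet (quo M A)" using lattice_det_box[OF lA box(1)] lattice_det_box[OF lQ box(2)] by simp
 have "dim M = card (U Un W)" using B(1) onb_card[of "U Un W"] by (simp add: ofd_def)
 also have "... = card U + card W" using fin B(2) by (rule card_Un_disjoint)
 finally show "dim M = j + dim (quo M A)" using box onb_card[of U] onb_card[of W] primD(2)[OF A(1)] by (simp add: ofd_def)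
qed

text \<open>The usual correspondence for quotients. The inverse takes preimages, which are primitive
  because \<open>perp A\<close> maps their span into the span of \<open>L\<close>.\<close>

lemma quo_prim_bij:
 assumes A: "A : prim j M" "latt M"
 shows "bij_betw (%B. quo B A) {B : prim (j + i) M. A <= B} (prim i (quo M A))"
proof -
 let ?x = "{B : prim (j + i) M. A <= B}"
 have spB: "x : span B" if B: "A <= B" "perp A x : span (quo B A)" for x B
 proof -
  obtain y where y: "y : span B" "perp A x = perp A y" using B(2) unfolding span_quo by blast
  hence "x - y : span B" using perp_eq_iff span_mono[OF B(1)] by blast
  hence "(x - y) + y : span B" using y(1) by (rule span_add)
  thus ?thesis by simp
 qed
 show ?thesis unfolding bij_betw_def
 proof (rule conjI, rule inj_onI)
  fix B C assume "B : ?x" "C : ?x" "quo B A = quo C A"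
  hence BC: "B : prim (j + i) M" "A <= B" "C : prim (j + i) M" "A <= C" "quo B A = quo C A" by auto
  have "x : B \<longleftrightarrow> x : C" for x
  proof -
   have "x : span C" if "x : B" using spB[OF BC(4), of x] BC(5) that by (metis image_eqI quo_def span_base)
   moreover have "x : span B" if "x : C" using spB[OF BC(2), of x] BC(5) that by (metis image_eqI quo_def span_base)
   ultimately show ?thesis using BC(1,3) primD(3) prim_memI by (metis subsetD)
  qed
  thus "B = C" by blast
 next
  show "(%B. quo B A) ` ?x = prim i (quo M A)"
  proof (intro equalityI subsetI)
  fix L assume "L : (%B. quo B A) ` ?x"
  then obtain B where B: "B : prim (j + i) M" "A <= B" "L = quo B A" by blast
  have BM: "B <= M" using B primD by blast
  have lB: "latt B" using prim_latt A B by blast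
  have AB: "A : prim j B" by (rule prim_down[OF A(1) B(2) BM])
  have "dim L = i" using quo_det(2)[OF AB lB] primD(2)[OF B(1)] B(3) by simp
  moreover have "L = quo M A Int span L"
  proof (intro equalityI subsetI)
   fix q assume "q : L"
   thus "q : quo M A Int span L" using BM B(3) by (auto simp: quo_def span_base)
  next
   fix q assume q: "q : quo M A Int span L"
   then obtain x where x: "x : M" "q = perp A x" by (auto simp: quo_def)
   hence "x : span B" using spB[OF B(2), of x] q B(3) by simp
   hence "x : B" using prim_memI[OF B(1)] x by blast
   thus "q : L" using x B(3) by (auto simp: quo_def)
  qed
  ultimately show "L : prim i (quo M A)" unfolding prim_def by blast
 next
  fix L assume L: "L : prim i (quo M A)"
  define B where "B = {x : M. perp A x : L}"
  have AB: "A <= B"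
  proof
   fix a assume "a : A"
   moreover have "0 : L" using prim_latt[OF quo_latt[OF A] L] by simp
   ultimately show "a : B" using primD(3)[OF A(1)] perp_eq_0_iff[of A a] by (auto simp: B_def span_base)
  qed
  have qB: "quo B A = L" using primD(3)[OF L] by (auto simp: quo_def B_def)
  have "M Int span B <= B"
  proof
   fix x assume x: "x : M Int span B"
   hence "perp A x : span L" unfolding qB[symmetric] span_quo by blast
   moreover have "perp A x : quo M A" using x by (auto simp: quo_def)
   ultimately show "x : B" using prim_memI[OF L] x by (auto simp: B_def)
  qed
  hence BM: "B = M Int span B" by (auto simp: B_def span_base)
  hence pB: "B : prim (dim B) M" unfolding prim_def by blast
  have "A : prim j B" by (rule prim_down[OF A(1) AB]) (auto simp: B_def)
  hence "dim B = j + dim (quo B A)" by (rule quo_det(2)) (rule prim_latt[OF A(2) pB])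
  hence "dim B = j + i" using qB primD(2)[OF L] by simp
  thus "L : (%B. quo B A) ` ?x" using pB AB qB by auto
  qed
 qed
qed

lemma rank1_gen:
 assumes L: "latt L" "dim L = 1"
 obtains x where "x : L" "norm x = ldet L" "x ~= 0" "L = range (%n::int. of_int n *\<^sub>R x)"
proof -
 have "{0} : prim 0 L" using prim_0[OF L(1)] by simp
 moreover have "dim L = Suc 0" using L by simp
 ultimately obtain u h y where s: "norm u = 1" "y : L" "y \<bullet> u = h" "h > 0"
  "!!x. x : L ==> EX n::int. x - of_int n *\<^sub>R y : {0} & x \<bullet> u = of_int n * h" "u : span L" "h = ldet L / ldet {0::'a}"
  by (rule det_step[OF L(1) _ _ ofd_zero]) (assumption | blast)+
 have eq: "L = range (%n::int. of_int n *\<^sub>R y)" using s(2,5) latt_scale[OF L(1)] by (fastforce simp: image_iff)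
 have "L <= span {y}" using eq by (auto simp: span_base span_scale)
 hence "u : span {y}" using s(6) span_mono[of L "span {y}"] by (auto simp: span_span)
 then obtain t where t: "u = t *\<^sub>R y" by (auto simp: span_singleton)
 have "norm y = h"
 proof -
  have "abs t * norm y = 1" using s(1) t by simp
  moreover have "t * (norm y * norm y) = h" using s(3) t by (simp add: power2_norm_eq_inner[symmetric] power2_eq_square)
  moreover have "t > 0" using calculation s(4) by (smt (verit) mult_nonneg_nonneg mult_nonpos_nonneg norm_ge_zero)
  ultimately show ?thesis by (metis abs_of_pos mult.assoc mult_1)
 qed
 hence "norm y = ldet L" "y ~= 0" using s(4,7) by auto
 thus ?thesis using that[OF s(2) _ _ eq] by blast
qed

lemma card_quo_children:
 assumes A: "A : prim j M" "latt M"
 shows "card {B : prim (Suc j) M. A <= B & ldet B <= T} = card (plev 1 (quo M A) (T / ldet A))"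
proof -
 let ?x = "{B : prim (Suc j) M. A <= B}"
 have d: "ldet B = ldet A * ldet (quo B A)" if "B : prim (Suc j) M" "A <= B" for B using quo_det(1)[OF prim_down[OF A(1) that(2)] prim_latt[OF A(2) that(1)]] primD(3)[OF that(1)] by simp
 have pos: "ldet A > 0" using det_pos prim_latt A by blast
 have b: "bij_betw (%B. quo B A) ?x (prim 1 (quo M A))" using quo_prim_bij[OF A, of 1] by simp
 have "bij_betw (%B. quo B A) {B : ?x. ldet B <= T} (plev 1 (quo M A) (T / ldet A))"
 proof (rule bij_betw_Collect[OF b])
  fix B assume "B : ?x"
  thus "(ldet (quo B A) <= T / ldet A) = (ldet B <= T)" using d[of B] pos by (simp add: field_simps)
 qed
 thus ?thesis by (simp add: bij_betw_same_card conj_assoc)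
qed

text \<open>For each \<open>L\<close> a generator of length \<open>ldet L\<close> is chosen; it
  recovers \<open>L\<close> through its span.\<close>

lemma card_prim1_le:
 assumes Q: "latt Q" shows "card (plev 1 Q t) <= card (Q Int cball 0 t - {0})"
proof -
 define f where "f = (%L::'a set. SOME x. x : L & norm x = ldet L & x ~= 0)"
 have f: "f L : L & norm (f L) = ldet L & f L ~= 0" if "L : prim 1 Q" for L
 proof -
  have "latt L" "dim L = 1" using prim_latt primD Q that by blast+
  hence "EX x. x : L & norm x = ldet L & x ~= 0" using rank1_gen by metis
  thus ?thesis unfolding f_def by (rule someI_ex)
 qed
 show ?thesis
 proof (rule card_inj_on_le[of f])
  show "inj_on f (plev 1 Q t)"
  proof (rule inj_onI)
   fix L K assume LK: "L : plev 1 Q t" "K : plev 1 Q t" "f L = f K"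
   have sp: "span L = span {f L}" if "L : prim 1 Q" for L
   proof -
    have "dim {f L} = 1" using f[OF that] by (simp add: dim_insert)
    thus ?thesis using f[OF that] primD(2)[OF that] dim_eq_span[of "{f L}" L] by simp
   qed
   hence "span L = span K" using LK by simp
   thus "L = K" using prim_span_inj LK by blast
  qed
  show "f ` (plev 1 Q t) <= Q Int cball 0 t - {0}" using f primD(3) by force
  show "finite (Q Int cball 0 t - {0})" using latt_finite[OF Q] by simp
 qed
qed

section \<open>Point counts in balls and in quotients\<close>

lemma fundom_vol_box: "latt A ==> ofd A U c ==> vol U (obox U c) = ennreal (ldet A)" using vol_obox[of U c] lattice_det_box[of A U c] by (simp add: ofd_def)

lemma count_upper:
 assumes A: "latt A" and box: "ofd A U c" and t: "0 < t + sum c U"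
 shows "rcard (A Int cball 0 t) * ldet A <= ubv (dim A) * (t + sum c U) ^ dim A"
proof -
 have U: "onb U" "span U = span A" using box by (auto simp: ofd_def)
 have c: "card U = dim A" using onb_card[OF U(1)] U(2) by simp
 have "ennreal (rcard (A Int cball 0 t) * ldet A) <= ennreal (ubv (dim A) * (t + sum c U) ^ dim A)" using fundom_count_upper[OF A U fundom_obox[OF box] t] det_pos[OF A]
  by (simp add: fundom_vol_box[OF A box] c ennreal_mult ennreal_of_nat_eq_real_of_nat)
 thus ?thesis using t by (simp add: ennreal_le_iff)
qed

lemma count_lower:
 assumes A: "latt A" and box: "ofd A U c" and t: "sum c U < t"
 shows "ubv (dim A) * (t - sum c U) ^ dim A <= rcard (A Int cball 0 t) * ldet A"
proof -
 have U: "onb U" "span U = span A" using box by (auto simp: ofd_def)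
 have c: "card U = dim A" using onb_card[OF U(1)] U(2) by simp
 have "ennreal (ubv (dim A) * (t - sum c U) ^ dim A) <= ennreal (rcard (A Int cball 0 t) * ldet A)" using fundom_count_lower[OF A U fundom_obox[OF box] t] det_pos[OF A]
  by (simp add: fundom_vol_box[OF A box] c ennreal_mult ennreal_of_nat_eq_real_of_nat)
 thus ?thesis using det_pos[OF A] by (simp add: ennreal_le_iff)
qed

text \<open>Balls of radius \<open>l / 3\<close> about the points are disjoint, so the bound depends
  on the minimal length alone and not on the determinant.\<close>

lemma packing_bound:
 assumes M: "latt M" and l: "l > 0" "!!x. x : M ==> x ~= 0 ==> l <= norm x" and t: "t >= 0"
 shows "rcard (M Int cball 0 t) <= (3 * t / l + 1) ^ dim M"
proof -
 let ?x = "M Int cball 0 t"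
 obtain U c where "ofd M U c" using ofd_exists M by blast
 hence U: "onb U" "span U = span M" by (auto simp: ofd_def)
 have c: "card U = dim M" using onb_card[OF U(1)] U(2) by simp
 have "of_nat (card ?x) * vol U (cball 0 (l / 3)) <= ennreal (unit_ball_vol (rcard U) * (t + l / 3) ^ card U)"
 proof (rule packing_upper[OF U])
  fix z w v assume h: "z : M Int cball 0 t" "w : M Int cball 0 t" "v - z : cball 0 (l / 3)" "v - w : cball 0 (l / 3)"
  have "norm (z - w) = norm ((v - w) - (v - z))" by simp
  also have "... <= norm (v - w) + norm (v - z)" by (rule norm_triangle_ineq4)
  also have "... < l" using h l by simp
  finally show "z = w" using l(2)[of "z - w"] latt_diff[OF M, of z w] h by force
 qed (use l t latt_finite[OF M] in \<open>auto simp: span_base\<close>)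
 hence "ennreal (rcard ?x * (ubv (dim M) * (l / 3) ^ dim M)) <= ennreal (ubv (dim M) * (t + l / 3) ^ dim M)"
  using vol_cball[OF U(1), of "l / 3"] l by (simp add: c ennreal_mult ennreal_of_nat_eq_real_of_nat)
 hence "rcard ?x * (ubv (dim M) * (l / 3) ^ dim M) <= ubv (dim M) * (t + l / 3) ^ dim M" using l t by (simp add: ennreal_le_iff)
 hence "ubv (dim M) * (rcard ?x * (l / 3) ^ dim M) <= ubv (dim M) * (t + l / 3) ^ dim M" by (simp add: algebra_simps)
 hence "rcard ?x * (l / 3) ^ dim M <= (t + l / 3) ^ dim M" by simp
 also have "t + l / 3 = (3 * t / l + 1) * (l / 3)" using l by (simp add: field_simps)
 finally have "rcard ?x * (l / 3) ^ dim M <= (3 * t / l + 1) ^ dim M * (l / 3) ^ dim M" unfolding power_mult_distrib .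
 thus ?thesis using l by (simp del: power_divide)
qed

text \<open>Each quotient point is lifted at distance at most \<open>r\<close> and translated by the
  points of \<open>A\<close> of norm at most \<open>2 * r\<close>; the results are distinct and have
  norm at most \<open>4 * r\<close>. Thus a count in a quotient, whose shape is unknown, is reduced
  to a count in \<open>M\<close>.\<close>

lemma card_quo_cball:
 assumes A: "A : prim j M" "latt M" and box: "ofd A U c" and r: "sum c U <= r" "r > 0"
 shows "rcard (quo M A Int cball 0 r) * (ubv j * r ^ j) <= rcard (M Int cball 0 (4 * r)) * ldet A"
proof -
 let ?a = "M Int cball 0 (4 * r)"
 let ?x = "A Int cball 0 (2 * r)"
 have lA: "latt A" using prim_latt A by blast
 have AM: "A <= M" using A primD by blast
 define Q where "Q = quo M A"
 let ?y = "Q Int cball 0 r"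
 have "EX y. y : M & perp A y = z & norm (y - z) <= sum c U" if "z : Q" for z using quo_lift[OF A box] that unfolding Q_def by metis
 then obtain g where g: "!!z. z : Q ==> g z : M & perp A (g z) = z & norm (g z - z) <= sum c U" by metis
 have pA: "perp A a = 0" if "a : A" for a using that by (simp add: perp_eq_0_iff span_base)
 have "card (?y \<times> ?x) <= card ?a"
 proof (rule card_inj_on_le[of "%(z, a). g z + a"])
  let ?z = "%(z, a). g z + a"
  show "inj_on ?z (?y \<times> ?x)"
  proof (rule inj_onI)
   fix p q assume pq: "p : ?y \<times> ?x" "q : ?y \<times> ?x"
    "?z p = ?z q"
   obtain z a w b where zw: "p = (z, a)" "q = (w, b)" by (metis surj_pair)
   hence h: "z : Q" "a : A" "w : Q" "b : A" "g z + a = g w + b" using pq by auto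
   hence "perp A (g z + a) = perp A (g w + b)" by simp
   hence "perp A (g z) + perp A a = perp A (g w) + perp A b" by (simp only: linear_add[OF perp_linear])
   hence "z = w" using h g pA by simp
   thus "p = q" using h zw by simp
  qed
  show "?z ` (?y \<times> ?x) <= M Int cball 0 (4 * r)"
  proof (rule image_subsetI)
   fix p assume p: "p : ?y \<times> ?x"
   then obtain z a where h: "p = (z, a)" "z : Q" "norm z <= r" "a : A" "norm a <= 2 * r" by auto
   have "g z + a = (g z - z) + z + a" by simp
   hence "norm (g z + a) <= norm (g z - z) + norm z + norm a" by (metis norm_triangle_mono norm_triangle_ineq order_refl)
   also have "... <= 4 * r" using h g[OF h(2)] r by linarith
   finally show "?z p : M Int cball 0 (4 * r)" using g[OF h(2)] h AM latt_add[OF A(2), of "g z" a] by auto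
  qed
 qed (rule latt_finite[OF A(2)])
 hence 1: "rcard ?y * rcard ?x <= rcard ?a" by (simp add: card_cartesian_product flip: of_nat_mult)
 have "ubv j * r ^ j <= ubv j * (2 * r - sum c U) ^ j" using r by (intro mult_left_mono power_mono) auto
 also have "... <= rcard ?x * ldet A" using count_lower[OF lA box, of "2 * r"] r primD(2)[OF A(1)] by simp
 finally have "rcard ?y * (ubv j * r ^ j) <= rcard ?y * (rcard ?x * ldet A)" by (rule mult_left_mono) simp
 also have "... <= rcard ?a * ldet A" unfolding mult.assoc[symmetric] using 1 det_pos[OF lA] by (intro mult_right_mono) auto
 finally show ?thesis unfolding Q_def .
qed

section \<open>Dual lattices\<close>

text \<open>Taken inside \<open>span B\<close>, so that lattices of smaller rank are
  covered.\<close>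

definition dual :: "'a::euclidean_space set => 'a set" where
 "dual B = {y : span B. ALL x:B. EX n::int. x \<bullet> y = of_int n}"

lemma dual_latt:
 assumes B: "latt B" shows "latt (dual B)"
proof -
 obtain S where S: "S <= B" "independent S" "B <= span S" by (metis basis_exists)
 have fin: "finite S" using S(2) by (rule independent_imp_finite)
 define K where "K = 1 + (SUM x:S. norm x)"
 have K: "K > 0" unfolding K_def by (smt (verit) norm_ge_zero sum_nonneg)
 have "1 / K <= norm y" if y: "y : dual B" "y ~= 0" for y
 proof -
  have "EX x:S. x \<bullet> y ~= 0"
  proof (rule ccontr)
   assume "~ ?thesis"
   hence "!!x. x : S ==> orthogonal y x" by (auto simp: orthogonal_def inner_commute)
   moreover have "y : span S" using y(1) span_minimal[OF S(3) subspace_span] by (auto simp: dual_def)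
   ultimately have "orthogonal y y" using orthogonal_to_span[of y S y] by blast
   thus False using y by (simp add: orthogonal_def)
  qed
  then obtain x where x: "x : S" "x \<bullet> y ~= 0" by blast
  obtain n :: int where n: "x \<bullet> y = of_int n" using y(1) x S(1) by (auto simp: dual_def)
  have "n ~= 0" using x(2) n by auto
  hence "1 <= abs (x \<bullet> y)" unfolding n by linarith
  also have "... <= norm x * norm y" by (rule Cauchy_Schwarz_ineq2)
  also have "norm x <= K" unfolding K_def using member_le_sum[OF x(1), of norm] fin by simp
  finally show ?thesis using K by (simp add: field_simps mult_right_mono)
 qed
 moreover have "x - y : dual B" if xy: "x : dual B" "y : dual B" for x y unfolding dual_def
 proof (intro CollectI conjI ballI)
  show "x - y : span B" using xy by (auto simp: dual_def intro: span_diff)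
  fix b assume "b : B"
  then obtain m n :: int where "b \<bullet> x = of_int m" "b \<bullet> y = of_int n" using xy by (auto simp: dual_def) metis
  thus "EX n::int. b \<bullet> (x - y) = of_int n" by (intro exI[of _ "m - n"]) (simp add: inner_diff_right)
 qed
 moreover have "0 : dual B" by (auto simp: dual_def span_0 intro: exI[of _ 0])
 ultimately show ?thesis unfolding latt_def using K by (metis zero_less_divide_1_iff)
qed

lemma span_insert_expand:
 assumes "onb (insert u U)" "u ~: U" "v : span (insert u U)" "!!x. x : U ==> v \<bullet> x = 0"
 shows "v = (v \<bullet> u) *\<^sub>R u"
proof -
 have "v = (SUM w:insert u U. (v \<bullet> w) *\<^sub>R w)" using onb_expand assms by metis
 also have "... = (v \<bullet> u) *\<^sub>R u + (SUM w:U. (v \<bullet> w) *\<^sub>R w)" using assms by (simp add: onb_def)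
 also have "(SUM w:U. (v \<bullet> w) *\<^sub>R w) = 0" using assms by (intro sum.neutral) auto
 finally show ?thesis by simp
qed

text \<open>The vector \<open>w\<close> is the unit normal of \<open>A\<close> divided by the
  height, so it takes the value one on the layer next to \<open>A\<close>. The last conclusion, that
  \<open>dual B\<close> modulo this line is \<open>dual A\<close>, drives the induction for the
  determinant of the dual.\<close>

lemma dual_hyperplane:
 assumes B: "latt B" "dim B = Suc k" and A: "A : prim k B"
 obtains w where "w : dual B" "w ~= 0" "norm w = ldet A / ldet B"
  "{y : dual B. ALL x:A. x \<bullet> y = 0} = dual B Int span {w}"
  "ldet (dual B Int span {w}) = ldet A / ldet B" "dual B Int span {w} : prim 1 (dual B)"
  "!!v. v : span B ==> v \<bullet> w = 0 \<longleftrightarrow> v : span A" "quo (dual B) (dual B Int span {w}) = dual A"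
proof -
 let ?x = "{y : dual B. ALL x:A. x \<bullet> y = 0}"
 have lA: "latt A" using prim_latt B A by blast
 have lD: "latt (dual B)" by (rule dual_latt[OF B(1)])
 obtain U c where box: "ofd A U c" using ofd_exists[OF lA] by blast
 obtain u h y where s: "norm u = 1" "!!a. a : span A ==> a \<bullet> u = 0" "u ~: U" "u : span B" "y : B" "y \<bullet> u = h" "h > 0"
  "!!x. x : B ==> EX n::int. x - of_int n *\<^sub>R y : A & x \<bullet> u = of_int n * h"
  "ofd B (insert u U) (c(u := h))" "h = ldet B / ldet A" by (rule det_step[OF B(1) A B(2) box]) blast
 have onb: "onb (insert u U)" "span (insert u U) = span B" "span U = span A" using s(9) box by (auto simp: ofd_def)
 define w where "w = (1 / h) *\<^sub>R u"
 have w: "w : dual B" unfolding dual_def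
 proof (intro CollectI conjI ballI)
  show "w : span B" unfolding w_def using s(4) by (rule span_scale)
  fix x assume "x : B"
  then obtain n :: int where "x \<bullet> u = of_int n * h" using s(8) by blast
  thus "EX n::int. x \<bullet> w = of_int n" using s(7) by (intro exI[of _ n]) (simp add: w_def)
 qed
 have w0: "w ~= 0" using s(1,7) by (auto simp: w_def)
 have nw: "norm w = ldet A / ldet B" using s(1,7,10) det_pos[OF lA] det_pos[OF B(1)] by (simp add: w_def)
 have spw: "v \<bullet> w = 0 \<longleftrightarrow> v : span A" if v: "v : span B" for v
 proof -
  have "v \<bullet> w = 0 \<longleftrightarrow> v \<bullet> u = 0" using s(7) by (simp add: w_def)
  thus ?thesis using span_insert_orth[OF onb(1) s(3), of v] v onb s(2) by auto
 qed
 define L where "L = dual B Int span {w}"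
 have L: "L : prim 1 (dual B)" using prim_Int_span[of "{w}" "dual B"] w w0 by (simp add: L_def dim_insert)
 have lL: "latt L" "dim L = 1" using prim_latt[OF lD L] primD(2)[OF L] by auto
 have eqL: "?x = L"
 proof (intro equalityI subsetI)
  fix z assume "z : ?x"
  hence z: "z : dual B" "!!x. x : A ==> orthogonal z x" by (auto simp: orthogonal_def inner_commute)
  have "z \<bullet> x = 0" if "x : U" for x
  proof -
   have "x : span A" using that onb(3) span_base by metis
   from orthogonal_to_span[OF this z(2)] show ?thesis by (simp add: orthogonal_def)
  qed
  hence "z = (z \<bullet> u) *\<^sub>R u" using span_insert_expand[OF onb(1) s(3), of z] z(1) onb(2) by (simp add: dual_def)
  hence "z = ((z \<bullet> u) * h) *\<^sub>R w" using s(7) by (simp add: w_def)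
  thus "z : L" unfolding L_def using z(1) by (metis IntI singletonI span_base span_scale)
 next
  fix z assume "z : L"
  then obtain t where "z : dual B" "z = t *\<^sub>R w" by (auto simp: L_def span_singleton)
  thus "z : ?x" using s(2) by (auto simp: w_def span_base)
 qed
 obtain x0 where x0: "x0 : L" "norm x0 = ldet L" "x0 ~= 0" "L = range (%n::int. of_int n *\<^sub>R x0)" using rank1_gen[OF lL] by metis
 \<comment> \<open>\<open>w\<close> and the generator \<open>x0\<close> are integral multiples of
   each other: \<open>x0\<close> takes an integral value on \<open>y\<close>, where \<open>w\<close>
   takes the value one.\<close>
 have "norm x0 = norm w"
 proof -
  obtain t where t: "x0 = t *\<^sub>R w" using x0(1) by (auto simp: L_def span_singleton)
  have "x0 : dual B" using x0(1) by (simp add: L_def)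
  then obtain n :: int where n: "y \<bullet> x0 = of_int n" using s(5) by (auto simp: dual_def)
  have "y \<bullet> x0 = t" using s(6,7) t by (simp add: w_def)
  hence tn: "t = of_int n" using n by simp
  have "w : L" using w by (simp add: L_def span_base)
  then obtain m :: int where m: "w = of_int m *\<^sub>R x0" using x0(4) by blast
  have "w = (of_int m * of_int n) *\<^sub>R w" using m t tn by (metis scaleR_scaleR)
  hence "of_int m * of_int n = (1::real)" using w0 by (metis scaleR_cancel_right scaleR_one)
  hence "m * n = 1" by (metis of_int_eq_1_iff of_int_mult)
  hence "abs n = 1" using zmult_eq_1_iff by fastforce
  thus ?thesis using t tn by (simp flip: of_int_abs)
 qed
 hence dL: "ldet L = ldet A / ldet B" using x0(2) nw by simp
 have spL: "span L = span {w}" unfolding L_def by (intro span_Int_span) (use w in auto)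
 have perpL: "perp L z = z - (z \<bullet> u) *\<^sub>R u" for z
 proof (rule perp_unique)
  fix v assume "v : span L"
  then obtain t where "v = t *\<^sub>R w" unfolding spL by (auto simp: span_singleton)
  thus "v \<bullet> (z - (z \<bullet> u) *\<^sub>R u) = 0" using s(1) by (simp add: w_def inner_diff_right norm_eq_1 inner_commute)
 next
  have "z - (z - (z \<bullet> u) *\<^sub>R u) = ((z \<bullet> u) * h) *\<^sub>R w" using s(7) by (simp add: w_def)
  thus "z - (z - (z \<bullet> u) *\<^sub>R u) : span L" unfolding spL by (simp add: span_base span_scale)
 qed
 have q: "quo (dual B) L = dual A"
 proof (intro equalityI subsetI)
  fix q assume "q : quo (dual B) L"
  then obtain z where z: "z : dual B" "q = z - (z \<bullet> u) *\<^sub>R u" by (auto simp: quo_def perpL)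
  have "q : span (insert u U)" unfolding onb(2) using z s(4) by (auto simp: dual_def intro: span_diff span_scale)
  moreover have "q \<bullet> u = 0" using s(1) z by (simp add: inner_diff_left norm_eq_1)
  ultimately have "q : span A" using span_insert_orth[OF onb(1) s(3)] onb(3) by blast
  moreover have "EX n::int. x \<bullet> q = of_int n" if x: "x : A" for x
  proof -
   have "x \<bullet> q = x \<bullet> z" using s(2)[OF span_base[OF x]] z by (simp add: inner_diff_right)
   thus ?thesis using z(1) x primD(3)[OF A] by (auto simp: dual_def)
  qed
  ultimately show "q : dual A" by (auto simp: dual_def)
 next
  fix z assume z: "z : dual A"
  hence zA: "z : span A" by (auto simp: dual_def)
  \<comment> \<open>The shift along \<open>u\<close> makes the lifted vector vanish on
    \<open>y\<close>; its values on \<open>B\<close> are then values of \<open>z\<close> on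
    \<open>A\<close>, hence integers.\<close>
  define alp where "alp = - (y \<bullet> z) / h"
  define y' where "y' = z + alp *\<^sub>R u"
  have yy': "y \<bullet> y' = 0" using s(6,7) by (simp add: y'_def alp_def inner_add_right inner_diff_right)
  have "y' : span B" unfolding y'_def using zA span_mono[OF primD(3)[OF A]] s(4) by (auto intro: span_add span_scale)
  moreover have "EX n::int. x \<bullet> y' = of_int n" if x: "x : B" for x
  proof -
   obtain n :: int where n: "x - of_int n *\<^sub>R y : A" using s(8)[OF x] by blast
   have "x \<bullet> y' = (x - of_int n *\<^sub>R y) \<bullet> y'" using yy' by (simp add: inner_diff_left)
   also have "... = (x - of_int n *\<^sub>R y) \<bullet> z" using s(2)[OF span_base[OF n]] by (simp add: y'_def inner_add_right)
   finally show ?thesis using z n by (auto simp: dual_def)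
  qed
  ultimately have "y' : dual B" by (auto simp: dual_def)
  moreover have "perp L y' = z" unfolding perpL using s(1) s(2)[OF zA] by (simp add: y'_def inner_add_left norm_eq_1)
  ultimately show "z : quo (dual B) L" unfolding quo_def by blast
 qed
 show thesis using that[of w] w w0 nw eqL dL L spw q unfolding L_def by blast
qed

lemma dual_det:
 assumes "latt B" shows "ldet (dual B) = 1 / ldet B & dim (dual B) = dim B" using assms
proof (induction "dim B" arbitrary: B)
 case 0
 hence B0: "B = {0}" using latt_dim0 by metis
 hence "dual B = {0}" by (auto simp: dual_def intro: exI[of _ 0])
 thus ?case using B0 by simp
next
 case (Suc k)
 hence B: "latt B" "dim B = Suc k" by auto
 obtain A where "A = B Int span A" "dim A = k" by (rule exists_hyperplane[OF B])
 hence A: "A : prim k B" unfolding prim_def by blast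
 have lA: "latt A" using prim_latt B A by blast
 obtain w where w: "ldet (dual B Int span {w}) = ldet A / ldet B" "dual B Int span {w} : prim 1 (dual B)"
  "quo (dual B) (dual B Int span {w}) = dual A" by (rule dual_hyperplane[OF B A]) blast
 note q = quo_det[OF w(2) dual_latt[OF B(1)], unfolded w(1,3)]
 have "ldet (dual A) = 1 / ldet A & dim (dual A) = dim A" using Suc(1)[of A] lA primD(2)[OF A] by simp
 thus ?case using q det_pos[OF lA] B(2) primD(2)[OF A] by simp
qed

text \<open>As the values are integers, \<open>m\<close> times \<open>s\<close> minus
  \<open>n\<close> times \<open>b\<close> lies in the kernel for every \<open>s\<close> in
  \<open>A\<close>, so the kernel together with the single vector \<open>b\<close> spans
  \<open>A\<close>.\<close>

lemma kernel_prim: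
 assumes A: "latt A" "dim A = Suc k" and int: "!!x. x : A ==> EX n::int. x \<bullet> w = of_int n" and b: "b : A" "b \<bullet> w ~= 0"
 shows "{x : A. x \<bullet> w = 0} : prim k A"
proof -
 define K where "K = {x : A. x \<bullet> w = 0}"
 have Kx: "x \<bullet> w = 0" if "x : span K" for x
 proof -
  have "orthogonal w x" by (rule orthogonal_to_span[OF that]) (auto simp: K_def orthogonal_def inner_commute)
  thus ?thesis by (simp add: orthogonal_def inner_commute)
 qed
 have "A Int span K <= K" using Kx by (auto simp: K_def)
 moreover have "K <= A Int span K" using span_superset[of K] by (auto simp: K_def)
 ultimately have "K = A Int span K" by blast
 hence Kp: "K : prim (dim K) A" unfolding prim_def by blast
 obtain m :: int where m: "b \<bullet> w = of_int m" using int[OF b(1)] by blast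
 have "s : span (insert b K)" if s: "s : A" for s
 proof -
  obtain n :: int where n: "s \<bullet> w = of_int n" using int[OF s] by blast
  have "of_int m *\<^sub>R s - of_int n *\<^sub>R b : K" unfolding K_def using s b(1) A(1) m n by (auto intro!: latt_diff latt_scale simp: inner_diff_left)
  hence "of_int m *\<^sub>R s - of_int n *\<^sub>R b : span (insert b K)" by (simp add: span_base)
  moreover have "of_int n *\<^sub>R b : span (insert b K)" by (simp add: span_base span_scale)
  ultimately have "(of_int m *\<^sub>R s - of_int n *\<^sub>R b) + of_int n *\<^sub>R b : span (insert b K)" by (rule span_add)
  hence "of_int m *\<^sub>R s : span (insert b K)" by simp
  from span_scale[OF this, of "1 / of_int m"] have "(1 / of_int m) *\<^sub>R (of_int m *\<^sub>R s) : span (insert b K)" .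
  moreover have "(1 / of_int m) *\<^sub>R (of_int m *\<^sub>R s) = s" using b(2) m by simp
  ultimately show ?thesis by (simp only:)
 qed
 hence "span A <= span (insert b K)" by (intro span_minimal) auto
 moreover have "insert b K <= A" using b by (auto simp: K_def)
 ultimately have "span (insert b K) = span A" using span_mono by blast
 hence "dim (insert b K) = Suc k" using A(2) by (metis dim_span)
 moreover have "b ~: span K" using b(2) Kx by blast
 ultimately have "dim K = k" by (simp add: dim_insert)
 thus ?thesis using Kp by (simp add: K_def)
qed

lemma dual_bij:
 assumes B: "latt B" "dim B = Suc k"
 shows "bij_betw (%A. {y : dual B. ALL x:A. x \<bullet> y = 0}) (prim k B) (prim 1 (dual B))" unfolding bij_betw_def
proof (rule conjI, rule inj_onI)
 fix A A' assume A: "A : prim k B" "A' : prim k B" "{y : dual B. ALL x:A. x \<bullet> y = 0} = {y : dual B. ALL x:A'. x \<bullet> y = 0}"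
 obtain w where w: "w : dual B" "{y : dual B. ALL x:A. x \<bullet> y = 0} = dual B Int span {w}"
  "!!v. v : span B ==> v \<bullet> w = 0 \<longleftrightarrow> v : span A" by (rule dual_hyperplane[OF B A(1)]) blast
 have "w : {y : dual B. ALL x:A'. x \<bullet> y = 0}" unfolding A(3)[symmetric] w(2) using w(1) by (simp add: span_base)
 hence sub: "A' <= span A" using w(3) primD(3)[OF A(2)] by (auto simp: span_base subset_iff)
 have "A' <= A"
 proof
  fix x assume "x : A'"
  thus "x : A" using sub primD(3)[OF A(2)] prim_memI[OF A(1)] by blast
 qed
 moreover have "dim A <= dim A'" using primD(2)[OF A(1)] primD(2)[OF A(2)] by simp
 ultimately have "span A' = span A" using dim_eq_span[of A' A] by blast
 thus "A = A'" using prim_span_inj A(1,2) by metis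
next
 let ?x = "%A. {y : dual B. ALL x:A. x \<bullet> y = 0}"
 show "?x ` prim k B = prim 1 (dual B)"
 proof (intro equalityI subsetI)
  fix L assume "L : ?x ` prim k B"
  then obtain A where A: "A : prim k B" "L = {y : dual B. ALL x:A. x \<bullet> y = 0}" by blast
  obtain w where w: "{y : dual B. ALL x:A. x \<bullet> y = 0} = dual B Int span {w}" "dual B Int span {w} : prim 1 (dual B)" by (rule dual_hyperplane[OF B A(1)]) blast
  thus "L : prim 1 (dual B)" using A by simp
 next
  fix L assume L: "L : prim 1 (dual B)"
  have lL: "latt L" "dim L = 1" using prim_latt[OF dual_latt[OF B(1)] L] primD(2)[OF L] by auto
  obtain x0 where x0: "x0 : L" "x0 ~= 0" using rank1_gen[OF lL] by metis
  have xD: "x0 : dual B" using x0 primD(3)[OF L] by blast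
  define A where "A = {x : B. x \<bullet> x0 = 0}"
  have "EX b:B. b \<bullet> x0 ~= 0"
  proof (rule ccontr)
   assume "~ ?thesis"
   hence "!!x. x : B ==> orthogonal x0 x" by (auto simp: orthogonal_def inner_commute)
   hence "orthogonal x0 x0" using orthogonal_to_span[of x0 B x0] xD by (auto simp: dual_def)
   thus False using x0 by (simp add: orthogonal_def)
  qed
  hence Ak: "A : prim k B" unfolding A_def using kernel_prim[OF B] xD by (auto simp: dual_def)
  obtain w where w: "{y : dual B. ALL x:A. x \<bullet> y = 0} = dual B Int span {w}" "dual B Int span {w} : prim 1 (dual B)" by (rule dual_hyperplane[OF B Ak]) blast
  have "x0 : dual B Int span {w}" unfolding w(1)[symmetric] using xD by (auto simp: A_def)
  hence "span {x0} = span (dual B Int span {w})" using x0(2) primD(2)[OF w(2)] dim_eq_span[of "{x0}" "dual B Int span {w}"] by (simp add: dim_insert)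
  moreover have "span {x0} = span L" using x0 lL(2) dim_eq_span[of "{x0}" L] by (simp add: dim_insert)
  ultimately have "L = dual B Int span {w}" using prim_span_inj[OF L w(2)] by simp
  thus "L : ?x ` prim k B" using Ak w(1) by blast
 qed
qed

lemma card_hyperplanes:
 assumes B: "latt B" "dim B = Suc k"
 shows "card (plev k B R) = card (plev 1 (dual B) (R / ldet B))"
proof -
 have "bij_betw (%A. {y : dual B. ALL x:A. x \<bullet> y = 0}) (plev k B R) (plev 1 (dual B) (R / ldet B))"
 proof (rule bij_betw_Collect[OF dual_bij[OF B]])
  fix A assume A: "A : prim k B"
  obtain w where "{y : dual B. ALL x:A. x \<bullet> y = 0} = dual B Int span {w}" "ldet (dual B Int span {w}) = ldet A / ldet B" by (rule dual_hyperplane[OF B A]) blast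
  hence "ldet {y : dual B. ALL x:A. x \<bullet> y = 0} = ldet A / ldet B" by simp
  thus "(ldet {y : dual B. ALL x:A. x \<bullet> y = 0} <= R / ldet B) = (ldet A <= R)" using det_pos[OF B(1)] by (simp add: divide_le_cancel)
 qed
 thus ?thesis by (rule bij_betw_same_card)
qed

text \<open>Dual vectors are multiples of generators of lines, and these have length
  \<open>ldet A / ldet B\<close> for hyperplanes \<open>A\<close>. So \<open>hmin B\<close> controls
  the first minimum of the dual, and with it the error in counting hyperplanes.\<close>

lemma dual_norm_ge:
 assumes B: "latt B" "dim B = Suc k" and y: "y : dual B" "y ~= 0"
 shows "hmin B / ldet B <= norm y"
proof -
 define L where "L = dual B Int span {y}"
 have L: "L : prim 1 (dual B)" using prim_Int_span[of "{y}" "dual B"] y by (simp add: L_def dim_insert)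
 hence "L : (%A. {y : dual B. ALL x:A. x \<bullet> y = 0}) ` prim k B" using dual_bij[OF B] by (simp add: bij_betw_def)
 then obtain A where A: "A : prim k B" "L = {y : dual B. ALL x:A. x \<bullet> y = 0}" by blast
 obtain w where w: "{y : dual B. ALL x:A. x \<bullet> y = 0} = dual B Int span {w}" "ldet (dual B Int span {w}) = ldet A / ldet B" by (rule dual_hyperplane[OF B A(1)]) blast
 hence dL: "ldet L = ldet A / ldet B" using A(2) by simp
 have lL: "latt L" "dim L = 1" using prim_latt[OF dual_latt[OF B(1)] L] primD(2)[OF L] by auto
 obtain x0 where x0: "norm x0 = ldet L" "L = range (%n::int. of_int n *\<^sub>R x0)" using rank1_gen[OF lL] by metis
 have "y : L" using y by (simp add: L_def span_base)
 then obtain n :: int where n: "y = of_int n *\<^sub>R x0" using x0(2) by blast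
 hence "n ~= 0" using y(2) by auto
 hence "1 <= abs (real_of_int n)" by linarith
 hence "norm x0 <= norm y" using n by (simp add: mult_le_cancel_right1)
 thus ?thesis using x0(1) dL hmin_le[OF B A(1)] det_pos[OF B(1)] by (smt (verit) divide_right_mono)
qed

section \<open>Abel summation\<close>

lemma powr_FTC:
 fixes p :: real
 assumes "0 < a" "a <= b"
 shows "((%r. p * r powr (-p-1)) has_integral (a powr (-p) - b powr (-p))) {a..b}"
proof -
 have "((%r. p * r powr (-p-1)) has_integral (- (b powr (-p)) - - (a powr (-p)))) {a..b}"
 proof (rule fundamental_theorem_of_calculus[OF assms(2)])
  fix x assume "x : {a..b}"
  hence "x > 0" using assms by simp
  hence "((%r. - (r powr (-p))) has_real_derivative (p * x powr (-p-1))) (at x within {a..b})" by (auto intro!: derivative_eq_intros simp: field_simps)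
  thus "((%r. - (r powr (-p))) has_vector_derivative (p * x powr (-p-1))) (at x within {a..b})" by (simp add: has_real_derivative_iff_has_vector_derivative)
 qed
 thus ?thesis by simp
qed

lemma powr_integral:
 fixes q :: real
 assumes "0 < a" "a <= b" "q ~= 0"
 shows "((%r. r powr (q - 1)) has_integral ((b powr q - a powr q) / q)) {a..b}"
proof -
 have "((%r. (-1/q) * (-q * r powr (-(-q)-1))) has_integral ((-1/q) * (a powr (-(-q)) - b powr (-(-q))))) {a..b}" by (intro has_integral_mult_right powr_FTC assms)
 thus ?thesis using assms(3) by (simp add: diff_divide_distrib)
qed

lemma inverse_integral:
 fixes a b :: real
 assumes "0 < a" "a <= b"
 shows "((%r. r powr (-1)) has_integral (ln (b / a))) {a..b}"
proof -
 have "((%r. r powr (-1)) has_integral (ln b - ln a)) {a..b}"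
 proof (rule fundamental_theorem_of_calculus[OF assms(2)])
  fix x assume "x : {a..b}"
  hence x: "x > 0" using assms by simp
  have "(ln has_real_derivative (x powr (-1))) (at x within {a..b})" using x by (auto intro!: derivative_eq_intros simp: powr_minus divide_inverse)
  thus "(ln has_vector_derivative (x powr (-1))) (at x within {a..b})" by (simp add: has_real_derivative_iff_has_vector_derivative)
 qed
 thus ?thesis using assms by (simp add: ln_div)
qed

definition csum :: "'i set => ('i => real) => ('i => real) => real => real" where
 "csum J h w r = (SUM j:lev h J r. w j)"

text \<open>Each term is an integral from \<open>max D (h j)\<close> to \<open>R\<close> plus its
  value at \<open>R\<close>. Terms below \<open>D\<close> are thereby treated as if they sat at
  \<open>D\<close>, which produces the boundary term there.\<close>

lemma abel_summation:
 fixes h w :: "'i => real" and p :: real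
 assumes fin: "finite (lev h J R)" and D: "0 < D" "D <= R"
 shows "(%r. p * (csum J h w r * r powr (-p-1))) integrable_on {D..R}"
  and "(SUM j:lay h J D R. w j * h j powr (-p)) =
  csum J h w R * R powr (-p) - csum J h w D * D powr (-p) + integral {D..R} (%r. p * (csum J h w r * r powr (-p-1)))"
proof -
 let ?x = "%r. p * (csum J h w r * r powr (-p-1))"
 define I where "I = (lev h J R)"
 define t where "t = (%j. max D (h j))"
 let ?z = "SUM j:I. w j * (t j powr (-p) - R powr (-p))"
 let ?y = "SUM j:I. w j * t j powr (-p)"
 have 1: "((%r. w j * (if r : {t j..R} then p * r powr (-p-1) else 0)) has_integral (w j * (t j powr (-p) - R powr (-p)))) {D..R}" if "j : I" for j
 proof (rule has_integral_mult_right)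
  have "((%r. p * r powr (-p-1)) has_integral (t j powr (-p) - R powr (-p))) {t j..R}" using that D by (intro powr_FTC) (auto simp: t_def I_def)
  thus "((%r. if r : {t j..R} then p * r powr (-p-1) else 0) has_integral (t j powr (-p) - R powr (-p))) {D..R}" by (subst has_integral_restrict) (auto simp: t_def)
 qed
 have 2: "((%r. SUM j:I. w j * (if r : {t j..R} then p * r powr (-p-1) else 0)) has_integral ?z) {D..R}" using fin 1 by (intro has_integral_sum) (auto simp: I_def)
 have 3: "(SUM j:I. w j * (if r : {t j..R} then p * r powr (-p-1) else 0)) = p * (csum J h w r * r powr (-p-1))" if r: "r : {D..R}" for r
 proof -
  have "(SUM j:I. w j * (if r : {t j..R} then p * r powr (-p-1) else 0)) = (SUM j:I. if h j <= r then w j * (p * r powr (-p-1)) else 0)"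
   using r by (intro sum.cong) (auto simp: t_def)
  also have "... = (SUM j:lev h I r. w j * (p * r powr (-p-1)))" using fin by (subst sum.inter_filter) (auto simp: I_def)
  also have "(lev h I r) = (lev h J r)" using r by (auto simp: I_def)
  finally show ?thesis by (simp add: csum_def sum_distrib_right sum_distrib_left mult_ac)
 qed
 have 4: "(?x has_integral ?z) {D..R}" by (rule has_integral_eq[OF 3 2])
 thus "?x integrable_on {D..R}" by blast
 have "integral {D..R} ?x = ?y - csum J h w R * R powr (-p)" using integral_unique[OF 4] by (simp add: csum_def I_def sum_distrib_right right_diff_distrib sum_subtractf)
 moreover have "?y = (SUM j:lay h J D R. w j * h j powr (-p)) + csum J h w D * D powr (-p)"
 proof -
  have "I = (lay h J D R) Un (lev h J D)" using D by (auto simp: I_def)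
  moreover have "(lay h J D R) <= I" "(lev h J D) <= I" using D by (auto simp: I_def)
  ultimately have "?y = (SUM j:lay h J D R. w j * t j powr (-p)) + (SUM j:lev h J D. w j * t j powr (-p))"
   using fin by (simp only: I_def[symmetric]) (subst sum.union_disjoint, auto intro: finite_subset)
  moreover have "(SUM j:lay h J D R. w j * t j powr (-p)) = (SUM j:lay h J D R. w j * h j powr (-p))" by (intro sum.cong) (auto simp: t_def)
  moreover have "(SUM j:lev h J D. w j * t j powr (-p)) = (SUM j:lev h J D. w j * D powr (-p))" by (intro sum.cong) (auto simp: t_def max_def)
  ultimately show ?thesis by (simp add: csum_def sum_distrib_right)
 qed
 ultimately show "(SUM j:lay h J D R. w j * h j powr (-p)) =
  csum J h w R * R powr (-p) - csum J h w D * D powr (-p) + integral {D..R} ?x" by simp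
qed

lemma exists_lower:
 fixes h :: "'i => real"
 assumes "finite (lev h J R)" "!!j. j : J ==> 0 < h j" "0 < R"
 obtains D where "0 < D" "D <= R" "!!j. j : J ==> D < h j"
proof -
 let ?x = "insert R (h ` (lev h J R))"
 define D where "D = Min ?x / 2"
 have fin: "finite ?x" using assms(1) by simp
 have "Min ?x > 0" using assms fin by (subst Min_gr_iff) auto
 moreover have "Min ?x <= R" using fin by (intro Min_le) auto
 moreover have "Min ?x <= h j" if "j : J" for j
 proof (cases "h j <= R")
  case True
  thus ?thesis using fin that by (intro Min_le) auto
 qed (use calculation in simp)
 ultimately show ?thesis using that[of D] by (force simp: D_def)
qed

text \<open>Main term and error integral enter as hypotheses, so that ordinary powers and the
  critical exponent, which gives a logarithm, are instances of one estimate.\<close>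

lemma abel_compare:
 fixes h w :: "'i => real" and p :: real
 assumes fin: "finite (lev h J R)" and D: "0 < D" "D <= R"
  and S: "!!r. r : {D..R} ==> abs (csum J h w r - f r) <= g r"
  and i: "((%r. p * f r * r powr (-p-1)) has_integral F) {D..R}" "((%r. abs p * g r * r powr (-p-1)) has_integral G) {D..R}"
 shows "abs ((SUM j:lay h J D R. w j * h j powr (-p)) + csum J h w D * D powr (-p) - (f R * R powr (-p) + F)) <= g R * R powr (-p) + G"
proof -
 let ?s = "%r. p * (csum J h w r * r powr (-p-1))"
 have "(?s has_integral integral {D..R} ?s) {D..R}" using abel_summation(1)[OF fin D] by (rule integrable_integral)
 note d = has_integral_diff[OF this i(1)]
 have "norm (integral {D..R} (%r. ?s r - p * f r * r powr (-p-1))) <= integral {D..R} (%r. abs p * g r * r powr (-p-1))"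
 proof (rule integral_norm_bound_integral)
  fix r assume r: "r : {D..R}"
  have "?s r - p * f r * r powr (-p-1) = p * (csum J h w r - f r) * r powr (-p-1)" by (simp add: algebra_simps)
  thus "norm (?s r - p * f r * r powr (-p-1)) <= abs p * g r * r powr (-p-1)" using S[OF r] by (simp add: abs_mult mult_left_mono mult_right_mono)
 qed (use d i(2) in blast)+
 hence "abs (integral {D..R} ?s - F) <= G" using integral_unique[OF d] integral_unique[OF i(2)] by simp
 moreover have "abs ((csum J h w R - f R) * R powr (-p)) <= g R * R powr (-p)" using S[of R] D by (simp add: abs_mult mult_right_mono)
 ultimately show ?thesis unfolding abel_summation(2)[OF fin D] by (simp only: left_diff_distrib)
qed

lemma abel_compare_powr:
 fixes h w :: "'i => real" and p m q alp be :: real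
 assumes "finite (lev h J R)" "0 < D" "D <= R" "!!r. r : {D..R} ==> abs (csum J h w r - alp * r powr m) <= be * r powr q" "m ~= p" "q ~= p"
 shows "abs ((SUM j:lay h J D R. w j * h j powr (-p)) + csum J h w D * D powr (-p) - (alp * R powr (m - p) + p * alp * ((R powr (m - p) - D powr (m - p)) / (m - p))))
  <= be * R powr (q - p) + abs p * be * ((R powr (q - p) - D powr (q - p)) / (q - p))"
proof -
 have "((%r. c * (a * r powr x) * r powr (-p-1)) has_integral c * a * ((R powr (x - p) - D powr (x - p)) / (x - p))) {D..R}" if "x ~= p" for a c x
 proof -
  have e: "c * (a * r powr x) * r powr (-p-1) = c * a * r powr ((x - p) - 1)" for r by (simp add: powr_add[symmetric] algebra_simps)
  show ?thesis unfolding e using assms(2,3) that by (intro has_integral_mult_right powr_integral) auto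
 qed
 from abel_compare[OF assms(1-4) this[OF assms(5)] this[OF assms(6)]] show ?thesis by (simp only: mult.assoc powr_add[symmetric] uminus_add_conv_diff diff_conv_add_uminus)
qed

lemma drop_low: "abs (s + c - z) <= b ==> z = 0 ==> 0 <= c ==> s <= (b::real)" by simp

lemma csum_nonneg: "(!!j. j : J ==> 0 <= w j) ==> 0 <= csum J h w r" unfolding csum_def by (intro sum_nonneg) auto

lemma abel_upper:
 fixes h w :: "'i => real" and p m K :: real
 assumes fin: "finite (lev h J R)" and h: "!!j. j : J ==> 0 < h j" and w: "!!j. j : J ==> 0 <= w j"
  and S: "!!r. 0 < r ==> r <= R ==> csum J h w r <= K * r powr m" and K: "0 <= K" and p: "p < m" and R: "0 < R"
 shows "(SUM j:lev h J R. w j * h j powr (-p)) <= (1 + abs p / (m - p)) * (K * R powr (m - p))"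
proof -
 have nn: "0 <= csum J h w r" for r by (rule csum_nonneg) (rule w)
 obtain D where D: "0 < D" "D <= R" "!!j. j : J ==> D < h j" using exists_lower[OF fin h R] by blast
 have "(lay h J D R) = (lev h J R)" using D(3) by auto
 moreover have "csum J h w D = 0" using D(3) by (fastforce simp: csum_def intro: sum.neutral)
 ultimately have "(SUM j:lev h J R. w j * h j powr (-p)) <= K * R powr (m - p) + abs p * K * ((R powr (m - p) - D powr (m - p)) / (m - p))"
  using abel_compare_powr[OF fin D(1,2), of w 0 m K m p] S nn p D(1) by simp
 also have "... <= K * R powr (m - p) + abs p * K * (R powr (m - p) / (m - p))" using p K by (intro add_left_mono mult_left_mono divide_right_mono) auto
 finally show ?thesis by (simp add: algebra_simps)
qed

text \<open>Beyond the critical exponent the lower end of the range dominates, so the bound is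
  independent of \<open>R\<close>.\<close>

lemma abel_tail:
 fixes h w :: "'i => real" and p m K :: real
 assumes fin: "finite (lev h J R)" and w: "!!j. j : J ==> 0 <= w j"
  and S: "!!r. D <= r ==> r <= R ==> csum J h w r <= K * r powr m" and K: "0 <= K" and p: "m < p" "0 <= m" and D: "0 < D" "D <= R"
 shows "(SUM j:lay h J D R. w j * h j powr (-p)) <= (1 + p / (p - m)) * (K * D powr (m - p))"
proof -
 have nn: "0 <= csum J h w r" for r by (rule csum_nonneg) (rule w)
 have "(SUM j:lay h J D R. w j * h j powr (-p)) <= K * R powr (m - p) + abs p * K * ((R powr (m - p) - D powr (m - p)) / (m - p))"
  by (rule drop_low[OF abel_compare_powr[OF fin D, of w 0 m K m p]]) (use S nn p in auto)
 also have "... = K * R powr (m - p) + p * K * ((D powr (m - p) - R powr (m - p)) / (p - m))" using p by (simp add: field_simps)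
 also have "... <= K * D powr (m - p) + p * K * (D powr (m - p) / (p - m))" using p K D by (intro add_mono mult_left_mono divide_right_mono powr_mono2') auto
 finally show ?thesis by (simp add: algebra_simps)
qed

lemma abel_compare_log:
 fixes h w :: "'i => real" and m alp be :: real
 assumes "finite (lev h J R)" "0 < D" "D <= R" "!!r. r : {D..R} ==> abs (csum J h w r - alp * r powr m) <= g r"
  and i: "((%r. abs m * g r * r powr (-m-1)) has_integral G) {D..R}"
 shows "abs ((SUM j:lay h J D R. w j * h j powr (-m)) + csum J h w D * D powr (-m) - (alp + m * alp * ln (R / D))) <= g R * R powr (-m) + G"
proof -
 have e: "m * (alp * r powr m) * r powr (-m-1) = m * alp * r powr (-1)" for r by (simp add: powr_add[symmetric] algebra_simps)
 have "((%r. m * (alp * r powr m) * r powr (-m-1)) has_integral m * alp * ln (R / D)) {D..R}" unfolding e by (intro has_integral_mult_right inverse_integral assms)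
 moreover have "R powr m * R powr (-m) = 1" using assms(2,3) by (simp add: powr_add[symmetric])
 ultimately show ?thesis using abel_compare[OF assms(1-4) _ i] by (simp only: mult.assoc mult_1_right)
qed

lemma abel_log_upper:
 fixes h w :: "'i => real" and m K :: real
 assumes fin: "finite (lev h J R)" and w: "!!j. j : J ==> 0 <= w j"
  and S: "!!r. D <= r ==> r <= R ==> csum J h w r <= K * r powr m" and K: "0 <= K" and m: "0 <= m" and D: "0 < D" "D <= R"
 shows "(SUM j:lay h J D R. w j * h j powr (-m)) <= K * (1 + m * ln (R / D))"
proof -
 have e: "m * (K * r powr m) * r powr (-m-1) = m * K * r powr (-1)" for r by (simp add: powr_add[symmetric] algebra_simps)
 have "((%r. abs m * (K * r powr m) * r powr (-m-1)) has_integral m * K * ln (R / D)) {D..R}" unfolding abs_of_nonneg[OF m] e by (intro has_integral_mult_right inverse_integral D)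
 note i = this
 have nn: "0 <= csum J h w r" for r by (rule csum_nonneg) (rule w)
 have "(SUM j:lay h J D R. w j * h j powr (-m)) <= K * R powr m * R powr (-m) + m * K * ln (R / D)" by (rule drop_low[OF abel_compare_log[OF fin D _ i, of w 0]]) (use S nn in auto)
 thus ?thesis using D by (simp add: powr_minus algebra_simps)
qed

text \<open>The constant produced by \<open>abel_asymp\<close>; it is named because it has to be
  chosen before the lattice is fixed.\<close>

definition abelc :: "real => real => real => real" where "abelc p m dlt = 1 + 2 * abs p / (m - p - dlt)"

lemma abelc_pos: "p < m - dlt ==> 0 < abelc p m dlt" by (simp add: abelc_def add_pos_nonneg)

lemma abel_asymp:
 fixes h w :: "'i => real" and p m dlt alp be :: real
 assumes p: "p < m - dlt" and d: "0 < dlt" and fin: "finite (lev h J R)" and h: "ALL j:J. 0 < h j"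
  and S: "ALL r>0. abs (csum J h w r - alp * r powr m) <= be * r powr (m - dlt)" and R: "0 < R"
 shows "abs ((SUM j:lev h J R. w j * h j powr (-p)) - alp * (m / (m - p)) * R powr (m - p)) <= abelc p m dlt * be * R powr (m - p - dlt)"
proof -
 define q where "q = m - p - dlt"
 have q: "q > 0" "m - p > q" "m - dlt - p = q" using p d by (auto simp: q_def)
 obtain D where D: "0 < D" "D <= R" "!!j. j : J ==> D < h j" using exists_lower[OF fin _ R] h by blast
 let ?x = "(R powr (m - p) - D powr (m - p)) / (m - p)"
 have J: "(lay h J D R) = (lev h J R)" using D(3) by auto
 have D0: "csum J h w D = 0" using D(3) by (fastforce simp: csum_def intro: sum.neutral)
 have "0 <= be * R powr (m - dlt)" using S R by (metis abs_ge_zero order_trans)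
 hence be: "0 <= be" using R by (simp add: zero_le_mult_iff)
 define z where "z = be * R powr q"
 have "abs p * be * ((R powr q - D powr q) / q) <= abs p * be * (R powr q / q)" using q be by (intro mult_left_mono divide_right_mono) auto
 hence 1: "abs ((SUM j:lev h J R. w j * h j powr (-p)) - (alp * R powr (m - p) + p * alp * ?x)) <= z + abs p / q * z"
  using abel_compare_powr[OF fin D(1,2), of w alp m be "m - dlt" p] S D q unfolding J D0 by (simp add: z_def)
 \<comment> \<open>No terms lie below \<open>D\<close>, so the hypothesis at \<open>D\<close> says
   that the main term there does not exceed the error. This removes the lower limit of
   integration.\<close>
 have 2: "abs ((p * alp) * (D powr (m - p) / (m - p))) <= abs p / q * z"
 proof -
  have "abs alp * D powr m <= be * D powr (m - dlt)" using S D(1) D0 by (force simp: abs_mult)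
  hence "abs alp * D powr m * D powr (-p) <= be * D powr (m - dlt) * D powr (-p)" by (rule mult_right_mono) auto
  hence "abs alp * D powr (m - p) <= be * D powr q" using q(3) by (simp add: powr_add[symmetric] mult.assoc)
  also have "... <= z" unfolding z_def using D q be by (intro mult_left_mono powr_mono2) auto
  finally have "abs alp * D powr (m - p) / (m - p) <= z / q" using q be by (intro frac_le) (auto simp: z_def)
  hence "abs p * (abs alp * D powr (m - p) / (m - p)) <= abs p * (z / q)" by (rule mult_left_mono) simp
  thus ?thesis using q by (simp add: abs_mult algebra_simps)
 qed
 have e1: "alp * (m / (m - p)) * R powr (m - p) = alp * R powr (m - p) + (p * alp) * (R powr (m - p) / (m - p))" using q by (simp add: field_simps)
 have e2: "(p * alp) * ?x = (p * alp) * (R powr (m - p) / (m - p)) - (p * alp) * (D powr (m - p) / (m - p))" by (simp add: diff_divide_distrib right_diff_distrib)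
 have "abs ((SUM j:lev h J R. w j * h j powr (-p)) - alp * (m / (m - p)) * R powr (m - p)) <= z + abs p / q * z + abs p / q * z"
 proof -
  have "X = a + P ==> Mid = P - Q ==> abs (s - (a + Mid)) <= u ==> abs Q <= v ==> abs (s - X) <= u + v" for X a P Mid Q s u v :: real by linarith
  from this[OF e1 e2 1 2] show ?thesis .
 qed
 also have "... = abelc p m dlt * be * R powr (m - p - dlt)" by (simp add: abelc_def z_def q_def algebra_simps)
 finally show ?thesis .
qed

text \<open>At the critical exponent the main term integrates to a logarithm, while the error
  integral converges at infinity and is governed by \<open>D\<close> alone.\<close>

lemma abel_log_asymp:
 fixes h w :: "'i => real" and m dlt alp be :: real
 assumes fin: "finite (lev h J R)"
  and S: "!!r. D <= r ==> r <= R ==> abs (csum J h w r - alp * r powr m) <= be * r powr (m - dlt)"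
  and d: "0 < dlt" and m: "0 <= m" and D: "0 < D" "D <= R"
 shows "abs ((SUM j:lay h J D R. w j * h j powr (-m)) - alp * m * ln (R / D)) <= (2 + m / dlt) * (be * D powr (-dlt))"
proof -
 have "0 <= be * R powr (m - dlt)" using S[of R] D by (meson abs_ge_zero order_refl order_trans)
 hence be: "0 <= be" using D by (simp add: zero_le_mult_iff)
 have e: "abs m * (be * r powr (m - dlt)) * r powr (-m-1) = m * be * r powr (-dlt-1)" for r using m by (simp add: powr_add[symmetric] algebra_simps)
 have "((%r. abs m * (be * r powr (m - dlt)) * r powr (-m-1)) has_integral m * be * ((R powr (-dlt) - D powr (-dlt)) / (-dlt))) {D..R}"
  unfolding e using d by (intro has_integral_mult_right powr_integral D) auto
 from abel_compare_log[OF fin D _ this, of w alp] S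
 have 1: "abs ((SUM j:lay h J D R. w j * h j powr (-m)) + csum J h w D * D powr (-m) - (alp + m * alp * ln (R / D))) <= be * R powr (m - dlt) * R powr (-m) + m * be * ((R powr (-dlt) - D powr (-dlt)) / (-dlt))"
  by simp
 have "be * R powr (m - dlt) * R powr (-m) = be * R powr (-dlt)" by (simp add: powr_add[symmetric] mult.assoc)
 also have "... <= be * D powr (-dlt)" using be d D by (intro mult_left_mono powr_mono2') auto
 finally have 2: "be * R powr (m - dlt) * R powr (-m) <= be * D powr (-dlt)" .
 have "m * be * ((R powr (-dlt) - D powr (-dlt)) / (-dlt)) = m * be * ((D powr (-dlt) - R powr (-dlt)) / dlt)" using d by (simp add: field_simps)
 also have "... <= m * be * (D powr (-dlt) / dlt)" using be m d by (intro mult_left_mono divide_right_mono) auto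
 finally have 3: "m * be * ((R powr (-dlt) - D powr (-dlt)) / (-dlt)) <= m / dlt * (be * D powr (-dlt))" by simp
 have "abs (csum J h w D - alp * D powr m) * D powr (-m) <= be * D powr (m - dlt) * D powr (-m)" using S[of D] D by (intro mult_right_mono) auto
 moreover have "abs (csum J h w D - alp * D powr m) * D powr (-m) = abs (csum J h w D * D powr (-m) - alp)"
  using D by (simp add: abs_mult_pos left_diff_distrib mult.assoc powr_add[symmetric])
 moreover have "be * D powr (m - dlt) * D powr (-m) = be * D powr (-dlt)" by (simp add: powr_add[symmetric] mult.assoc)
 ultimately have 4: "abs (csum J h w D * D powr (-m) - alp) <= be * D powr (-dlt)" by simp
 have "m * alp * ln (R / D) = alp * m * ln (R / D)" by simp
 hence "abs ((SUM j:lay h J D R. w j * h j powr (-m)) - alp * m * ln (R / D)) <= be * D powr (-dlt) + be * D powr (-dlt) + m / dlt * (be * D powr (-dlt))"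
  using 1 2 3 4 by linarith
 thus ?thesis by (simp add: algebra_simps)
qed

section \<open>Lattices with first minimum at least one\<close>

text \<open>One minimal hyperplane is fixed for each \<open>B\<close>, so that sums over
  \<open>B\<close> can be sorted by it.\<close>

definition mu :: "'a::euclidean_space set => 'a set" where
 "mu B = (SOME A. mhyp A B)"

lemma mu_mhyp: "latt B ==> dim B = Suc k ==> mhyp (mu B) B" unfolding mu_def using mhyp_exists by (metis someI_ex)

lemma mu_prim: "latt M ==> B : prim (Suc k) M ==> mu B : prim k M" "latt M ==> B : prim (Suc k) M ==> mu B : prim k B"
 "latt M ==> B : prim (Suc k) M ==> mhyp (mu B) B" "latt M ==> B : prim (Suc k) M ==> hmin B = ldet (mu B)"
proof -
 assume a: "latt M" "B : prim (Suc k) M"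
 have B: "latt B" "dim B = Suc k" using a prim_latt primD by blast+
 show m: "mhyp (mu B) B" by (rule mu_mhyp[OF B])
 show p: "mu B : prim k B" by (rule mhypD(1)[OF m B])
 show "mu B : prim k M" by (rule prim_trans[OF p a(2)])
 show "hmin B = ldet (mu B)" by (rule hmin_mhyp[OF m])
qed

text \<open>\<open>det_le_gap\<close> bounds \<open>ldet B\<close> by a power of
  \<open>ldet B / ldet A\<close>; solving for \<open>ldet A\<close> gives the exponent
  \<open>k / Suc k\<close>.\<close>

lemma mhyp_det_le:
 assumes B: "latt B" "dim B = Suc k" and A: "mhyp A B" and T: "ldet B <= T"
 shows "ldet A <= 2 ^ k * T powr (real k / real (Suc k))"
proof -
 have lA: "latt A" by (rule mhypD(2)[OF A B])
 have pos: "ldet A > 0" "ldet B > 0" using det_pos lA B by blast+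
 have "ldet B <= (2 ^ k * (ldet B / ldet A)) ^ Suc k" using det_le_gap[OF B] gap_mhyp[OF A] by simp
 also have "... = (2 ^ k) ^ Suc k * ldet B ^ Suc k / ldet A ^ Suc k" by (simp only: power_mult_distrib power_divide times_divide_eq_right)
 finally have "ldet B * ldet A ^ Suc k <= ldet B * ((2 ^ k) ^ Suc k * ldet B ^ k)" using pos by (simp add: field_simps)
 hence "ldet A ^ Suc k <= (2 ^ k) ^ Suc k * ldet B ^ k" using pos by simp
 also have "... <= (2 ^ k) ^ Suc k * T ^ k" using T pos by (intro mult_left_mono power_mono) auto
 also have "T ^ k = (T powr (real k / real (Suc k))) ^ Suc k" using T pos by (subst powr_power) (auto simp: powr_realpow simp del: power_Suc)
 also have "(2 ^ k) ^ Suc k * (T powr (real k / real (Suc k))) ^ Suc k = (2 ^ k * T powr (real k / real (Suc k))) ^ Suc k" by (simp only: power_mult_distrib)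
 finally show ?thesis by (rule power_le_imp_le_base) simp
qed

lemma gap_step:
 assumes B: "latt B" "dim B = Suc (Suc k)" and A: "mhyp A B" shows "gap A <= 2 * gap B"
proof -
 note A' = mhypD[OF A B]
 obtain A2 where A2: "mhyp A2 A" using mhyp_exists[OF A'(2,3)] by blast
 show ?thesis using swap_step[OF B A'(1) mhypD(1)[OF A2 A'(2,3)] A'(4)] gap_mhyp[OF A] gap_mhyp[OF A2] by simp
qed

text \<open>The factor from \<open>span_cball_gap\<close> by which a ball has to exceed the gap in
  order to contain spanning points.\<close>

definition kap :: "nat => real" where "kap k = 3 * (real (Suc k) * 2 ^ k)"

lemma kap_ge1: "kap k >= 1"
proof -
 have "1 * 1 <= real (Suc k) * 2 ^ k" by (intro mult_mono) auto
 thus ?thesis by (simp add: kap_def)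
qed

text \<open>Each \<open>B\<close> is a line of length at most \<open>r = T / ldet A\<close> in the
  quotient by \<open>A\<close>. Since \<open>A\<close> is minimal in \<open>B\<close>, the gap of
  \<open>A\<close> is at most \<open>2 * r\<close>; therefore \<open>A\<close> has a box of size
  \<open>O(r)\<close>, and \<open>card_quo_cball\<close> moves the count into a ball of
  \<open>M\<close>.\<close>

lemma children_bound:
 assumes M: "latt M" and A: "A : prim k M" and T: "T > 0"
  and cnt: "rcard (M Int cball 0 (4 * kap k * (T / ldet A))) <= G * (T / ldet A) ^ m" and m: "k <= m" and G: "G >= 0"
 shows "rcard {B : prim (Suc k) M. mhyp A B & ldet B <= T} <= G / ubv k * ((T / ldet A) ^ (m - k) * ldet A)"
proof (cases "{B : prim (Suc k) M. mhyp A B & ldet B <= T} = {}")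
 case True
 have "ldet A > 0" using det_pos prim_latt M A by blast
 thus ?thesis unfolding True using G T by simp
next
 case False
 define r where "r = T / ldet A"
 let ?x = "quo M A Int cball 0 (kap k * r)"
 have lA: "latt A" using prim_latt M A by blast
 have dA: "ldet A > 0" by (rule det_pos[OF lA])
 have r: "r > 0" using T dA by (simp add: r_def)
 obtain B where B: "B : prim (Suc k) M" "mhyp A B" "ldet B <= T" using False by blast
 have lB: "latt B" "dim B = Suc k" using B M prim_latt primD by blast+
 have gB: "gap B <= r" using gap_mhyp[OF B(2)] B(3) dA by (simp add: r_def divide_right_mono)
 obtain U c where box: "ofd A U c" "sum c U <= kap k * r"
 proof (cases k)
  case 0
  hence "A = {0}" using prim_0[OF M] A by simp
  hence "ofd A {} (%_. 1)" using ofd_zero by simp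
  thus ?thesis using that[of "{}" "%_. 1"] r kap_ge1[of k] by simp
 next
  case (Suc j)
  have dimA: "dim A = Suc j" using primD(2)[OF A] Suc by simp
  obtain U c where Uc: "ofd A U c" "sum c U <= real (Suc j) * (2 ^ j * gap A)" using good_box_gap[OF lA dimA] by metis
  have "gap A <= 2 * r" using gap_step[OF lB(1) _ B(2)] lB(2) Suc gB by force
  hence "real (Suc j) * (2 ^ j * gap A) <= real (Suc j) * (2 ^ j * (2 * r))" by (intro mult_left_mono) auto
  also have "... = (real k * 2 ^ k) * r" using Suc by simp
  also have "... <= kap k * r" using r by (intro mult_right_mono) (auto simp: kap_def)
  finally show ?thesis using that[of U c] Uc by simp
 qed
 define Ch where "Ch = {B : prim (Suc k) M. mhyp A B & ldet B <= T}"
 have fin: "finite {B : prim (Suc k) M. A <= B & ldet B <= T}" by (rule fin_prim[OF M, of _ "Suc k" T]) auto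
 have "Ch <= {B : prim (Suc k) M. A <= B & ldet B <= T}" using primD(2) primD(3) by (fastforce simp: Ch_def mhyp_def)
 hence "card Ch <= card {B : prim (Suc k) M. A <= B & ldet B <= T}" using fin by (rule card_mono[rotated])
 also have "... = card (plev 1 (quo M A) r)" unfolding r_def by (rule card_quo_children[OF A M])
 also have "... <= card (quo M A Int cball 0 r - {0})" by (rule card_prim1_le[OF quo_latt[OF A M]])
 also have "... <= card ?x"
 proof (rule card_mono)
  have "1 * r <= kap k * r" using kap_ge1[of k] r by (intro mult_right_mono) auto
  thus "quo M A Int cball 0 r - {0} <= quo M A Int cball 0 (kap k * r)" by auto
 qed (rule latt_finite[OF quo_latt[OF A M]])
 finally have 1: "rcard Ch <= rcard ?x" by simp
 have V: "ubv k > 0" by simp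
 have kr: "kap k * r > 0" using kap_ge1[of k] r by simp
 have "rcard Ch * (ubv k * r ^ k) <= rcard ?x * (ubv k * (kap k * r) ^ k)"
 proof (intro mult_mono 1 power_mono)
  show "r <= kap k * r" using kap_ge1[of k] r by simp
 qed (use r V in auto)
 also have "... <= rcard (M Int cball 0 (4 * (kap k * r))) * ldet A" by (rule card_quo_cball[OF A M box kr])
 also have "... <= (G * r ^ m) * ldet A" using cnt dA by (intro mult_right_mono) (auto simp: r_def mult.assoc)
 also have "r ^ m = r ^ (m - k) * r ^ k" using m by (simp flip: power_add)
 finally have "(rcard Ch * ubv k) * r ^ k <= (G * r ^ (m - k) * ldet A) * r ^ k" by (simp add: algebra_simps)
 hence "rcard Ch * ubv k <= G * r ^ (m - k) * ldet A" using r by simp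
 hence "rcard Ch <= (G * r ^ (m - k) * ldet A) / ubv k" using V by (simp only: pos_le_divide_eq)
 thus ?thesis by (simp add: Ch_def r_def mult.assoc)
qed

section \<open>Crude upper bounds and moments of \<open>hmin\<close>\<close>

definition sep :: "'a::euclidean_space set => bool" where
 "sep M \<longleftrightarrow> latt M & (ALL x:M. x ~= 0 --> 1 <= norm x)"

lemma sep_latt: "sep M ==> latt M" by (simp add: sep_def)

lemma sep_subset: "sep M ==> latt A ==> A <= M ==> sep A" by (auto simp: sep_def)

lemma sep_prim: "sep M ==> A : prim k M ==> sep A" using prim_latt[of M A k] primD(3)[of A k M] by (auto simp: sep_def)

lemma sep_count:
 assumes "sep M" "dim M <= m" "s >= 1" shows "rcard (M Int cball 0 s) <= 4 ^ m * s ^ m"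
proof -
 have "rcard (M Int cball 0 s) <= (3 * s / 1 + 1) ^ dim M" using assms by (intro packing_bound) (auto simp: sep_def)
 also have "... <= (4 * s) ^ dim M" using assms by (intro power_mono) auto
 also have "... <= (4 * s) ^ m" using assms by (intro power_increasing) auto
 finally show ?thesis by (simp add: power_mult_distrib)
qed

text \<open>Points of norm at most \<open>kap k * gap B\<close> span \<open>B\<close>, whereas a
  ball of radius below one contains only the origin.\<close>

lemma sep_gap:
 assumes "sep B" "dim B = Suc k" shows "1 <= kap k * gap B"
proof (rule ccontr)
 assume n: "~ ?thesis"
 have B: "latt B" using assms by (simp add: sep_def)
 have "B Int cball 0 (kap k * gap B) <= {0}" using n assms by (force simp: sep_def)
 hence "span (B Int cball 0 (kap k * gap B)) <= span {0}" by (rule span_mono)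
 moreover have "span (B Int cball 0 (kap k * gap B)) = span B" by (rule span_cball_gap[OF B assms(2)]) (simp add: kap_def)
 ultimately have "B <= {0}" using span_superset[of B] by auto
 thus False using assms(2) by (metis dim_eq_0 nat.distinct(1))
qed

lemma sep_children_bound:
 assumes M: "sep M" "dim M <= m" and A: "A : prim k M" and T: "T > 0" and m: "k <= m"
 shows "rcard {B : prim (Suc k) M. mhyp A B & ldet B <= T} <= (4 ^ m * (4 * kap k) ^ m) / ubv k * ((T / ldet A) ^ (m - k) * ldet A)"
proof (cases "{B : prim (Suc k) M. mhyp A B & ldet B <= T} = {}")
 case True
 have "ldet A > 0" using det_pos prim_latt M A by (auto simp: sep_def)
 thus ?thesis unfolding True using T kap_ge1[of k] by simp
next
 case False
 note lM = sep_latt[OF M(1)]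
 obtain B where B: "B : prim (Suc k) M" "mhyp A B" "ldet B <= T" using False by blast
 have sB: "sep B" "dim B = Suc k" using B M sep_prim primD by blast+
 have dA: "ldet A > 0" using det_pos prim_latt lM A by blast
 have "gap B <= T / ldet A" using gap_mhyp[OF B(2)] B(3) dA by (simp add: divide_right_mono)
 hence "kap k * gap B <= kap k * (T / ldet A)" using kap_ge1[of k] by (intro mult_left_mono) auto
 hence g: "1 <= kap k * (T / ldet A)" using sep_gap[OF sB] by linarith
 have "1 <= 4 * kap k * (T / ldet A)" using g by linarith
 from sep_count[OF M this]
 have "rcard (M Int cball 0 (4 * kap k * (T / ldet A))) <= (4 ^ m * (4 * kap k) ^ m) * (T / ldet A) ^ m" by (simp only: power_mult_distrib mult.assoc)
 from children_bound[OF lM A T this m] show ?thesis using kap_ge1[of k] by simp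
qed

lemma sep_children_mu:
 assumes M: "sep M" "dim M <= m" and X: "X <= prim (Suc k) M" and A: "A : prim k M" and T: "T > 0" and m: "k <= m"
 shows "rcard {B : X. mu B = A & ldet B <= T} <= (4 ^ m * (4 * kap k) ^ m) / ubv k * ((T / ldet A) ^ (m - k) * ldet A)"
proof -
 let ?x = "{B : prim (Suc k) M. mhyp A B & ldet B <= T}"
 note lM = sep_latt[OF M(1)]
 have "card {B : X. mu B = A & ldet B <= T} <= card ?x"
 proof (rule card_mono)
  show "finite ?x" by (rule fin_prim[OF lM, of _ "Suc k" T]) auto
  show "{B : X. mu B = A & ldet B <= T} <= ?x" using X mu_prim(3)[OF lM] by auto
 qed
 thus ?thesis using sep_children_bound[OF M A T m] by linarith
qed

lemma children_powr:
 fixes T a :: real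
 assumes "T > 0" "a > 0" "k <= m"
 shows "(T / a) ^ (m - k) * a = T powr (real m - real k) * a powr (- (real m - real k - 1))"
proof -
 have "(T / a) ^ (m - k) * a = T powr (real m - real k) / a powr (real m - real k) * a powr 1" using assms by (simp add: powr_realpow[symmetric] powr_divide of_nat_diff)
 also have "... = T powr (real m - real k) * (a powr 1 / a powr (real m - real k))" by simp
 also have "a powr 1 / a powr (real m - real k) = a powr (- (real m - real k - 1))" by (simp only: powr_diff[symmetric]) (simp add: algebra_simps)
 finally show ?thesis .
qed

text \<open>Sorting by \<open>mu B\<close> turns a sum over rank \<open>Suc k\<close> into one over
  rank \<open>k\<close>: \<open>hmin B\<close> becomes \<open>ldet A\<close>, and \<open>A\<close>
  ranges only up to the bound of \<open>mhyp_det_le\<close>. The number \<open>m\<close> is the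
  dimension in which the children of \<open>A\<close> are counted; it may be smaller than
  \<open>dim M\<close>.\<close>

lemma mhyp_sum:
 fixes M :: "'a::euclidean_space set" and kp :: real
 assumes M: "latt M" and T: "T > 0" and X: "X <= prim (Suc k) M" and Y: "!!B. B : X ==> ldet B <= T ==> mu B : Y" "Y <= prim k M"
  and ch: "!!A. A : Y ==> rcard {B : X. mu B = A & ldet B <= T} <= C * ((T / ldet A) ^ (m - k) * ldet A)"
  and m: "k <= m" and C: "C >= 0"
 shows "(SUM B:dlev X T. hmin B powr (-kp)) <=
  C * T powr (real m - real k) * (SUM A:dlev Y (2 ^ k * T powr (real k / real (Suc k))). ldet A powr (- (real m - real k - 1 + kp)))"
proof -
 let ?x = "- (real m - real k - 1 + kp)"
 define R where "R = 2 ^ k * T powr (real k / real (Suc k))"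
 define F where "F = (dlev X T)"
 define Z where "Z = (dlev Y R)"
 have finF: "finite F" unfolding F_def by (rule fin_prim[OF M, of _ "Suc k" T]) (use X in auto)
 have finZ: "finite Z" unfolding Z_def by (rule fin_prim[OF M, of _ k R]) (use Y in auto)
 have muZ: "mu ` F <= Z"
 proof (rule image_subsetI)
  fix B assume B: "B : F"
  hence Bp: "B : prim (Suc k) M" "ldet B <= T" using X by (auto simp: F_def)
  have "ldet (mu B) <= R" unfolding R_def using mhyp_det_le[OF prim_latt[OF M Bp(1)] primD(2)[OF Bp(1)] mu_prim(3)[OF M Bp(1)] Bp(2)] .
  thus "mu B : Z" using Y(1) B by (auto simp: Z_def F_def)
 qed
 have "(SUM B:F. hmin B powr (-kp)) = (SUM A:Z. SUM B:{B : F. mu B = A}. hmin B powr (-kp))" by (rule sum.group[OF finF finZ muZ, symmetric])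
 also have "... <= (SUM A:Z. C * T powr (real m - real k) * ldet A powr ?x)"
 proof (rule sum_mono)
  fix A assume A: "A : Z"
  hence Ap: "A : prim k M" "A : Y" using Y by (auto simp: Z_def)
  have dA: "ldet A > 0" using det_pos prim_latt M Ap by blast
  have "(SUM B:{B : F. mu B = A}. hmin B powr (-kp)) = (SUM B:{B : F. mu B = A}. ldet A powr (-kp))" using X mu_prim(4)[OF M] by (intro sum.cong) (auto simp: F_def)
  also have "... = rcard {B : F. mu B = A} * ldet A powr (-kp)" by simp
  also have "... <= (C * ((T / ldet A) ^ (m - k) * ldet A)) * ldet A powr (-kp)"
  proof (rule mult_right_mono)
   have "{B : F. mu B = A} = {B : X. mu B = A & ldet B <= T}" by (auto simp: F_def)
   thus "rcard {B : F. mu B = A} <= C * ((T / ldet A) ^ (m - k) * ldet A)" using ch[OF Ap(2)] by simp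
  qed simp
  also have "... = C * T powr (real m - real k) * (ldet A powr (- (real m - real k - 1)) * ldet A powr (-kp))" unfolding children_powr[OF T dA m] by simp
  also have "ldet A powr (- (real m - real k - 1)) * ldet A powr (-kp) = ldet A powr ?x" by (simp add: powr_add[symmetric] algebra_simps)
  finally show "(SUM B:{B : F. mu B = A}. hmin B powr (-kp)) <= C * T powr (real m - real k) * ldet A powr ?x" .
 qed
 finally show ?thesis by (simp add: F_def Z_def R_def sum_distrib_left)
qed

lemma csum_const: "csum J h (%_. 1) r = rcard (lev h J r)" by (simp add: csum_def)

lemma mhyp_exponent:
 fixes T :: real
 assumes T: "T > 0"
 shows "T powr a * (2 ^ k * T powr (real k / real (Suc k))) powr b = (2 ^ k) powr b * T powr (a + b * real k / real (Suc k))" using T by (simp add: powr_mult powr_powr powr_add algebra_simps)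

definition hyp_const :: "nat => real => real => real => real => real" where
 "hyp_const k C K s p = C * ((1 + abs p / s) * (K * (2 ^ k) powr s))"

lemma hyp_const_pos: "0 < C ==> 0 < K ==> 0 < s ==> 0 < hyp_const k C K s p" by (simp add: hyp_const_def add_pos_nonneg)

text \<open>Abel summation over \<open>A\<close>, counted with exponent \<open>q\<close>, completes
  the estimate. The condition \<open>p < q\<close> is what limits the admissible moments
  \<open>kp\<close>.\<close>

lemma mhyp_step:
 fixes kp :: real
 assumes M: "latt M" and T: "T > 0" and X: "X <= prim (Suc k) M" and Y: "!!B. B : X ==> mu B : Y" "Y <= prim k M"
  and ch: "!!A. A : Y ==> rcard {B : X. mu B = A & ldet B <= T} <= C * ((T / ldet A) ^ (m - k) * ldet A)"
  and cnt: "!!r. 0 < r ==> rcard (dlev Y r) <= K * r powr q"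
  and "k <= m" "C > 0" "K > 0" and p: "p = real m - real k - 1 + kp" "p < q" and e: "real m - real k + (q - p) * real k / real (Suc k) = e"
 shows "(SUM B:dlev X T. hmin B powr (-kp)) <= hyp_const k C K (q - p) p * T powr e"
proof -
 let ?x = "1 + abs p / (q - p)"
 define R where "R = 2 ^ k * T powr (real k / real (Suc k))"
 have "(SUM B:dlev X T. hmin B powr (-kp)) <= C * T powr (real m - real k) * (SUM A:dlev Y R. ldet A powr (- p))"
  unfolding R_def p(1) by (rule mhyp_sum[OF M T X]) (use assms in auto)
 also have "(SUM A:dlev Y R. ldet A powr (- p)) <= ?x * (K * R powr (q - p))"
  using abel_upper[of Y ldet R "%_. 1" K q p] finite_subset[OF _ prim_finite[OF M, of k R], of "(dlev Y R)"]
   det_pos prim_latt[OF M, of _ k] Y(2) assms by (auto simp: csum_const R_def subset_eq)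
 also have "C * T powr (real m - real k) * (?x * (K * R powr (q - p)))
  = C * (?x * K) * (T powr (real m - real k) * R powr (q - p))" by simp
 also have "... = hyp_const k C K (q - p) p * T powr e" unfolding R_def mhyp_exponent[OF T] hyp_const_def e[symmetric] by simp
 finally show ?thesis using \<open>C > 0\<close> by (simp add: mult_left_mono)
qed

lemma hmin_powr_0:
 assumes "latt M" "X <= prim (Suc k) M"
 shows "(SUM B:dlev X T. hmin B powr 0) = rcard (dlev X T)"
proof -
 have "hmin B powr 0 = 1" if "B : X" for B using hmin_pos[of B k] prim_latt[OF assms(1), of B "Suc k"] primD(2)[of B "Suc k" M] assms(2) that by auto
 hence "(SUM B:dlev X T. hmin B powr 0) = (SUM B:dlev X T. 1)" by (intro sum.cong) auto
 thus ?thesis by simp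
qed

lemma mhyp_step_card:
 assumes "latt M" "T > 0" "X <= prim (Suc k) M" "!!B. B : X ==> mu B : Y" "Y <= prim k M"
  "!!A. A : Y ==> rcard {B : X. mu B = A & ldet B <= T} <= C * ((T / ldet A) ^ (m - k) * ldet A)"
  "!!r. 0 < r ==> rcard (dlev Y r) <= K * r powr q"
  "k <= m" "C > 0" "K > 0" "p = real m - real k - 1" "p < q" "real m - real k + (q - p) * real k / real (Suc k) = e"
 shows "rcard (dlev X T) <= hyp_const k C K (q - p) p * T powr e" using mhyp_step[OF assms(1-10), of p 0 e] hmin_powr_0[OF assms(1,3), of T] assms(11-) by simp

definition Ucond :: "'a::euclidean_space itself => nat => nat => real => bool" where
 "Ucond _ m k C \<longleftrightarrow> C > 0 & (ALL (M::'a set) T. sep M --> dim M = m --> T > 0 --> pc k M T <= C * T powr (real m))"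

text \<open>\<open>kp < Suc k\<close> amounts to \<open>p < m\<close>, the range in which the sum
  over \<open>A\<close> is dominated by the largest \<open>A\<close>.\<close>

lemma moment_step:
 fixes kp :: real
 assumes U: "Ucond TYPE('a::euclidean_space) m k C" and m: "Suc k <= m" and kp: "kp < real (Suc k)"
 shows "EX C'>0. ALL (M::'a set) T. sep M --> dim M = m --> T > 0 -->
  (SUM B:plev (Suc k) M T. hmin B powr (-kp)) <= C' * T powr (real m - kp * real k / real (Suc k))"
proof -
 define C1 where "C1 = (4 ^ m * (4 * kap k) ^ m) / ubv k"
 define p where "p = real m - real k - 1 + kp"
 have C1: "C1 > 0" using kap_ge1[of k] by (simp add: C1_def)
 have p: "p < real m" using kp by (simp add: p_def)
 have C: "C > 0" using U by (simp add: Ucond_def)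
 have "(SUM B:plev (Suc k) M T. hmin B powr (-kp)) <= hyp_const k C1 C (real m - p) p * T powr (real m - kp * real k / real (Suc k))"
  if M: "sep M" "dim M = m" and T: "T > 0" for M :: "'a set" and T
 proof (rule mhyp_step[OF _ T order_refl _ order_refl])
  show "latt M" using M by (simp add: sep_def)
  thus "mu B : prim k M" if "B : prim (Suc k) M" for B using mu_prim(1) that by blast
  fix A assume A: "A : prim k M"
  show "rcard {B : prim (Suc k) M. mu B = A & ldet B <= T} <= C1 * ((T / ldet A) ^ (m - k) * ldet A)"
   unfolding C1_def using m M(2) by (intro sep_children_mu[OF M(1) _ order_refl A T]) auto
 qed (use U M m C1 C p in \<open>auto simp: Ucond_def p_def field_simps\<close>)
 thus ?thesis using hyp_const_pos[OF C1 C, of "real m - p"] p by (intro exI[of _ "hyp_const k C1 C (real m - p) p"]) simp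
qed

text \<open>The moment of order zero is the count itself, so the bound climbs from rank
  \<open>k\<close> to rank \<open>Suc k\<close>.\<close>

lemma U_bound: "k <= m ==> EX C. Ucond TYPE('a::euclidean_space) m k C"
proof (induction k)
 case 0
 have "pc 0 M T <= 1 * T powr (real m)" if M: "sep M" and T: "T > 0" for M :: "'a set" and T
 proof (cases "T >= 1")
  case True
  have "(plev 0 M T) <= {{0}}" using prim_0[of M] M by (auto simp: sep_def)
  hence "card (plev 0 M T) <= card {{0::'a}}" by (intro card_mono) auto
  moreover have "1 <= T powr real m" using True by (simp add: ge_one_powr_ge_zero)
  ultimately show ?thesis by simp
 next
  case False
  hence "(plev 0 M T) = {}" using prim_0[of M] M by (auto simp: sep_def)
  thus ?thesis by (metis card.empty mult_1 of_nat_0 powr_ge_zero)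
 qed
 thus ?case unfolding Ucond_def by (intro exI[of _ 1]) auto
next
 case (Suc k)
 then obtain C where "Ucond TYPE('a) m k C" by force
 from moment_step[OF this Suc.prems, of 0] obtain C' where C': "C' > 0" "!!(M::'a set) T. sep M ==> dim M = m ==> T > 0 ==>
  (SUM B:plev (Suc k) M T. hmin B powr 0) <= C' * T powr (real m)" by auto
 have "Ucond TYPE('a) m (Suc k) C'" unfolding Ucond_def
 proof (intro conjI C'(1) allI impI)
  fix M :: "'a set" and T :: real assume M: "sep M" "dim M = m" "T > 0"
  show "pc (Suc k) M T <= C' * T powr (real m)" using C'(2)[OF M] hmin_powr_0[of M "prim (Suc k) M" k T] M(1) by (simp add: sep_def)
 qed
 thus ?case by blast
qed

lemma moment_bound:
 fixes kp :: real
 assumes m: "Suc k <= m" and kp: "kp < real (Suc k)"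
 shows "EX C'>0. ALL (M::'a::euclidean_space set) T. sep M --> dim M = m --> T > 0 -->
  (SUM B:plev (Suc k) M T. hmin B powr (-kp)) <= C' * T powr (real m - kp * real k / real (Suc k))"
proof -
 obtain C where "Ucond TYPE('a) m k C" using U_bound[of k m] m by force
 from moment_step[OF this m kp] show ?thesis .
qed

section \<open>Sublattices in special position\<close>

text \<open>Special position is measured by the dimension of the sum, so that \<open>W\<close> may
  be any subset of \<open>span M\<close>.\<close>

definition nongen :: "nat => 'a::euclidean_space set => 'a set => 'a set set" where
 "nongen k M W = {A : prim k M. dim (A Un W) < min (k + dim W) (dim M)}"

lemma nongen_prim: "nongen k M W <= prim k M" by (auto simp: nongen_def)

lemma nongen_0:
 assumes "latt M" "W <= span M" shows "nongen 0 M W = {}"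
proof -
 have "dim ({0} Un W) = dim W" by (simp add: dim_insert span_0)
 moreover have "dim W <= dim M" using assms(2) by (metis dim_span dim_subset)
 ultimately show ?thesis using prim_0[OF assms(1)] by (auto simp: nongen_def)
qed

text \<open>The \<open>B\<close> are sorted by \<open>mu B\<close>. If \<open>mu B\<close> is
  special already, induction applies. Otherwise passing from \<open>mu B\<close> to \<open>B\<close>
  does not enlarge the sum with \<open>W\<close>, so \<open>B\<close> lies in the proper subspace
  spanned by \<open>mu B\<close> and \<open>W\<close> and is counted in a lattice of rank at most
  \<open>m - 1\<close>. Both cases give the same exponent \<open>m - 1 / Suc k\<close>.\<close>

lemma nongen_bound:
 "k <= m ==> EX C>0. ALL (M::'a::euclidean_space set) W T. sep M --> dim M = m --> W <= span M --> T > 0 -->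
  rcard (dlev (nongen k M W) T) <= C * T powr (real m - 1 / real k)"
proof (induction k)
 case 0
 have "rcard (dlev (nongen 0 M W) T) <= 1 * T powr (real m - 1 / real 0)" if "sep M" "W <= span M" for M W :: "'a set" and T using nongen_0[of M W] that by (simp add: sep_def)
 thus ?case by (intro exI[of _ 1]) auto
next
 case (Suc k)
 then obtain C where C: "C > 0" "!!(M::'a set) W T. sep M ==> dim M = m ==> W <= span M ==> T > 0 ==>
  rcard (dlev (nongen k M W) T) <= C * T powr (real m - 1 / real k)" by force
 let ?x = "real m - 1 / real (Suc k)"
 obtain CU where "Ucond TYPE('a) m k CU" using U_bound[of k m] Suc.prems by force
 hence CU: "CU > 0" "!!(M::'a set) T. sep M ==> dim M = m ==> T > 0 ==> pc k M T <= CU * T powr (real m)" by (auto simp: Ucond_def)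
 define c1 where "c1 = (4 ^ m * (4 * kap k) ^ m) / ubv k"
 define c2 where "c2 = (4 ^ (m - 1) * (4 * kap k) ^ (m - 1)) / ubv k"
 have c12: "c1 > 0" "c2 > 0" using kap_ge1[of k] by (auto simp: c1_def c2_def)
 \<comment> \<open>For \<open>k = 0\<close> the quotient \<open>1 / real k\<close> is
   \<open>0\<close>; this is harmless, as no sublattice of rank zero is special.\<close>
 define m1 where "m1 = real m - 1 / real k"
 define p1 where "p1 = real m - real k - 1"
 define p2 where "p2 = real m - real k - 2"
 define D1 where "D1 = hyp_const k c1 C (m1 - p1) p1"
 define D2 where "D2 = hyp_const k c2 CU (real m - p2) p2"
 have pm1: "p1 < m1"
 proof (cases "k = 0")
  case False
  hence "1 / real k <= 1" by simp
  thus ?thesis unfolding p1_def m1_def using of_nat_0_le_iff[of k] False by linarith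
 qed (simp add: p1_def m1_def)
 have D12: "D1 > 0" "D2 > 0" unfolding D1_def D2_def by (intro hyp_const_pos c12 C CU; use pm1 in \<open>simp add: p2_def\<close>)+
 have "rcard (dlev (nongen (Suc k) M W) T) <= (D1 + D2) * T powr ?x" if M: "sep M" "dim M = m" and W: "W <= span M" and T: "T > 0" for M W :: "'a set" and T
 proof -
  note lM = sep_latt[OF M(1)]
  define X1 where "X1 = {B : nongen (Suc k) M W. mu B : nongen k M W}"
  define X2 where "X2 = {B : nongen (Suc k) M W. mu B ~: nongen k M W}"
  have X: "X1 <= prim (Suc k) M" "X2 <= prim (Suc k) M" using nongen_prim by (auto simp: X1_def X2_def)
  have "rcard (dlev X1 T) <= D1 * T powr ?x"
  proof (cases "k = 0")
   case True
   hence "X1 = {}" using nongen_0[OF lM W] by (simp add: X1_def)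
   thus ?thesis using D12 by simp
  next
   case False
   show ?thesis unfolding D1_def
   proof (rule mhyp_step_card[OF lM T X(1) _ nongen_prim])
    show "mu B : nongen k M W" if "B : X1" for B using that by (simp add: X1_def)
    show "rcard (dlev (nongen k M W) r) <= C * r powr m1" if "0 < r" for r using C(2)[OF M W that] by (simp add: m1_def)
    have "(m1 - p1) * real k = real (Suc k) * real k - 1" using False by (simp add: p1_def m1_def field_simps)
    hence "(m1 - p1) * real k / real (Suc k) = real k - 1 / real (Suc k)" by (simp only: diff_divide_distrib) simp
    thus "real m - real k + (m1 - p1) * real k / real (Suc k) = real m - 1 / real (Suc k)" by simp
    fix A assume A: "A : nongen k M W"
    hence "A : prim k M" using nongen_prim by blast
    thus "rcard {B : X1. mu B = A & ldet B <= T} <= c1 * ((T / ldet A) ^ (m - k) * ldet A)"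
     unfolding c1_def using Suc.prems M(2) by (intro sep_children_mu[OF M(1) _ X(1) _ T]) auto
   qed (use Suc.prems c12 C pm1 in \<open>auto simp: p1_def\<close>)
  qed
  moreover have "rcard (dlev X2 T) <= D2 * T powr ?x" unfolding D2_def
  proof (rule mhyp_step_card[OF lM T X(2) _ order_refl])
   have rm: "real (m - 1) = real m - 1" using Suc.prems by simp
   show "mu B : prim k M" if "B : X2" for B using that X(2) mu_prim(1)[OF lM] by blast
   show "pc k M r <= CU * r powr real m" if "0 < r" for r using CU(2)[OF M that] .
   show "p2 = real (m - 1) - real k - 1" "real (m - 1) - real k + (real m - p2) * real k / real (Suc k) = real m - 1 / real (Suc k)" unfolding rm by (auto simp: p2_def field_simps)
   fix A assume A: "A : prim k M"
   have dA: "ldet A > 0" using det_pos prim_latt lM A by blast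
   show "rcard {B : X2. mu B = A & ldet B <= T} <= c2 * ((T / ldet A) ^ (m - 1 - k) * ldet A)"
   proof (cases "{B : X2. mu B = A & ldet B <= T} = {}")
    case True
    show ?thesis unfolding True using dA T c12 by simp
   next
    case False
    define V where "V = span (A Un W)"
    \<comment> \<open>The sum with \<open>W\<close> has at least its general dimension for
      \<open>A\<close> and less than that for \<open>B\<close>, one rank higher; so both sums have
      the same span.\<close>
    have key: "B <= V & dim V < m" if B: "B : X2" "mu B = A" for B
    proof -
     have Bn: "dim (B Un W) < min (Suc k + dim W) m" "A ~: nongen k M W" using B M(2) by (auto simp: X2_def nongen_def)
     have AB: "A <= B" using mu_prim(2)[OF lM, of B k] B X(2) primD(3) by blast
     have "dim (A Un W) <= dim (B Un W)" using AB by (intro dim_subset) auto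
     moreover have "~ dim (A Un W) < min (k + dim W) m" using Bn(2) A M(2) by (auto simp: nongen_def)
     ultimately have "dim (B Un W) <= dim (A Un W)" using Bn(1) by linarith
     hence "span (A Un W) = span (B Un W)" using AB by (intro dim_eq_span) auto
     hence "B <= V" "dim V = dim (B Un W)" using span_superset[of "B Un W"] by (auto simp: V_def)
     thus ?thesis using Bn(1) by simp
    qed
    hence Vm: "dim V < m" using False by blast
    have "dim (M Int V) <= dim V" by (intro dim_subset) auto
    hence dMV: "dim (M Int V) <= m - 1" using Vm by linarith
    have lMV: "latt (M Int V)" unfolding V_def by (rule latt_Int_span[OF lM])
    have sMV: "sep (M Int V)" by (rule sep_subset[OF M(1) lMV]) auto
    have AV: "A : prim k (M Int V)" by (rule prim_down[OF A]) (use primD(3)[OF A] in \<open>auto simp: V_def span_base\<close>)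
    have "card {B : X2. mu B = A & ldet B <= T} <= card {B : prim (Suc k) (M Int V). mhyp A B & ldet B <= T}"
    proof (rule card_mono)
     show "finite {B : prim (Suc k) (M Int V). mhyp A B & ldet B <= T}" by (rule fin_prim[OF lMV, of _ "Suc k" T]) auto
     show "{B : X2. mu B = A & ldet B <= T} <= {B : prim (Suc k) (M Int V). mhyp A B & ldet B <= T}"
     proof
      fix B assume "B : {B : X2. mu B = A & ldet B <= T}"
      hence B: "B : X2" "mu B = A" "ldet B <= T" "B : prim (Suc k) M" using X by auto
      have "B : prim (Suc k) (M Int V)" using primD(3)[OF B(4)] key[OF B(1,2)] by (intro prim_down[OF B(4)]) auto
      thus "B : {B : prim (Suc k) (M Int V). mhyp A B & ldet B <= T}" using mu_prim(3)[OF lM B(4)] B by simp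
     qed
    qed
    moreover have "rcard {B : prim (Suc k) (M Int V). mhyp A B & ldet B <= T} <= c2 * ((T / ldet A) ^ (m - 1 - k) * ldet A)"
     unfolding c2_def using Suc.prems by (intro sep_children_bound[OF sMV dMV AV T]) auto
    ultimately show ?thesis by linarith
   qed
  qed (use Suc.prems c12 CU in \<open>auto simp: p2_def\<close>)
  moreover have "card (dlev (nongen (Suc k) M W) T) <= card (dlev X1 T) + card (dlev X2 T)"
  proof -
   have "(dlev (nongen (Suc k) M W) T) = (dlev X1 T) Un (dlev X2 T)" by (auto simp: X1_def X2_def)
   thus ?thesis by (simp add: card_Un_le)
  qed
  ultimately show ?thesis by (simp add: algebra_simps)
 qed
 thus ?case using D12 by (intro exI[of _ "D1 + D2"]) auto
qed

lemma prim_Int: "A : prim a P ==> W : prim b P ==> A Int W : prim (dim (A Int W)) P"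
proof -
 assume A: "A : prim a P" and W: "W : prim b P"
 have "span (A Int W) <= span A" "span (A Int W) <= span W" by (intro span_mono; auto)+
 hence "P Int span (A Int W) <= A Int W" using prim_memI[OF A] prim_memI[OF W] by blast
 moreover have "A Int W <= P Int span (A Int W)" using primD(3)[OF A] span_superset by blast
 ultimately show ?thesis unfolding prim_def by blast
qed

text \<open>For real spans this is linear algebra; here the intersection of the lattices themselves
  has to be large. Enlarging \<open>A\<close> by one rank enlarges the intersection by at most one
  rank, because the old intersection is the kernel of an integral functional on the new one.\<close>

lemma prim_inter_dim:
 assumes P: "latt P" and A: "A : prim a P" and W: "W : prim b P"
 shows "a + b <= dim P + dim (A Int W)" using A
proof (induction "dim P - a" arbitrary: a A)
 case 0
 have "a <= dim P" using primD(2,3)[OF 0(2)] dim_subset by metis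
 hence "a = dim P" using 0 by simp
 hence "A = P" using prim_top 0(2) by blast
 moreover have "W <= P" "dim W = b" using W primD by blast+
 ultimately show ?case using \<open>a = dim P\<close> by (simp add: Int_absorb1)
next
 case (Suc i)
 have "A ~= P" using Suc(2) primD(2)[OF Suc(3)] by auto
 then obtain x where x: "x : P" "x ~: A" using primD(3)[OF Suc(3)] by blast
 define A1 where "A1 = P Int span (insert x A)"
 note E = prim_extend[OF P Suc(3) x, folded A1_def]
 have IH: "Suc a + b <= dim P + dim (A1 Int W)" using Suc(2) by (intro Suc(1)[OF _ E(1)]) simp
 obtain U c where box: "ofd A U c" using ofd_exists prim_latt P Suc(3) by blast
 obtain u h y where s: "!!a. a : span A ==> a \<bullet> u = 0" "h > 0"
  "!!x. x : A1 ==> EX n::int. x - of_int n *\<^sub>R y : A & x \<bullet> u = of_int n * h" by (rule det_step[OF E(4,2,5) box]) blast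
 define w where "w = (1 / h) *\<^sub>R u"
 let ?x = "{x : A1 Int W. x \<bullet> w = 0}"
 have int: "EX n::int. x \<bullet> w = of_int n" if x: "x : A1" for x
 proof -
  obtain n :: int where "x \<bullet> u = of_int n * h" using s(3)[OF x] by blast
  thus ?thesis using s(2) by (intro exI[of _ n]) (simp add: w_def)
 qed
 have K: "?x = A Int W"
 proof (intro equalityI subsetI)
  fix x assume x: "x : ?x"
  then obtain n :: int where n: "x - of_int n *\<^sub>R y : A" "x \<bullet> u = of_int n * h" using s(3) by blast
  have "x \<bullet> u = 0" using x s(2) by (simp add: w_def)
  hence "n = 0" using n s(2) by simp
  thus "x : A Int W" using n x by simp
 next
  fix x assume "x : A Int W"
  thus "x : ?x" using s(1)[of x] primD(3)[OF E(2)] by (auto simp: w_def span_base)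
 qed
 have "dim (A1 Int W) <= Suc (dim (A Int W))"
 proof (cases "EX b:A1 Int W. b \<bullet> w ~= 0")
  case False
  hence "A1 Int W = A Int W" unfolding K[symmetric] by blast
  thus ?thesis by simp
 next
  case True
  then obtain b where b: "b : A1 Int W" "b \<bullet> w ~= 0" by blast
  have lI: "latt (A1 Int W)" using prim_latt[OF P prim_Int[OF E(1) W]] .
  show ?thesis
  proof (cases "dim (A1 Int W)")
   case (Suc j)
   have "?x : prim j (A1 Int W)" using int by (intro kernel_prim[OF lI Suc _ b]) blast
   thus ?thesis using primD(2) K Suc by force
  next
   case 0
   thus ?thesis by linarith
  qed
 qed
 thus ?case using IH by linarith
qed

lemma prim_Un_dim:
 assumes P: "latt P" and A: "A : prim a P" and W: "W : prim b P"
 shows "a + b <= dim (A Un W) + dim (A Int W)"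
proof -
 define Q where "Q = P Int span (A Un W)"
 have AW: "A <= P" "W <= P" using primD A W by blast+
 have Q: "Q : prim (dim (A Un W)) P" unfolding Q_def using AW by (intro prim_Int_span) auto
 have sub: "A <= Q" "W <= Q" using AW by (auto simp: Q_def span_base)
 have "a + b <= dim Q + dim (A Int W)" using prim_down[OF A sub(1)] prim_down[OF W sub(2)] primD(3)[OF Q] by (intro prim_inter_dim[OF prim_latt[OF P Q]]) auto
 thus ?thesis using primD(2)[OF Q] by simp
qed

lemma dim_Un_Int_le: "dim (A Un W) + dim (A Int W) <= dim A + dim (W::'a::euclidean_space set)"
proof -
 have "dim (A Un W) = dim {x + y |x y. x : span A & y : span W}" unfolding span_Un[symmetric] by (simp only: dim_span)
 moreover have "dim (A Int W) <= dim (span A Int span W)" by (intro dim_subset) (auto intro: span_base)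
 ultimately show ?thesis using dim_sums_Int[of "span A" "span W"] by (simp add: dim_span)
qed

lemma nongenI:
 assumes "A : prim k M" "W : prim b M" "k + b <= dim M + j" "j < dim (A Int W)" "dim M <= k + b"
 shows "A : nongen k M W" using dim_Un_Int_le[of A W] assms primD(2)[OF assms(1)] primD(2)[OF assms(2)] by (simp add: nongen_def)

section \<open>Sublattices that avoid a layer of a reduced system\<close>

definition layer :: "'a::euclidean_space set => (nat => 'a) => nat => 'a set" where
 "layer N v j = N Int span (v ` {1..j})"

text \<open>Quotients of consecutive layer determinants are the heights of the layers; all earlier
  vectors are bounded by the height of the \<open>j\<close>-th layer. This is the only property of
  minimal vectors behind \<open>restricted_bound\<close>.\<close>

definition redv :: "real => nat => 'a::euclidean_space set => (nat => 'a) => bool" where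
 "redv c m N v \<longleftrightarrow> latt N & dim N = m & inj_on v {1..m} & independent (v ` {1..m}) & v ` {1..m} <= N &
  (ALL j:{1..m}. ALL i:{1..<j}. norm (v i) * ldet (layer N v (j - 1)) <= c * ldet (layer N v j))"

lemma layer_prim:
 assumes "inj_on v {1..m}" "independent (v ` {1..m})" "v ` {1..m} <= N" "j <= m"
 shows "layer N v j : prim j N" "span (layer N v j) = span (v ` {1..j})"
proof -
 have sub: "{1..j} <= {1..m}" using assms(4) by auto
 have s: "v ` {1..j} <= N" using assms(3) sub by blast
 have "independent (v ` {1..j})" using assms(2) sub by (meson image_mono independent_mono)
 hence "dim (v ` {1..j}) = card (v ` {1..j})" by (metis dim_eq_card_independent)
 also have "... = j" using assms(1) sub by (simp add: card_image inj_on_subset)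
 finally show "layer N v j : prim j N" using prim_Int_span[OF s] by (simp add: layer_def)
 show "span (layer N v j) = span (v ` {1..j})" unfolding layer_def by (rule span_Int_span[OF s])
qed

lemma redv_layer:
 assumes "redv c m N v" "j <= m"
 shows "layer N v j : prim j N" "span (layer N v j) = span (v ` {1..j})" "latt (layer N v j)"
proof -
 show 1: "layer N v j : prim j N" "span (layer N v j) = span (v ` {1..j})" using assms layer_prim[of v m N j] by (auto simp: redv_def)
 show "latt (layer N v j)" using prim_latt[OF _ 1(1)] assms(1) by (simp add: redv_def)
qed

lemma layer_layer: "i <= j ==> layer (layer N v j) v i = layer N v i" using span_mono[of "v ` {1..i}" "v ` {1..j}"] by (auto simp: layer_def image_mono)

lemma layer_top: "redv c m N v ==> layer N v m = N" using prim_top redv_layer(1)[of c m N v m] by (metis order_refl redv_def)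

lemma redv_sub:
 assumes "redv c (Suc m) N v" shows "redv c m (layer N v m) v" unfolding redv_def
proof (intro conjI ballI)
 have sub: "{1..m} <= {1..Suc m}" by auto
 have l: "layer N v m : prim m N" by (rule redv_layer(1)[OF assms]) simp
 show "latt (layer N v m)" by (rule redv_layer(3)[OF assms]) simp
 show "dim (layer N v m) = m" using l primD by blast
 show "inj_on v {1..m}" using assms sub inj_on_subset unfolding redv_def by blast
 show "independent (v ` {1..m})" using assms sub unfolding redv_def by (meson image_mono independent_mono)
 show "v ` {1..m} <= layer N v m" using assms sub unfolding redv_def layer_def by (auto simp: span_base)
 fix j i assume "j : {1..m}" "i : {1..<j}"
 thus "norm (v i) * ldet (layer (layer N v m) v (j - 1)) <= c * ldet (layer (layer N v m) v j)" using assms unfolding redv_def by (simp add: layer_layer)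
qed

text \<open>Since \<open>A'\<close> avoids the first \<open>m - k\<close> vectors, their projections
  span the hyperplane \<open>Q'\<close> of the quotient \<open>Q\<close>, and they have length at
  most \<open>c * h\<close>. So \<open>Q\<close> has a box of size \<open>O(h)\<close>. A line that
  leaves the hyperplane has length at least \<open>h\<close>, hence \<open>T / ldet A'\<close> is no
  smaller than the box, and the count is bounded by a volume without error term.\<close>

lemma restricted_step:
 assumes r: "redv c (Suc m) N v" and c: "c >= 0" and k: "k <= m" and T: "T > 0"
  and A': "A' : prim k (layer N v m)" "A' Int span (v ` {1..m - k}) = {0}"
 shows "rcard {A : prim (Suc k) N. A Int layer N v m = A' & ldet A <= T} <=
  (ubv (Suc m - k) * (2 + real m * c) ^ (Suc m - k) / ldet N) * ((T / ldet A') ^ (Suc m - k) * ldet A')"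
  and "{A : prim (Suc k) N. A Int layer N v m = A' & ldet A <= T} ~= {} ==> ldet A' <= T / (ldet N / ldet (layer N v m))"
proof -
 let ?x = "{A : prim (Suc k) N. A Int layer N v m = A' & ldet A <= T}"
 define N' where "N' = layer N v m"
 define h where "h = ldet N / ldet N'"
 have N: "latt N" "dim N = Suc m" using r by (auto simp: redv_def)
 have N'p: "N' : prim m N" and spN': "span N' = span (v ` {1..m})" and lN': "latt N'" using redv_layer[OF r, of m] by (auto simp: N'_def)
 have dimN': "dim N' = m" using N'p primD by blast
 have A'N: "A' : prim k N" using prim_trans[OF A'(1)] N'p by (simp add: N'_def)
 have A'N': "A' : prim k N'" using A'(1) by (simp add: N'_def)
 have lA': "latt A'" using prim_latt N A'N by blast
 have pos: "ldet N > 0" "ldet N' > 0" "ldet A' > 0" using det_pos N lN' lA' by auto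
 have h: "h > 0" using pos by (simp add: h_def)
 define Q where "Q = quo N A'"
 define Q' where "Q' = quo N' A'"
 have Q: "latt Q" "ldet Q = ldet N / ldet A'" "dim Q = Suc m - k" using quo_latt[OF A'N N(1)] quo_det[OF A'N N(1)] pos N(2) by (auto simp: Q_def)
 have Q': "latt Q'" "ldet Q' = ldet N' / ldet A'" "dim Q' = m - k" using quo_latt[OF A'N' lN'] quo_det[OF A'N' lN'] pos dimN' by (auto simp: Q'_def)
 have A'subN': "A' <= N'" using A'N' primD by blast
 have Q'p: "Q' : prim (m - k) Q"
 proof -
  have "N' : {B : prim (k + (m - k)) N. A' <= B}" using N'p A'subN' k by simp
  thus ?thesis using quo_prim_bij[OF A'N N(1), of "m - k"] unfolding bij_betw_def Q'_def Q_def by blast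
 qed
 define W where "W = layer N v (m - k)"
 have W: "W : prim (m - k) N" "span W = span (v ` {1..m - k})" using redv_layer[OF r, of "m - k"] by (auto simp: W_def)
 have WN': "W <= N'" unfolding W_def N'_def layer_def using span_mono[of "v ` {1..m - k}" "v ` {1..m}"] by (auto simp: image_mono)
 have A'W: "A' Int W = {0}"
 proof -
  have "A' Int W = A' Int span (v ` {1..m - k})" using primD(3)[OF A'N] by (auto simp: W_def layer_def)
  thus ?thesis using A'(2) by simp
 qed
 have "dim N' <= dim (A' Un W)" using prim_Un_dim[OF N(1) A'N W(1)] A'W dimN' k by simp
 hence spAW: "span (A' Un W) = span N'" using A'subN' WN' by (intro dim_eq_span) auto
 define S where "S = perp A' ` (v ` {1..m - k})"
 have vN': "v i : N'" if "i : {1..m - k}" for i using that r by (auto simp: N'_def layer_def redv_def intro!: span_base)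
 have SQ': "S <= Q'" using vN' by (auto simp: S_def Q'_def quo_def)
 have spS: "span S = span Q'"
 proof -
  have "span S = perp A' ` span W" unfolding S_def W(2) by (rule linear_span_image[OF perp_linear])
  also have "... = perp A' ` span N'"
  proof (intro equalityI subsetI)
   fix x assume "x : perp A' ` span W" then show "x : perp A' ` span N'" using span_mono[OF WN'] by blast
  next
   fix x assume "x : perp A' ` span N'"
   then obtain y where y: "y : span (A' Un W)" "x = perp A' y" unfolding spAW by blast
   then obtain a w where "a : span A'" "w : span W" "y = a + w" unfolding span_Un by blast
   hence "x = perp A' w" using y(2) by (simp add: linear_add[OF perp_linear] perp_eq_0_iff)
   thus "x : perp A' ` span W" using \<open>w : span W\<close> by blast
  qed
  finally show ?thesis by (simp add: Q'_def span_quo)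
 qed
 have finS: "finite S" by (simp add: S_def)
 \<comment> \<open>There are at most \<open>m - k\<close> projections, and they span a space of
   exactly this dimension.\<close>
 have indS: "independent S"
 proof (rule card_le_dim_spanning[of _ "span Q'"])
  have "card S <= m - k" unfolding S_def using card_image_le[of "{1..m-k}" "%i. perp A' (v i)"] by (simp add: image_image)
  thus "card S <= dim (span Q')" using Q'(3) by simp
 qed (use SQ' spS finS in \<open>auto simp: span_base\<close>)
 have nS: "norm x <= c * h" if x: "x : S" for x
 proof -
  obtain i where i: "i : {1..m - k}" "x = perp A' (v i)" using x by (auto simp: S_def)
  have lt: "layer N v (Suc m) = N" by (rule layer_top[OF r])
  have "ALL j:{1..Suc m}. ALL i:{1..<j}. norm (v i) * ldet (layer N v (j - 1)) <= c * ldet (layer N v j)" using r by (simp add: redv_def)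
  moreover have "Suc m : {1..Suc m}" "i : {1..<Suc m}" using i by auto
  ultimately have "norm (v i) * ldet (layer N v (Suc m - 1)) <= c * ldet (layer N v (Suc m))" by blast
  hence "norm (v i) * ldet N' <= c * ldet N" by (simp add: lt N'_def)
  hence "norm (v i) <= c * h" using pos by (simp add: h_def field_simps)
  thus ?thesis using i(2) perp_norm_le[of A' "v i"] by simp
 qed
 obtain U d where box': "ofd (Q Int span S) U d" "!!u. u : U ==> d u <= c * h" using chain_box[OF Q(1) finS _ indS nS] SQ' primD(3)[OF Q'p] by (metis subset_trans)
 have QS: "Q Int span S = Q'" using primD(1)[OF Q'p] spS by simp
 have dQ: "dim Q = Suc (m - k)" using Q(3) k by simp
 obtain u hh y where s: "norm u = 1" "!!a. a : span Q' ==> a \<bullet> u = 0" "u ~: U"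
  "!!x. x : Q ==> EX n::int. x - of_int n *\<^sub>R y : Q' & x \<bullet> u = of_int n * hh"
  "ofd Q (insert u U) (d(u := hh))" "hh = ldet Q / ldet Q'" by (rule det_step[OF Q(1) Q'p dQ box'(1)[unfolded QS]]) blast
 have hh: "hh = h" using s(6) Q(2) Q'(2) pos by (simp add: h_def)
 have cardU: "card U = m - k" using box'(1)[unfolded QS] Q'(3) onb_card[of U] by (simp add: ofd_def)
 have finU: "finite U" using box'(1) by (auto simp: ofd_def onb_def)
 have sumd: "sum (d(u := hh)) (insert u U) <= (1 + real m * c) * h"
 proof -
  have "sum (d(u := hh)) U <= rcard U * (c * h)" using box'(2) s(3) by (intro sum_bounded_above) auto
  also have "... <= real m * (c * h)" using cardU c h by (intro mult_right_mono) auto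
  finally show ?thesis using finU s(3) hh by (simp add: algebra_simps)
 qed
 define X where "X = {A : prim (Suc k) N. A Int N' = A' & ldet A <= T}"
 define t where "t = T / ldet A'"
 \<comment> \<open>A generator of the image of \<open>A\<close> in \<open>Q\<close> has nonzero
   height over \<open>Q'\<close>, because \<open>A\<close> meets the layer in \<open>A'\<close>
   only.\<close>
 have ht: "h <= t" if A: "A : X" for A
 proof -
  have Ap: "A : prim (Suc k) N" "A Int N' = A'" "ldet A <= T" using A by (auto simp: X_def)
  have lA: "latt A" using prim_latt N Ap by blast
  have A'A: "A' : prim k A" using Ap primD(3)[OF Ap(1)] by (intro prim_down[OF A'N]) auto
  have q: "latt (quo A A')" "ldet (quo A A') = ldet A / ldet A'" "dim (quo A A') = 1" using quo_latt[OF A'A lA] quo_det[OF A'A lA] pos primD(2)[OF Ap(1)] by auto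
  obtain x where x: "x : quo A A'" "norm x = ldet A / ldet A'" "x ~= 0" using rank1_gen[OF q(1,3)] q(2) by metis
  obtain a where a: "a : A" "x = perp A' a" using x(1) by (auto simp: quo_def)
  have "x : Q" using a primD(3)[OF Ap(1)] by (auto simp: Q_def quo_def)
  then obtain n :: int where n: "x - of_int n *\<^sub>R y : Q'" "x \<bullet> u = of_int n * hh" using s(4) by blast
  have "n ~= 0"
  proof
   assume "n = 0"
   hence "x : Q'" using n by simp
   then obtain b where b: "b : N'" "x = perp A' b" by (auto simp: Q'_def quo_def)
   have "a - b : span A'" using a b perp_eq_iff by metis
   hence "(a - b) + b : span N'" using span_mono[OF A'subN'] b(1) by (intro span_add) (auto simp: span_base)
   hence "a : N'" using prim_memI[OF N'p] a(1) primD(3)[OF Ap(1)] by auto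
   hence "a : A'" using a(1) Ap(2) by blast
   hence "x = 0" using a(2) by (simp add: perp_eq_0_iff span_base)
   thus False using x(3) by simp
  qed
  hence "1 <= abs (real_of_int n)" by linarith
  hence "h <= abs (x \<bullet> u)" using n(2) hh h by (simp add: abs_mult)
  also have "... <= norm x" using Cauchy_Schwarz_ineq2[of x u] s(1) by simp
  also have "... <= t" using x(2) Ap(3) pos by (simp add: t_def divide_right_mono)
  finally show ?thesis .
 qed
 show "ldet A' <= T / (ldet N / ldet (layer N v m))" if "?x ~= {}"
 proof -
  have "h <= t" using ht that by (auto simp: X_def N'_def)
  hence "ldet A' <= T / h" using pos h by (simp add: t_def field_simps)
  thus ?thesis by (simp add: h_def N'_def)
 qed
 show "rcard ?x <=
  (ubv (Suc m - k) * (2 + real m * c) ^ (Suc m - k) / ldet N) * ((T / ldet A') ^ (Suc m - k) * ldet A')"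
 proof (cases "X = {}")
  case True
  hence XE: "?x = {}" by (simp only: X_def N'_def)
  show ?thesis unfolding XE using pos T c by simp
 next
  case False
  hence ht': "h <= t" using ht by blast
  let ?z = "(2 + real m * c) ^ (Suc m - k) * t ^ (Suc m - k)"
  let ?y = "{B : prim (Suc k) N. A' <= B & ldet B <= T}"
  have t0: "t > 0" using ht' h by linarith
  have fin: "finite ?y" by (rule fin_prim[OF N(1), of _ "Suc k" T]) auto
  have "card X <= card ?y" by (rule card_mono[OF fin]) (auto simp: X_def)
  also have "... = card (plev 1 Q t)" unfolding t_def Q_def by (rule card_quo_children[OF A'N N(1)])
  also have "... <= card (Q Int cball 0 t - {0})" by (rule card_prim1_le[OF Q(1)])
  also have "... <= card (Q Int cball 0 t)" by (rule card_mono[OF latt_finite[OF Q(1)]]) auto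
  finally have "rcard X * ldet Q <= rcard (Q Int cball 0 t) * ldet Q" using det_pos[OF Q(1)] by (intro mult_right_mono) auto
  also have "... <= ubv (dim Q) * (t + sum (d(u := hh)) (insert u U)) ^ dim Q"
  proof (rule count_upper[OF Q(1) s(5)])
   have "0 <= sum (d(u := hh)) (insert u U)" using s(5) by (intro sum_nonneg) (auto simp: ofd_def less_imp_le)
   thus "0 < t + sum (d(u := hh)) (insert u U)" using t0 by linarith
  qed
  also have "... <= ubv (dim Q) * ((2 + real m * c) * t) ^ dim Q"
  proof (intro mult_left_mono power_mono)
   have "(1 + real m * c) * h <= (1 + real m * c) * t" using ht' c by (intro mult_left_mono) auto
   thus "t + sum (d(u := hh)) (insert u U) <= (2 + real m * c) * t" using sumd by (simp add: algebra_simps)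
   have "0 <= sum (d(u := hh)) (insert u U)" using s(5) by (intro sum_nonneg) (auto simp: ofd_def less_imp_le)
   thus "0 <= t + sum (d(u := hh)) (insert u U)" using t0 by linarith
  qed simp
  finally have "rcard X * (ldet N / ldet A') <= ubv (Suc m - k) * ?z" by (simp only: Q(2,3) power_mult_distrib)
  hence "rcard X <= ubv (Suc m - k) * ?z / (ldet N / ldet A')" using pos by (subst pos_le_divide_eq) auto
  thus ?thesis by (simp add: X_def N'_def t_def)
 qed
qed

text \<open>\<open>A\<close> is peeled by intersecting it with the layer of rank
  \<open>m - 1\<close>, where it loses exactly one rank, and the heights recombine to
  \<open>ldet N powr k\<close>. The bound holds for all \<open>T\<close> and all shapes of
  \<open>N\<close>, in contrast to the asymptotic counts.\<close>

lemma restricted_bound: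
 fixes c :: real
 assumes c: "c >= 0"
 shows "k <= m ==> EX C>0. ALL (N::'a::euclidean_space set) v T. redv c m N v --> T > 0 -->
  real (card {A : prim k N. A Int span (v ` {1..m - k}) = {0} & ldet A <= T}) <= C * (T powr real m / ldet N powr real k)"
proof (induction k arbitrary: m)
 case 0
 have "real (card {A : prim 0 N. A Int span (v ` {1..m - 0}) = {0} & ldet A <= T}) <= 1 * (T powr real m / ldet N powr real 0)"
  if r: "redv c m N v" and T: "T > 0" for N :: "'a set" and v T
 proof (cases "T >= 1")
  case True
  have lN: "latt N" using r by (simp add: redv_def)
  have "{A : prim 0 N. A Int span (v ` {1..m - 0}) = {0} & ldet A <= T} <= {{0}}" using prim_0[OF lN] by auto
  hence "card {A : prim 0 N. A Int span (v ` {1..m - 0}) = {0} & ldet A <= T} <= card {{0::'a}}" by (intro card_mono) auto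
  moreover have "1 <= T powr real m" using True by (simp add: ge_one_powr_ge_zero)
  ultimately show ?thesis using det_pos[OF lN] by simp
 next
  case False
  hence "{A : prim 0 N. A Int span (v ` {1..m - 0}) = {0} & ldet A <= T} = {}" using prim_0[of N] r by (auto simp: redv_def)
  thus ?thesis by (metis card.empty divide_nonneg_nonneg mult_1 of_nat_0 powr_ge_zero)
 qed
 thus ?case by (intro exI[of _ 1]) auto
next
 case (Suc k)
 obtain m' where m: "m = Suc m'" "k <= m'" using Suc.prems by (cases m) auto
 obtain C where C: "C > 0" "!!(N::'a set) v T. redv c m' N v ==> T > 0 ==>
  real (card {A : prim k N. A Int span (v ` {1..m' - k}) = {0} & ldet A <= T}) <= C * (T powr real m' / ldet N powr real k)" using Suc.IH[OF m(2)] by blast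
 define c1 where "c1 = ubv (Suc m' - k) * (2 + real m' * c) ^ (Suc m' - k)"
 have c1: "c1 > 0" using c by (simp add: c1_def add_pos_nonneg)
 define p where "p = real m' - real k"
 \<comment> \<open>For \<open>k = 0\<close> the exponent \<open>p\<close> is \<open>real m'\<close>
   and Abel summation would be critical, but then \<open>A'\<close> can only be the zero
   lattice.\<close>
 define c2 where "c2 = (if k = 0 then 1 else (1 + abs p / (real m' - p)) * C)"
 have c2: "c2 > 0" using C(1) by (auto simp: c2_def p_def intro!: mult_pos_pos add_pos_nonneg)
 have "real (card {A : prim (Suc k) N. A Int span (v ` {1..m - Suc k}) = {0} & ldet A <= T}) <= (c1 * c2) * (T powr real m / ldet N powr real (Suc k))"
  if r: "redv c m N v" and T: "T > 0" for N :: "'a set" and v T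
 proof -
  let ?x = "real (Suc m') - real k"
  have r': "redv c (Suc m') N v" using r m by simp
  define N' where "N' = layer N v m'"
  have rN': "redv c m' N' v" unfolding N'_def by (rule redv_sub[OF r'])
  have N: "latt N" "latt N'" "dim N = Suc m'" using r' rN' by (auto simp: redv_def)
  have N'p: "N' : prim m' N" using redv_layer(1)[OF r', of m'] by (simp add: N'_def)
  have pos: "ldet N > 0" "ldet N' > 0" using det_pos N by auto
  define h where "h = ldet N / ldet N'"
  have h: "h > 0" using pos by (simp add: h_def)
  define X where "X = {A : prim (Suc k) N. A Int span (v ` {1..m' - k}) = {0} & ldet A <= T}"
  define Y where "Y = {A : prim k N'. A Int span (v ` {1..m' - k}) = {0}}"
  define Z where "Z = (dlev Y (T / h))"
  let ?y = "SUM A':Z. 1 * ldet A' powr (-p)"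
  have finX: "finite X" by (rule fin_prim[OF N(1), of _ "Suc k" T]) (auto simp: X_def)
  have finZ: "finite Z" by (rule fin_prim[OF N(2), of _ k "T / h"]) (auto simp: Z_def Y_def)
  have XZ: "(%A. A Int N') ` X <= Z"
  proof (rule image_subsetI)
   fix A assume A: "A : X"
   hence Ap: "A : prim (Suc k) N" "A Int span (v ` {1..m' - k}) = {0}" "ldet A <= T" by (auto simp: X_def)
   define W where "W = layer N v (m' - k)"
   have W: "W : prim (m' - k) N" using redv_layer(1)[OF r', of "m' - k"] by (simp add: W_def)
   have WN': "W <= N'" unfolding W_def N'_def layer_def using span_mono[of "v ` {1..m' - k}" "v ` {1..m'}"] by (auto simp: image_mono)
   have AN: "A <= N" using Ap(1) primD by blast
   have AW: "A Int W = {0}" using Ap(2) AN by (auto simp: W_def layer_def)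
   have pI: "A Int N' : prim (dim (A Int N')) N" by (rule prim_Int[OF Ap(1) N'p])
   have "Suc k + m' <= dim N + dim (A Int N')" by (rule prim_inter_dim[OF N(1) Ap(1) N'p])
   hence d1: "k <= dim (A Int N')" using N(3) by simp
   have d2: "dim (A Int N') <= k"
   proof -
    have "A Int N' : prim (dim (A Int N')) N'" using primD(3)[OF N'p] by (intro prim_down[OF pI]) auto
    moreover have "W : prim (m' - k) N'" using primD(3)[OF N'p] WN' by (intro prim_down[OF W]) auto
    ultimately have "dim (A Int N') + (m' - k) <= dim N' + dim (A Int N' Int W)" by (rule prim_inter_dim[OF N(2)])
    moreover have "A Int N' Int W = {0}" using AW WN' by blast
    moreover have "dim N' = m'" using N'p primD by blast
    ultimately show ?thesis using m(2) by simp
   qed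
   hence AN'k: "A Int N' : prim k N'" using d1 pI primD(3)[OF N'p] prim_down[OF pI, of N'] by simp
   have z: "(A Int N') Int span (v ` {1..m' - k}) = {0}"
   proof -
    have "0 : N'" using N by simp
    thus ?thesis using Ap(2) by blast
   qed
   have "ldet (A Int N') <= T / h" unfolding h_def N'_def
   proof (rule restricted_step(2)[OF r' c m(2) T])
    show "A Int layer N v m' : prim k (layer N v m')" "A Int layer N v m' Int span (v ` {1..m' - k}) = {0}" using AN'k z by (auto simp: N'_def)
    show "{Aa : prim (Suc k) N. Aa Int layer N v m' = A Int layer N v m' & ldet Aa <= T} ~= {}" using Ap by blast
   qed
   thus "A Int N' : Z" using AN'k z by (simp add: Z_def Y_def)
  qed
  have "rcard X = (SUM A:X. 1)" by simp
  also have "... = (SUM A':Z. SUM A:{A : X. A Int N' = A'}. 1)" by (rule sum.group[OF finX finZ XZ, symmetric])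
  also have "... <= (SUM A':Z. (c1 / ldet N) * (T powr ?x * ldet A' powr (-p)))"
  proof (rule sum_mono)
   fix A' assume "A' : Z"
   hence A': "A' : prim k N'" "A' Int span (v ` {1..m' - k}) = {0}" by (auto simp: Z_def Y_def)
   have dA': "ldet A' > 0" using det_pos prim_latt N A' by blast
   have "card {A : X. A Int N' = A'} <= card {A : prim (Suc k) N. A Int N' = A' & ldet A <= T}"
    by (rule card_mono[OF fin_prim[OF N(1), of _ "Suc k" T]]) (auto simp: X_def)
   moreover have "rcard {A : prim (Suc k) N. A Int N' = A' & ldet A <= T} <= (c1 / ldet N) * ((T / ldet A') ^ (Suc m' - k) * ldet A')"
    using restricted_step(1)[OF r' c m(2) T, of A'] A' by (simp add: N'_def c1_def)
   moreover have "(T / ldet A') ^ (Suc m' - k) * ldet A' = T powr ?x * ldet A' powr (-p)" using children_powr[OF T dA', of k "Suc m'"] m(2) by (simp add: p_def)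
   ultimately show "(SUM A:{A : X. A Int N' = A'}. 1) <= (c1 / ldet N) * (T powr ?x * ldet A' powr (-p))" by simp
  qed
  also have "... = (c1 / ldet N) * T powr ?x * ?y" by (simp add: sum_distrib_left mult.assoc)
  also have "?y <= c2 / ldet N' powr real k * (T / h) powr real k"
  proof (cases "k = 0")
   case True
   have "Z <= {{0}}" using prim_0[OF N(2)] True by (auto simp: Z_def Y_def)
   hence "?y <= (SUM A':{{0::'a}}. 1 * ldet A' powr (-p))" by (intro sum_mono2) auto
   thus ?thesis using True pos T h by (simp add: c2_def)
  next
   case False
   have "(SUM A':dlev Y (T / h). 1 * ldet A' powr (-p)) <= (1 + abs p / (real m' - p)) * ((C / ldet N' powr real k) * (T / h) powr (real m' - p))"
   proof (rule abel_upper[where w = "%_. 1"])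
    show "finite (dlev Y (T / h))" using finZ by (simp add: Z_def)
    show "0 < ldet A" if "A : Y" for A using det_pos prim_latt N(2) that by (auto simp: Y_def)
    show "csum Y ldet (%_. 1) t <= C / ldet N' powr real k * t powr real m'" if "0 < t" for t using C(2)[OF rN' that] by (simp add: csum_const Y_def conj_assoc)
   qed (use C pos False T h in \<open>auto simp: p_def\<close>)
   thus ?thesis using False by (simp add: Z_def c2_def p_def)
  qed
  also have "(c1 / ldet N) * T powr ?x * (c2 / ldet N' powr real k * (T / h) powr real k)
   = (c1 * c2) * (T powr real m / ldet N powr real (Suc k))"
  proof -
   have "(T / h) powr real k = T powr real k * ldet N' powr real k / ldet N powr real k" unfolding h_def using T pos by (simp add: powr_divide powr_mult)
   moreover have "T powr ?x * T powr real k = T powr real m" unfolding m(1) by (simp flip: powr_add)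
   moreover have "ldet N powr real (Suc k) = ldet N * ldet N powr real k" using pos by (simp add: powr_add)
   moreover have "n' ~= 0 ==> (c1 / l) * a * (c2 / n' * (b * n' / n)) = (c1 * c2) * ((a * b) / (l * n))" for l n n' a b by simp
   ultimately show ?thesis using pos by simp
  qed
  finally have "(!!x y. x <= y ==> c1 / ldet N * T powr ?x * x <= c1 / ldet N * T powr ?x * y) ==>
   rcard X <= (c1 * c2) * (T powr real m / ldet N powr real (Suc k))" .
  moreover have "c1 / ldet N * T powr ?x * x <= c1 / ldet N * T powr ?x * y" if "x <= y" for x y using that c1 pos by (intro mult_left_mono) auto
  ultimately show ?thesis by (simp add: X_def m(1))
 qed
 thus ?case using c1 c2 by (intro exI[of _ "c1 * c2"]) auto
qed

section \<open>Lattice points in balls and rank one sublattices\<close>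

definition sc :: "real => 'a::euclidean_space set => 'a set" where
 "sc a M = (%x. a *\<^sub>R x) ` M"

lemma sc_iff: "a > 0 ==> x : sc a M \<longleftrightarrow> (1 / a) *\<^sub>R x : M" by (auto simp: sc_def intro: image_eqI[of x _ "(1 / a) *\<^sub>R x"])

lemma sc_sc: "a > 0 ==> b > 0 ==> sc a (sc b M) = sc (a * b) M" by (auto simp: sc_def image_image)

lemma sc_1: "sc 1 M = M" by (simp add: sc_def)

lemma span_sc:
 assumes "a > 0" shows "span (sc a M) = span M"
proof (rule span_eq[THEN iffD2], intro conjI subsetI)
 show "x : span M" if "x : sc a M" for x using that by (auto simp: sc_def span_base span_scale)
 fix x assume x: "x : M"
 have "a *\<^sub>R x : span (sc a M)" unfolding sc_def using x by (intro span_base imageI)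
 from span_scale[OF this, of "1 / a"] show "x : span (sc a M)" using assms by simp
qed

lemma dim_sc: "a > 0 ==> dim (sc a M) = dim M" by (metis span_sc dim_span)

lemma latt_sc:
 assumes a: "a > 0" and M: "latt M" shows "latt (sc a M)"
proof -
 obtain e where e: "e > 0" "!!x. x : M ==> x ~= 0 ==> e <= norm x" using M by (auto simp: latt_def)
 have "ALL x:sc a M. x ~= 0 --> a * e <= norm x" using e a by (auto simp: sc_def)
 moreover have "x - y : sc a M" if "x : sc a M" "y : sc a M" for x y using that latt_diff[OF M] by (auto simp: sc_def scaleR_diff_right[symmetric])
 moreover have "0 : sc a M" using M by (force simp: sc_def)
 moreover have "a * e > 0" using a e by simp
 ultimately show ?thesis unfolding latt_def by blast
qed

lemma ofd_sc:
 assumes a: "a > 0" and box: "ofd M U c" shows "ofd (sc a M) U (%u. a * c u)" unfolding ofd_def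
proof (intro conjI ballI)
 fix v assume "v : span (sc a M)"
 hence "(1 / a) *\<^sub>R v : span M" using span_sc[OF a] by (auto intro: span_scale)
 hence ex1: "EX! z. z : M & (ALL u:U. 0 <= ((1 / a) *\<^sub>R v - z) \<bullet> u & ((1 / a) *\<^sub>R v - z) \<bullet> u < c u)" using box by (auto simp: ofd_def)
 have iff: "(0 <= (v - z) \<bullet> u & (v - z) \<bullet> u < a * c u) \<longleftrightarrow> (0 <= ((1 / a) *\<^sub>R v - (1 / a) *\<^sub>R z) \<bullet> u & ((1 / a) *\<^sub>R v - (1 / a) *\<^sub>R z) \<bullet> u < c u)" for z u
 proof -
  have e: "((1 / a) *\<^sub>R v - (1 / a) *\<^sub>R z) \<bullet> u = ((v - z) \<bullet> u) / a" by (simp add: inner_diff_left diff_divide_distrib)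
  show ?thesis unfolding e using a by (simp add: zero_le_divide_iff pos_divide_less_eq mult.commute)
 qed
 from ex1 obtain z where z: "z : M" "ALL u:U. 0 <= ((1 / a) *\<^sub>R v - z) \<bullet> u & ((1 / a) *\<^sub>R v - z) \<bullet> u < c u"
  and zu: "!!z'. z' : M ==> ALL u:U. 0 <= ((1 / a) *\<^sub>R v - z') \<bullet> u & ((1 / a) *\<^sub>R v - z') \<bullet> u < c u ==> z' = z" by metis
 show "EX! z. z : sc a M & (ALL u:U. 0 <= (v - z) \<bullet> u & (v - z) \<bullet> u < a * c u)"
 proof (intro ex1I[of _ "a *\<^sub>R z"] conjI)
  show "a *\<^sub>R z : sc a M" unfolding sc_def using z(1) by (rule imageI)
  show "ALL u:U. 0 <= (v - a *\<^sub>R z) \<bullet> u & (v - a *\<^sub>R z) \<bullet> u < a * c u" unfolding iff using z(2) a by simp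
  fix w assume w: "w : sc a M & (ALL u:U. 0 <= (v - w) \<bullet> u & (v - w) \<bullet> u < a * c u)"
  have "(1 / a) *\<^sub>R w = z"
  proof (rule zu)
   show "(1 / a) *\<^sub>R w : M" using w a by (simp add: sc_iff)
   show "ALL u:U. 0 <= ((1 / a) *\<^sub>R v - (1 / a) *\<^sub>R w) \<bullet> u & ((1 / a) *\<^sub>R v - (1 / a) *\<^sub>R w) \<bullet> u < c u" using w unfolding iff by blast
  qed
  hence "a *\<^sub>R ((1 / a) *\<^sub>R w) = a *\<^sub>R z" by simp
  thus "w = a *\<^sub>R z" using a by simp
 qed
qed (use box a span_sc[OF a, of M] in \<open>auto simp: ofd_def\<close>)

lemma det_sc:
 assumes a: "a > 0" and M: "latt M" shows "ldet (sc a M) = a ^ dim M * ldet M"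
proof -
 obtain U c where box: "ofd M U c" using ofd_exists M by blast
 have "ldet (sc a M) = (PROD u:U. a * c u)" by (rule lattice_det_box[OF latt_sc[OF a M] ofd_sc[OF a box]])
 also have "... = a ^ card U * (PROD u:U. c u)" by (simp add: prod.distrib)
 also have "card U = dim M" using box onb_card[of U] by (simp add: ofd_def)
 finally show ?thesis using lattice_det_box[OF M box] by simp
qed

lemma prim_sc1:
 assumes a: "a > 0" and A: "A : prim k M" shows "sc a A : prim k (sc a M)"
proof -
 have "sc a M Int span A <= sc a A"
 proof
  fix x assume x: "x : sc a M Int span A"
  hence "(1 / a) *\<^sub>R x : M" "(1 / a) *\<^sub>R x : span A" using a by (auto simp: sc_iff span_scale)
  thus "x : sc a A" using prim_memI[OF A] a by (simp add: sc_iff)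
 qed
 moreover have "sc a A <= sc a M Int span A" using primD(3)[OF A] by (auto simp: sc_def span_base span_scale)
 ultimately show ?thesis using primD(2)[OF A] a unfolding prim_def by (auto simp: span_sc dim_sc)
qed

lemma sc_inverse: "a > 0 ==> sc (1 / a) (sc a M) = M" by (simp add: sc_sc sc_1)

lemma sc_inverse': "a > 0 ==> sc a (sc (1 / a) M) = M" by (simp add: sc_sc sc_1)

lemma prim_sc_bij:
 assumes a: "a > 0" shows "bij_betw (sc a) (prim k M) (prim k (sc a M))"
proof (rule bij_betw_byWitness[where f' = "sc (1 / a)"])
 show "sc (1 / a) ` prim k (sc a M) <= prim k M" using prim_sc1[of "1 / a" _ k "sc a M"] a by (auto simp: sc_inverse)
qed (use a prim_sc1 in \<open>auto simp: sc_inverse sc_inverse'\<close>)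

lemma card_prim_sc:
 assumes a: "a > 0" and M: "latt M"
 shows "card (plev k (sc a M) T) = card (plev k M (T / a ^ k))"
proof -
 have "bij_betw (sc a) (plev k M (T / a ^ k)) (plev k (sc a M) T)"
 proof (rule bij_betw_Collect[OF prim_sc_bij[OF a]])
  fix A assume A: "A : prim k M"
  have "ldet (sc a A) = a ^ k * ldet A" using det_sc[OF a prim_latt[OF M A]] primD(2)[OF A] by simp
  thus "(ldet (sc a A) <= T) = (ldet A <= T / a ^ k)" using a by (simp add: pos_le_divide_eq mult.commute)
 qed
 thus ?thesis by (rule bij_betw_same_card[symmetric])
qed

lemma sep_sc:
 assumes l: "l > 0" and M: "latt M" "!!x. x : M ==> x ~= 0 ==> l <= norm x" shows "sep (sc (1 / l) M)"
 unfolding sep_def using latt_sc[of "1 / l" M] l M by (auto simp: sc_def field_simps)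

section \<open>Point counts in balls with uniform error\<close>

lemma power_diff_le:
 fixes x y :: real
 assumes "0 <= y" "y <= x" shows "x ^ r - y ^ r <= real r * (x - y) * x ^ (r - 1)"
proof (induction r)
 case (Suc r)
 have "x ^ Suc r - y ^ Suc r = x * (x ^ r - y ^ r) + (x - y) * y ^ r" by (simp add: algebra_simps)
 also have "... <= x * (real r * (x - y) * x ^ (r - 1)) + (x - y) * x ^ r" using Suc assms by (intro add_mono mult_left_mono power_mono) auto
 also have "... = real (Suc r) * (x - y) * x ^ (Suc r - 1)" by (cases r) (auto simp: algebra_simps)
 finally show ?case .
qed simp

text \<open>Balls of radius below one contain only the origin, so the constant sequence one is
  admissible in \<open>minkowski_second\<close>.\<close>

lemma sep_det_lower: "EX c>0. ALL M::'a::euclidean_space set. sep M --> dim M = k --> c <= ldet M"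
proof -
 obtain C where C: "C > 0" "!!(N::'a set) mm. latt N ==> dim N = k ==> (ALL i:{1..k}. 0 <= mm i & (ALL r<mm i. dim (N Int cball 0 r) < i)) ==>
  (\<Prod>i=1..k. mm i) <= C * ldet N" using minkowski_second[of k, where ?'a = 'a] by blast
 have "1 / C <= ldet M" if M: "sep M" "dim M = k" for M :: "'a set"
 proof -
  have "(\<Prod>i=1..k. (1::real)) <= C * ldet M"
  proof (rule C(2))
   show "latt M" "dim M = k" using M by (auto simp: sep_def)
   show "ALL i:{1..k}. 0 <= (1::real) & (ALL r<1. dim (M Int cball 0 r) < i)"
   proof (intro ballI conjI allI impI)
    fix i r assume i: "i : {1..k}" and r: "r < (1::real)"
    have "M Int cball 0 r <= {0}" using r M by (force simp: sep_def)
    hence "dim (M Int cball 0 r) = 0" by (simp only: dim_eq_0)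
    moreover have "1 <= i" using i by simp
    ultimately show "dim (M Int cball 0 r) < i" by linarith
   qed simp
  qed
  thus ?thesis using C(1) by (simp add: field_simps)
 qed
 thus ?thesis using C(1) by (intro exI[of _ "1 / C"]) auto
qed

text \<open>The error is independent of the shape of \<open>Q\<close>. For \<open>t\<close> below
  the gap all points lie in a minimal hyperplane \<open>A\<close>, and both count and volume term
  are \<open>O(t^k)\<close>. For larger \<open>t\<close> the box has size \<open>O(gap Q)\<close>,
  and the boundary term carries \<open>gap Q / ldet Q = 1 / ldet A\<close>, which is
  bounded.\<close>

lemma sep_ball_count:
 "EX C>0. ALL (Q::'a::euclidean_space set) t. sep Q --> dim Q = Suc k --> t >= 1 -->
  abs (rcard (Q Int cball 0 t) - ubv (Suc k) * t ^ Suc k / ldet Q) <= C * t ^ k"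
proof -
 obtain c0 where c0: "c0 > 0" "!!M::'a set. sep M ==> dim M = k ==> c0 <= ldet M" using sep_det_lower by blast
 define V where "V = ubv (Suc k)"
 have V: "V > 0" by (simp add: V_def)
 define K where "K = kap k"
 have K: "K >= 1" unfolding K_def by (rule kap_ge1)
 define C where "C = 4 ^ k + V / c0 + V * real (Suc k) * K * (1 + K) ^ k / c0"
 have "C > 0" unfolding C_def using V K c0 by (intro add_pos_nonneg) auto
 moreover have "abs (rcard (Q Int cball 0 t) - V * t ^ Suc k / ldet Q) <= C * t ^ k" if sQ: "sep Q" and dQ: "dim Q = Suc k" and t: "t >= 1" for Q :: "'a set" and t
 proof -
  have Q: "latt Q" "dim Q = Suc k" using sQ dQ by (auto simp: sep_def)
  obtain A where A: "mhyp A Q" using mhyp_exists[OF Q] by blast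
  note A' = mhypD[OF A Q]
  have sA: "sep A" using sep_prim[OF sQ A'(1)] .
  have dA: "c0 <= ldet A" by (rule c0(2)[OF sA A'(3)])
  define g where "g = gap Q"
  have g: "g = ldet Q / ldet A" unfolding g_def by (rule gap_mhyp[OF A])
  have pos: "ldet Q > 0" "ldet A > 0" "g > 0" using det_pos Q A'(2) gap_pos[OF Q] by (auto simp: g_def)
  have gd: "g / ldet Q <= 1 / c0" using g pos dA c0(1) by (simp add: frac_le)
  define N where "N = rcard (Q Int cball 0 t)"
  show ?thesis
  proof (cases "t < g")
   case True
   have "Q Int cball 0 t <= A Int cball 0 t"
   proof
    fix x assume x: "x : Q Int cball 0 t"
    have "x : A"
    proof (rule ccontr)
     assume "x ~: A"
     hence "ldet Q <= ldet A * norm (x - 0)" using x by (intro det_height_le[OF Q(1) A'(1) Q(2)]) (auto simp: span_0)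
     also have "... <= ldet A * t" using x pos by (intro mult_left_mono) auto
     finally show False using True pos by (simp add: g field_simps)
    qed
    thus "x : A Int cball 0 t" using x by simp
   qed
   hence "card (Q Int cball 0 t) <= card (A Int cball 0 t)" by (rule card_mono[OF latt_finite[OF A'(2)]])
   moreover have "rcard (A Int cball 0 t) <= 4 ^ k * t ^ k" using sA A'(3) t by (intro sep_count) auto
   ultimately have 1: "0 <= N" "N <= 4 ^ k * t ^ k" by (auto simp: N_def)
   have "V * t ^ Suc k / ldet Q = V * t ^ k * (t / ldet Q)" by simp
   also have "... <= V * t ^ k * (1 / c0)"
   proof (rule mult_left_mono)
    have "t / ldet Q <= g / ldet Q" using True pos by (simp add: divide_right_mono)
    thus "t / ldet Q <= 1 / c0" using gd by linarith
   qed (use V t in auto)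
   finally have 2: "V * t ^ Suc k / ldet Q <= V / c0 * t ^ k" by simp
   have 3: "0 <= V * t ^ Suc k / ldet Q" using V t pos by simp
   have 4: "0 <= V * real (Suc k) * K * (1 + K) ^ k / c0 * t ^ k" using V K c0 t by simp
   have "C * t ^ k = 4 ^ k * t ^ k + V / c0 * t ^ k + V * real (Suc k) * K * (1 + K) ^ k / c0 * t ^ k" by (simp add: C_def algebra_simps)
   thus ?thesis using 1 2 3 4 unfolding N_def by linarith
  next
   case False
   obtain U c where box: "ofd Q U c" "sum c U <= real (Suc k) * (2 ^ k * g)" using good_box_gap[OF Q] unfolding g_def by metis
   define rh where "rh = sum c U"
   have rh0: "rh >= 0" unfolding rh_def using box(1) by (intro sum_nonneg) (auto simp: ofd_def less_imp_le)
   have "real (Suc k) * (2 ^ k * g) = (real (Suc k) * 2 ^ k) * g" by simp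
   also have "... <= K * g" unfolding K_def kap_def using pos by (intro mult_right_mono) auto
   finally have rhK: "rh <= K * g" using box(2) by (simp add: rh_def)
   have tg: "K * g <= K * t" using False K by (intro mult_left_mono) auto
   have up: "N * ldet Q <= V * (t + rh) ^ Suc k" using count_upper[OF Q(1) box(1), of t] t rh0 by (simp add: N_def V_def rh_def Q(2))
   have "(t + rh) ^ Suc k - t ^ Suc k <= real (Suc k) * ((t + rh) - t) * (t + rh) ^ (Suc k - 1)" using t rh0 by (intro power_diff_le) auto
   also have "... <= real (Suc k) * (K * g) * ((1 + K) * t) ^ k"
   proof (intro mult_mono)
    have "t + rh <= (1 + K) * t" using rhK tg by (simp add: algebra_simps)
    thus "(t + rh) ^ (Suc k - 1) <= ((1 + K) * t) ^ k" using t rh0 by (simp add: power_mono)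
   qed (use rhK rh0 t K pos in auto)
   finally have up2: "(t + rh) ^ Suc k <= t ^ Suc k + real (Suc k) * (K * g) * ((1 + K) * t) ^ k" by simp
   define W where "W = V * (real (Suc k) * (K * g) * ((1 + K) * t) ^ k)"
   have W0: "W >= 0" unfolding W_def using V K pos t by simp
   have "N * ldet Q <= V * (t ^ Suc k + real (Suc k) * (K * g) * ((1 + K) * t) ^ k)" using up mult_left_mono[OF up2, of V] V by linarith
   hence u: "N * ldet Q - V * t ^ Suc k <= W" by (simp add: W_def algebra_simps)
   have l: "V * t ^ Suc k - W <= N * ldet Q"
   proof (cases "rh < t")
    case True
    have "V * (t - rh) ^ Suc k <= N * ldet Q" using count_lower[OF Q(1) box(1), of t] True by (simp add: N_def V_def rh_def Q(2))
    moreover have "t ^ Suc k - (t - rh) ^ Suc k <= real (Suc k) * (K * g) * ((1 + K) * t) ^ k"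
    proof -
     have "t ^ Suc k - (t - rh) ^ Suc k <= real (Suc k) * (t - (t - rh)) * t ^ (Suc k - 1)" using True rh0 by (intro power_diff_le) auto
     also have "... <= real (Suc k) * (K * g) * ((1 + K) * t) ^ k"
     proof (intro mult_mono)
      have "t <= (1 + K) * t" using K t by simp
      thus "t ^ (Suc k - 1) <= ((1 + K) * t) ^ k" using t by (simp add: power_mono)
     qed (use rhK rh0 t K pos in auto)
     finally show ?thesis .
    qed
    hence "V * (t ^ Suc k - (t - rh) ^ Suc k) <= W" unfolding W_def using V by (intro mult_left_mono) auto
    ultimately show ?thesis by (simp add: algebra_simps)
   next
    case False
    \<comment> \<open>If the box is larger than the ball, the volume term is itself at most
      \<open>W\<close> and the lower bound is trivial.\<close>
    have "t ^ Suc k <= real (Suc k) * (K * g) * ((1 + K) * t) ^ k"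
    proof -
     have "t ^ Suc k = 1 * t * t ^ k" by simp
     also have "... <= real (Suc k) * (K * g) * ((1 + K) * t) ^ k"
     proof (intro mult_mono power_mono)
      show "t <= K * g" using False rhK by simp
      show "t <= (1 + K) * t" using K t by simp
     qed (use t K pos in auto)
     finally show ?thesis .
    qed
    hence "V * t ^ Suc k <= W" unfolding W_def using V by (intro mult_left_mono) auto
    moreover have "0 <= N * ldet Q" using pos by (simp add: N_def)
    ultimately show ?thesis by linarith
   qed
   have "abs (N - V * t ^ Suc k / ldet Q) = abs (N * ldet Q - V * t ^ Suc k) / ldet Q"
   proof -
    have "N - V * t ^ Suc k / ldet Q = (N * ldet Q - V * t ^ Suc k) / ldet Q" using pos by (simp add: diff_divide_distrib)
    thus ?thesis using pos by (simp only: abs_divide abs_of_pos)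
   qed
   also have "... <= W / ldet Q" using u l pos by (intro divide_right_mono) auto
   also have "... = V * real (Suc k) * K * (1 + K) ^ k * t ^ k * (g / ldet Q)" by (simp add: W_def power_mult_distrib)
   also have "... <= V * real (Suc k) * K * (1 + K) ^ k * t ^ k * (1 / c0)" using gd V K t by (intro mult_left_mono) auto
   also have "... <= C * t ^ k"
   proof -
    have "0 <= 4 ^ k * t ^ k" "0 <= V / c0 * t ^ k" using t V c0 by auto
    moreover have "C * t ^ k = 4 ^ k * t ^ k + V / c0 * t ^ k + V * real (Suc k) * K * (1 + K) ^ k / c0 * t ^ k" by (simp only: C_def distrib_right)
    moreover have "V * real (Suc k) * K * (1 + K) ^ k * t ^ k * (1 / c0) = V * real (Suc k) * K * (1 + K) ^ k / c0 * t ^ k" by simp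
    ultimately show ?thesis by linarith
   qed
   finally show ?thesis by (simp add: N_def)
  qed
 qed
 ultimately show ?thesis unfolding V_def by blast
qed

text \<open>Every nonzero point is, up to sign, \<open>j\<close> times the generator of a unique
  primitive line. Generators have norm at least one, so \<open>j\<close> does not exceed
  \<open>t\<close>.\<close>

lemma prim1_count:
 assumes sQ: "sep Q"
 shows "card (Q Int cball 0 t - {0}) = (SUM j:{1..nat \<lfloor>t\<rfloor>}. 2 * card (plev 1 Q (t / real j)))"
proof -
 let ?x = "{1..nat \<lfloor>t\<rfloor>}"
 have Q: "latt Q" using sQ by (simp add: sep_def)
 define g where "g = (%L::'a set. SOME x. x : L & norm x = ldet L & x ~= 0 & L = range (%n::int. of_int n *\<^sub>R x))"
 have g: "g L : L & norm (g L) = ldet L & g L ~= 0 & L = range (%n::int. of_int n *\<^sub>R g L)" if "L : prim 1 Q" for L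
 proof -
  have "latt L" "dim L = 1" using prim_latt primD Q that by blast+
  hence "EX x. x : L & norm x = ldet L & x ~= 0 & L = range (%n::int. of_int n *\<^sub>R x)" using rank1_gen by metis
  thus ?thesis unfolding g_def by (rule someI_ex)
 qed
 have gs: "span L = span {s *\<^sub>R g L}" if L: "L : prim 1 Q" "s ~= 0" for L s
 proof -
  have "s *\<^sub>R g L ~= 0" using g[OF L(1)] L(2) by simp
  hence "dim {s *\<^sub>R g L} = 1" by (simp add: dim_insert)
  moreover have "s *\<^sub>R g L : span L" using g[OF L(1)] by (simp add: span_base span_scale)
  ultimately have "span {s *\<^sub>R g L} = span (span L)" using primD(2)[OF L(1)] by (intro dim_eq_span) auto
  thus ?thesis by (simp add: span_span)
 qed
 define D where "D = (SIGMA j:?x. (plev 1 Q (t / real j)) \<times> {1, -1::real})"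
 define f where "f = (%(j::nat, L, s). (s * real j) *\<^sub>R g L)"
 have D: "j >= 1 & L : prim 1 Q & ldet L <= t / real j & (s = 1 | s = -1)" if "(j, L, s) : D" for j L s using that by (auto simp: D_def)
 have "bij_betw f D (Q Int cball 0 t - {0})" unfolding bij_betw_def
 proof
  show "inj_on f D"
  proof (rule inj_onI)
   fix p q assume pq: "p : D" "q : D" "f p = f q"
   obtain j L s where p: "p = (j, L, s)" by (metis surj_pair)
   obtain j' L' s' where q: "q = (j', L', s')" by (metis surj_pair)
   have d: "j >= 1" "L : prim 1 Q" "s = 1 | s = -1" "j' >= 1" "L' : prim 1 Q" "s' = 1 | s' = -1" using D pq(1,2) p q by auto
   have e: "(s * real j) *\<^sub>R g L = (s' * real j') *\<^sub>R g L'" using pq(3) by (simp add: f_def p q)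
   have "span L = span L'" using gs[OF d(2), of "s * real j"] gs[OF d(5), of "s' * real j'"] e d by auto
   hence L: "L = L'" using prim_span_inj d by metis
   hence "s * real j = s' * real j'" using e g[OF d(2)] by simp
   hence "s = s' & real j = real j'" using d(1,3,4,6) by auto
   thus "p = q" using L p q by simp
  qed
  show "f ` D = Q Int cball 0 t - {0}"
  proof (intro equalityI subsetI)
   fix x assume "x : f ` D"
   then obtain j L s where x: "(j, L, s) : D" "x = (s * real j) *\<^sub>R g L" by (force simp: f_def)
   note d = D[OF x(1)]
   have "norm x = real j * ldet L" using x(2) d g[of L] by auto
   also have "... <= t"
   proof -
    have "real j > 0" using d by simp
    moreover have "ldet L <= t / real j" using d by blast
    ultimately show ?thesis by (metis mult.commute pos_le_divide_eq)
   qed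
   finally have n: "norm x <= t" .
   have "g L : Q" using g[of L] d primD(3) by blast
   hence "of_int (int j) *\<^sub>R g L : Q" by (rule latt_scale[OF Q])
   moreover have "of_int (- int j) *\<^sub>R g L : Q" using \<open>g L : Q\<close> by (rule latt_scale[OF Q])
   ultimately have "x : Q" using x(2) d by auto
   moreover have "x ~= 0" using x(2) d g[of L] by auto
   ultimately show "x : Q Int cball 0 t - {0}" using n by simp
  next
   fix x assume x: "x : Q Int cball 0 t - {0}"
   define L where "L = Q Int span {x}"
   have L: "L : prim 1 Q" using prim_Int_span[of "{x}" Q] x by (simp add: L_def dim_insert)
   have "x : L" using x by (simp add: L_def span_base)
   then obtain n :: int where n: "x = of_int n *\<^sub>R g L" using g[OF L] by blast
   hence n0: "n ~= 0" using x by auto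
   define j where "j = nat (abs n)"
   have j: "j >= 1" "real j = abs (real_of_int n)" using n0 by (auto simp: j_def)
   have nx: "norm x = real j * ldet L" using n j g[OF L] by simp
   have "1 <= ldet L" using g[OF L] primD(3)[OF L] sQ unfolding sep_def by (metis subsetD)
   hence "real j * 1 <= real j * ldet L" by (intro mult_left_mono) auto
   hence "real j <= t" using nx x by simp
   hence jt: "j <= nat \<lfloor>t\<rfloor>" by (simp add: le_nat_floor)
   have "ldet L <= t / real j" using nx x j by (simp add: field_simps)
   hence "(j, L, if n > 0 then 1 else -1) : D" using j jt L by (simp add: D_def)
   moreover have "f (j, L, if n > 0 then 1 else -1) = x" using n j n0 by (auto simp: f_def)
   ultimately show "x : f ` D" by (metis image_eqI)
  qed
 qed
 hence "card (Q Int cball 0 t - {0}) = card D" by (metis bij_betw_same_card)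
 also have "... = (SUM j:?x. card ((plev 1 Q (t / real j)) \<times> {1, -1::real}))" unfolding D_def using prim_finite[OF Q] by (intro card_SigmaI) auto
 also have "... = (SUM j:?x. 2 * card (plev 1 Q (t / real j)))" by (intro sum.cong refl) (simp add: card_cartesian_product mult.commute)
 finally show ?thesis .
qed

section \<open>From lattice points to primitive lines\<close>

lemma powr_bound_18:
 "(2::real) powr (-15/8) <= 28/100" "(3::real) powr (-15/8) <= 13/100" "(3::real) powr (-7/8) <= 2/5"
proof -
 \<comment> \<open>Raising to the eighth power reduces the three bounds to comparisons of rational
   numbers.\<close>
 have p: "(a powr b) ^ 8 = a powr (8 * b)" if "a > 0" for a b :: real using that by (simp add: powr_power mult.commute)
 have "(2::real) powr (-15) = 1 / 2 ^ 15" "(3::real) powr (-15) = 1 / 3 ^ 15" "(3::real) powr (-7) = 1 / 3 ^ 7" by (simp_all add: powr_minus_divide powr_numeral)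
 hence "((2::real) powr (-15/8)) ^ 8 <= (28/100) ^ 8" "((3::real) powr (-15/8)) ^ 8 <= (13/100) ^ 8" "((3::real) powr (-7/8)) ^ 8 <= (2/5) ^ 8" by (simp_all add: p power_divide)
 thus "(2::real) powr (-15/8) <= 28/100" "(3::real) powr (-15/8) <= 13/100" "(3::real) powr (-7/8) <= 2/5"
  using power_le_imp_le_base[of "(2::real) powr (-15/8)" 7 "28/100"] power_le_imp_le_base[of "(3::real) powr (-15/8)" 7 "13/100"]
   power_le_imp_le_base[of "(3::real) powr (-7/8)" 7 "2/5"] by (simp_all add: eval_nat_numeral)
qed

text \<open>The right side is made to telescope: by comparison with an integral each new term is at
  most the drop of \<open>8/7 * n powr (-7/8)\<close>. Starting at three keeps the total below
  \<open>9/10\<close>.\<close>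

lemma powr_sum_aux:
 "n >= 3 ==> (SUM j:{2..n}. real j powr (-15/8)) <= 9/10 - 8/7 * real n powr (-7/8)"
proof (induction n rule: dec_induct)
 case base
 have "{2..3::nat} = {2, 3}" by auto
 hence "(SUM j:{2..3::nat}. real j powr (-15/8)) = 2 powr (-15/8) + 3 powr (-15/8)" by simp
 thus ?case using powr_bound_18 by simp
next
 case (step n)
 let ?x = "real (Suc n) powr (-7/8) - real n powr (-7/8)"
 have n: "real n > 0" using step by simp
 have "((%r. r powr (- 7/8 - 1)) has_integral (?x / (-7/8))) {real n..real (Suc n)}" using n by (intro powr_integral) auto
 moreover have "((%r. real (Suc n) powr (- 7/8 - 1)) has_integral ((real (Suc n) - real n) *\<^sub>R (real (Suc n) powr (- 7/8 - 1)))) {real n..real (Suc n)}"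
  using has_integral_const_real[of "real (Suc n) powr (- 7/8 - 1)" "real n" "real (Suc n)"] by simp
 ultimately have "(real (Suc n) - real n) *\<^sub>R (real (Suc n) powr (- 7/8 - 1)) <= ?x / (-7/8)" using n by (elim has_integral_le[rotated]) (auto intro!: powr_mono2')
 hence "real (Suc n) powr (- 7/8 - 1) <= ?x / (-7/8)" by simp
 moreover have "(- 7/8 - 1 :: real) = -15/8" by simp
 moreover have "(x - y) / (-7/8) = 8/7 * y - 8/7 * x" for x y :: real by (simp add: field_simps)
 ultimately have "real (Suc n) powr (-15/8) <= 8/7 * real n powr (-7/8) - 8/7 * real (Suc n) powr (-7/8)" by (simp only:)
 moreover have "(SUM j:{2..Suc n}. real j powr (-15/8)) = (SUM j:{2..n}. real j powr (-15/8)) + real (Suc n) powr (-15/8)" using step by simp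
 ultimately show ?case using step.IH by linarith
qed

lemma zeta_summable: "summable (%i. real (Suc i) powr (-15/8))"
proof -
 have "summable (%i. real i powr (-15/8))" by (simp add: summable_real_powr_iff)
 thus ?thesis by (subst (asm) summable_Suc_iff[symmetric])
qed

lemma zeta_bound: "(\<Sum>i. real (Suc i) powr (-15/8)) <= 19/10"
proof (rule suminf_le_const[OF zeta_summable])
 fix n
 have "(\<Sum>i<n. real (Suc i) powr (-15/8)) <= (\<Sum>i<n + 3. real (Suc i) powr (-15/8))" by (intro sum_mono2) auto
 also have "... = (SUM j:{1..n + 3}. real j powr (-15/8))" by (simp add: sum.atLeast1_atMost_eq)
 also have "... = 1 + (SUM j:{2..n + 3}. real j powr (-15/8))" by (subst sum.atLeast_Suc_atMost) (auto simp: numeral_2_eq_2)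
 also have "... <= 1 + (9/10 - 8/7 * real (n + 3) powr (-7/8))" using powr_sum_aux[of "n + 3"] by simp
 also have "... <= 19/10" using powr_ge_zero[of "real (n + 3)" "-7/8"] by simp
 finally show "(\<Sum>i<n. real (Suc i) powr (-15/8)) <= 19/10" .
qed

definition zeta :: "nat => real" where
 "zeta r = (\<Sum>i. 1 / real (Suc i) ^ r)"

lemma zeta_sum: "r >= 2 ==> summable (%i. 1 / real (Suc i) ^ r)"
proof -
 assume "r >= 2"
 hence "summable (%n. inverse (real n ^ r))" by (rule inverse_power_summable)
 hence "summable (%n. inverse (real (Suc n) ^ r))" by (subst summable_Suc_iff)
 thus ?thesis by (simp only: inverse_eq_divide)
qed

lemma zeta_ge1: assumes "r >= 2" shows "zeta r >= 1"
proof -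
 have "(\<Sum>i<1. 1 / real (Suc i) ^ r) <= zeta r" unfolding zeta_def by (rule sum_le_suminf[OF zeta_sum[OF assms]]) auto
 thus ?thesis by simp
qed

text \<open>Instead of Moebius inversion: as \<open>\<zeta>(\<kappa>) < 2\<close> for \<open>\<kappa> \<ge> 15/8\<close>, the error of \<open>n\<close> is controlled by
  that of \<open>\<Sum>\<^sub>j n(t/j)\<close> through a contraction.\<close>

lemma primitive_inversion:
 fixes n :: "real => real"
 assumes n0: "!!t. t < 1 ==> n t = 0" and alp: "alp >= 0" and C: "C >= 0" and r: "r >= 2" and kp: "15/8 <= kp" "kp <= real r"
  and P: "!!t. t >= 1 ==> abs ((SUM j:{1..nat \<lfloor>t\<rfloor>}. n (t / real j)) - alp * t ^ r) <= C * t powr kp"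
  and t: "t > 0"
 shows "abs (n t - alp / zeta r * t ^ r) <= 10 * (C + alp) * t powr kp"
proof -
 define c where "c = alp / zeta r"
 have Z: "zeta r >= 1" by (rule zeta_ge1[OF r])
 have c0: "c >= 0" unfolding c_def using alp Z by simp
 have calp: "c <= alp" unfolding c_def using alp Z by (simp add: divide_le_eq mult_le_cancel_left1)
 \<comment> \<open>Chosen so that \<open>c <= E\<close> and \<open>C + 9/10 * E <= E\<close>, where
   \<open>9/10\<close> bounds the zeta series at \<open>15/8\<close> without its first term.\<close>
 define E where "E = 10 * (C + alp)"
 have E: "E >= c" "E >= 0" using C alp calp by (auto simp: E_def)
 define b where "b = (%i. real (Suc i) powr (-15/8))"
 have sb: "summable b" unfolding b_def by (rule zeta_summable)
 define e where "e = (%t. n t - c * t ^ r)"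
 have le: "s ^ r <= s powr kp" if "0 < s" "s <= 1" for s :: real
 proof -
  have "s powr real r <= s powr kp" using that kp by (intro powr_mono') auto
  thus ?thesis using that by (simp add: powr_realpow)
 qed
 \<comment> \<open>Induction over unit intervals works because the error at \<open>t\<close>
   involves only errors at \<open>t / j\<close> with \<open>j >= 2\<close>.\<close>
 have "ALL t. 0 < t --> t < real (Suc N) --> abs (e t) <= E * t powr kp" for N
 proof (induction N)
  case 0
  show ?case
  proof (intro allI impI)
   fix t :: real assume t: "0 < t" "t < real (Suc 0)"
   have "abs (e t) = c * t ^ r" using n0[of t] t c0 by (simp add: e_def)
   also have "... <= E * t powr kp" using le[of t] t c0 E by (intro mult_mono) auto
   finally show "abs (e t) <= E * t powr kp" .
  qed
 next
  case (Suc N)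
  show ?case
  proof (intro allI impI)
   fix t :: real assume t: "0 < t" "t < real (Suc (Suc N))"
   show "abs (e t) <= E * t powr kp"
   proof (cases "t < 1")
    case True
    thus ?thesis using Suc.IH t by force
   next
    case False
    hence t1: "t >= 1" by simp
    obtain J where J: "nat \<lfloor>t\<rfloor> = Suc J" using t1 by (metis One_nat_def le_nat_floor not0_implies_Suc not_one_le_zero of_nat_1)
    let ?z = "\<Sum>i<J. b (Suc i)"
    let ?y = "\<Sum>i. b (i + Suc J)"
    have tJ: "t < real (Suc J) + 1"
    proof -
     have "t < of_int \<lfloor>t\<rfloor> + 1" by linarith
     also have "of_int \<lfloor>t\<rfloor> = real (nat \<lfloor>t\<rfloor>)" using t1 by simp
     finally show ?thesis unfolding J .
    qed
    define a where "a = (%i. 1 / real (Suc i) ^ r)"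
    let ?a = "\<Sum>i<Suc J. a i"
    let ?x = "\<Sum>i. a (i + Suc J)"
    have sa: "summable a" unfolding a_def by (rule zeta_sum[OF r])
    define P' where "P' = (\<Sum>i<Suc J. n (t / real (Suc i)))"
    have P'b: "abs (P' - alp * t ^ r) <= C * t powr kp" using P[OF t1] unfolding J P'_def by (simp only: One_nat_def sum.atLeast1_atMost_eq)
    have "P' = (\<Sum>i<Suc J. e (t / real (Suc i)) + c * t ^ r * a i)" unfolding P'_def e_def a_def by (simp add: power_divide)
    also have "... = (\<Sum>i<Suc J. e (t / real (Suc i))) + c * t ^ r * ?a" by (simp only: sum.distrib sum_distrib_left)
    also have "(\<Sum>i<Suc J. e (t / real (Suc i))) = e t + (\<Sum>i<J. e (t / real (Suc (Suc i))))" by (subst sum.lessThan_Suc_shift) simp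
    finally have eqP: "P' = e t + (\<Sum>i<J. e (t / real (Suc (Suc i)))) + c * t ^ r * ?a" .
    have Zs: "zeta r = ?x + ?a" unfolding zeta_def a_def[symmetric] using suminf_split_initial_segment[OF sa, of "Suc J"] by (simp only: a_def)
    have "alp = c * zeta r" using Z by (simp add: c_def)
    hence "alp * t ^ r = c * t ^ r * (?x + ?a)" unfolding Zs[symmetric] by simp
    hence et: "e t = (P' - alp * t ^ r) - (\<Sum>i<J. e (t / real (Suc (Suc i)))) + c * t ^ r * ?x" using eqP by (simp add: distrib_left)
    have 1: "abs (\<Sum>i<J. e (t / real (Suc (Suc i)))) <= E * t powr kp * ?z"
    proof -
     have "abs (\<Sum>i<J. e (t / real (Suc (Suc i)))) <= (\<Sum>i<J. abs (e (t / real (Suc (Suc i)))))" by (rule sum_abs)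
     also have "... <= (\<Sum>i<J. E * t powr kp * b (Suc i))"
     proof (rule sum_mono)
      fix i assume "i : {..<J}"
      have "t / real (Suc (Suc i)) <= t / 2" using t by (intro divide_left_mono) auto
      also have "... < real (Suc N)" using t by simp
      finally have "abs (e (t / real (Suc (Suc i)))) <= E * (t / real (Suc (Suc i))) powr kp" using Suc.IH t by simp
      also have "(t / real (Suc (Suc i))) powr kp = t powr kp * real (Suc (Suc i)) powr (-kp)" using t by (simp add: powr_divide powr_minus_divide)
      also have "... <= t powr kp * b (Suc i)" unfolding b_def using kp by (intro mult_left_mono powr_mono) auto
      finally show "abs (e (t / real (Suc (Suc i)))) <= E * t powr kp * b (Suc i)" using E by (simp add: mult_left_mono mult.assoc)
     qed
     finally show ?thesis by (simp add: sum_distrib_left)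
    qed
    \<comment> \<open>Indices \<open>j > t\<close> are missing from the sum but present in
      \<open>zeta r\<close>. There \<open>t / j\<close> is below one, so the power \<open>r\<close>
      may be lowered to \<open>kp\<close>.\<close>
    have 2: "c * t ^ r * ?x <= E * t powr kp * ?y"
    proof -
     have sa': "summable (%i. a (i + Suc J))" using sa summable_iff_shift by blast
     have sb': "summable (%i. b (i + Suc J))" using sb summable_iff_shift by blast
     have "t ^ r * ?x = (\<Sum>i. t ^ r * a (i + Suc J))" by (rule suminf_mult[OF sa', symmetric])
     also have "... <= (\<Sum>i. t powr kp * b (i + Suc J))"
     proof (rule suminf_le)
      fix i
      define s where "s = t / real (Suc (i + Suc J))"
      have s: "0 < s" "s <= 1" using t tJ by (auto simp: s_def)
      have "t ^ r * a (i + Suc J) = s ^ r" by (simp add: a_def s_def power_divide)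
      also have "... <= s powr kp" by (rule le[OF s])
      also have "... = t powr kp * real (Suc (i + Suc J)) powr (-kp)" unfolding s_def using t by (simp add: powr_divide powr_minus_divide)
      also have "... <= t powr kp * b (i + Suc J)" unfolding b_def using kp by (intro mult_left_mono powr_mono) auto
      finally show "t ^ r * a (i + Suc J) <= t powr kp * b (i + Suc J)" .
     qed (use sa' sb' summable_mult in auto)
     also have "... = t powr kp * ?y" by (rule suminf_mult[OF sb'])
     finally have "t ^ r * ?x <= t powr kp * ?y" .
     note F = this
     have "c * (t ^ r * ?x) <= E * (t powr kp * ?y)"
     proof (rule mult_mono[OF E(1) F E(2)])
      have "0 <= ?x" by (rule suminf_nonneg[OF sa']) (simp add: a_def)
      thus "0 <= t ^ r * ?x" using t by simp
     qed
     thus ?thesis by (simp only: mult.assoc)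
    qed
    have 3: "0 <= c * t ^ r * ?x" using c0 t sa summable_iff_shift[of a "Suc J"] by (intro mult_nonneg_nonneg suminf_nonneg) (auto simp: a_def)
    have bs: "?z + ?y <= 9/10"
    proof -
     have "suminf b = ?y + (\<Sum>i<Suc J. b i)" by (rule suminf_split_initial_segment[OF sb])
     also have "(\<Sum>i<Suc J. b i) = 1 + ?z" by (subst sum.lessThan_Suc_shift) (simp add: b_def)
     finally show ?thesis using zeta_bound unfolding b_def[symmetric] by linarith
    qed
    have "abs (e t) <= C * t powr kp + E * t powr kp * ?z + E * t powr kp * ?y" using et P'b 1 2 3 by linarith
    also have "... = C * t powr kp + E * t powr kp * (?z + ?y)" by (simp only: distrib_left add.assoc)
    also have "... <= C * t powr kp + E * t powr kp * (9/10)" using bs E by (intro add_left_mono mult_left_mono) auto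
    also have "... = (C + 9 * (C + alp)) * t powr kp" by (simp add: E_def algebra_simps)
    also have "... <= E * t powr kp" using alp by (intro mult_right_mono) (auto simp: E_def)
    finally show ?thesis .
   qed
  qed
 qed
 moreover have "t < real (Suc (nat \<lceil>t\<rceil>))" by linarith
 ultimately show ?thesis using t unfolding e_def c_def E_def by blast
qed

text \<open>The volume of the unit ball, divided by two for the sign and by \<open>zeta r\<close>
  for primitivity.\<close>

definition c1 :: "nat => real" where
 "c1 r = ubv r / (2 * zeta r)"

lemma c1_pos: "r >= 2 ==> c1 r > 0" using zeta_ge1[of r] by (simp add: c1_def)

text \<open>The exponent \<open>r - 1/8\<close> is dictated by the contraction, which needs at least
  \<open>15/8\<close> already for \<open>r = 2\<close>; the error from \<open>sep_ball_count\<close>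
  is of smaller order.\<close>

lemma prim1_asymp_sep:
 assumes r: "r >= 2"
 shows "EX C>0. ALL (Q::'a::euclidean_space set) t. sep Q --> dim Q = r --> t > 0 -->
  abs (pc 1 Q t - c1 r * t ^ r / ldet Q) <= C * t powr (real r - 1/8)"
proof -
 obtain k where k: "r = Suc k" using r by (cases r) auto
 obtain C where C: "C > 0" "!!(Q::'a set) t. sep Q ==> dim Q = Suc k ==> t >= 1 ==>
  abs (rcard (Q Int cball 0 t) - ubv (Suc k) * t ^ Suc k / ldet Q) <= C * t ^ k" using sep_ball_count by blast
 obtain c0 where c0: "c0 > 0" "!!M::'a set. sep M ==> dim M = r ==> c0 <= ldet M" using sep_det_lower by blast
 define V where "V = ubv r"
 have V: "V > 0" by (simp add: V_def)
 define D where "D = 10 * ((C + 1) / 2 + V / (2 * c0))"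
 have "D > 0" unfolding D_def using C c0 V by (intro mult_pos_pos add_pos_pos) auto
 moreover have "abs (pc 1 Q t - c1 r * t ^ r / ldet Q) <= D * t powr (real r - 1/8)" if Q: "sep Q" "dim Q = r" and t: "t > 0" for Q :: "'a set" and t
 proof -
  have lQ: "latt Q" using Q by (simp add: sep_def)
  have d: "ldet Q > 0" using det_pos lQ .
  define alp where "alp = V / (2 * ldet Q)"
  have alp: "alp >= 0" "alp <= V / (2 * c0)" unfolding alp_def using V d c0(1) c0(2)[OF Q] by (auto intro!: divide_left_mono)
  define n where "n = (%t. pc 1 Q t)"
  have "abs (n t - alp / zeta r * t ^ r) <= 10 * ((C + 1) / 2 + alp) * t powr (real r - 1/8)"
  proof (rule primitive_inversion[OF _ alp(1) _ r])
   fix s :: real assume s: "s < 1"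
   have "card (plev 1 Q s) <= card (Q Int cball 0 s - {0})" by (rule card_prim1_le[OF lQ])
   also have "Q Int cball 0 s - {0} = {}" using s Q by (force simp: sep_def)
   finally show "n s = 0" by (simp add: n_def)
  next
   fix s :: real assume s: "s >= 1"
   have N: "rcard (Q Int cball 0 s) = 1 + 2 * (SUM j:{1..nat \<lfloor>s\<rfloor>}. n (s / real j))"
   proof -
    have "card (Q Int cball 0 s) = Suc (card (Q Int cball 0 s - {0}))" using latt_finite[OF lQ] lQ s by (intro card.remove) auto
    thus ?thesis unfolding prim1_count[OF Q(1)] n_def by (simp add: sum_distrib_left)
   qed
   have "abs (rcard (Q Int cball 0 s) - V * s ^ r / ldet Q) <= C * s ^ k" using C(2)[OF Q(1) _ s] Q(2) unfolding k V_def by simp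
   moreover have "V * s ^ r / ldet Q = 2 * (alp * s ^ r)" by (simp add: alp_def)
   ultimately have "abs (1 + 2 * (SUM j:{1..nat \<lfloor>s\<rfloor>}. n (s / real j)) - 2 * (alp * s ^ r)) <= C * s ^ k" unfolding N by simp
   hence "abs ((SUM j:{1..nat \<lfloor>s\<rfloor>}. n (s / real j)) - alp * s ^ r) <= (C * s ^ k + 1) / 2"
   proof -
    have "abs (1 + 2 * x - 2 * y) <= z ==> abs (x - y) <= (z + 1) / 2" for x y z :: real by (simp only: abs_le_iff) (simp add: field_simps)
    thus "abs (1 + 2 * (SUM j:{1..nat \<lfloor>s\<rfloor>}. n (s / real j)) - 2 * (alp * s ^ r)) <= C * s ^ k ==> ?thesis" by blast
   qed
   also have "... <= (C * s ^ k + s ^ k) / 2" using s by simp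
   also have "... = (C + 1) / 2 * s ^ k" by (simp add: algebra_simps add_divide_distrib)
   also have "... <= (C + 1) / 2 * s powr (real r - 1/8)"
   proof (rule mult_left_mono)
    have "s ^ k = s powr real k" using s by (simp add: powr_realpow)
    also have "... <= s powr (real r - 1/8)" using s by (intro powr_mono) (auto simp: k)
    finally show "s ^ k <= s powr (real r - 1/8)" .
   qed (use C in simp)
   finally show "abs ((SUM j:{1..nat \<lfloor>s\<rfloor>}. n (s / real j)) - alp * s ^ r) <= (C + 1) / 2 * s powr (real r - 1/8)" .
  qed (use C r t in auto)
  also have "... <= D * t powr (real r - 1/8)" using alp by (intro mult_right_mono) (auto simp: D_def)
  also have "alp / zeta r * t ^ r = c1 r * t ^ r / ldet Q" by (simp add: alp_def c1_def V_def)
  finally show ?thesis by (simp add: n_def)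
 qed
 ultimately show ?thesis by blast
qed

text \<open>Division by \<open>l\<close> makes the lattice separated; the main term is invariant,
  and the error becomes a function of \<open>t / l\<close>.\<close>

lemma prim1_asymp:
 assumes r: "r >= 2"
 shows "EX C>0. ALL (Q::'a::euclidean_space set) l t. latt Q --> dim Q = r --> l > 0 --> (ALL x:Q. x ~= 0 --> l <= norm x) --> t > 0 -->
  abs (pc 1 Q t - c1 r * t ^ r / ldet Q) <= C * (t / l) powr (real r - 1/8)"
proof -
 obtain C where C: "C > 0" "!!(Q::'a set) t. sep Q ==> dim Q = r ==> t > 0 ==>
  abs (pc 1 Q t - c1 r * t ^ r / ldet Q) <= C * t powr (real r - 1/8)" using prim1_asymp_sep[OF r] by blast
 have "abs (pc 1 Q t - c1 r * t ^ r / ldet Q) <= C * (t / l) powr (real r - 1/8)"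
  if Q: "latt Q" "dim Q = r" and l: "l > 0" "ALL x:Q. x ~= 0 --> l <= norm x" and t: "t > 0" for Q :: "'a set" and l t
 proof -
  have s: "sep (sc (1 / l) Q)" using l Q by (intro sep_sc) auto
  have "card (dlev (prim 1 (sc (1 / l) Q)) (t / l)) = card (plev 1 Q t)" using card_prim_sc[of "1 / l" Q 1 "t / l"] l Q by simp
  moreover have "ldet (sc (1 / l) Q) = ldet Q / l ^ r" using det_sc[of "1 / l" Q] l Q by (simp add: power_divide)
  moreover have "dim (sc (1 / l) Q) = r" using dim_sc[of "1 / l" Q] l Q by simp
  ultimately show ?thesis using C(2)[OF s, of "t / l"] l t by (simp add: power_divide)
 qed
 thus ?thesis using C(1) by blast
qed

section \<open>Asymptotic count of primitive sublattices\<close>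

text \<open>Hyperplanes of \<open>B\<close> are lines of the dual, whose nonzero vectors have length
  at least \<open>hmin B / ldet B\<close>. In the error the determinant cancels and only
  \<open>hmin B\<close> is left.\<close>

lemma hyper_count:
 assumes k: "k >= 1"
 shows "EX C>0. ALL (B::'a::euclidean_space set) T. latt B --> dim B = Suc k --> T > 0 -->
  abs (pc k B T - c1 (Suc k) * T powr real (Suc k) * ldet B powr (- real k)) <= C * (T powr (real (Suc k) - 1/8) * hmin B powr (- (real (Suc k) - 1/8)))"
proof -
 let ?x = "real (Suc k) - 1/8"
 have "Suc k >= 2" using k by simp
 from prim1_asymp[OF this] obtain C where C: "C > 0" "!!(Q::'a set) l t. latt Q ==> dim Q = Suc k ==> l > 0 ==> (ALL x:Q. x ~= 0 --> l <= norm x) ==> t > 0 ==>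
  abs (pc 1 Q t - c1 (Suc k) * t ^ Suc k / ldet Q) <= C * (t / l) powr ?x" by blast
 have "abs (pc k B T - c1 (Suc k) * T powr real (Suc k) * ldet B powr (- real k)) <= C * (T powr ?x * hmin B powr (- ?x))"
  if B: "latt B" "dim B = Suc k" and T: "T > 0" for B :: "'a set" and T
 proof -
  define d where "d = ldet B"
  have d: "d > 0" unfolding d_def by (rule det_pos[OF B(1)])
  have h: "hmin B > 0" by (rule hmin_pos[OF B])
  have D: "latt (dual B)" "dim (dual B) = Suc k" "ldet (dual B) = 1 / d" using dual_latt[OF B(1)] dual_det[OF B(1)] B(2) by (auto simp: d_def)
  have "abs (pc 1 (dual B) (T / d) - c1 (Suc k) * (T / d) ^ Suc k / ldet (dual B)) <= C * ((T / d) / (hmin B / d)) powr ?x"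
   using T d h dual_norm_ge[OF B] by (intro C(2)[OF D(1,2)]) (auto simp: d_def)
  moreover have "pc 1 (dual B) (T / d) = pc k B T" unfolding d_def using card_hyperplanes[OF B, of T] by simp
  moreover have "c1 (Suc k) * (T / d) ^ Suc k / ldet (dual B) = c1 (Suc k) * T powr real (Suc k) * d powr (- real k)"
  proof -
   have "(T / d) ^ Suc k / ldet (dual B) = T ^ Suc k / d ^ k" using D(3) d by (simp add: power_divide)
   also have "... = T powr real (Suc k) * d powr (- real k)" using T d by (simp add: powr_realpow[symmetric] powr_minus_divide powr_add)
   finally show ?thesis by (simp only: mult.assoc times_divide_eq_right[symmetric])
  qed
  moreover have "((T / d) / (hmin B / d)) powr ?x = T powr ?x * hmin B powr (- ?x)" using T d h by (simp only: powr_minus_divide) (simp add: powr_divide)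
  ultimately show ?thesis unfolding d_def by (simp only:)
 qed
 thus ?thesis using C(1) by blast
qed

definition ups :: "nat => 'a::euclidean_space set => 'a set => 'a set set" where
 "ups k M A = {B : prim (Suc k) M. A <= B}"

text \<open>A cheapest extension of \<open>A\<close> by one rank:
  \<open>ldet (bmin k M A) / ldet A\<close> is the first minimum of the quotient by \<open>A\<close>
  and governs the error in \<open>up_count\<close>.\<close>

definition bmin :: "nat => 'a::euclidean_space set => 'a set => 'a set" where
 "bmin k M A = (SOME B. B : ups k M A & (ALL B':ups k M A. ldet B <= ldet B'))"

lemma bmin_props:
 assumes M: "latt M" and A: "A : prim k M" and k: "k < dim M"
 shows "bmin k M A : ups k M A" "B' : ups k M A ==> ldet (bmin k M A) <= ldet B'"
proof -
 have "A ~= M" using primD(2)[OF A] k by auto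
 then obtain x where x: "x : M" "x ~: A" using primD(3)[OF A] by blast
 define B0 where "B0 = M Int span (insert x A)"
 note E = prim_extend[OF M A x, folded B0_def]
 have B0: "B0 : ups k M A" using E(1,2) primD(3) by (auto simp: ups_def)
 define F where "F = (dlev (ups k M A) (ldet B0))"
 have "finite F" unfolding F_def by (rule fin_prim[OF M, of _ "Suc k" "ldet B0"]) (auto simp: ups_def)
 moreover have "F ~= {}" using B0 by (auto simp: F_def)
 ultimately obtain B where "is_arg_min ldet (%B. B : F) B" using ex_is_arg_min_if_finite[of F ldet] by blast
 hence B: "B : F" "!!B'. B' : F ==> ldet B <= ldet B'" unfolding is_arg_min_linorder by blast+
 have "ldet B <= ldet B'" if "B' : ups k M A" for B' using B(1) B(2)[of B'] that by (force simp: F_def)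
 hence "B : ups k M A & (ALL B':ups k M A. ldet B <= ldet B')" using B(1) by (simp add: F_def)
 hence "bmin k M A : ups k M A & (ALL B':ups k M A. ldet (bmin k M A) <= ldet B')" unfolding bmin_def by (rule someI)
 thus "bmin k M A : ups k M A" "B' : ups k M A ==> ldet (bmin k M A) <= ldet B'" by auto
qed

lemma up_count:
 assumes k: "k + 2 <= m"
 shows "EX C>0. ALL (M::'a::euclidean_space set) A T. latt M --> dim M = m --> A : prim k M --> T > 0 -->
  abs (rcard (dlev (ups k M A) T) - c1 (m - k) / ldet M * T powr (real m - real k) * ldet A powr (- (real m - real k - 1)))
    <= C * (T powr (real m - real k - 1/8) * ldet (bmin k M A) powr (- (real m - real k - 1/8)))"
proof -
 let ?x = "real m - real k - 1/8"
 have "m - k >= 2" using k by simp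
 from prim1_asymp[OF this] obtain C where C: "C > 0" "!!(Q::'a set) l t. latt Q ==> dim Q = m - k ==> l > 0 ==> (ALL x:Q. x ~= 0 --> l <= norm x) ==> t > 0 ==>
  abs (pc 1 Q t - c1 (m - k) * t ^ (m - k) / ldet Q) <= C * (t / l) powr (real (m - k) - 1/8)" by blast
 have rmk: "real (m - k) = real m - real k" using k by simp
 have "abs (rcard (dlev (ups k M A) T) - c1 (m - k) / ldet M * T powr (real m - real k) * ldet A powr (- (real m - real k - 1)))
    <= C * (T powr ?x * ldet (bmin k M A) powr (- ?x))" if M: "latt M" "dim M = m" and A: "A : prim k M" and T: "T > 0" for M A :: "'a set" and T
 proof -
  define a where "a = ldet A"
  define e where "e = ldet (bmin k M A)"
  have a: "a > 0" unfolding a_def using det_pos prim_latt M A by blast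
  have kM: "k < dim M" using M k by simp
  have "bmin k M A : prim (Suc k) M" using bmin_props(1)[OF M(1) A kM] by (simp add: ups_def)
  hence e: "e > 0" unfolding e_def using det_pos prim_latt M by blast
  have dM: "ldet M > 0" using det_pos M by blast
  define Q where "Q = quo M A"
  have Q: "latt Q" "ldet Q = ldet M / a" "dim Q = m - k" using quo_latt[OF A M(1)] quo_det[OF A M(1)] a M(2) by (auto simp: Q_def a_def)
  have n: "e / a <= norm q" if q: "q : Q" "q ~= 0" for q
  proof -
   define L where "L = Q Int span {q}"
   have L: "L : prim 1 Q" using prim_Int_span[of "{q}" Q] q by (simp add: L_def dim_insert)
   have b: "bij_betw (%B. quo B A) {B : prim (Suc k) M. A <= B} (prim 1 Q)" using quo_prim_bij[OF A M(1), of 1] by (simp add: Q_def)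
   then obtain B where B: "B : prim (Suc k) M" "A <= B" "L = quo B A" using L unfolding bij_betw_def by blast
   have "ldet B = a * ldet L" using quo_det(1)[OF prim_down[OF A B(2) primD(3)[OF B(1)]] prim_latt[OF M(1) B(1)]] B(3) by (simp add: a_def)
   moreover have "e <= ldet B" unfolding e_def using bmin_props(2)[OF M(1) A kM] B by (simp add: ups_def)
   ultimately have eL: "e / a <= ldet L" using a by (simp add: pos_divide_le_eq mult.commute)
   have lL: "latt L" "dim L = 1" using prim_latt[OF Q(1) L] primD(2)[OF L] by auto
   obtain x0 where x0: "norm x0 = ldet L" "L = range (%n::int. of_int n *\<^sub>R x0)" using rank1_gen[OF lL] by metis
   have "q : L" using q by (simp add: L_def span_base)
   then obtain n :: int where n: "q = of_int n *\<^sub>R x0" using x0(2) by blast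
   hence "n ~= 0" using q(2) by auto
   hence "1 <= abs (real_of_int n)" by linarith
   hence "norm x0 <= norm q" using n by (simp add: mult_le_cancel_right1)
   thus ?thesis using eL x0(1) by simp
  qed
  have "abs (pc 1 Q (T / a) - c1 (m - k) * (T / a) ^ (m - k) / ldet Q) <= C * ((T / a) / (e / a)) powr (real (m - k) - 1/8)" using n T a e by (intro C(2)[OF Q(1,3)]) auto
  moreover have "pc 1 Q (T / a) = rcard (dlev (ups k M A) T)" using card_quo_children[OF A M(1), of T] by (simp add: Q_def a_def ups_def conj_assoc)
  moreover have "c1 (m - k) * (T / a) ^ (m - k) / ldet Q = c1 (m - k) / ldet M * T powr (real m - real k) * a powr (- (real m - real k - 1))"
  proof -
   have "c1 (m - k) * (T / a) ^ (m - k) / ldet Q = c1 (m - k) / ldet M * ((T / a) ^ (m - k) * a)" using Q(2) by simp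
   thus ?thesis using children_powr[OF T a, of k m] k by simp
  qed
  moreover have "((T / a) / (e / a)) powr (real (m - k) - 1/8) = T powr ?x * e powr (- ?x)" unfolding rmk using T a e by (simp only: powr_minus_divide) (simp add: powr_divide)
  ultimately show ?thesis unfolding a_def e_def by (simp only:)
 qed
 thus ?thesis using C(1) by blast
qed

lemma prim_det_sum:
 fixes q :: real
 assumes k: "k <= m" and q: "q < real m"
 shows "EX C>0. ALL (M::'a::euclidean_space set) T. sep M --> dim M = m --> T > 0 -->
  (SUM B:plev k M T. ldet B powr (-q)) <= C * T powr (real m - q)"
proof -
 obtain CU where CU: "CU > 0" "!!(M::'a set) T. sep M ==> dim M = m ==> T > 0 ==> pc k M T <= CU * T powr (real m)"
  using U_bound[OF k, where ?'a = 'a] by (auto simp: Ucond_def)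
 define C where "C = (1 + abs q / (real m - q)) * CU"
 have "C > 0" unfolding C_def using CU q by (intro mult_pos_pos add_pos_nonneg) auto
 moreover have "(SUM B:plev k M T. ldet B powr (-q)) <= C * T powr (real m - q)" if M: "sep M" "dim M = m" and T: "T > 0" for M :: "'a set" and T
 proof -
  note lM = sep_latt[OF M(1)]
  have "(SUM B:plev k M T. 1 * ldet B powr (-q)) <= (1 + abs q / (real m - q)) * (CU * T powr (real m - q))"
  proof (rule abel_upper[where w = "%_. 1"])
   show "finite (plev k M T)" by (rule prim_finite[OF lM])
   show "0 < ldet B" if "B : prim k M" for B using det_pos prim_latt lM that by blast
   show "csum (prim k M) ldet (%_. 1) r <= CU * r powr real m" if "0 < r" for r using CU(2)[OF M that] by (simp add: csum_const)
  qed (use q T CU in auto)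
  thus ?thesis by (simp add: C_def)
 qed
 ultimately show ?thesis by blast
qed

text \<open>Summing \<open>hyper_count\<close> over \<open>B\<close> leaves the moment of
  \<open>hmin\<close> of order \<open>Suc k - 1/8\<close>, just below the limit in
  \<open>moment_bound\<close>.\<close>

lemma hyper_sum:
 assumes k: "k >= 1" and m: "Suc k <= m"
 shows "EX C>0. ALL (M::'a::euclidean_space set) t T. sep M --> dim M = m --> t > 0 --> T > 0 -->
  abs ((SUM B:plev (Suc k) M t. pc k B T) - c1 (Suc k) * T powr real (Suc k) * (SUM B:plev (Suc k) M t. ldet B powr (- real k)))
   <= C * (T powr (real (Suc k) - 1/8) * t powr (real m - (real (Suc k) - 1/8) * real k / real (Suc k)))"
proof -
 define kp where "kp = real (Suc k) - 1/8"
 let ?x = "real m - kp * real k / real (Suc k)"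
 have "kp < real (Suc k)" by (simp add: kp_def)
 from moment_bound[OF m this, where ?'a = 'a] obtain C1 where C1: "C1 > 0" "!!(M::'a set) T. sep M ==> dim M = m ==> T > 0 ==>
  (SUM B:plev (Suc k) M T. hmin B powr (-kp)) <= C1 * T powr ?x" by blast
 from hyper_count[OF k, where ?'a = 'a] obtain C2 where C2: "C2 > 0" "!!(B::'a set) T. latt B ==> dim B = Suc k ==> T > 0 ==>
  abs (pc k B T - c1 (Suc k) * T powr real (Suc k) * ldet B powr (- real k)) <= C2 * (T powr kp * hmin B powr (- kp))" by (auto simp: kp_def)
 have "abs ((SUM B:plev (Suc k) M t. pc k B T) - c1 (Suc k) * T powr real (Suc k) * (SUM B:plev (Suc k) M t. ldet B powr (- real k)))
   <= (C2 * C1) * (T powr kp * t powr ?x)" if M: "sep M" "dim M = m" and t: "t > 0" and T: "T > 0" for M :: "'a set" and t T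
 proof -
  define F where "F = (plev (Suc k) M t)"
  have lB: "latt B & dim B = Suc k" if "B : F" for B using that M prim_latt[of M B "Suc k"] primD(2)[of B "Suc k" M] by (auto simp: F_def sep_def)
  have "(SUM B:F. pc k B T) - c1 (Suc k) * T powr real (Suc k) * (SUM B:F. ldet B powr (- real k))
   = (SUM B:F. pc k B T - c1 (Suc k) * T powr real (Suc k) * ldet B powr (- real k))" by (simp add: sum_subtractf sum_distrib_left)
  also have "abs ... <= (SUM B:F. abs (pc k B T - c1 (Suc k) * T powr real (Suc k) * ldet B powr (- real k)))" by (rule sum_abs)
  also have "... <= (SUM B:F. C2 * (T powr kp * hmin B powr (- kp)))" using lB C2(2) T by (intro sum_mono) blast
  also have "... = C2 * T powr kp * (SUM B:F. hmin B powr (- kp))" by (simp add: sum_distrib_left mult.assoc)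
  also have "... <= C2 * T powr kp * (C1 * t powr ?x)" unfolding F_def using C2(1) C1(2)[OF M t] by (intro mult_left_mono) auto
  finally show ?thesis by (simp only: F_def mult_ac)
 qed
 thus ?thesis using C1(1) C2(1) unfolding kp_def by (intro exI[of _ "C2 * C1"]) auto
qed

text \<open>The error in \<open>hyper_sum\<close> has a smaller power of \<open>T\<close> and a
  larger power of \<open>t\<close> than the main term; for \<open>t <= T\<close> and
  \<open>1 <= T\<close> it is absorbed.\<close>

lemma hyper_sum_upper:
 assumes k: "k >= 1" and m: "Suc k <= m"
 shows "EX C>0. ALL (M::'a::euclidean_space set) t T. sep M --> dim M = m --> t > 0 --> t <= T --> 1 <= T -->
  (SUM B:plev (Suc k) M t. pc k B T) <= C * T powr real (Suc k) * t powr (real m - real k)"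
proof -
 let ?x = "real (Suc k) - 1/8"
 from hyper_sum[OF k m, where ?'a = 'a] obtain C1 where C1: "C1 > 0" "!!(M::'a set) t T. sep M ==> dim M = m ==> t > 0 ==> T > 0 ==>
  abs ((SUM B:plev (Suc k) M t. pc k B T) - c1 (Suc k) * T powr real (Suc k) * (SUM B:plev (Suc k) M t. ldet B powr (- real k)))
   <= C1 * (T powr ?x * t powr (real m - ?x * real k / real (Suc k)))" by blast
 have "real k < real m" using m by simp
 from prim_det_sum[OF m this, where ?'a = 'a] obtain C2 where C2: "C2 > 0" "!!(M::'a set) T. sep M ==> dim M = m ==> T > 0 ==>
  (SUM B:plev (Suc k) M T. ldet B powr (- real k)) <= C2 * T powr (real m - real k)" by blast
 have c1: "c1 (Suc k) > 0" using k by (intro c1_pos) simp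
 have "(SUM B:plev (Suc k) M t. pc k B T) <= (c1 (Suc k) * C2 + C1) * T powr real (Suc k) * t powr (real m - real k)"
  if M: "sep M" "dim M = m" and t: "t > 0" "t <= T" "1 <= T" for M :: "'a set" and t T
 proof -
  have T: "T > 0" using t by simp
  have "c1 (Suc k) * T powr real (Suc k) * (SUM B:plev (Suc k) M t. ldet B powr (- real k)) <= c1 (Suc k) * T powr real (Suc k) * (C2 * t powr (real m - real k))"
   using C2(2)[OF M t(1)] c1 by (intro mult_left_mono) auto
  moreover have "T powr ?x * t powr (real m - ?x * real k / real (Suc k)) <= T powr real (Suc k) * t powr (real m - real k)"
  proof -
   let ?y = "(1/8) * (real k / real (Suc k))"
   have e: "real m - ?x * real k / real (Suc k) = (real m - real k) + (1/8) * (real k / real (Suc k))" by (simp add: field_simps)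
   have "t powr ?y <= T powr ?y" using t by (intro powr_mono2) auto
   also have "... <= T powr (1/8)" using t by (intro powr_mono) auto
   finally have f: "t powr ?y <= T powr (1/8)" .
   have "T powr ?x * t powr (real m - ?x * real k / real (Suc k)) = T powr ?x * (t powr (real m - real k) * t powr ?y)" unfolding e by (simp only: powr_add)
   also have "... <= T powr ?x * (t powr (real m - real k) * T powr (1/8))" using f by (intro mult_left_mono) auto
   also have "... = (T powr ?x * T powr (1/8)) * t powr (real m - real k)" by simp
   also have "T powr ?x * T powr (1/8) = T powr real (Suc k)" by (simp flip: powr_add)
   finally show ?thesis .
  qed
  hence "C1 * (T powr ?x * t powr (real m - ?x * real k / real (Suc k))) <= C1 * (T powr real (Suc k) * t powr (real m - real k))" using C1(1) by (intro mult_left_mono) auto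
  ultimately have "(SUM B:plev (Suc k) M t. pc k B T) <= c1 (Suc k) * T powr real (Suc k) * (C2 * t powr (real m - real k)) + C1 * (T powr real (Suc k) * t powr (real m - real k))"
   using C1(2)[OF M t(1) T] by linarith
  thus ?thesis by (simp add: algebra_simps)
 qed
 thus ?thesis using C1(1) C2(1) c1 by (intro exI[of _ "c1 (Suc k) * C2 + C1"]) (auto intro: add_pos_pos)
qed

lemma flag_swap:
 assumes M: "latt M"
 shows "(SUM B:plev (Suc k) M t. pc k B T) = (SUM A:plev k M T. rcard (dlev (ups k M A) t))"
proof -
 define F where "F = (plev (Suc k) M t)"
 define G where "G = (plev k M T)"
 have fin: "finite F" "finite G" unfolding F_def G_def by (rule prim_finite[OF M])+
 have 1: "(plev k B T) = {A : G. A <= B}" if "B : F" for B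
 proof -
  have B: "B : prim (Suc k) M" using that by (simp add: F_def)
  have "A : prim k B \<longleftrightarrow> A : prim k M & A <= B" for A using prim_trans[OF _ B] prim_down[of A k M B] primD(3)[OF B] primD(3)[of A k B] by blast
  thus ?thesis by (auto simp: G_def)
 qed
 have 2: "(dlev (ups k M A) t) = {B : F. A <= B}" for A by (auto simp: ups_def F_def)
 have "(SUM B:F. pc k B T) = (SUM B:F. SUM A:{A : G. A <= B}. 1)" by (intro sum.cong refl) (simp add: 1)
 also have "... = (SUM A:G. SUM B:{B : F. A <= B}. 1)" using fin by (rule sum.swap_restrict)
 also have "... = (SUM A:G. rcard (dlev (ups k M A) t))" by (simp add: 2)
 finally show ?thesis by (simp add: F_def G_def)
qed

text \<open>An \<open>A\<close> with a cheap extension contributes a pair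
  \<open>A \<subset> B\<close> with \<open>ldet B <= t\<close>, and \<open>hyper_sum_upper\<close>
  makes such pairs rare for small \<open>t\<close>. Above the threshold \<open>t0\<close> the
  trivial count of \<open>A\<close> is used; with \<open>r = m - k\<close> the choice
  \<open>T powr (1 - 1 / r)\<close> makes both bounds the same power of \<open>T\<close>.\<close>

lemma bmin_sum:
 assumes k: "k >= 1" and m: "k + 2 <= m"
 shows "EX C>0. ALL (M::'a::euclidean_space set) T. sep M --> dim M = m --> 1 <= T -->
  (SUM A:plev k M T. ldet (bmin k M A) powr (- (real m - real k - 1/8)))
   <= C * T powr (real k + 1 + 1/8 - (1/8) / (real m - real k))"
proof -
 define r where "r = real m - real k"
 define kp where "kp = r - 1/8"
 let ?y = "1 + abs kp / (r - kp)"
 have r: "r >= 2" using m by (simp add: r_def)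
 have kp: "kp > 0" "kp < r" using r by (auto simp: kp_def)
 obtain CU where CU: "CU > 0" "!!(M::'a set) T. sep M ==> dim M = m ==> T > 0 ==> pc k M T <= CU * T powr (real m)"
  using U_bound[of k m, where ?'a = 'a] m by (auto simp: Ucond_def)
 have "Suc k <= m" using m by simp
 from hyper_sum_upper[OF k this, where ?'a = 'a] obtain C1 where C1: "C1 > 0" "!!(M::'a set) t T. sep M ==> dim M = m ==> t > 0 ==> t <= T ==> 1 <= T ==>
  (SUM B:plev (Suc k) M t. pc k B T) <= C1 * T powr real (Suc k) * t powr r" by (auto simp: r_def)
 define C where "C = CU + ?y * C1"
 have "C > 0" unfolding C_def using CU(1) C1(1) kp by (intro add_pos_nonneg mult_nonneg_nonneg) auto
 moreover have "(SUM A:plev k M T. ldet (bmin k M A) powr (- kp)) <= C * T powr (real k + 1 + 1/8 - (1/8) / r)" if M: "sep M" "dim M = m" and T: "1 <= T" for M :: "'a set" and T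
 proof -
  note lM = sep_latt[OF M(1)]
  define J where "J = (plev k M T)"
  define e where "e = (%A. ldet (bmin k M A))"
  define t0 where "t0 = T powr (1 - 1 / r)"
  let ?z = "SUM A:lev e J t0. e A powr (- kp)"
  let ?x = "SUM A:{A : J. t0 < e A}. e A powr (- kp)"
  have t0: "t0 > 0" "t0 <= T"
  proof -
   have "T powr (1 - 1 / r) <= T powr 1" using T r by (intro powr_mono) auto
   thus "t0 <= T" using T by (simp add: t0_def)
  qed (use T in \<open>simp add: t0_def\<close>)
  have finJ: "finite J" unfolding J_def by (rule prim_finite[OF lM])
  have kM: "k < dim M" using M m by simp
  have bm: "bmin k M A : ups k M A" if "A : J" for A using bmin_props(1)[OF lM _ kM] that by (simp add: J_def)
  have e0: "e A > 0" if "A : J" for A using bm[OF that] det_pos prim_latt[OF lM] by (auto simp: ups_def e_def)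
  have cs: "csum J e (%_. 1) t <= (C1 * T powr real (Suc k)) * t powr r" if t: "0 < t" "t <= t0" for t
  proof -
   have "csum J e (%_. 1) t = (SUM A:lev e J t. 1)" by (simp add: csum_def)
   also have "... <= (SUM A:lev e J t. rcard (dlev (ups k M A) t))"
   proof (rule sum_mono)
    fix A assume A: "A : lev e J t"
    hence "bmin k M A : dlev (ups k M A) t" using bm by (simp add: e_def)
    moreover have "finite (dlev (ups k M A) t)" by (rule fin_prim[OF lM, of _ "Suc k" t]) (auto simp: ups_def)
    ultimately have "0 < card (dlev (ups k M A) t)" by (metis card_gt_0_iff empty_iff)
    thus "1 <= rcard (dlev (ups k M A) t)" by linarith
   qed
   also have "... <= (SUM A:J. rcard (dlev (ups k M A) t))" using finJ by (intro sum_mono2) auto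
   also have "... = (SUM B:plev (Suc k) M t. pc k B T)" unfolding J_def by (rule flag_swap[OF lM, symmetric])
   also have "... <= C1 * T powr real (Suc k) * t powr r" using t t0 T by (intro C1(2)[OF M]) auto
   finally show ?thesis .
  qed
  have ex: "real m - kp * (1 - 1/r) = real k + 1 + 1/8 - (1/8) / r"
  proof -
   have "kp * (1 - 1/r) = r - 1 - 1/8 + (1/8) / r" using r by (simp add: kp_def field_simps)
   thus ?thesis by (simp add: r_def)
  qed
  have "(SUM A:J. e A powr (- kp)) = ?z + ?x" using finJ by (subst sum.union_disjoint[symmetric]) (auto intro!: sum.cong)
  also have "?x <= CU * T powr (real m - kp * (1 - 1/r))"
  proof -
   have "?x <= (SUM A:{A : J. t0 < e A}. t0 powr (- kp))" using t0 kp by (intro sum_mono powr_mono2') auto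
   also have "... <= (SUM A:J. t0 powr (- kp))" using finJ by (intro sum_mono2) auto
   also have "... = rcard J * t0 powr (- kp)" by simp
   also have "... <= CU * T powr real m * t0 powr (- kp)" unfolding J_def using CU(2)[OF M, of T] T by (intro mult_right_mono) auto
   also have "t0 powr (- kp) = T powr (- kp * (1 - 1/r))" unfolding t0_def by (simp add: powr_powr mult.commute)
   also have "CU * T powr real m * T powr (- kp * (1 - 1/r)) = CU * T powr (real m - kp * (1 - 1/r))" by (simp add: powr_add[symmetric] mult.assoc)
   finally show ?thesis .
  qed
  also have "?z <= ?y * (C1 * T powr real (Suc k) * t0 powr (r - kp))"
  proof -
   have "(SUM A:lev e J t0. 1 * e A powr (- kp)) <= ?y * (C1 * T powr real (Suc k) * t0 powr (r - kp))"
    by (rule abel_upper[where w = "%_. 1"]) (use finJ e0 cs C1(1) kp t0 in auto)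
   thus ?thesis by simp
  qed
  also have "C1 * T powr real (Suc k) * t0 powr (r - kp) = C1 * T powr (real k + 1 + 1/8 - (1/8) / r)"
  proof -
   have "T powr real (Suc k) * t0 powr (r - kp) = T powr (real (Suc k) + (1 - 1/r) * (r - kp))" unfolding t0_def by (simp add: powr_powr powr_add)
   also have "real (Suc k) + (1 - 1/r) * (r - kp) = real k + 1 + 1/8 - (1/8) / r" using r by (simp add: kp_def field_simps)
   finally show ?thesis by simp
  qed
  finally show ?thesis unfolding ex J_def e_def C_def by (simp add: algebra_simps)
 qed
 ultimately show ?thesis unfolding kp_def r_def by blast
qed

section \<open>Induction on the rank by double counting\<close>

definition Fasymp :: "'a::euclidean_space itself => nat => nat => real => real => real => bool" where
 "Fasymp _ m k c C dlt \<longleftrightarrow> 0 < C & 0 < dlt & dlt <= 1/8 & (ALL (M::'a set) T. sep M --> dim M = m --> T > 0 -->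
  abs (pc k M T - c * ldet M powr (- real k) * T powr real m) <= C * T powr (real m - dlt))"

lemma Fasymp_1:
 assumes m: "m >= 2"
 shows "EX C. Fasymp TYPE('a::euclidean_space) m 1 (c1 m) C (1/8)"
proof -
 obtain C where C: "C > 0" "!!(Q::'a set) t. sep Q ==> dim Q = m ==> t > 0 ==>
  abs (pc 1 Q t - c1 m * t ^ m / ldet Q) <= C * t powr (real m - 1/8)" using prim1_asymp_sep[OF m] by blast
 have "abs (pc 1 M T - c1 m * ldet M powr (- real 1) * T powr real m) <= C * T powr (real m - 1/8)" if M: "sep M" "dim M = m" and T: "T > 0" for M :: "'a set" and T
 proof -
  have "ldet M > 0" using M det_pos by (auto simp: sep_def)
  hence "c1 m * ldet M powr (- real 1) * T powr real m = c1 m * T ^ m / ldet M" using T by (simp add: powr_realpow powr_minus_divide)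
  thus ?thesis using C(2)[OF M T] by simp
 qed
 thus ?thesis using C(1) unfolding Fasymp_def by (intro exI[of _ C]) auto
qed

lemma det_weight_csum:
 "csum J ldet (%B. ldet B powr q) r = (SUM B:dlev J r. ldet B powr q)" by (simp add: csum_def)

text \<open>Pairs \<open>A \<subset> B\<close> of ranks \<open>k\<close> and \<open>Suc k\<close>,
  both of determinant at most \<open>T\<close>, are counted in two ways. Summed over
  \<open>B\<close> they give the desired weighted sum \<open>W\<close> times
  \<open>T powr Suc k\<close>; summed over \<open>A\<close> they reduce to the known asymptotics of
  rank \<open>k\<close>. With one cutoff for both determinants each error is smaller than the main
  term by a power of \<open>T\<close>.\<close>

lemma Fasymp_weight:
 assumes F: "Fasymp TYPE('a::euclidean_space) m k c C dlt" and k: "k >= 1" and m: "k + 2 <= m"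
 shows "EX c' C' dlt'. C' > 0 & 0 < dlt' & dlt' <= 1/8 & (ALL (M::'a set) T. sep M --> dim M = m --> T > 0 -->
  abs ((SUM B:plev (Suc k) M T. ldet B powr (- real k)) - c' * ldet M powr (- real (Suc k)) * T powr (real m - real k))
    <= C' * T powr (real m - real k - dlt'))"
proof -
 let ?a = "real (Suc k) - 1/8"
 let ?x = "real m - ?a * real k / real (Suc k)"
 define r where "r = real m - real k"
 let ?z = "real k + 1 + 1/8 - (1/8) / r"
 have r: "r >= 2" using m by (simp add: r_def)
 have F': "0 < C" "0 < dlt" "dlt <= 1/8" "!!(M::'a set) T. sep M ==> dim M = m ==> T > 0 ==>
  abs (pc k M T - c * ldet M powr (- real k) * T powr real m) <= C * T powr (real m - dlt)" using F by (auto simp: Fasymp_def)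
 have Sk: "Suc k <= m" using m by simp
 have km: "real k < real m" using m by simp
 obtain C1 where C1: "C1 > 0" "!!(M::'a set) t T. sep M ==> dim M = m ==> t > 0 ==> T > 0 ==>
  abs ((SUM B:plev (Suc k) M t. pc k B T) - c1 (Suc k) * T powr real (Suc k) * (SUM B:plev (Suc k) M t. ldet B powr (- real k)))
   <= C1 * (T powr ?a * t powr ?x)" using hyper_sum[OF k Sk, where ?'a = 'a] by blast
 obtain C2 where C2: "C2 > 0" "!!(M::'a set) A T. latt M ==> dim M = m ==> A : prim k M ==> T > 0 ==>
  abs (rcard (dlev (ups k M A) T) - c1 (m - k) / ldet M * T powr r * ldet A powr (- (r - 1)))
    <= C2 * (T powr (r - 1/8) * ldet (bmin k M A) powr (- (r - 1/8)))" using up_count[OF m, where ?'a = 'a] unfolding r_def by blast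
 obtain C3 where C3: "C3 > 0" "!!(M::'a set) T. sep M ==> dim M = m ==> 1 <= T ==>
  (SUM A:plev k M T. ldet (bmin k M A) powr (- (r - 1/8))) <= C3 * T powr ?z" using bmin_sum[OF k m, where ?'a = 'a] unfolding r_def by blast
 have pr: "r - 1 < real m - dlt" using F'(3) k by (simp add: r_def)
 define C4 where "C4 = abelc (r - 1) m dlt"
 have C4: "C4 > 0" unfolding C4_def by (rule abelc_pos[OF pr])
 obtain c0 where c0: "c0 > 0" "!!M::'a set. sep M ==> dim M = m ==> c0 <= ldet M" using sep_det_lower by blast
 obtain C5 where C5: "C5 > 0" "!!(M::'a set) T. sep M ==> dim M = m ==> T > 0 ==>
  (SUM B:plev (Suc k) M T. ldet B powr (- real k)) <= C5 * T powr r" using prim_det_sum[OF Sk km, where ?'a = 'a] unfolding r_def by blast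
 define ga where "ga = c1 (m - k)"
 have ga: "ga > 0" unfolding ga_def using m by (intro c1_pos) simp
 define ee where "ee = c1 (Suc k)"
 have ee: "ee > 0" unfolding ee_def using k by (intro c1_pos) simp
 \<comment> \<open>The least of three savings: that of rank \<open>k\<close>, that of the sum over
   \<open>A\<close> through \<open>bmin\<close>, and that of the sum over \<open>B\<close> through
   \<open>hmin\<close>.\<close>
 define dlt' where "dlt' = min dlt (min ((1/8) / r) ((1/8) / real (Suc k)))"
 have dlt': "0 < dlt'" "dlt' <= dlt" "dlt' <= (1/8) / r" "dlt' <= (1/8) / real (Suc k)" using F'(2) r by (auto simp: dlt'_def)
 \<comment> \<open>Obtained by equating the two main terms; the factor
   \<open>real m / real (Suc k)\<close> stems from Abel summation over \<open>A\<close>.\<close>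
 define c' where "c' = ga * c * (real m / real (Suc k)) / ee"
 let ?y = "C5 + abs c' * c0 powr (- real (Suc k))"
 define E where "E = C1 + C2 * C3 + ga / c0 * (C4 * C)"
 have E: "E > 0" unfolding E_def using C1 C2 C3 C4 F'(1) ga c0 by (intro add_pos_pos mult_pos_pos divide_pos_pos) auto
 define C' where "C' = E / ee + ?y"
 have C': "C' > 0" unfolding C'_def using E ee C5 by (intro add_pos_nonneg divide_pos_pos add_nonneg_nonneg mult_nonneg_nonneg) auto
 have "abs ((SUM B:plev (Suc k) M T. ldet B powr (- real k)) - c' * ldet M powr (- real (Suc k)) * T powr r)
    <= C' * T powr (r - dlt')" if M: "sep M" "dim M = m" and T: "T > 0" for M :: "'a set" and T
 proof -
  note lM = sep_latt[OF M(1)]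
  have dM: "ldet M > 0" "ldet M >= c0" using det_pos[OF lM] c0(2)[OF M] by auto
  define W where "W = (SUM B:plev (Suc k) M T. ldet B powr (- real k))"
  show ?thesis
  proof (cases "T < 1")
   case True
   \<comment> \<open>For \<open>T < 1\<close> both terms obey crude bounds of exponent
     \<open>r\<close>, and lowering the exponent only enlarges the right side.\<close>
   have "T powr r <= T powr (r - dlt')" using True T dlt' by (intro powr_mono') auto
   moreover have "0 <= W" unfolding W_def by (intro sum_nonneg) auto
   moreover have "W <= C5 * T powr r" unfolding W_def by (rule C5(2)[OF M T])
   moreover have "abs (c' * ldet M powr (- real (Suc k)) * T powr r) <= abs c' * c0 powr (- real (Suc k)) * T powr r"
   proof -
    have "ldet M powr (- real (Suc k)) <= c0 powr (- real (Suc k))" using c0(1) dM by (intro powr_mono2') auto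
    moreover have "abs (c' * x * T powr r) <= abs c' * y * T powr r" if "0 <= x" "x <= y" for x y using that by (auto simp: abs_mult intro!: mult_right_mono mult_left_mono)
    ultimately show ?thesis by simp
   qed
   ultimately have "abs (W - c' * ldet M powr (- real (Suc k)) * T powr r) <= ?y * T powr r" by (simp add: distrib_right)
   also have "... <= ?y * T powr (r - dlt')" using \<open>T powr r <= T powr (r - dlt')\<close> C5(1) by (intro mult_left_mono add_nonneg_nonneg mult_nonneg_nonneg) auto
   also have "... <= C' * T powr (r - dlt')" unfolding C'_def using E ee by (intro mult_right_mono) auto
   finally show ?thesis by (simp only: W_def)
  next
   case False
   hence T1: "T >= 1" by simp
   let ?b = "real (Suc k) - dlt"
   define S where "S = (SUM B:plev (Suc k) M T. pc k B T)"
   define e where "e = real (Suc k) + r - dlt'"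
   have 1: "abs (S - ee * T powr real (Suc k) * W) <= C1 * T powr e"
   proof -
    have "abs (S - ee * T powr real (Suc k) * W) <= C1 * (T powr ?a * T powr ?x)" unfolding S_def ee_def W_def by (rule C1(2)[OF M T T])
    also have "T powr ?a * T powr ?x = T powr (real (Suc k) + r - (1/8) / real (Suc k))"
    proof -
     have "?a + ?x = real (Suc k) + r - (1/8) / real (Suc k)" by (simp add: r_def field_simps)
     thus ?thesis by (simp only: powr_add[symmetric])
    qed
    also have "C1 * ... <= C1 * T powr e" unfolding e_def using T1 dlt' C1(1) by (intro mult_left_mono powr_mono) auto
    finally show ?thesis .
   qed
   define Y where "Y = (SUM A:plev k M T. ldet A powr (- (r - 1)))"
   have 2: "abs (S - ga / ldet M * T powr r * Y) <= C2 * C3 * T powr e"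
   proof -
    define G where "G = (plev k M T)"
    have "S = (SUM A:G. rcard (dlev (ups k M A) T))" unfolding S_def G_def by (rule flag_swap[OF lM])
    hence eq: "S - ga / ldet M * T powr r * Y = (SUM A:G. rcard (dlev (ups k M A) T) - ga / ldet M * T powr r * ldet A powr (- (r - 1)))"
     by (simp add: Y_def G_def sum_subtractf sum_distrib_left)
    have "abs (S - ga / ldet M * T powr r * Y) <= (SUM A:G. abs (rcard (dlev (ups k M A) T) - ga / ldet M * T powr r * ldet A powr (- (r - 1))))"
     unfolding eq by (rule sum_abs)
    also have "... <= (SUM A:G. C2 * (T powr (r - 1/8) * ldet (bmin k M A) powr (- (r - 1/8))))" unfolding ga_def using lM M(2) T by (intro sum_mono C2(2)) (auto simp: G_def)
    also have "... = C2 * T powr (r - 1/8) * (SUM A:G. ldet (bmin k M A) powr (- (r - 1/8)))" by (simp add: sum_distrib_left mult.assoc)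
    also have "... <= C2 * T powr (r - 1/8) * (C3 * T powr ?z)" unfolding G_def using C2(1) C3(2)[OF M T1] by (intro mult_left_mono) auto
    also have "... = C2 * C3 * T powr (real (Suc k) + r - (1/8) / r)"
    proof -
     have "(r - 1/8) + ?z = real (Suc k) + r - (1/8) / r" by simp
     hence "T powr (r - 1/8) * T powr ?z = T powr (real (Suc k) + r - (1/8) / r)" by (simp only: powr_add[symmetric])
     thus ?thesis by simp
    qed
    also have "... <= C2 * C3 * T powr e" unfolding e_def using T1 dlt' C2(1) C3(1) by (intro mult_left_mono powr_mono) auto
    finally show ?thesis .
   qed
   have mr: "real m - (r - 1) = real (Suc k)" by (simp add: r_def)
   have 3: "abs (Y - (c * ldet M powr (- real k)) * (real m / real (Suc k)) * T powr real (Suc k)) <= C4 * C * T powr ?b"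
   proof -
    have "abs ((SUM A:plev k M T. 1 * ldet A powr (- (r - 1))) - (c * ldet M powr (- real k)) * (real m / (real m - (r - 1))) * T powr (real m - (r - 1))) <= C4 * C * T powr (real m - (r - 1) - dlt)"
    unfolding C4_def
    proof (rule abel_asymp[OF pr F'(2)])
     show "finite (plev k M T)" by (rule prim_finite[OF lM])
     show "ALL A:prim k M. 0 < ldet A" using det_pos prim_latt lM by blast
     show "ALL t>0. abs (csum (prim k M) ldet (%_. 1) t - c * ldet M powr - real k * t powr real m) <= C * t powr (real m - dlt)"
      using F'(4)[OF M] by (simp add: csum_const)
    qed (rule T)
    thus ?thesis unfolding mr Y_def by simp
   qed
   define Y0 where "Y0 = (c * ldet M powr (- real k)) * (real m / real (Suc k)) * T powr real (Suc k)"
   have 4: "abs (ga / ldet M * T powr r * Y - ga / ldet M * T powr r * Y0) <= ga / c0 * (C4 * C) * T powr e"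
   proof -
    have "ga / ldet M * T powr r * Y - ga / ldet M * T powr r * Y0 = ga / ldet M * T powr r * (Y - Y0)" by (simp only: right_diff_distrib)
    hence "abs (ga / ldet M * T powr r * Y - ga / ldet M * T powr r * Y0) = ga / ldet M * T powr r * abs (Y - Y0)" using ga dM by (simp add: abs_mult)
    also have "... <= ga / c0 * T powr r * (C4 * C * T powr ?b)" using 3 ga dM c0(1) unfolding Y0_def by (intro mult_mono mult_right_mono divide_left_mono) auto
    also have "... = ga / c0 * (C4 * C) * (T powr r * T powr ?b)" by simp
    also have "T powr r * T powr ?b = T powr (real (Suc k) + r - dlt)" by (simp add: powr_add[symmetric] algebra_simps)
    also have "ga / c0 * (C4 * C) * ... <= ga / c0 * (C4 * C) * T powr e" unfolding e_def using T1 dlt' ga c0(1) C4 F'(1) by (intro mult_left_mono powr_mono) auto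
    finally show ?thesis .
   qed
   have 5: "abs (ee * T powr real (Suc k) * W - ga / ldet M * T powr r * Y0) <= E * T powr e"
   proof -
    have "abs (s - x) <= a ==> abs (s - y) <= b ==> abs (y - z) <= d ==> abs (x - z) <= a + b + d" for s x y z a b d :: real by linarith
    from this[OF 1 2 4] show ?thesis by (simp add: E_def algebra_simps)
   qed
   have 6: "ga / ldet M * T powr r * Y0 = ee * T powr real (Suc k) * (c' * ldet M powr (- real (Suc k)) * T powr r)"
   proof -
    have "ldet M powr (- real (Suc k)) = ldet M powr (- real k) / ldet M"
    proof -
     have "- real (Suc k) = - real k - 1" by simp
     thus ?thesis using dM by (simp only: powr_diff powr_one)
    qed
    moreover have "ga / d * x * (c * p * q * y) = ee * y * (ga * c * q / ee * (p / d) * x)" for d x p q y using ee by simp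
    ultimately show ?thesis unfolding Y0_def c'_def by (simp only:)
   qed
   have "ee * T powr real (Suc k) * abs (W - c' * ldet M powr (- real (Suc k)) * T powr r) <= E * T powr e"
    using 5 unfolding 6 right_diff_distrib[symmetric] abs_mult using ee by simp
   also have "T powr e = T powr real (Suc k) * T powr (r - dlt')" by (simp add: e_def powr_add[symmetric] algebra_simps)
   finally have "T powr real (Suc k) * (ee * abs (W - c' * ldet M powr (- real (Suc k)) * T powr r)) <= T powr real (Suc k) * (E * T powr (r - dlt'))" by (simp only: mult_ac)
   hence "ee * abs (W - c' * ldet M powr (- real (Suc k)) * T powr r) <= E * T powr (r - dlt')" using T by (simp only: mult_le_cancel_left_pos powr_gt_zero)
   hence "abs (W - c' * ldet M powr (- real (Suc k)) * T powr r) <= E / ee * T powr (r - dlt')" using ee by (simp add: field_simps)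
   also have "... <= C' * T powr (r - dlt')" unfolding C'_def using C5(1) by (intro mult_right_mono) (auto intro!: add_nonneg_nonneg mult_nonneg_nonneg)
   finally show ?thesis by (simp only: W_def)
  qed
 qed
 moreover have "dlt' <= 1/8" using dlt'(2) F'(3) by simp
 ultimately show ?thesis using C' dlt'(1) unfolding r_def by blast
qed

text \<open>Abel summation with a negative exponent removes the weight
  \<open>ldet B powr (- k)\<close> again.\<close>

lemma Fasymp_step:
 assumes F: "Fasymp TYPE('a::euclidean_space) m k c C dlt" and k: "k >= 1" and m: "k + 2 <= m"
 shows "EX c' C' dlt'. Fasymp TYPE('a) m (Suc k) c' C' dlt'"
proof -
 obtain c' C' dlt' where W: "C' > 0" "0 < dlt'" "dlt' <= 1/8" "!!(M::'a set) T. sep M ==> dim M = m ==> T > 0 ==>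
  abs ((SUM B:plev (Suc k) M T. ldet B powr (- real k)) - c' * ldet M powr (- real (Suc k)) * T powr (real m - real k))
    <= C' * T powr (real m - real k - dlt')" using Fasymp_weight[OF F k m] by blast
 have p: "- real k < (real m - real k) - dlt'" using W(3) m by simp
 have "Fasymp TYPE('a) m (Suc k) (c' * ((real m - real k) / real m)) (abelc (- real k) (real m - real k) dlt' * C') dlt'" unfolding Fasymp_def
 proof (intro conjI allI impI)
  fix M :: "'a set" and T :: real assume M: "sep M" "dim M = m" and T: "T > 0"
  let ?x = "SUM B:plev (Suc k) M T. ldet B powr (- real k) * ldet B powr (-(- real k))"
  note lM = sep_latt[OF M(1)]
  have "\<bar>?x
    - (c' * ldet M powr (- real (Suc k))) * ((real m - real k) / ((real m - real k) - (- real k))) * T powr ((real m - real k) - (- real k))\<bar> <= abelc (- real k) (real m - real k) dlt' * C' * T powr ((real m - real k) - (- real k) - dlt')"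
  proof (rule abel_asymp[OF p W(2)])
   show "finite (plev (Suc k) M T)" by (rule prim_finite[OF lM])
   show "ALL A:prim (Suc k) M. 0 < ldet A" using det_pos prim_latt lM by blast
   show "ALL t>0. abs (csum (prim (Suc k) M) ldet (%B. ldet B powr - real k) t - c' * ldet M powr - real (Suc k) * t powr (real m - real k)) <= C' * t powr (real m - real k - dlt')"
    using W(4)[OF M] by (simp add: det_weight_csum)
  qed (rule T)
  moreover have "?x = pc (Suc k) M T"
  proof -
   have "ldet B powr (- real k) * ldet B powr (-(- real k)) = 1" if "B : prim (Suc k) M" for B using det_pos[OF prim_latt[OF lM that]] by (simp add: powr_add[symmetric])
   thus ?thesis by simp
  qed
  ultimately show "abs (pc (Suc k) M T - c' * ((real m - real k) / real m) * ldet M powr - real (Suc k) * T powr real m) <= abelc (- real k) (real m - real k) dlt' * C' * T powr (real m - dlt')"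
   by (simp add: mult_ac)
 qed (use W abelc_pos[OF p] in auto)
 thus ?thesis by blast
qed

lemma Fasymp_exists:
 "1 <= k ==> k < m ==> EX c C dlt. Fasymp TYPE('a::euclidean_space) m k c C dlt"
proof (induction k rule: dec_induct)
 case base
 thus ?case using Fasymp_1[of m, where ?'a = 'a] by auto
next
 case (step k)
 then obtain c C dlt where "Fasymp TYPE('a) m k c C dlt" by auto
 thus ?case using Fasymp_step step by (metis Suc_leI add_2_eq_Suc')
qed

section \<open>Minimal vectors\<close>

text \<open>The properties of minimal vectors used later. They are visibly stable under scaling, so
  that vectors transported from another lattice qualify.\<close>

definition minv :: "nat => 'a::euclidean_space set => (nat => 'a) => bool" where
 "minv m M v \<longleftrightarrow> latt M & dim M = m & inj_on v {1..m} & independent (v ` {1..m}) & v ` {1..m} <= M &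
  (ALL i:{1..m}. ALL r<norm (v i). dim (M Int cball 0 r) < i) & (ALL i j. 1 <= i --> i <= j --> j <= m --> norm (v i) <= norm (v j))"

text \<open>Finitely many points have norm just above the infimum, so a slightly larger ball
  contains no further points.\<close>

lemma dim_cball_attained:
 assumes M: "latt M" and i: "1 <= i" "i <= dim M"
 shows "0 < succ_min i M" "i <= dim (M Int cball 0 (succ_min i M))" "r < succ_min i M ==> dim (M Int cball 0 r) < i"
proof -
 define S where "S = {r. r > 0 & i <= dim (M Int cball 0 r)}"
 have bdd: "bdd_below S" by (rule bdd_belowI[of _ 0]) (auto simp: S_def)
 obtain B where B: "B <= M" "independent B" "span B = span M" by (metis basis_exists dim_span span_eq span_superset subset_trans)
 define R where "R = 1 + (SUM b:B. norm b)"
 have fB: "finite B" using B(2) by (rule independent_imp_finite)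
 have "norm b < R" if "b : B" for b using member_le_sum[OF that, of norm] fB by (auto simp: R_def)
 hence "B <= M Int cball 0 R" using B(1) by (auto simp: less_imp_le)
 hence "dim M <= dim (M Int cball 0 R)" using B(3) by (metis dim_span dim_subset)
 moreover have "R > 0" unfolding R_def by (intro add_pos_nonneg sum_nonneg) auto
 ultimately have ne: "S ~= {}" using i by (auto simp: S_def)
 have \<lambda>: "succ_min i M = Inf S" by (simp add: succ_min_def S_def)
 obtain e where e: "e > 0" "!!x. x : M ==> x ~= 0 ==> e <= norm x" using M by (auto simp: latt_def)
 have "e <= r" if "r : S" for r
 proof (rule ccontr)
  assume "~ e <= r"
  hence "M Int cball 0 r <= {0}" using e(2) by force
  hence "dim (M Int cball 0 r) = 0" by (simp add: dim_eq_0)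
  thus False using that i unfolding S_def mem_Collect_eq by linarith
 qed
 hence "e <= Inf S" using ne by (intro cInf_greatest) auto
 thus pos: "0 < succ_min i M" using e(1) \<lambda> by simp
 define F where "F = {x : M Int cball 0 (Inf S + 1). norm x > Inf S}"
 have "finite F" by (rule finite_subset[OF _ latt_finite[OF M, of "Inf S + 1"]]) (auto simp: F_def)
 then obtain t where t: "t > Inf S" "!!x. x : F ==> t <= norm x"
 proof (cases "F = {}")
  case True then show ?thesis using that[of "Inf S + 1"] by simp
 next
  case False
  have "Min (norm ` F) : norm ` F" using \<open>finite F\<close> False by (intro Min_in) auto
  thus ?thesis using that[of "Min (norm ` F)"] \<open>finite F\<close> by (auto simp: F_def)
 qed
 obtain rh where r: "rh : S" "rh < min t (Inf S + 1)" using cInf_lessD[OF ne, of "min t (Inf S + 1)"] t(1) by auto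
 have "norm x <= Inf S" if "x : M" "norm x <= rh" for x
 proof (rule ccontr)
  assume "~ norm x <= Inf S"
  hence "x : F" using that r(2) by (simp add: F_def)
  thus False using t(2)[of x] that r(2) by simp
 qed
 hence "M Int cball 0 rh <= M Int cball 0 (Inf S)" by auto
 hence "dim (M Int cball 0 rh) <= dim (M Int cball 0 (succ_min i M))" unfolding \<lambda> by (rule dim_subset)
 thus "i <= dim (M Int cball 0 (succ_min i M))" using r(1) unfolding S_def mem_Collect_eq by linarith
 show "dim (M Int cball 0 r) < i" if "r < succ_min i M"
 proof (rule ccontr)
  assume a: "~ dim (M Int cball 0 r) < i"
  hence "r > 0"
  proof -
   have "r <= 0 ==> M Int cball 0 r <= {0}" by (auto simp: norm_le_zero_iff[symmetric] simp del: norm_le_zero_iff)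
   thus ?thesis using a i by (metis dim_eq_0 not_le_imp_less not_less_eq_eq One_nat_def le0 le_trans not_less)
  qed
  hence "r : S" using a by (simp add: S_def)
  hence "succ_min i M <= r" unfolding \<lambda> by (rule cInf_lower[OF _ bdd])
  thus False using that by simp
 qed
qed

lemma minimal_vectors_minv:
 assumes M: "latt M" and v: "minimal_vectors M v" shows "minv (dim M) M v" unfolding minv_def
proof (intro conjI ballI allI impI)
 have n: "norm (v i) = succ_min i M" if "1 <= i" "i <= dim M" for i using v that by (simp add: minimal_vectors_def)
 fix i j assume ij: "1 <= i" "i <= j" "j <= dim M"
 hence "i <= dim (M Int cball 0 (succ_min j M))" using dim_cball_attained(2)[OF M, of j] by simp
 hence "~ succ_min j M < succ_min i M" using dim_cball_attained(3)[OF M, of i] ij by fastforce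
 thus "norm (v i) <= norm (v j)" using n[of i] n[of j] ij by simp
next
 fix i r assume "i : {1..dim M}" "r < norm (v i)"
 thus "dim (M Int cball 0 r) < i" using dim_cball_attained(3)[OF M, of i] v by (simp add: minimal_vectors_def)
qed (use M v in \<open>auto simp: minimal_vectors_def\<close>)

text \<open>Greedy choice: \<open>v j\<close> is a shortest vector outside the span of its
  predecessors. The ball of radius \<open>succ_min j M\<close> contains a vector outside that span,
  which bounds \<open>norm (v j)\<close> from above; independence and monotonicity give the other
  inequality.\<close>

lemma minimal_vectors_exist:
 assumes M: "latt M" shows "EX v. minimal_vectors M v"
proof -
 define P where "P v j \<longleftrightarrow> v j : M - span (v ` {1..<j}) & (ALL x:M - span (v ` {1..<j}). norm (v j) <= norm x)" for v :: "nat => 'a" and j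
 have "k <= dim M ==> EX v. ALL j:{1..k}. P v j" for k
 proof (induction k)
  case (Suc k)
  then obtain v where v: "ALL j:{1..k}. P v j" by auto
  have "dim (v ` {1..<Suc k}) <= card (v ` {1..<Suc k})" by (rule dim_le_card') simp
  also have "... <= k" using card_image_le[of "{1..<Suc k}" v] by simp
  finally have "~ M <= span (v ` {1..<Suc k})" using Suc.prems dim_subset[of M "span (v ` {1..<Suc k})"] by (auto simp: dim_span)
  then obtain y where y: "y : M - span (v ` {1..<Suc k})" by blast
  define F where "F = (M - span (v ` {1..<Suc k})) Int cball 0 (norm y)"
  have F: "finite F" "F ~= {}" using y latt_finite[OF M, of "norm y"] finite_subset[of F "M Int cball 0 (norm y)"] by (auto simp: F_def)
  obtain x where x: "x : F" "!!z. z : F ==> norm x <= norm z" using arg_min_if_finite[OF F, of norm] by (metis not_le_imp_less)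
  have xm: "norm x <= norm z" if "z : M - span (v ` {1..<Suc k})" for z using x(2)[of z] x(2)[of y] y that by (cases "norm z <= norm y") (auto simp: F_def)
  define w where "w = v(Suc k := x)"
  have im: "w ` {1..<j} = v ` {1..<j}" if "j <= Suc k" for j using that by (intro image_cong) (auto simp: w_def)
  have "P w j" if "j : {1..Suc k}" for j
  proof (cases "j = Suc k")
   case True then show ?thesis using x(1) xm im[of "Suc k"] by (auto simp: P_def w_def F_def)
  next
   case False then show ?thesis using v that im[of j] by (auto simp: P_def w_def)
  qed
  thus ?case by blast
 qed simp
 then obtain v where v: "!!j. j : {1..dim M} ==> P v j" by blast
 have ind: "inj_on v {1..k} & independent (v ` {1..k})" if "k <= dim M" for k using that
 proof (induction k)
  case (Suc k)
  have "v (Suc k) ~: span (v ` {1..<Suc k})" using v[of "Suc k"] Suc.prems by (simp add: P_def)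
  hence "v (Suc k) ~: span (v ` {1..k})" by (simp add: atLeastLessThanSuc_atLeastAtMost)
  thus ?case using Suc span_superset[of "v ` {1..k}"] by (auto simp: atLeastAtMostSuc_conv independent_insert)
 qed (simp add: independent_empty)
 have mono: "norm (v i) <= norm (v j)" if "1 <= i" "i <= j" "j <= dim M" for i j
 proof -
  have "span (v ` {1..<i}) <= span (v ` {1..<j})" using that by (intro span_mono image_mono) auto
  thus ?thesis using v[of i] v[of j] that by (auto simp: P_def)
 qed
 have "norm (v j) = succ_min j M" if j: "j : {1..dim M}" for j
 proof (rule antisym)
  have jj: "1 <= j" "j <= dim M" using j by auto
  have "v ` {1..j} <= M Int cball 0 (norm (v j))" using mono jj v by (auto simp: P_def)
  hence "dim (v ` {1..j}) <= dim (M Int cball 0 (norm (v j)))" by (rule dim_subset)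
  moreover have "dim (v ` {1..j}) = j" using ind[OF jj(2)] by (simp add: dim_eq_card_independent card_image)
  ultimately show "succ_min j M <= norm (v j)" using dim_cball_attained(3)[OF M jj, of "norm (v j)"] by fastforce
  have "dim (v ` {1..<j}) <= card (v ` {1..<j})" by (rule dim_le_card') simp
  also have "... <= j - 1" using card_image_le[of "{1..<j}" v] by simp
  finally have "~ M Int cball 0 (succ_min j M) <= span (v ` {1..<j})"
   using dim_cball_attained(2)[OF M jj] jj dim_subset[of "M Int cball 0 (succ_min j M)" "span (v ` {1..<j})"] by (auto simp: dim_span)
  then obtain z where "z : M - span (v ` {1..<j})" "norm z <= succ_min j M" unfolding subset_iff by (auto simp del: One_nat_def)
  thus "norm (v j) <= succ_min j M" using v[OF j] unfolding P_def by (meson order_trans)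
 qed
 hence "minimal_vectors M v" using ind[of "dim M"] v by (simp add: minimal_vectors_def P_def)
 thus ?thesis by blast
qed

lemma minv_layer:
 assumes "minv m N v" "j <= m"
 shows "layer N v j : prim j N" "span (layer N v j) = span (v ` {1..j})" "latt (layer N v j)"
proof -
 show 1: "layer N v j : prim j N" "span (layer N v j) = span (v ` {1..j})" using assms layer_prim[of v m N j] by (auto simp: minv_def)
 show "latt (layer N v j)" using prim_latt[OF _ 1(1)] assms(1) by (simp add: minv_def)
qed

lemma minv_layer_top: "minv m N v ==> layer N v m = N" using prim_top minv_layer(1)[of m N v m] by (metis order_refl minv_def)

lemma minv_norm_pos: "minv m N v ==> i : {1..m} ==> norm (v i) > 0" using dependent_zero[of "v ` {1..m}"] unfolding minv_def by force

text \<open>Hadamard's inequality layer by layer: the height of the next layer is at most the norm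
  of its vector.\<close>

lemma layer_det_le: "minv m N v ==> j <= m ==> ldet (layer N v j) <= (\<Prod>i=1..j. norm (v i))"
proof (induction j)
 case 0
 have "layer N v 0 = {0}" using 0 latt_0 by (auto simp: layer_def minv_def)
 thus ?case by simp
next
 case (Suc j)
 have jm: "j <= m" using Suc by simp
 note L = minv_layer[OF Suc.prems(1) jm] and L' = minv_layer[OF Suc.prems]
 have sub: "layer N v j <= layer N v (Suc j)" unfolding layer_def by (intro Int_mono span_mono) auto
 have "v (Suc j) ~: span (v ` {1..j})"
 proof
  assume a: "v (Suc j) : span (v ` {1..j})"
  have inj: "inj_on v {1..m}" using Suc.prems by (simp add: minv_def)
  have "v i ~= v (Suc j)" if "i : {1..j}" for i using inj_onD[OF inj, of i "Suc j"] that Suc.prems(2) by auto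
  hence "v ` {1..j} <= v ` {1..m} - {v (Suc j)}" using Suc.prems(2) by auto
  hence "v (Suc j) : span (v ` {1..m} - {v (Suc j)})" using a span_mono by blast
  thus False using Suc.prems unfolding minv_def dependent_def by force
 qed
 hence "v (Suc j) ~: layer N v j" by (simp add: layer_def)
 moreover have "v (Suc j) : layer N v (Suc j)" using Suc.prems by (auto simp: layer_def minv_def intro!: span_base)
 moreover have "layer N v j : prim j (layer N v (Suc j))" by (rule prim_down[OF L(1) sub primD(3)[OF L'(1)]])
 ultimately have "ldet (layer N v (Suc j)) <= ldet (layer N v j) * norm (v (Suc j) - 0)" using primD(2)[OF L'(1)] L'(3) by (intro det_height_le) (auto simp: span_0)
 also have "... <= (\<Prod>i=1..j. norm (v i)) * norm (v (Suc j))" using Suc by (intro mult_mono) (auto intro: prod_nonneg)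
 finally show ?case by simp
qed

text \<open>A layer has no smaller minima than \<open>N\<close>, so \<open>minkowski_second\<close>
  applies to it with the norms of vectors minimal for \<open>N\<close>.\<close>

lemma layer_det_ge:
 "EX C>0. ALL (N::'a::euclidean_space set) v. minv m N v --> (ALL j<=m. (\<Prod>i=1..j. norm (v i)) <= C * ldet (layer N v j))"
proof -
 obtain K where K: "!!k. K k > 0" "!!k (N::'a set) mm. latt N ==> dim N = k ==> (ALL i:{1..k}. 0 <= mm i & (ALL r<mm i. dim (N Int cball 0 r) < i)) ==>
  (\<Prod>i=1..k. mm i) <= K k * ldet N" using minkowski_second[where ?'a = 'a] by metis
 have "(\<Prod>i=1..j. norm (v i)) <= (\<Sum>k\<le>m. K k) * ldet (layer N v j)" if v: "minv m N v" and j: "j <= m" for N :: "'a set" and v j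
 proof -
  note L = minv_layer[OF v j]
  have "dim (layer N v j Int cball 0 r) < i" if i: "i : {1..j}" and r: "r < norm (v i)" for i r
  proof -
   have "dim (layer N v j Int cball 0 r) <= dim (N Int cball 0 r)" by (intro dim_subset) (auto simp: layer_def)
   also have "... < i" using v i r j by (auto simp: minv_def)
   finally show ?thesis .
  qed
  hence "(\<Prod>i=1..j. norm (v i)) <= K j * ldet (layer N v j)" using L primD(2)[OF L(1)] by (intro K(2)) auto
  also have "... <= (\<Sum>k\<le>m. K k) * ldet (layer N v j)" using K(1) j det_pos[OF L(3)] by (intro mult_right_mono member_le_sum) (auto simp: less_imp_le)
  finally show ?thesis .
 qed
 moreover have "(\<Sum>k\<le>m. K k) > 0" using K(1) by (intro sum_pos) auto
 ultimately show ?thesis by blast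
qed

text \<open>Hadamard for the first \<open>j - 1\<close> vectors and Minkowski for the first
  \<open>j\<close> compare the height of the \<open>j\<close>-th layer with
  \<open>norm (v j)\<close>, which is at least \<open>norm (v i)\<close>.\<close>

lemma minv_redv: "EX c>=0. ALL (N::'a::euclidean_space set) v. minv m N v --> redv c m N v"
proof -
 obtain C where C: "C > 0" "!!(N::'a set) v j. minv m N v ==> j <= m ==> (\<Prod>i=1..j. norm (v i)) <= C * ldet (layer N v j)"
  using layer_det_ge[where ?'a = 'a] by blast
 have "norm (v i) * ldet (layer N v (j - 1)) <= C * ldet (layer N v j)" if v: "minv m N v" and j: "j : {1..m}" and i: "i : {1..<j}" for N :: "'a set" and v j i
 proof -
  obtain j' where j': "j = Suc j'" using j by (cases j) auto
  have "norm (v i) * ldet (layer N v (j - 1)) <= norm (v j) * (\<Prod>i=1..j'. norm (v i))" using v i j layer_det_le[OF v, of j'] j' det_pos[OF minv_layer(3)[OF v, of j']]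
   by (intro mult_mono) (auto simp: minv_def intro: less_imp_le)
  also have "... = (\<Prod>i=1..j. norm (v i))" unfolding j' by simp
  also have "... <= C * ldet (layer N v j)" using C(2)[OF v] j by simp
  finally show ?thesis .
 qed
 hence "minv m N v --> redv C m N v" for N :: "'a set" and v by (simp add: minv_def redv_def)
 thus ?thesis using C(1) by (intro exI[of _ C]) auto
qed

section \<open>The inner count\<close>

text \<open>Two forbidden sublattices allow one treatment of both kinds of flags: for those of the
  theorem \<open>V\<close> and \<open>W\<close> coincide, for Thunder's flags \<open>W\<close> is
  the trace of a layer of the large lattice.\<close>

definition gcount :: "nat => 'a::euclidean_space set => 'a set => 'a set => real => real" where
 "gcount k Q V W T = real (card {A : prim k Q. A Int V = {0} & A Int W = {0} & ldet A <= T})"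

lemma gcount_le_pc: "latt Q ==> gcount k Q V W T <= pc k Q T" unfolding gcount_def using prim_finite[of Q k T] by (intro of_nat_mono card_mono) auto

text \<open>\<open>V\<close> and \<open>W\<close> have rank complementary to \<open>k\<close>, so
  any nonzero intersection with them is special position.\<close>

lemma gcount_ge_pc:
 assumes Q: "latt Q" "dim Q = m" "k <= m" and V: "V : prim (m - k) Q" and W: "W : prim (m - k) Q"
 shows "pc k Q T <= gcount k Q V W T + rcard (dlev (nongen k Q V) T) + rcard (dlev (nongen k Q W) T)"
proof -
 let ?G = "{A : prim k Q. A Int V = {0} & A Int W = {0} & ldet A <= T}"
 let ?N = "%V. (dlev (nongen k Q V) T)"
 have *: "A : nongen k Q V" if A: "A : prim k Q" "A Int V ~= {0}" and V: "V : prim (m - k) Q" for A V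
  using nongenI[OF A(1) V, of 0] A Q(2,3) latt_dim0[OF prim_latt[OF Q(1) prim_Int[OF A(1) V]]] by fastforce
 have fin: "finite ?G" "finite (?N V)" "finite (?N W)" by (rule fin_prim[OF Q(1), of _ k T], auto simp: nongen_def)+
 have "(plev k Q T) <= ?G Un ?N V Un ?N W" using * V W by blast
 hence "card (plev k Q T) <= card (?G Un ?N V Un ?N W)" using fin by (intro card_mono) auto
 also have "... <= card ?G + card (?N V) + card (?N W)" by (meson add_mono card_Un_le order_refl order_trans)
 finally show ?thesis unfolding gcount_def by linarith
qed

text \<open>The excluded members are special and save the exponent \<open>1 / k\<close>; for
  \<open>T < 1\<close> crude bounds suffice.\<close>

lemma gcount_asymp_sep:
 assumes F: "Fasymp TYPE('a::euclidean_space) m k c C dlt" and k: "1 <= k" "k < m"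
 shows "EX C'>0. EX dlt'>0. dlt' <= 1 & (ALL (Q::'a set) V W T. sep Q --> dim Q = m --> V : prim (m - k) Q --> W : prim (m - k) Q --> T > 0 -->
  abs (gcount k Q V W T - c * ldet Q powr (- real k) * T powr real m) <= C' * T powr (real m - dlt'))"
proof -
 have F': "0 < C" "0 < dlt" "dlt <= 1/8" "!!(M::'a set) T. sep M ==> dim M = m ==> T > 0 ==>
  abs (pc k M T - c * ldet M powr (- real k) * T powr real m) <= C * T powr (real m - dlt)" using F by (auto simp: Fasymp_def)
 obtain CN where CN: "CN > 0" "!!(M::'a set) W T. sep M ==> dim M = m ==> W <= span M ==> T > 0 ==>
  rcard (dlev (nongen k M W) T) <= CN * T powr (real m - 1 / real k)" using nongen_bound[of k m, where ?'a = 'a] k by auto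
 obtain CU where CU: "CU > 0" "!!(M::'a set) T. sep M ==> dim M = m ==> T > 0 ==> pc k M T <= CU * T powr real m"
  using U_bound[of k m, where ?'a = 'a] k by (auto simp: Ucond_def)
 obtain c0 where c0: "c0 > 0" "!!M::'a set. sep M ==> dim M = m ==> c0 <= ldet M" using sep_det_lower by blast
 define dlt' where "dlt' = min dlt (1 / real k)"
 let ?x = "real m - dlt'"
 have dlt': "dlt' > 0" "dlt' <= dlt" "dlt' <= 1 / real k" using F'(2) k by (auto simp: dlt'_def)
 define C' where "C' = C + 2 * CN + CU + abs c * c0 powr (- real k)"
 have C': "C' > 0" unfolding C'_def using F'(1) CN CU by (intro add_pos_nonneg) auto
 have "abs (gcount k Q V W T - c * ldet Q powr (- real k) * T powr real m) <= C' * T powr ?x"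
  if Q: "sep Q" "dim Q = m" and V: "V : prim (m - k) Q" and W: "W : prim (m - k) Q" and T: "T > 0" for Q V W :: "'a set" and T
 proof -
  have lQ: "latt Q" using Q by (simp add: sep_def)
  define x where "x = c * ldet Q powr (- real k) * T powr real m"
  define g where "g = gcount k Q V W T"
  have g: "0 <= g" "g <= pc k Q T" using gcount_le_pc[OF lQ] by (auto simp: g_def gcount_def)
  show ?thesis
  proof (cases "T < 1")
   case True
   have m: "T powr real m <= T powr ?x" using True T dlt' by (intro powr_mono') auto
   have "ldet Q powr (- real k) <= c0 powr (- real k)" using c0 Q by (intro powr_mono2') auto
   moreover have "abs (c * z * T powr real m) <= abs c * y * T powr real m" if "0 <= z" "z <= y" for z y
    using that by (auto simp: abs_mult intro!: mult_right_mono mult_left_mono)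
   ultimately have "abs x <= abs c * c0 powr (- real k) * T powr real m" by (simp add: x_def)
   moreover have "g <= CU * T powr real m" using CU(2)[OF Q T] g by linarith
   ultimately have "abs (g - x) <= (CU + abs c * c0 powr (- real k)) * T powr real m" using g by (simp add: distrib_right)
   also have "... <= C' * T powr ?x" using m F'(1) CN CU unfolding C'_def by (intro mult_mono) (auto intro!: add_nonneg_nonneg)
   finally show ?thesis by (simp only: g_def x_def)
  next
   case False
   have sp: "V <= span Q" "W <= span Q" using primD(3)[OF V] primD(3)[OF W] span_superset by blast+
   have 1: "pc k Q T <= g + 2 * (CN * T powr (real m - 1 / real k))" using gcount_ge_pc[OF lQ Q(2) _ V W, of T] k CN(2)[OF Q sp(1) T] CN(2)[OF Q sp(2) T] by (simp add: g_def)
   have 2: "abs (pc k Q T - x) <= C * T powr (real m - dlt)" unfolding x_def by (rule F'(4)[OF Q T])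
   have "abs (g - x) <= C * T powr (real m - dlt) + 2 * (CN * T powr (real m - 1 / real k))" using 1 2 g by linarith
   also have "... <= C * T powr ?x + 2 * (CN * T powr ?x)" using False dlt' F'(1) CN(1) by (intro add_mono mult_left_mono powr_mono) auto
   also have "... = (C + 2 * CN) * T powr ?x" by (simp add: distrib_right)
   also have "... <= C' * T powr ?x" unfolding C'_def using CU by (intro mult_right_mono) auto
   finally show ?thesis by (simp only: g_def x_def)
  qed
 qed
 moreover have "dlt' <= 1" using dlt' F'(3) by simp
 ultimately show ?thesis using C' dlt' by blast
qed

lemma sc_Int_zero: "a > 0 ==> sc a A Int sc a V = {0} \<longleftrightarrow> A Int V = {0::'a::euclidean_space}"
proof -
 assume a: "a > 0"
 hence inj: "inj (%x::'a. a *\<^sub>R x)" by (auto simp: inj_def)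
 hence "sc a A Int sc a V = sc a (A Int V)" by (simp add: sc_def image_Int)
 moreover have "sc a (A Int V) = sc a {0} \<longleftrightarrow> A Int V = {0}" unfolding sc_def by (rule inj_image_eq_iff[OF inj])
 ultimately show ?thesis by (simp add: sc_def)
qed

lemma gcount_sc:
 assumes a: "a > 0" and Q: "latt Q"
 shows "gcount k (sc a Q) (sc a V) (sc a W) (a ^ k * T) = gcount k Q V W T"
proof -
 have "bij_betw (sc a) {A : prim k Q. A Int V = {0} & A Int W = {0} & ldet A <= T}
  {A : prim k (sc a Q). A Int sc a V = {0} & A Int sc a W = {0} & ldet A <= a ^ k * T}"
 proof (rule bij_betw_Collect[OF prim_sc_bij[OF a]])
  fix A assume A: "A : prim k Q"
  show "(sc a A Int sc a V = {0} & sc a A Int sc a W = {0} & ldet (sc a A) <= a ^ k * T) = (A Int V = {0} & A Int W = {0} & ldet A <= T)"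
   using a det_sc[OF a prim_latt[OF Q A]] primD(2)[OF A] by (simp add: sc_Int_zero)
 qed
 from bij_betw_same_card[OF this] show ?thesis unfolding gcount_def by (simp only:)
qed

text \<open>A purely real interpolation, with \<open>X\<close> the expected size of the count and
  \<open>P\<close> the distortion of the lattice. The error \<open>(X * P) powr (1 - dlt)\<close> is
  useless for large \<open>P\<close>, where the bound \<open>O(X)\<close> takes over; interpolation
  lowers the power of \<open>P\<close> to \<open>tht\<close>. For \<open>X < 1\<close> a nonzero
  count forces a lower bound on \<open>X * P\<close>, which gains the additional power of
  \<open>X\<close>.\<close>

lemma inner_real_bound:
 fixes c C1 C2 P0 y0 dlt tht :: real
 assumes c: "0 < C1" "0 < C2" "0 < P0" "0 < y0" "0 < dlt" "dlt <= 1" "0 < tht" "tht <= 1"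
 shows "EX C>0. ALL n X P. 0 <= n --> 0 < X --> P0 <= P --> abs (n - c * X) <= C1 * (X * P) powr (1 - dlt) --> n <= C2 * X --> (n ~= 0 --> y0 <= X * P) -->
  (1 <= X --> abs (n - c * X) <= C * X powr (1 - dlt * tht) * P powr tht) & (X < 1 --> n <= C * X powr (1 + dlt * tht) * P powr tht)"
proof -
 define C3 where "C3 = C1 * P0 powr (- dlt) + (C2 + abs c)"
 define C4 where "C4 = C2 * y0 powr (- tht)"
 have C3: "C3 > 0" unfolding C3_def using c by (intro add_pos_nonneg) auto
 have C4: "C4 > 0" unfolding C4_def using c by simp
 have "(1 <= X --> abs (n - c * X) <= (C3 + C4) * X powr (1 - dlt * tht) * P powr tht) & (X < 1 --> n <= (C3 + C4) * X powr (1 + dlt * tht) * P powr tht)"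
  if n: "0 <= n" and X: "0 < X" and P: "P0 <= P" and a1: "abs (n - c * X) <= C1 * (X * P) powr (1 - dlt)" and a2: "n <= C2 * X" and a3: "n ~= 0 --> y0 <= X * P" for n X P
 proof (intro conjI impI)
  have Pp: "P > 0" using P c by linarith
  {
   assume "1 <= X"
   \<comment> \<open>Up to constants, \<open>X * z\<close> bounds the error by the asymptotics and
     \<open>X\<close> bounds it trivially; \<open>min 1 z <= z powr tht\<close>
     interpolates.\<close>
   define z where "z = X powr (- dlt) * P"
   have z: "z > 0" using X Pp by (simp add: z_def)
   have "(X * P) powr (1 - dlt) = X * z * P powr (- dlt)" using X Pp by (simp add: z_def powr_mult powr_diff powr_minus field_simps)
   also have "... <= X * z * P0 powr (- dlt)" using P c z X by (intro mult_left_mono powr_mono2') auto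
   finally have "C1 * (X * P) powr (1 - dlt) <= C1 * (X * z * P0 powr (- dlt))" using c(1) by (rule mult_left_mono[OF _ less_imp_le])
   hence "abs (n - c * X) <= C1 * P0 powr (- dlt) * (X * z)" using a1 by (simp only: mult_ac)
   also have "... <= C3 * (X * z)" unfolding C3_def using z X c by (intro mult_right_mono) auto
   finally have b1: "abs (n - c * X) <= C3 * (X * z)" .
   have "abs (n - c * X) <= C2 * X + abs c * X" using a2 n X abs_mult[of c X] by linarith
   also have "... <= C3 * X" unfolding C3_def using c X by (simp add: distrib_right)
   finally have b2: "abs (n - c * X) <= C3 * X" .
   have "min 1 z <= z powr tht"
   proof (cases "z <= 1")
    case True then have "z powr 1 <= z powr tht" using z c by (intro powr_mono') auto
    thus ?thesis using z by simp
   next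
    case False then show ?thesis using c by (simp add: ge_one_powr_ge_zero)
   qed
   have "abs (n - c * X) <= C3 * (X * min 1 z)" using b1 b2 by (cases "z <= 1") (auto simp: min_def)
   also have "... <= C3 * (X * z powr tht)" using \<open>min 1 z <= z powr tht\<close> C3 X by (intro mult_left_mono) auto
   also have "X * z powr tht = X powr (1 - dlt * tht) * P powr tht"
   proof -
    have "z powr tht = X powr (- (dlt * tht)) * P powr tht" unfolding z_def using X Pp by (subst powr_mult) (auto simp: powr_powr)
    moreover have "X powr (1 - dlt * tht) = X * X powr (- (dlt * tht))" using X by (simp add: powr_diff powr_minus divide_inverse)
    ultimately show ?thesis by simp
   qed
   also have "C3 * (X powr (1 - dlt * tht) * P powr tht) <= (C3 + C4) * (X powr (1 - dlt * tht) * P powr tht)" using C4 by (intro mult_right_mono) auto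
   finally show "abs (n - c * X) <= (C3 + C4) * X powr (1 - dlt * tht) * P powr tht" by (simp only: mult.assoc)
  }
  assume X1: "X < 1"
  show "n <= (C3 + C4) * X powr (1 + dlt * tht) * P powr tht"
  proof (cases "n = 0")
   case True then show ?thesis using C3 C4 by simp
  next
   case False
   hence "1 <= X * P / y0" using a3 c(4) by simp
   hence "1 <= (X * P / y0) powr tht" using c by (simp add: ge_one_powr_ge_zero)
   hence "C2 * X * 1 <= C2 * X * (X * P / y0) powr tht" using X c by (intro mult_left_mono) auto
   hence "n <= C2 * X * (X * P / y0) powr tht" using a2 by linarith
   also have "... = C4 * (X powr (1 + tht) * P powr tht)" using X Pp c by (simp add: C4_def powr_mult powr_divide powr_add powr_minus field_simps)
   also have "... <= (C3 + C4) * (X powr (1 + dlt * tht) * P powr tht)"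
   proof -
    have "dlt * tht <= 1 * tht" using c by (intro mult_right_mono) auto
    hence "X powr (1 + tht) <= X powr (1 + dlt * tht)" using X X1 by (intro powr_mono') auto
    thus ?thesis using C3 C4 by (intro mult_mono) auto
   qed
   finally show ?thesis by (simp only: mult.assoc)
  qed
 qed
 moreover have "C3 + C4 > 0" using C3 C4 by simp
 ultimately show ?thesis by blast
qed

lemma minv_gcount_bound:
 assumes "k <= m"
 shows "EX C>0. ALL (B::'a::euclidean_space set) v W T. minv m B v --> T > 0 -->
  gcount k B (layer B v (m - k)) W T <= C * (T powr real m / ldet B powr real k)"
proof -
 obtain c where c: "c >= 0" "!!(N::'a set) v. minv m N v ==> redv c m N v" using minv_redv[where ?'a = 'a] by blast
 obtain C where C: "C > 0" "!!(N::'a set) v T. redv c m N v ==> T > 0 ==>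
  real (card {A : prim k N. A Int span (v ` {1..m - k}) = {0} & ldet A <= T}) <= C * (T powr real m / ldet N powr real k)"
  using restricted_bound[OF c(1) assms, where ?'a = 'a] by blast
 have "gcount k B (layer B v (m - k)) W T <= C * (T powr real m / ldet B powr real k)" if v: "minv m B v" and T: "T > 0" for B :: "'a set" and v W T
 proof -
  have l: "latt B" using v by (simp add: minv_def)
  have "gcount k B (layer B v (m - k)) W T <= real (card {A : prim k B. A Int span (v ` {1..m - k}) = {0} & ldet A <= T})" unfolding gcount_def
  proof (intro of_nat_mono card_mono)
   show "finite {A : prim k B. A Int span (v ` {1..m - k}) = {0} & ldet A <= T}" by (rule fin_prim[OF l, of _ k T]) auto
   show "{A : prim k B. A Int layer B v (m - k) = {0} & A Int W = {0} & ldet A <= T} <= {A : prim k B. A Int span (v ` {1..m - k}) = {0} & ldet A <= T}"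
    using primD(3)[of _ k B] by (fastforce simp: layer_def)
  qed
  also have "... <= C * (T powr real m / ldet B powr real k)" by (rule C(2)[OF c(2)[OF v] T])
  finally show ?thesis .
 qed
 thus ?thesis using C(1) by blast
qed

text \<open>A scale invariant measure of skewness: a balanced lattice has \<open>hmin B\<close> of
  order \<open>ldet B powr ((d - 1) / d)\<close>. Only the first power of \<open>1 / hmin B\<close>
  occurs, so averages of the weight are moments of order one.\<close>

definition wt :: "nat => 'a::euclidean_space set => real" where
 "wt d B = ldet B powr (real (d - 1) / real d) / hmin B"

definition Inner :: "'a::euclidean_space itself => nat => nat => real => real => real => bool" where
 "Inner _ e d c C ee \<longleftrightarrow> 0 < C & 0 < ee & ee < 1 & (ALL (B::'a set) v W T. minv d B v --> W : prim (d - e) B --> T > 0 -->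
  (let X = T powr real d / ldet B powr real e; g = gcount e B (layer B v (d - e)) W T in
   (1 <= X --> abs (g - c * X) <= C * X powr (1 - ee) * wt d B) & (X < 1 --> g <= C * X powr (1 + ee) * wt d B)))"

text \<open>Division by a lower bound \<open>l\<close> for the shortest vector makes
  \<open>B\<close> separated. The distortion \<open>P = (D / l ^ d) powr e\<close> is, up to a
  constant, the power \<open>N\<close> of \<open>wt d B\<close>; interpolation with exponent
  \<open>1 / N\<close> therefore leaves exactly the first power of the weight.\<close>

lemma Inner_exists:
 assumes e: "1 <= e" "e < d"
 shows "EX c C ee. Inner TYPE('a::euclidean_space) e d c C ee"
proof -
 obtain c CF dltF where F: "Fasymp TYPE('a) d e c CF dltF" using Fasymp_exists[OF e, where ?'a = 'a] by blast
 obtain C1 dlt1 where C1: "C1 > 0" "dlt1 > 0" "dlt1 <= 1" "!!(Q::'a set) V W T. sep Q ==> dim Q = d ==> V : prim (d - e) Q ==> W : prim (d - e) Q ==> T > 0 ==>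
  abs (gcount e Q V W T - c * ldet Q powr (- real e) * T powr real d) <= C1 * T powr (real d - dlt1)" using gcount_asymp_sep[OF F e] by blast
 obtain C2 where C2: "C2 > 0" "!!(B::'a set) v W T. minv d B v ==> T > 0 ==>
  gcount e B (layer B v (d - e)) W T <= C2 * (T powr real d / ldet B powr real e)" using minv_gcount_bound[of e d, where ?'a = 'a] e by auto
 obtain c0 where c0: "c0 > 0" "!!M::'a set. sep M ==> dim M = d ==> c0 <= ldet M" using sep_det_lower by blast
 obtain ce where ce: "ce > 0" "!!M::'a set. sep M ==> dim M = e ==> ce <= ldet M" using sep_det_lower by blast
 obtain k where k: "d = Suc k" "k >= 1" using e by (cases d) auto
 define N where "N = real (k * d * e)"
 have N: "N >= 1" unfolding N_def using k e by (metis One_nat_def Suc_leI mult_pos_pos nat_0_less_mult_iff of_nat_1 of_nat_mono zero_less_Suc less_le_trans zero_less_one)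
 define K :: real where "K = (2 ^ k) ^ (k * d)"
 have K: "K > 0" by (simp add: K_def)
 define dlt where "dlt = dlt1 / real d"
 have dlt: "0 < dlt" "dlt <= 1" "dlt < 1" using C1 k by (auto simp: dlt_def field_simps)
 define ee where "ee = dlt * (1 / N)"
 have ee: "ee > 0" "ee < 1" using dlt N by (auto simp: ee_def field_simps)
 obtain C where C: "C > 0" "!!n X P. 0 <= n ==> 0 < X ==> c0 powr real e <= P ==> abs (n - c * X) <= C1 * (X * P) powr (1 - dlt) ==> n <= C2 * X ==> (n ~= 0 --> ce powr real d <= X * P) ==>
  (1 <= X --> abs (n - c * X) <= C * X powr (1 - dlt * (1 / N)) * P powr (1 / N)) & (X < 1 --> n <= C * X powr (1 + dlt * (1 / N)) * P powr (1 / N))"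
  using inner_real_bound[of C1 C2 "c0 powr real e" "ce powr real d" dlt "1 / N" c] C1(1) C2(1) c0(1) ce(1) dlt N by auto
 have "(let X = T powr real d / ldet B powr real e; g = gcount e B (layer B v (d - e)) W T in
   (1 <= X --> abs (g - c * X) <= (C * K powr (real e / N)) * X powr (1 - ee) * wt d B) & (X < 1 --> g <= (C * K powr (real e / N)) * X powr (1 + ee) * wt d B))"
  if v: "minv d B v" and W: "W : prim (d - e) B" and T: "T > 0" for B :: "'a set" and v W T
 proof -
  have B: "latt B" "dim B = Suc k" using v k by (auto simp: minv_def)
  define D where "D = ldet B"
  define h where "h = hmin B"
  define V where "V = layer B v (d - e)"
  have D: "D > 0" using det_pos[OF B(1)] by (simp add: D_def)
  have h: "h > 0" using hmin_pos[OF B] by (simp add: h_def)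
  \<comment> \<open>The bound of \<open>norm_ge_gap\<close> for the shortest vector.\<close>
  define l where "l = D / (2 ^ k * (D / h)) ^ k"
  have l: "l > 0" using D h by (simp add: l_def)
  have nl: "l <= norm x" if "x : B" "x ~= 0" for x using norm_ge_gap[OF B that] D h by (simp add: l_def gap_def D_def[symmetric] h_def[symmetric] pos_divide_le_eq)
  define Q where "Q = sc (1 / l) B"
  have Q: "sep Q" "dim Q = d" using sep_sc[OF l B(1) nl] dim_sc[of "1 / l" B] l B(2) k by (auto simp: Q_def)
  define X where "X = T powr real d / D powr real e"
  have X: "X > 0" using T D by (simp add: X_def)
  define p where "p = D powr (real (d - 1) / real d) / h"
  have pw: "wt d B = p" by (simp add: wt_def p_def D_def h_def)
  have p: "p > 0" using D h by (simp add: p_def)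
  define P where "P = (D / l ^ d) powr real e"
  define T' where "T' = (1 / l) ^ e * T"
  have T': "T' > 0" using l T by (simp add: T'_def)
  have Dl: "D / l ^ d = K * p powr real (k * d)"
  proof -
   have "real k / real d * real (k * d) = real (k * k)" using e by simp
   hence a: "(D powr (real k / real d)) powr real (k * d) = D ^ (k * k)" using D by (simp only: powr_powr powr_realpow)
   have "D / l ^ d = D * ((2 ^ k * (D / h)) ^ k) ^ d / D ^ d" unfolding l_def by (simp only: power_divide divide_divide_eq_right)
   also have "((2 ^ k * (D / h)) ^ k) ^ d = K * (D ^ (k * d) / h ^ (k * d))" unfolding K_def by (simp only: power_mult_distrib power_divide power_mult)
   also have "D * (K * (D ^ (k * d) / h ^ (k * d))) / D ^ d = K * (D ^ (k * k) / h ^ (k * d))"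
   proof -
    have "D ^ (k * d) = D ^ (k * k) * D ^ k" by (simp add: k(1) power_add)
    thus ?thesis using D by (simp add: k(1))
   qed
   also have "D ^ (k * k) / h ^ (k * d) = p powr real (k * d)" using D h a k(1) by (simp add: p_def powr_divide powr_realpow[symmetric])
   finally show ?thesis .
  qed
  have lQ: "ldet Q = D / l ^ d" unfolding Q_def using det_sc[of "1 / l" B] l B k(1) by (simp add: D_def power_divide)
  have XP: "X * P = T' powr real d"
  proof -
   have "P = D powr real e / l powr (real d * real e)" using D l by (simp add: P_def powr_divide powr_powr powr_realpow[symmetric])
   moreover have "T' powr real d = T powr real d / l powr (real d * real e)" using l T by (simp add: T'_def powr_mult powr_divide powr_powr powr_realpow[symmetric] mult.commute)
   ultimately show ?thesis using D by (simp add: X_def)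
  qed
  have g: "gcount e B V W T = gcount e Q (sc (1 / l) V) (sc (1 / l) W) T'" unfolding Q_def T'_def using gcount_sc[of "1 / l" B e V W T] l B(1) by simp
  have V: "V : prim (d - e) B" unfolding V_def by (rule minv_layer(1)[OF v]) simp
  have VW: "sc (1 / l) V : prim (d - e) Q" "sc (1 / l) W : prim (d - e) Q" unfolding Q_def using prim_sc_bij[of "1 / l" "d - e" B] l V W by (auto simp: bij_betw_def)
  have m: "c * ldet Q powr (- real e) * T' powr real d = c * X"
  proof -
   have "ldet Q powr (- real e) = 1 / P" by (simp add: lQ P_def powr_minus_divide)
   moreover have "P > 0" using D l by (simp add: P_def)
   ultimately show ?thesis by (simp add: XP[symmetric])
  qed
  have P0: "c0 powr real e <= P" unfolding P_def lQ[symmetric] using c0 Q by (intro powr_mono2) auto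
  have a1: "abs (gcount e B V W T - c * X) <= C1 * (X * P) powr (1 - dlt)"
  proof -
   have "(X * P) powr (1 - dlt) = T' powr (real d - dlt1)"
   proof -
    have "real d * (1 - dlt) = real d - dlt1" using e by (simp add: dlt_def right_diff_distrib)
    thus ?thesis unfolding XP by (simp only: powr_powr)
   qed
   thus ?thesis using C1(4)[OF Q VW T'] unfolding g m by simp
  qed
  have g0: "0 <= gcount e B V W T" by (simp add: gcount_def)
  have a2: "gcount e B V W T <= C2 * X" unfolding V_def X_def D_def by (rule C2(2)[OF v T])
  \<comment> \<open>A nonzero count exhibits a sublattice of rank \<open>e\<close> in a separated
    lattice, whose determinant has an absolute lower bound.\<close>
  have a3: "gcount e B V W T ~= 0 --> ce powr real d <= X * P"
  proof
   assume "gcount e B V W T ~= 0"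
   hence "{A : prim e Q. A Int sc (1 / l) V = {0} & A Int sc (1 / l) W = {0} & ldet A <= T'} ~= {}" unfolding g unfolding gcount_def by (intro notI) simp
   then obtain A where A: "A : prim e Q" "ldet A <= T'" by blast
   have "ce <= T'" using ce(2)[OF sep_prim[OF Q(1) A(1)] primD(2)[OF A(1)]] A(2) by linarith
   thus "ce powr real d <= X * P" unfolding XP using ce(1) by (intro powr_mono2) auto
  qed
  have Pp: "P powr (1 / N) = K powr (real e / N) * p"
  proof -
   have N': "real (k * d) * real e = N" by (simp add: N_def)
   have "P = K powr real e * p powr N" unfolding P_def Dl N'[symmetric] powr_powr[symmetric] using K p by (subst powr_mult) auto
   hence "P powr (1 / N) = K powr (real e * (1 / N)) * p powr (N * (1 / N))" using K p by (simp only: powr_powr powr_mult powr_ge_zero)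
   thus ?thesis using N p by simp
  qed
  show ?thesis
  proof -
   have "C * x * (K powr (real e / N) * p) = C * K powr (real e / N) * x * p" for x by simp
   thus ?thesis using C(2)[OF g0 X P0 a1 a2 a3, unfolded Pp ee_def[symmetric]] unfolding Let_def V_def[symmetric] D_def[symmetric] h_def[symmetric] X_def[symmetric] pw by (simp only:)
  qed
 qed
 moreover have "C * K powr (real e / N) > 0" using C K by simp
 ultimately show ?thesis using ee unfolding Inner_def by blast
qed

section \<open>Summation over the upper sublattice\<close>

text \<open>The split is at \<open>h j = H powr (1 / n)\<close>, that is, at \<open>X = 1\<close>.
  Below it the sum of \<open>X powr (1 - ee)\<close> and above it the sum of
  \<open>X powr (1 + ee)\<close> are both dominated by terms near the split, so each contributes
  \<open>O(H)\<close> without a logarithm.\<close>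

lemma outer_error:
 fixes h p g :: "'i => real" and n :: nat
 assumes fin: "finite (lev h J R)" and h: "!!j. j : J ==> 0 < h j" and p: "!!j. j : J ==> 0 <= p j"
  and S: "!!r. 0 < r ==> csum J h p r <= K * r powr real n" and K: "0 <= K" and ee: "0 < ee" "ee < 1" and C: "0 <= C" and n: "1 <= n" and H: "0 < H"
  and g: "!!j. j : J ==> 0 <= g j" "!!j. j : J ==> 1 <= H / h j ^ n ==> abs (g j - c * (H / h j ^ n)) <= C * (H / h j ^ n) powr (1 - ee) * p j"
  "!!j. j : J ==> H / h j ^ n < 1 ==> g j <= C * (H / h j ^ n) powr (1 + ee) * p j"
  and R: "H powr (1 / real n) <= R"
 shows "abs ((SUM j:lev h J R. g j) - c * H * (SUM j:lev h J (H powr (1 / real n)). h j powr (- real n))) <= (2 + 2 / ee) * C * K * H"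
proof -
 define R0 where "R0 = H powr (1 / real n)"
 let ?a = "K * R0 powr (real n * ee)"
 let ?y = "(2 + 1 / ee) * (K * R0 powr (- (real n * ee)))"
 have R0: "0 < R0" "R0 powr real n = H" "R0 <= R" using H n R by (auto simp: R0_def powr_powr)
 have X: "1 <= H / h j ^ n \<longleftrightarrow> h j <= R0" if "j : J" for j
 proof -
  have "1 <= H / h j ^ n \<longleftrightarrow> h j powr real n <= R0 powr real n" using h[OF that] R0(2) by (simp add: powr_realpow)
  also have "... \<longleftrightarrow> h j <= R0" using h[OF that] R0(1) n powr_less_mono2[of "real n" R0 "h j"] powr_mono2[of "real n" "h j" R0] by fastforce
  finally show ?thesis .
 qed
 have Xp: "(H / h j ^ n) powr q = H powr q * h j powr (- (real n * q))" if "j : J" for j q using h[OF that] H by (simp add: powr_divide powr_realpow[symmetric] powr_powr powr_minus_divide)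
 have fin0: "finite (lev h J R0)" by (rule finite_subset[OF _ fin]) (use R0(3) in auto)
 have 1: "abs ((SUM j:lev h J R0. g j) - c * H * (SUM j:lev h J R0. h j powr (- real n))) <= C * H powr (1 - ee) * ((1 / ee) * ?a)"
 proof -
  let ?x = "- (real n * (1 - ee))"
  have "(SUM j:lev h J R0. g j) - c * H * (SUM j:lev h J R0. h j powr (- real n)) = (SUM j:lev h J R0. g j - c * (H / h j ^ n))"
  proof -
   have "c * (H / h j ^ n) = c * H * h j powr (- real n)" if "j : J" for j using h[OF that] by (simp add: powr_minus_divide powr_realpow)
   thus ?thesis by (simp add: sum_subtractf sum_distrib_left)
  qed
  moreover have "abs (SUM j:lev h J R0. g j - c * (H / h j ^ n)) <= (SUM j:lev h J R0. C * H powr (1 - ee) * (p j * h j powr ?x))"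
  proof (rule order_trans[OF sum_abs], rule sum_mono)
   fix j assume "j : lev h J R0"
   hence j: "j : J" "h j <= R0" by auto
   have "abs (g j - c * (H / h j ^ n)) <= C * (H / h j ^ n) powr (1 - ee) * p j" using g(2)[OF j(1)] X[OF j(1)] j(2) by blast
   thus "abs (g j - c * (H / h j ^ n)) <= C * H powr (1 - ee) * (p j * h j powr ?x)" unfolding Xp[OF j(1)] by (simp only: mult_ac)
  qed
  moreover have "(SUM j:lev h J R0. C * H powr (1 - ee) * (p j * h j powr ?x)) = C * H powr (1 - ee) * (SUM j:lev h J R0. p j * h j powr ?x)" by (simp only: sum_distrib_left)
  moreover have "(SUM j:lev h J R0. p j * h j powr ?x) <= (1 / ee) * ?a"
  proof -
   have "(SUM j:lev h J R0. p j * h j powr ?x) <= (1 + abs (real n * (1 - ee)) / (real n - real n * (1 - ee))) * (K * R0 powr (real n - real n * (1 - ee)))"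
    using fin0 h p S K R0 n ee by (intro abel_upper) auto
   moreover have "real n - real n * (1 - ee) = real n * ee" by (simp add: right_diff_distrib)
   moreover have "1 + abs (real n * (1 - ee)) / (real n * ee) = 1 / ee" using ee n by (simp add: field_simps)
   ultimately show ?thesis by simp
  qed
  ultimately show ?thesis using C mult_left_mono[of _ _ "C * H powr (1 - ee)"] by (smt (verit) mult_nonneg_nonneg powr_ge_zero)
 qed
 have 2: "abs (SUM j:lay h J R0 R. g j) <= C * H powr (1 + ee) * ?y"
 proof -
  let ?z = "- (real n * (1 + ee))"
  have "(SUM j:lay h J R0 R. g j) <= (SUM j:lay h J R0 R. C * H powr (1 + ee) * (p j * h j powr ?z))"
  proof (rule sum_mono)
   fix j assume "j : lay h J R0 R"
   hence j: "j : J" "~ h j <= R0" by auto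
   have "g j <= C * (H / h j ^ n) powr (1 + ee) * p j" using g(3)[OF j(1)] X[OF j(1)] j(2) by force
   thus "g j <= C * H powr (1 + ee) * (p j * h j powr ?z)" unfolding Xp[OF j(1)] by (simp only: mult_ac)
  qed
  also have "... = C * H powr (1 + ee) * (SUM j:lay h J R0 R. p j * h j powr ?z)" by (simp only: sum_distrib_left)
  also have "... <= C * H powr (1 + ee) * ?y"
  proof (rule mult_left_mono)
   have "(SUM j:lay h J R0 R. p j * h j powr ?z) <= (1 + real n * (1 + ee) / (real n * (1 + ee) - real n)) * (K * R0 powr (real n - real n * (1 + ee)))"
    using fin p S K R0 n ee by (intro abel_tail) auto
   moreover have "real n - real n * (1 + ee) = - (real n * ee)" "real n * (1 + ee) - real n = real n * ee" by (simp_all add: distrib_left)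
   moreover have "1 + real n * (1 + ee) / (real n * ee) = 2 + 1 / ee" using ee n by (simp add: field_simps)
   ultimately show "(SUM j:lay h J R0 R. p j * h j powr ?z) <= (2 + 1 / ee) * (K * R0 powr (- (real n * ee)))" by simp
  qed (use C in auto)
  finally show ?thesis using sum_nonneg[of "(lay h J R0 R)" g] g(1) by simp
 qed
 have "R0 powr (real n * ee) = H powr ee" "R0 powr (- (real n * ee)) = H powr (- ee)" using n by (auto simp: R0_def powr_powr)
 hence e1: "C * H powr (1 - ee) * ((1 / ee) * ?a) = (1 / ee) * C * K * (H powr (1 - ee) * H powr ee)"
  and e2: "C * H powr (1 + ee) * ?y = (2 + 1 / ee) * C * K * (H powr (1 + ee) * H powr (- ee))" by simp_all
 have "H powr (1 - ee) * H powr ee = H" "H powr (1 + ee) * H powr (- ee) = H" using H by (simp_all add: powr_add[symmetric])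
 note e = e1[unfolded this(1)] e2[unfolded this(2)]
 have "(lev h J R) = (lev h J R0) Un (lay h J R0 R)" using R0(3) by auto
 hence "(SUM j:lev h J R. g j) = (SUM j:lev h J R0. g j) + (SUM j:lay h J R0 R. g j)"
  using fin0 finite_subset[OF _ fin, of "(lay h J R0 R)"] by (subst sum.union_disjoint[symmetric]) auto
 moreover have "(2 + 2 / ee) * C * K * H = (1 / ee) * C * K * H + (2 + 1 / ee) * C * K * H" by (simp add: distrib_right add_divide_distrib)
 ultimately show ?thesis using 1 2 unfolding e R0_def[symmetric] by linarith
qed

lemma wt_nonneg: "latt B ==> dim B = d ==> 1 <= d ==> 0 <= wt d B" using hmin_pos[of B "d - 1"] by (simp add: wt_def)

lemma wt_csum:
 assumes T: "T > 0" and M: "latt M" and d: "1 <= d"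
 shows "csum (prim d M) ldet (wt d) T <= T powr (real (d - 1) / real d) * (SUM B:plev d M T. hmin B powr (-1))" unfolding csum_def sum_distrib_left
proof (rule sum_mono)
 fix B assume "B : plev d M T"
 hence B: "latt B" "dim B = Suc (d - 1)" "ldet B <= T" using prim_latt[OF M] primD(2) d by auto
 have "hmin B > 0" by (rule hmin_pos[OF B(1,2)])
 moreover have "ldet B powr (real (d - 1) / real d) <= T powr (real (d - 1) / real d)" using B det_pos[OF B(1)] by (intro powr_mono2) auto
 ultimately show "wt d B <= T powr (real (d - 1) / real d) * hmin B powr (-1)" by (simp add: wt_def powr_minus divide_inverse)
qed

text \<open>A moment of order one, admissible because \<open>d\<close> is at least two. The loss of
  \<open>(d - 1) / d\<close> in the exponent of the moment is restored by the determinant in the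
  weight.\<close>

lemma wt_bound:
 assumes d: "2 <= d" "d <= m"
 shows "EX C>0. ALL (M::'a::euclidean_space set) T. sep M --> dim M = m --> T > 0 --> csum (prim d M) ldet (wt d) T <= C * T powr real m"
proof -
 obtain k where k: "d = Suc k" "k >= 1" using d by (cases d) auto
 obtain C where C: "C > 0" "!!(M::'a set) T. sep M ==> dim M = m ==> T > 0 ==>
  (SUM B:plev (Suc k) M T. hmin B powr (-1)) <= C * T powr (real m - 1 * real k / real (Suc k))" using moment_bound[of k m 1, where ?'a = 'a] d k by auto
 have "csum (prim d M) ldet (wt d) T <= C * T powr real m" if M: "sep M" "dim M = m" and T: "T > 0" for M :: "'a set" and T
 proof -
  have "csum (prim d M) ldet (wt d) T <= T powr (real (d - 1) / real d) * (SUM B:plev d M T. hmin B powr (-1))" using M T d by (intro wt_csum) (auto simp: sep_def)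
  also have "... <= T powr (real (d - 1) / real d) * (C * T powr (real m - 1 * real k / real (Suc k)))" using C(2)[OF M T] unfolding k(1) by (intro mult_left_mono) auto
  also have "... = C * (T powr (real k / real (Suc k)) * T powr (real m - real k / real (Suc k)))" by (simp add: k(1))
  also have "... = C * T powr real m" using T unfolding powr_add[symmetric] by simp
  finally show ?thesis .
 qed
 thus ?thesis using C(1) by blast
qed

text \<open>A common form for the flags of the theorem and those of Thunder that can be cut along
  the upper member and rescaled.\<close>

definition flg :: "nat => nat => nat => 'a::euclidean_space set set => ('a set => 'a set) => ('a set => 'a set) => real => ('a set \<times> 'a set) set" where
 "flg n e d J V W H = {(A, B). B : J & A : prim e B & A Int V B = {0} & A Int W B = {0} & ldet A ^ d * ldet B ^ (n - e) <= H}"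

text \<open>Determinants of rank \<open>e\<close> are bounded below in a separated lattice, so the
  height bounds \<open>ldet B\<close>; the sum may be cut at any larger \<open>R\<close>.\<close>

lemma flg_sum:
 assumes e: "1 <= e" "e < d" "d < n" and M: "sep M" "dim (M::'a::euclidean_space set) = n"
 shows "EX C>0. ALL J V W H R. J <= prim d M --> 0 < H --> C * H powr (1 / real (n - e)) <= R -->
  rcard (flg n e d J V W H) = (SUM B:dlev J R. gcount e B (V B) (W B) ((H / ldet B ^ (n - e)) powr (1 / real d)))"
proof -
 let ?x = "1 / real (n - e)"
 obtain ce where ce: "ce > 0" "!!M::'a set. sep M ==> dim M = e ==> ce <= ldet M" using sep_det_lower by blast
 define C where "C = (1 / ce ^ d) powr ?x"
 have "rcard (flg n e d J V W H) = (SUM B:dlev J R. gcount e B (V B) (W B) ((H / ldet B ^ (n - e)) powr (1 / real d)))"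
  if J: "J <= prim d M" and H: "0 < H" and R: "C * H powr ?x <= R" for J V W H R
 proof -
  let ?y = "%(B, A). (A, B)"
  note lM = sep_latt[OF M(1)]
  define S where "S B = {A : prim e B. A Int V B = {0} & A Int W B = {0} & ldet A <= (H / ldet B ^ (n - e)) powr (1 / real d)}" for B
  define JR where "JR = (dlev J R)"
  have iff: "ldet A ^ d * ldet B ^ (n - e) <= H \<longleftrightarrow> ldet A <= (H / ldet B ^ (n - e)) powr (1 / real d)" if "latt A" "latt B" for A B :: "'a set"
  proof -
   define x where "x = H / ldet B ^ (n - e)"
   have p: "ldet A > 0" "ldet B > 0" using det_pos that by auto
   have x: "x > 0" using H p by (simp add: x_def)
   have "ldet A ^ d * ldet B ^ (n - e) <= H \<longleftrightarrow> ldet A ^ d <= x" using p by (simp add: x_def pos_le_divide_eq)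
   also have "... \<longleftrightarrow> ldet A ^ d <= (x powr (1 / real d)) ^ d" using x e by (simp add: powr_realpow[symmetric] powr_powr)
   also have "... \<longleftrightarrow> ldet A <= x powr (1 / real d)" using p e by (intro power_mono_iff) auto
   finally show ?thesis by (simp add: x_def)
  qed
  have lB: "latt B" "sep B" if "B : J" for B using J that prim_latt[OF lM] sep_prim[OF M(1)] by blast+
  have bij: "flg n e d J V W H = ?y ` (SIGMA B:JR. S B)"
  proof (intro equalityI subsetI)
   fix x assume "x : flg n e d J V W H"
   then obtain A B where x: "x = (A, B)" "B : J" "A : prim e B" "A Int V B = {0}" "A Int W B = {0}" "ldet A ^ d * ldet B ^ (n - e) <= H" by (auto simp: flg_def)
   note l = lB[OF x(2)]
   have "ce ^ d * ldet B ^ (n - e) <= ldet A ^ d * ldet B ^ (n - e)" using ce(1) ce(2)[OF sep_prim[OF l(2) x(3)] primD(2)[OF x(3)]] det_pos[OF l(1)] by (intro mult_right_mono power_mono) auto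
   hence "ldet B ^ (n - e) <= H / ce ^ d" using x(6) ce(1) by (simp add: pos_le_divide_eq mult.commute)
   hence "(ldet B ^ (n - e)) powr ?x <= (H / ce ^ d) powr ?x" using det_pos[OF l(1)] by (intro powr_mono2) auto
   moreover have "(ldet B ^ (n - e)) powr ?x = ldet B" using det_pos[OF l(1)] e by (simp add: powr_realpow[symmetric] powr_powr)
   moreover have "(H / ce ^ d) powr ?x = C * H powr ?x" using ce(1) H by (simp add: C_def powr_divide)
   ultimately have "B : JR" using R x(2) by (simp add: JR_def)
   moreover have "A : S B" using x iff[OF prim_latt[OF l(1) x(3)] l(1)] by (simp add: S_def)
   ultimately show "x : ?y ` (SIGMA B:JR. S B)" using x(1) by force
  next
   fix x assume "x : ?y ` (SIGMA B:JR. S B)"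
   then obtain A B where x: "x = (A, B)" "B : J" "A : S B" by (auto simp: JR_def)
   have "A : prim e B" using x(3) by (simp add: S_def)
   thus "x : flg n e d J V W H" using x iff[OF prim_latt[OF lB(1)[OF x(2)]] lB(1)[OF x(2)]] by (simp add: S_def flg_def)
  qed
  have "card (flg n e d J V W H) = card (SIGMA B:JR. S B)" unfolding bij by (rule card_image) (auto simp: inj_on_def)
  also have "... = (SUM B:JR. card (S B))"
  proof (rule card_SigmaI)
   show "finite JR" by (rule fin_prim[OF lM, of _ d R]) (use J in \<open>auto simp: JR_def\<close>)
   show "ALL B:JR. finite (S B)"
   proof
    fix B assume "B : JR"
    hence "latt B" using lB by (simp add: JR_def)
    thus "finite (S B)" by (intro finite_subset[OF _ prim_finite[of B e "(H / ldet B ^ (n - e)) powr (1 / real d)"]]) (auto simp: S_def)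
   qed
  qed
  finally show ?thesis by (simp add: JR_def S_def gcount_def)
 qed
 moreover have "C > 0" using ce by (simp add: C_def)
 ultimately show ?thesis by blast
qed

text \<open>Sublattices of rank \<open>d\<close> are counted by \<open>T powr n\<close>, so
  \<open>n\<close> is the critical exponent. This is the source of the logarithm in the
  theorem.\<close>

lemma det_sum_log:
 assumes F: "Fasymp TYPE('a::euclidean_space) n d c C dlt" and d: "1 <= d" "d < n"
  and M: "sep M" "dim (M::'a set) = n" and D: "0 < D" "D <= R"
 shows "abs ((SUM B:dlay (prim d M) D R. ldet B powr (- real n)) - c * ldet M powr (- real d) * real n * ln (R / D))
  <= (2 + real n / dlt) * (C * D powr (-dlt))"
proof -
 have F': "0 < C" "0 < dlt" "!!(M::'a set) T. sep M ==> dim M = n ==> T > 0 ==>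
  abs (pc d M T - c * ldet M powr (- real d) * T powr real n) <= C * T powr (real n - dlt)" using F by (auto simp: Fasymp_def)
 note lM = sep_latt[OF M(1)]
 have "abs ((SUM B:dlay (prim d M) D R. 1 * ldet B powr (- real n)) - c * ldet M powr (- real d) * real n * ln (R / D))
  <= (2 + real n / dlt) * (C * D powr (-dlt))" using F'(3)[OF M] D by (intro abel_log_asymp prim_finite[OF lM] F'(2)) (auto simp: csum_const)
 thus ?thesis by simp
qed

lemma Inner_gcount:
 assumes I: "Inner TYPE('a::euclidean_space) e d c C ee" and e: "1 <= e" "e < d" "d < n"
  and v: "minv d (B::'a set) v" and W: "W : prim (d - e) B" and H: "0 < H"
 defines "g == gcount e B (layer B v (d - e)) W ((H / ldet B ^ (n - e)) powr (1 / real d))"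
 shows "1 <= H / ldet B ^ n ==> abs (g - c * (H / ldet B ^ n)) <= C * (H / ldet B ^ n) powr (1 - ee) * wt d B"
  and "H / ldet B ^ n < 1 ==> g <= C * (H / ldet B ^ n) powr (1 + ee) * wt d B"
proof -
 have D: "ldet B > 0" using v det_pos by (auto simp: minv_def)
 define T where "T = (H / ldet B ^ (n - e)) powr (1 / real d)"
 have T: "T > 0" using D H by (simp add: T_def)
 have "T powr real d = H / ldet B ^ (n - e)" using D H e by (simp add: T_def powr_powr)
 moreover have "ldet B ^ n = ldet B ^ (n - e) * ldet B ^ e" using e by (simp add: power_add[symmetric])
 ultimately have X: "T powr real d / ldet B powr real e = H / ldet B ^ n" using D by (simp add: powr_realpow)
 have "ALL (B::'a set) v W T. minv d B v --> W : prim (d - e) B --> T > 0 -->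
  (let X = T powr real d / ldet B powr real e; g = gcount e B (layer B v (d - e)) W T in
   (1 <= X --> abs (g - c * X) <= C * X powr (1 - ee) * wt d B) & (X < 1 --> g <= C * X powr (1 + ee) * wt d B))"
  using I unfolding Inner_def by blast
 from this[rule_format, OF v W T, unfolded Let_def X]
 show "1 <= H / ldet B ^ n ==> abs (g - c * (H / ldet B ^ n)) <= C * (H / ldet B ^ n) powr (1 - ee) * wt d B"
  and "H / ldet B ^ n < 1 ==> g <= C * (H / ldet B ^ n) powr (1 + ee) * wt d B" unfolding g_def T_def by blast+
qed

lemma flg_det_sum:
 assumes I: "Inner TYPE('a::euclidean_space) e d c C ee" and e: "1 <= e" "e < d" "d < n"
  and M: "sep M" "dim (M::'a set) = n" and J: "J <= prim d M" and v: "!!B. B : J ==> minv d B (v B)" and W: "!!B. B : J ==> W B : prim (d - e) B"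
  and S: "!!r. 0 < r ==> csum J ldet (wt d) r <= K * r powr real n" and K: "0 <= K" and H: "0 < H"
 shows "abs (rcard (flg n e d J (%B. layer B (v B) (d - e)) W H) - c * H * (SUM B:dlev J (H powr (1 / real n)). ldet B powr (- real n)))
  <= (2 + 2 / ee) * C * K * H"
proof -
 have C: "0 < C" "0 < ee" "ee < 1" using I by (auto simp: Inner_def)
 note lM = sep_latt[OF M(1)]
 have lB: "latt B" "dim B = d" if "B : J" for B using J that prim_latt[OF lM] primD(2) by blast+
 obtain C' where C': "C' > 0" "!!J V W H R. J <= prim d M ==> 0 < H ==> C' * H powr (1 / real (n - e)) <= R ==>
  rcard (flg n e d J V W H) = (SUM B:dlev J R. gcount e B (V B) (W B) ((H / ldet B ^ (n - e)) powr (1 / real d)))" using flg_sum[OF e M] by blast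
 define R where "R = max (C' * H powr (1 / real (n - e))) (H powr (1 / real n))"
 have RR: "C' * H powr (1 / real (n - e)) <= R" by (simp add: R_def)
 show ?thesis unfolding C'(2)[OF J H RR]
 proof (rule outer_error[where p = "wt d"])
  show "finite (dlev J R)" by (rule fin_prim[OF lM, of _ d R]) (use J in auto)
  show "0 <= wt d B" if "B : J" for B using wt_nonneg[OF lB[OF that]] e by simp
  show "0 <= gcount e B (layer B (v B) (d - e)) (W B) ((H / ldet B ^ (n - e)) powr (1 / real d))" for B by (simp add: gcount_def)
 qed (use C K H S e lB det_pos Inner_gcount[OF I e v W H] in \<open>auto simp: R_def\<close>)
qed

lemma flags_sep:
 assumes I: "Inner TYPE('a::euclidean_space) e d c C ee" and F: "Fasymp TYPE('a) n d c' C' dlt" and e: "1 <= e" "e < d" "d < n"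
 shows "EX K>0. ALL (M::'a set) v H. sep M --> dim M = n --> (ALL B:prim d M. minv d B (v B)) --> 1 <= H -->
  abs (rcard (flg n e d (prim d M) (%B. layer B (v B) (d - e)) (%B. layer B (v B) (d - e)) H) - c * c' * ldet M powr (- real d) * H * ln H) <= K * H"
proof -
 have C: "0 < C" "0 < ee" "ee < 1" using I by (auto simp: Inner_def)
 have C': "0 < C'" "0 < dlt" using F by (auto simp: Fasymp_def)
 obtain K1 where K1: "K1 > 0" "!!(M::'a set) T. sep M ==> dim M = n ==> T > 0 ==> csum (prim d M) ldet (wt d) T <= K1 * T powr real n"
  using wt_bound[of d n, where ?'a = 'a] e by auto
 obtain cd where cd: "cd > 0" "!!M::'a set. sep M ==> dim M = d ==> cd <= ldet M" using sep_det_lower by blast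
 obtain cn where cn: "cn > 0" "!!M::'a set. sep M ==> dim M = n ==> cn <= ldet M" using sep_det_lower by blast
 \<comment> \<open>Below all determinants of rank \<open>d\<close>, so the logarithmic sum may start
   here; \<open>D\<close> affects only constants.\<close>
 define D where "D = min 1 (cd / 2)"
 have D: "0 < D" "D <= 1" "D < cd" using cd by (auto simp: D_def)
 define E where "E = (2 + real n / dlt) * (C' * D powr (-dlt)) + abs c' * cn powr (- real d) * real n * abs (ln D)"
 have E: "E >= 0" unfolding E_def using C' by (intro add_nonneg_nonneg mult_nonneg_nonneg) auto
 define K where "K = (2 + 2 / ee) * C * K1 + abs c * E"
 have K: "K > 0" unfolding K_def using C K1 E by (intro add_pos_nonneg mult_pos_pos add_pos_pos) auto
 have "abs (rcard (flg n e d (prim d M) (%B. layer B (v B) (d - e)) (%B. layer B (v B) (d - e)) H) - c * c' * ldet M powr (- real d) * H * ln H) <= K * H"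
  if M: "sep M" "dim M = n" and v: "ALL B:prim d M. minv d B (v B)" and H: "1 <= H" for M :: "'a set" and v H
 proof -
  define x where "x = rcard (flg n e d (prim d M) (%B. layer B (v B) (d - e)) (%B. layer B (v B) (d - e)) H)"
  define R0 where "R0 = H powr (1 / real n)"
  define S where "S = (SUM B:plev d M R0. ldet B powr (- real n))"
  define alp where "alp = c' * ldet M powr (- real d)"
  have 1: "abs (x - c * H * S) <= (2 + 2 / ee) * C * K1 * H" unfolding x_def S_def R0_def using v K1 H M by (intro flg_det_sum[OF I e M]) (auto intro: minv_layer(1))
  have R0: "R0 >= 1" using H by (simp add: R0_def ge_one_powr_ge_zero)
  have "(plev d M R0) = (dlay (prim d M) D R0)" using cd(2)[OF sep_prim[OF M(1)] primD(2)] D by fastforce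
  hence 2: "abs (S - alp * real n * ln (R0 / D)) <= (2 + real n / dlt) * (C' * D powr (-dlt))"
   using det_sum_log[OF F _ _ M D(1), of R0] e D R0 by (simp add: S_def alp_def)
  have "ln R0 = ln H / real n" using H by (simp add: R0_def)
  hence 3: "alp * real n * ln (R0 / D) = alp * ln H - alp * real n * ln D" using R0 D e by (simp add: ln_div right_diff_distrib)
  have "abs alp <= abs c' * cn powr (- real d)" unfolding alp_def abs_mult using cn M by (intro mult_mono) (auto intro!: powr_mono2')
  hence "abs (alp * real n * ln D) <= abs c' * cn powr (- real d) * real n * abs (ln D)" unfolding abs_mult by (intro mult_mono) auto
  hence "abs (S - alp * ln H) <= E" using 2 unfolding 3 E_def by linarith
  hence "abs (c * H) * abs (S - alp * ln H) <= (abs c * H) * E" using H E by (intro mult_mono) (auto simp: abs_mult)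
  hence "abs (c * H * S - c * H * (alp * ln H)) <= abs c * E * H" by (simp add: abs_mult[symmetric] right_diff_distrib mult_ac)
  hence "abs (x - c * H * (alp * ln H)) <= (2 + 2 / ee) * C * K1 * H + abs c * E * H" using 1 by linarith
  also have "c * H * (alp * ln H) = c * c' * ldet M powr (- real d) * H * ln H" by (simp add: alp_def)
  finally show ?thesis by (simp only: K_def x_def distrib_right)
 qed
 thus ?thesis using K by blast
qed

section \<open>Averages with the exact power of the determinant\<close>

lemma sep_cball_det:
 assumes M: "sep M" "dim (M::'a::euclidean_space set) = n" and n: "1 <= n"
 shows "EX t0. ALL t>=t0. rcard (M Int cball 0 t) <= 2 * ubv n / ldet M * t ^ n"
proof -
 obtain k where k: "n = Suc k" using n by (cases n) auto
 obtain C where C: "C > 0" "!!t. t >= 1 ==> abs (rcard (M Int cball 0 t) - ubv (Suc k) * t ^ Suc k / ldet M) <= C * t ^ k"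
  using sep_ball_count[of k, where ?'a = 'a] M k by blast
 have d: "ldet M > 0" using M det_pos by (auto simp: sep_def)
 define u where "u = ubv n / ldet M"
 have u: "u > 0" using d by (simp add: u_def)
 have "rcard (M Int cball 0 t) <= 2 * u * t ^ n" if t: "t >= max 1 (C / u)" for t
 proof -
  have "C * t ^ k <= (u * t) * t ^ k" using t u by (intro mult_right_mono) (auto simp: pos_divide_le_eq mult.commute)
  thus ?thesis using C(2)[of t] t unfolding k[symmetric] by (simp add: u_def k)
 qed
 thus ?thesis unfolding u_def times_divide_eq_right by blast
qed

text \<open>Thunder's error term requires the factor \<open>ldet M powr (- d)\<close>, which
  \<open>wt_bound\<close> lacks. It appears once \<open>T\<close> is large in terms of
  \<open>M\<close>, when ball counts and the count of rank \<open>k\<close> follow their main terms;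
  the \<open>A\<close> of determinant at most \<open>q\<close> contribute a bounded amount that is
  swallowed by large \<open>T\<close>.\<close>

lemma wt_bound_det:
 assumes d: "2 <= d" "d <= n"
 shows "EX C>0. ALL M::'a::euclidean_space set. sep M --> dim M = n -->
  (\<forall>\<^sub>F T in at_top. csum (prim d M) ldet (wt d) T <= C * ldet M powr (- real d) * T powr real n)"
proof -
 obtain k where k: "d = Suc k" "1 <= k" "k < n" using d by (cases d) auto
 let ?z = "1 + abs (real n - real k) / (real n - (real n - real k))"
 obtain c CF dlt where "Fasymp TYPE('a) n k c CF dlt" using Fasymp_exists[OF k(2,3), where ?'a = 'a] by blast
 hence F: "0 < CF" "0 < dlt" "!!(M::'a set) T. sep M ==> dim M = n ==> T > 0 ==>
  abs (pc k M T - c * ldet M powr (- real k) * T powr real n) <= CF * T powr (real n - dlt)" by (auto simp: Fasymp_def)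
 define g where "g = 2 * ubv n * (4 * kap k) ^ n / ubv k"
 have g: "g > 0" using kap_ge1[of k] by (simp add: g_def)
 define a where "a = ?z * (abs c + 1)"
 let ?b = "2 * a * (2 ^ k) powr real k"
 have a: "a > 0" unfolding a_def using k by (intro mult_pos_pos add_pos_nonneg[of 1] add_nonneg_pos[of "abs c"] divide_nonneg_nonneg) auto
 have "\<forall>\<^sub>F T in at_top. csum (prim d M) ldet (wt d) T <= (g * ?b) * ldet M powr (- real d) * T powr real n" if M: "sep M" "dim M = n" for M :: "'a set"
 proof -
  let ?a = "- (real n - real k)"
  let ?y = "real k / real (Suc k)"
  let ?x = "real k / real (Suc k) * real k"
  note lM = sep_latt[OF M(1)]
  have dM: "ldet M > 0" by (rule det_pos[OF lM])
  define De where "De = ldet M powr (- real k)"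
  have De: "De > 0" using dM by (simp add: De_def)
  obtain t0 where t0: "!!t. t >= t0 ==> rcard (M Int cball 0 t) <= 2 * ubv n / ldet M * t ^ n" using sep_cball_det[OF M] d by auto
  define R where "R T = 2 ^ k * T powr ?y" for T
  define W where "W t = (SUM A:plev k M t. ldet A powr ?a)" for t
  have W: "EX L. ALL t>0. W t <= L + a * De * t powr real k"
  proof -
   \<comment> \<open>Beyond \<open>q\<close> the error in the count of rank \<open>k\<close> is at
     most \<open>De * r powr n\<close>, so it carries the same factor as the main term.\<close>
   define q where "q = (CF / De) powr (1 / dlt)"
   define J where "J = {A : prim k M. q < ldet A}"
   have J: "csum J ldet (%_. 1) r <= (abs c + 1) * De * r powr real n" if r: "r > 0" for r
   proof (cases "q < r")
    case True
    have "CF / De = q powr dlt" using F(1,2) De by (simp add: q_def powr_powr)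
    also have "... <= r powr dlt" using True F(2) by (intro powr_mono2) (auto simp: q_def)
    finally have "CF <= De * r powr dlt" using De by (simp add: pos_divide_le_eq mult.commute)
    hence "CF * r powr (real n - dlt) <= De * r powr dlt * r powr (real n - dlt)" by (intro mult_right_mono) auto
    also have "... = De * r powr real n" by (simp add: powr_add[symmetric] mult.assoc)
    finally have "CF * r powr (real n - dlt) <= De * r powr real n" .
    moreover have "c * De * r powr real n <= abs c * De * r powr real n" using De by (intro mult_right_mono) auto
    moreover have "csum J ldet (%_. 1) r <= pc k M r" unfolding csum_const by (intro of_nat_mono card_mono prim_finite[OF lM]) (auto simp: J_def)
    ultimately show ?thesis using F(3)[OF M r, folded De_def] by (simp add: distrib_right)
   next
    case False
    hence e: "(dlev J r) = {}" by (auto simp: J_def)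
    show ?thesis using De unfolding csum_def e by simp
   qed
   have "W t <= W q + a * De * t powr real k" if t: "t > 0" for t
   proof -
    have fin: "finite (plev k M s)" for s by (rule prim_finite[OF lM])
    have finJ: "finite (dlev J t)" by (rule finite_subset[OF _ fin[of t]]) (auto simp: J_def)
    have "W t <= (SUM A:(plev k M q) Un (dlev J t). ldet A powr ?a)" unfolding W_def using fin[of q] finJ by (intro sum_mono2 finite_UnI) (auto simp: J_def)
    also have "... = W q + (SUM A:dlev J t. 1 * ldet A powr ?a)" unfolding W_def using fin[of q] finJ by (subst sum.union_disjoint) (auto simp: J_def)
    also have "(SUM A:dlev J t. 1 * ldet A powr ?a) <= ?z * ((abs c + 1) * De * t powr (real n - (real n - real k)))"
     using J De k t det_pos prim_latt[OF lM, of _ k] finJ by (intro abel_upper) (auto simp: J_def)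
    also have "... = a * De * t powr real k" by (simp add: a_def)
    finally show ?thesis by simp
   qed
   thus ?thesis by blast
  qed
  then obtain L where L: "!!t. t > 0 ==> W t <= L + a * De * t powr real k" by blast
  have "filterlim (%T. T powr (1 / real (Suc k))) at_top at_top" by real_asymp
  hence ev1: "\<forall>\<^sub>F T in at_top. abs t0 * 2 ^ k <= T powr (1 / real (Suc k))" by (simp add: filterlim_at_top)
  have "k / real (Suc k) * real k > 0" using k by simp
  hence "filterlim (%T. T powr ?x) at_top at_top" by real_asymp
  hence ev2: "\<forall>\<^sub>F T in at_top. L / (a * De) <= T powr ?x" by (simp add: filterlim_at_top)
  show ?thesis using ev1 ev2 eventually_gt_at_top[of 0]
  proof eventually_elim
   case (elim T)
   have RT: "R T > 0" using elim(3) by (simp add: R_def)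
   define Y where "Y = (plev k M (R T))"
   have "(SUM B:plev (Suc k) M T. hmin B powr (-1)) <=
    g / ldet M * T powr (real n - real k) * (SUM A:dlev Y (2 ^ k * T powr ?y). ldet A powr (- (real n - real k - 1 + 1)))"
   proof (rule mhyp_sum[OF lM elim(3)])
    show "mu B : Y" if B: "B : prim (Suc k) M" "ldet B <= T" for B
     using mhyp_det_le[OF prim_latt[OF lM B(1)] primD(2)[OF B(1)] mu_prim(3)[OF lM B(1)] B(2)] mu_prim(1)[OF lM B(1)] by (simp add: Y_def R_def)
    fix A assume "A : Y"
    hence A: "A : prim k M" "ldet A <= R T" by (auto simp: Y_def)
    have dA: "ldet A > 0" by (rule det_pos[OF prim_latt[OF lM A(1)]])
    have "t0 <= 4 * kap k * (T / ldet A)"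
    proof -
     have "abs t0 * R T <= T powr (1 / real (Suc k)) * T powr ?y" using elim(1) mult_right_mono[OF elim(1), of "T powr ?y"] by (simp add: R_def mult.assoc)
     also have "... = T" using elim(3) by (simp add: powr_add[symmetric] add_divide_distrib[symmetric])
     finally have "abs t0 * ldet A <= T" using mult_left_mono[OF A(2), of "abs t0"] by linarith
     hence "abs t0 <= T / ldet A" using dA by (simp add: pos_le_divide_eq)
     also have "... <= 4 * kap k * (T / ldet A)" using kap_ge1[of k] dA elim(3) by (simp add: pos_divide_le_eq)
     finally show ?thesis by linarith
    qed
    from t0[OF this, unfolded power_mult_distrib[of "4 * kap k"]] have "rcard (M Int cball 0 (4 * kap k * (T / ldet A))) <= (2 * ubv n * (4 * kap k) ^ n / ldet M) * (T / ldet A) ^ n"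
     by (simp only: times_divide_eq_left mult.assoc)
    from children_bound[OF lM A(1) elim(3) this]
    have "rcard {B : prim (Suc k) M. mhyp A B & ldet B <= T} <= g / ldet M * ((T / ldet A) ^ (n - k) * ldet A)" using k kap_ge1[of k] dM by (simp add: g_def mult.commute)
    moreover have "card {B : prim (Suc k) M. mu B = A & ldet B <= T} <= card {B : prim (Suc k) M. mhyp A B & ldet B <= T}"
     using mu_prim(3)[OF lM] by (intro card_mono fin_prim[OF lM, of _ "Suc k" T]) auto
    ultimately show "rcard {B : prim (Suc k) M. mu B = A & ldet B <= T} <= g / ldet M * ((T / ldet A) ^ (n - k) * ldet A)" by linarith
   qed (use k g dM in \<open>auto simp: Y_def\<close>)
   moreover have "(SUM A:dlev Y (2 ^ k * T powr ?y). ldet A powr (- (real n - real k - 1 + 1))) = W (R T)" unfolding W_def Y_def R_def by (intro sum.cong) auto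
   moreover have "W (R T) <= 2 * a * (2 ^ k) powr real k * De * T powr ?x"
   proof -
    have p: "R T powr real k = (2 ^ k) powr real k * T powr ?x" unfolding R_def by (simp add: powr_mult powr_powr)
    have "1 <= (2 ^ k :: real) powr real k" by (simp add: ge_one_powr_ge_zero)
    hence "T powr ?x <= R T powr real k" unfolding p using mult_right_mono[of 1 "(2 ^ k) powr real k"] by fastforce
    hence "L / (a * De) <= R T powr real k" using elim(2) by linarith
    hence "L <= a * De * R T powr real k" using a De by (simp add: pos_divide_le_eq mult_ac)
    hence "W (R T) <= 2 * (a * De * R T powr real k)" using L[OF RT] by simp
    thus ?thesis unfolding p by (simp only: mult_ac)
   qed
   ultimately have h: "(SUM B:plev (Suc k) M T. hmin B powr (-1)) <= g / ldet M * T powr (real n - real k) * (2 * a * (2 ^ k) powr real k * De * T powr ?x)"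
    using g dM mult_left_mono[of "W (R T)" _ "g / ldet M * T powr (real n - real k)"] by (smt (verit) divide_nonneg_pos mult_nonneg_nonneg powr_ge_zero)
   have "csum (prim d M) ldet (wt d) T <= T powr (real (d - 1) / real d) * (SUM B:plev d M T. hmin B powr (-1))" using elim(3) lM d by (intro wt_csum) auto
   also have "... <= T powr ?y * (g / ldet M * T powr (real n - real k) * (2 * a * (2 ^ k) powr real k * De * T powr ?x))"
    using h unfolding k(1) by (intro mult_mono) (auto intro!: sum_nonneg)
   also have "... = (g * ?b) * (De / ldet M) * (T powr ?y * T powr (real n - real k) * T powr ?x)" by simp
   also have "T powr ?y * T powr (real n - real k) * T powr ?x = T powr real n"
   proof -
    have "real k / real (Suc k) + real k / real (Suc k) * real k = real k / real (Suc k) * real (Suc k)" by (simp add: distrib_left)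
    hence "real k / real (Suc k) + (real n - real k) + real k / real (Suc k) * real k = real n" by simp
    thus ?thesis by (simp only: powr_add[symmetric])
   qed
   also have "De / ldet M = ldet M powr (- real d)"
   proof -
    have "- real d = - real k - 1" by (simp add: k(1))
    thus ?thesis using dM by (simp only: De_def powr_diff powr_one)
   qed
   finally show ?case .
  qed
 qed
 moreover have "g * ?b > 0" using g a by simp
 ultimately show ?thesis by blast
qed

section \<open>Flags in general position\<close>

text \<open>The scale invariant ratio in Thunder's error term, which is
  \<open>H * ldet M powr (- d)\<close> times the power \<open>b\<close> of this ratio.\<close>

definition Delta :: "nat => nat => 'a::euclidean_space set => (nat => 'a) => real" where
 "Delta n d M w = ldet M powr (real (n - d) / real n) / ldet (layer M w (n - d))"

text \<open>The first \<open>s = n - d\<close> vectors have norms at most \<open>mm\<close>, the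
  others at least \<open>mm\<close>, and the last has norm \<open>La\<close>. Comparing the partial
  products \<open>P\<close> and \<open>Q\<close> gives \<open>La * P ^ d <= Q ^ s\<close>, while the
  \<open>n\<close>-th power of \<open>Delta\<close> is at least a constant times
  \<open>Q ^ s / P ^ d\<close>.\<close>

lemma Delta_lower:
 assumes d: "1 <= d" "d < n"
 shows "EX c>0. ALL (M::'a::euclidean_space set) w. minv n M w --> norm (w 1) = 1 --> c * norm (w n) <= Delta n d M w powr real n"
proof -
 obtain C where C: "C > 0" "!!(N::'a set) v j. minv n N v ==> j <= n ==> (\<Prod>i=1..j. norm (v i)) <= C * ldet (layer N v j)"
  using layer_det_ge[where ?'a = 'a] by blast
 define s where "s = n - d"
 have s: "1 <= s" "s < n" "n = s + d" using d by (auto simp: s_def)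
 have "(1 / C) ^ s * norm (w n) <= Delta n d M w powr real n" if w: "minv n M w" and w1: "norm (w 1) = 1" for M :: "'a set" and w
 proof -
  define mm where "mm = norm (w s)"
  define La where "La = norm (w n)"
  have mono: "norm (w i) <= norm (w j)" if "1 <= i" "i <= j" "j <= n" for i j using w that by (simp add: minv_def)
  have mm: "1 <= mm" "mm <= La" using mono[of 1 s] mono[of s n] w1 s by (auto simp: mm_def La_def)
  define P where "P = (\<Prod>i=1..s. norm (w i))"
  define Q where "Q = (\<Prod>i=s+1..n. norm (w i))"
  have "P = norm (w 1) * (\<Prod>i=2..s. norm (w i))" unfolding P_def using s by (subst prod.atLeast_Suc_atMost) (auto simp: numeral_2_eq_2)
  also have "... <= (\<Prod>i=2..s. mm)" unfolding w1 mult_1 mm_def using mono s by (intro prod_mono) auto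
  finally have P: "P <= mm ^ (s - 1)" by simp
  have "mm ^ (d - 1) * La = (\<Prod>i=s+1..n-1. mm) * La" using s by simp
  also have "... <= (\<Prod>i=s+1..n-1. norm (w i)) * La" unfolding mm_def La_def using mono s by (intro mult_right_mono prod_mono) auto
  also have "... = Q"
  proof -
   obtain d' where d': "d = Suc d'" using d not0_implies_Suc[of d] by auto
   show ?thesis unfolding Q_def La_def s(3) d' by simp
  qed
  finally have Q: "mm ^ (d - 1) * La <= Q" .
  have P1: "P > 0" unfolding P_def using minv_norm_pos[OF w] s by (intro prod_pos) auto
  have "{1..n} = {1..s} Un {s+1..n}" using s by auto
  hence "P * Q = (\<Prod>i=1..n. norm (w i))" unfolding P_def Q_def by (simp add: prod.union_disjoint)
  hence PQ: "P * Q <= C * ldet M" using C(2)[OF w, of n] minv_layer_top[OF w] by simp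
  have dM: "ldet M > 0" using w det_pos by (auto simp: minv_def)
  have dl: "ldet (layer M w s) > 0" "ldet (layer M w s) <= P" using det_pos[OF minv_layer(3)[OF w]] layer_det_le[OF w, of s] s by (auto simp: P_def)
  have e: "La * P ^ d <= Q ^ s"
  proof -
   have "La * P ^ d <= La * (mm ^ (s - 1)) ^ d" using P P1 mm by (intro mult_left_mono power_mono) auto
   also have "... <= mm ^ ((d - 1) * s) * La ^ s"
   proof (cases "d <= s")
    case True
    have "La * (mm ^ (s - 1)) ^ d = La * (mm ^ (s - d) * mm ^ ((d - 1) * s))"
    proof -
     have "(s - 1) * d = (s - d) + (d - 1) * s" using True d s by (simp add: algebra_simps diff_mult_distrib diff_mult_distrib2)
     thus ?thesis by (simp only: power_mult[symmetric] power_add)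
    qed
    also have "... <= La * (La ^ (s - 1) * mm ^ ((d - 1) * s))"
    proof -
     have "mm ^ (s - d) <= La ^ (s - d)" using mm by (intro power_mono) auto
     also have "... <= La ^ (s - 1)" using mm d by (intro power_increasing) auto
     finally show ?thesis using mm by (intro mult_left_mono mult_right_mono) auto
    qed
    also have "... = mm ^ ((d - 1) * s) * La ^ s" using s by (cases s) auto
    finally show ?thesis .
   next
    case False
    have "(s - 1) * d <= (d - 1) * s" using False diff_le_mono2[of s d "s * d"] by (simp only: diff_mult_distrib mult.commute[of d s] mult_1)
    hence "mm ^ ((s - 1) * d) <= mm ^ ((d - 1) * s)" using mm by (intro power_increasing) auto
    moreover have "La ^ 1 <= La ^ s" using mm s by (intro power_increasing) auto
    ultimately have "La ^ 1 * mm ^ ((s - 1) * d) <= La ^ s * mm ^ ((d - 1) * s)" using mm by (intro mult_mono) auto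
    thus ?thesis by (simp only: power_mult[symmetric] power_one_right mult.commute[of "La ^ s"])
   qed
   also have "... = (mm ^ (d - 1) * La) ^ s" by (simp add: power_mult_distrib power_mult)
   also have "... <= Q ^ s" using Q mm by (intro power_mono) auto
   finally show ?thesis .
  qed
  have "Delta n d M w powr real n = ldet M ^ s / ldet (layer M w s) ^ n" using dM dl s unfolding Delta_def s_def[symmetric] by (simp add: powr_divide powr_powr powr_realpow[symmetric])
  moreover have "(1 / C) ^ s * La <= ldet M ^ s / ldet (layer M w s) ^ n"
  proof -
   have "La * P ^ n = La * P ^ d * P ^ s" by (simp add: s(3) power_add mult_ac)
   also have "... <= Q ^ s * P ^ s" using e P1 by (intro mult_right_mono) auto
   also have "... = (P * Q) ^ s" by (simp add: power_mult_distrib mult.commute)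
   also have "... <= (C * ldet M) ^ s" using PQ P1 Q mm by (intro power_mono mult_nonneg_nonneg) (auto intro: order_trans[OF _ Q])
   finally have "La * P ^ n <= (C * ldet M) ^ s" .
   moreover have "La * ldet (layer M w s) ^ n <= La * P ^ n" using dl mm by (intro mult_left_mono power_mono) auto
   ultimately have "La * ldet (layer M w s) ^ n <= (C * ldet M) ^ s" by (rule order_trans[rotated])
   thus ?thesis using dl C(1) by (simp add: power_mult_distrib field_simps)
  qed
  ultimately show ?thesis by (simp add: La_def)
 qed
 moreover have "(1 / C) ^ s > 0" using C by simp
 ultimately show ?thesis by blast
qed

text \<open>With shortest length one, \<open>ldet M\<close> lies between a constant and
  \<open>norm (w n) ^ n\<close>. Its logarithm is thus bounded by any positive power of
  \<open>norm (w n)\<close>, hence of \<open>Delta\<close>.\<close>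

lemma Delta_log:
 assumes d: "1 <= d" "d < n" and b: "0 < b"
 shows "EX K>0. ALL (M::'a::euclidean_space set) w. minv n M w --> norm (w 1) = 1 --> 1 + ln (max 1 (ldet M)) + abs (ln (ldet M)) <= K * Delta n d M w powr b"
proof -
 obtain c where c: "c > 0" "!!(M::'a set) w. minv n M w ==> norm (w 1) = 1 ==> c * norm (w n) <= Delta n d M w powr real n"
  using Delta_lower[OF d, where ?'a = 'a] by blast
 obtain C where C: "C > 0" "!!(N::'a set) v j. minv n N v ==> j <= n ==> (\<Prod>i=1..j. norm (v i)) <= C * ldet (layer N v j)"
  using layer_det_ge[where ?'a = 'a] by blast
 define tht where "tht = b / real n"
 let ?x = "1 + abs (ln C) + 2 * real n / tht"
 have tht: "tht > 0" using b d by (simp add: tht_def)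
 define K where "K = ?x / c powr tht"
 have "1 + ln (max 1 (ldet M)) + abs (ln (ldet M)) <= K * Delta n d M w powr b" if w: "minv n M w" and w1: "norm (w 1) = 1" for M :: "'a set" and w
 proof -
  define La where "La = norm (w n)"
  have mono: "norm (w i) <= norm (w j)" if "1 <= i" "i <= j" "j <= n" for i j using w that by (simp add: minv_def)
  have La: "1 <= La" using mono[of 1 n] w1 d by (simp add: La_def)
  have dM: "ldet M > 0" using w det_pos by (auto simp: minv_def)
  have "ldet M <= (\<Prod>i=1..n. norm (w i))" using layer_det_le[OF w, of n] minv_layer_top[OF w] by simp
  also have "... <= (\<Prod>i=1..n. La)" unfolding La_def using mono by (intro prod_mono) auto
  finally have u: "ldet M <= La ^ n" by simp
  hence "ln (ldet M) <= real n * ln La" using dM La by (simp add: ln_realpow[symmetric])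
  moreover have "(\<Prod>i=1..n. 1) <= (\<Prod>i=1..n. norm (w i))" using mono[of 1] w1 by (intro prod_mono) auto
  hence "1 <= C * ldet M" using C(2)[OF w, of n] minv_layer_top[OF w] by simp
  hence "0 <= ln (C * ldet M)" by simp
  hence "- ln C <= ln (ldet M)" using C dM by (simp add: ln_mult)
  moreover have "ln (max 1 (ldet M)) <= real n * ln La" using calculation(1) La by (cases "ldet M <= 1") (auto simp: max_def)
  moreover have "0 <= real n * ln La" using La by simp
  ultimately have "1 + ln (max 1 (ldet M)) + abs (ln (ldet M)) <= 1 + abs (ln C) + 2 * (real n * ln La)" by linarith
  moreover have "ln La <= La powr tht / tht"
  proof -
   have "ln (La powr tht) <= La powr tht" using La by (intro ln_bound) auto
   thus ?thesis using La tht by (simp add: field_simps)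
  qed
  hence "real n * ln La <= real n * (La powr tht / tht)" by (intro mult_left_mono) auto
  moreover have "1 <= La powr tht" using La tht by (simp add: ge_one_powr_ge_zero)
  hence "(1 + abs (ln C)) * 1 <= (1 + abs (ln C)) * La powr tht" by (intro mult_left_mono) auto
  ultimately have "1 + ln (max 1 (ldet M)) + abs (ln (ldet M)) <= ?x * La powr tht" by (simp add: distrib_right)
  also have "... = K * (c * La) powr tht" using c(1) La by (simp add: K_def powr_mult)
  also have "(c * La) powr tht <= (Delta n d M w powr real n) powr tht" using c w w1 tht La by (intro powr_mono2) (auto simp: La_def)
  also have "(Delta n d M w powr real n) powr tht = Delta n d M w powr b" using d by (simp add: powr_powr tht_def)
  finally show ?thesis using c(1) tht by (simp add: K_def divide_right_mono mult_left_mono)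
 qed
 moreover have "K > 0" unfolding K_def using c tht by (intro divide_pos_pos add_pos_nonneg divide_nonneg_nonneg) auto
 ultimately show ?thesis by blast
qed

lemma flg_split:
 assumes M: "sep M" "dim (M::'a::euclidean_space set) = n" and J: "J1 <= prim d M" "J2 <= prim d M" "J1 Int J2 = {}" and e: "1 <= e" "e < d" "d < n" and H: "0 < H"
 shows "rcard (flg n e d (J1 Un J2) V W H) = rcard (flg n e d J1 V W H) + rcard (flg n e d J2 V W H)"
proof -
 obtain C where C: "!!J V W H R. J <= prim d M ==> 0 < H ==> C * H powr (1 / real (n - e)) <= R ==>
  rcard (flg n e d J V W H) = (SUM B:dlev J R. gcount e B (V B) (W B) ((H / ldet B ^ (n - e)) powr (1 / real d)))" using flg_sum[OF e M] by blast
 define R where "R = C * H powr (1 / real (n - e))"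
 have "latt M" using M by (simp add: sep_def)
 hence fin: "finite (dlev J R)" if "J <= prim d M" for J using that by (intro finite_subset[OF _ prim_finite[of M d R]]) auto
 have "(dlev (J1 Un J2) R) = (dlev J1 R) Un (dlev J2 R)" by auto
 thus ?thesis using C[of J1 H R] C[of J2 H R] C[of "J1 Un J2" H R] H J fin[OF J(1)] fin[OF J(2)] by (simp add: R_def) (subst sum.union_disjoint, auto)
qed

text \<open>For a fixed finite family the error is \<open>O(H powr (1 - ee))\<close>, eventually
  below any multiple of \<open>H\<close>. This disposes of those \<open>B\<close> for which the
  sharp averages are not yet valid.\<close>

lemma flg_low:
 assumes I: "Inner TYPE('a::euclidean_space) e d c C ee" and e: "1 <= e" "e < d" "d < n"
  and M: "sep M" "dim (M::'a set) = n" and J: "J <= prim d M" "finite J" and v: "!!B. B : J ==> minv d B (v B)" and W: "!!B. B : J ==> W B : prim (d - e) B"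
  and ep: "0 < ep"
 shows "\<forall>\<^sub>F H in at_top. abs (rcard (flg n e d J (%B. layer B (v B) (d - e)) W H) - c * H * (SUM B:J. ldet B powr (- real n))) <= ep * H"
proof -
 note lM = sep_latt[OF M(1)]
 have C: "0 < C" "0 < ee" "ee < 1" using I by (auto simp: Inner_def)
 have dB: "ldet B > 0" if "B : J" for B using J(1) that det_pos prim_latt[OF lM] by blast
 obtain C' where C': "!!J V W H R. J <= prim d M ==> 0 < H ==> C' * H powr (1 / real (n - e)) <= R ==>
  rcard (flg n e d J V W H) = (SUM B:dlev J R. gcount e B (V B) (W B) ((H / ldet B ^ (n - e)) powr (1 / real d)))" using flg_sum[OF e M] by blast
 define g where "g H B = gcount e B (layer B (v B) (d - e)) (W B) ((H / ldet B ^ (n - e)) powr (1 / real d))" for H and B :: "'a set"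
 define r where "r H B = C * (H / ldet B ^ n) powr (1 - ee) * wt d B / H" for H and B :: "'a set"
 have "((%H. r H B) \<longlongrightarrow> 0) at_top" if "B : J" for B
 proof -
  have "((%H. H powr (- ee)) \<longlongrightarrow> 0) at_top" using C(2) by (intro tendsto_neg_powr) (auto intro: filterlim_ident)
  hence "((%H. C * (1 / ldet B ^ n) powr (1 - ee) * wt d B * H powr (- ee)) \<longlongrightarrow> 0) at_top" by (rule tendsto_mult_right_zero)
  moreover have "\<forall>\<^sub>F H in at_top. C * (1 / ldet B ^ n) powr (1 - ee) * wt d B * H powr (- ee) = r H B" using eventually_gt_at_top[of 0]
  proof eventually_elim
   case (elim H)
   have "(H / ldet B ^ n) powr (1 - ee) = (1 / ldet B ^ n) powr (1 - ee) * H powr (- ee) * H" using elim dB[OF that] by (simp add: powr_divide powr_diff powr_minus_divide)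
   thus ?case using elim by (simp add: r_def)
  qed
  ultimately show ?thesis by (rule Lim_transform_eventually)
 qed
 hence "((%H. SUM B:J. r H B) \<longlongrightarrow> (SUM B:J. 0)) at_top" by (intro tendsto_sum) auto
 hence "\<forall>\<^sub>F H in at_top. (SUM B:J. r H B) < ep" using ep by (intro order_tendstoD(2)) auto
 moreover have "\<forall>\<^sub>F H in at_top. ALL B:J. ldet B ^ n <= H" using J(2) by (intro eventually_ball_finite) (auto intro: eventually_ge_at_top)
 ultimately show ?thesis using eventually_gt_at_top[of 0]
 proof eventually_elim
  case (elim H)
  define R where "R = max (C' * H powr (1 / real (n - e))) (Max (insert 0 (ldet ` J)))"
  have "(dlev J R) = J" using J(2) Max_ge[of "insert 0 (ldet ` J)"] by (auto simp: R_def le_max_iff_disj)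
  hence "rcard (flg n e d J (%B. layer B (v B) (d - e)) W H) = (SUM B:J. g H B)" using C'[OF J(1), of H R "%B. layer B (v B) (d - e)" W] elim(3) by (simp add: g_def R_def)
  moreover have "c * H * (SUM B:J. ldet B powr (- real n)) = (SUM B:J. c * (H / ldet B ^ n))"
   unfolding sum_distrib_left by (intro sum.cong refl) (use dB in \<open>auto simp: powr_minus_divide powr_realpow\<close>)
  ultimately have "abs (rcard (flg n e d J (%B. layer B (v B) (d - e)) W H) - c * H * (SUM B:J. ldet B powr (- real n))) = abs (SUM B:J. g H B - c * (H / ldet B ^ n))"
   by (simp only: sum_subtractf)
  also have "... <= (SUM B:J. H * r H B)"
  proof (rule order_trans[OF sum_abs], rule sum_mono)
   fix B assume B: "B : J"
   have "1 <= H / ldet B ^ n" using elim(2) B dB[OF B] by simp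
   thus "abs (g H B - c * (H / ldet B ^ n)) <= H * r H B" using Inner_gcount(1)[OF I e v[OF B] W[OF B] elim(3)] elim(3) by (simp add: g_def r_def)
  qed
  also have "... <= ep * H" using elim(1,3) by (simp add: sum_distrib_left[symmetric])
  finally show ?case .
 qed
qed

text \<open>The trace on the layer of rank \<open>n - e\<close> has its least possible rank
  \<open>d - e\<close>, complementary to the rank of \<open>A\<close> in \<open>B\<close>; so it can
  serve as the second forbidden sublattice in \<open>gcount\<close>.\<close>

definition good :: "nat => nat => nat => 'a::euclidean_space set => (nat => 'a) => 'a set set" where
 "good n e d M w = {B : prim d M. B Int layer M w (n - d) = {0} & dim (B Int layer M w (n - e)) = d - e}"

lemma not_good:
 assumes w: "minv n M w" and e: "e < d" "d < n" and B: "B : prim d M" "B ~: good n e d M w"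
 shows "B : nongen d M (layer M w (n - d)) | B : nongen d M (layer M w (n - e))"
proof (cases "B Int layer M w (n - d) = {0}")
 case False
 have M: "latt M" "dim M = n" using w by (auto simp: minv_def)
 have "latt (B Int layer M w (n - d))" "B Int layer M w (n - d) ~= {0}"  using prim_latt[OF M(1) prim_Int[OF B(1) minv_layer(1)[OF w]]] False by auto
 hence "0 < dim (B Int layer M w (n - d))" using latt_dim0 by blast
 thus ?thesis using nongenI[OF B(1) minv_layer(1)[OF w, of "n - d"], of 0] M e by simp
next
 case True
 have M: "latt M" "dim M = n" using w by (auto simp: minv_def)
 have "d + (n - e) <= n + dim (B Int layer M w (n - e))" using prim_inter_dim[OF M(1) B(1) minv_layer(1)[OF w, of "n - e"]] M by simp
 moreover have "dim (B Int layer M w (n - e)) ~= d - e" using True B by (auto simp: good_def)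
 ultimately show ?thesis using nongenI[OF B(1) minv_layer(1)[OF w, of "n - e"], of "d - e"] M e by simp
qed

text \<open>Up to \<open>D1\<close> only avoidance of the layer of rank \<open>n - d\<close> is
  used: \<open>minv_gcount_bound\<close> supplies the factor \<open>ldet M powr (- d)\<close> at the
  cost of a logarithm of \<open>D1\<close>. Beyond \<open>D1\<close> the asymptotics of rank
  \<open>d\<close> hold for all sublattices, and those that are not \<open>good\<close> are
  discarded by \<open>nongen_bound\<close>. \<open>D1\<close> is a power of
  \<open>max 1 (ldet M)\<close>, so the remaining logarithms are absorbed by
  \<open>Delta_log\<close>.\<close>

lemma thunder_det_sum:
 assumes F: "Fasymp TYPE('a::euclidean_space) n d c C dlt" and e: "e < d" "d < n" and b: "0 < b"
 shows "EX K>0. ALL (M::'a set) w. sep M --> minv n M w --> norm (w 1) = 1 --> (\<forall>\<^sub>F H in at_top.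
  abs ((SUM B:dlev (good n e d M w) (H powr (1 / real n)). ldet B powr (- real n)) - c * ldet M powr (- real d) * ln (H / ldet M ^ d))
   <= K * (ldet M powr (- real d) * Delta n d M w powr b))"
proof -
 let ?z = "real n - 1 / real d"
 have d: "1 <= d" "d <= n" using e by auto
 have C: "0 < C" "0 < dlt" using F by (auto simp: Fasymp_def)
 obtain C1 where C1: "C1 > 0" "!!(M::'a set) w W T. minv n M w ==> T > 0 ==>
  gcount d M (layer M w (n - d)) W T <= C1 * (T powr real n / ldet M powr real d)" using minv_gcount_bound[OF d(2), where ?'a = 'a] by blast
 obtain CN where CN: "CN > 0" "!!(M::'a set) W T. sep M ==> dim M = n ==> W <= span M ==> T > 0 ==>
  rcard (dlev (nongen d M W) T) <= CN * T powr ?z" using nongen_bound[OF d(2), where ?'a = 'a] by auto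
 obtain cd where cd: "cd > 0" "!!M::'a set. sep M ==> dim M = d ==> cd <= ldet M" using sep_det_lower by blast
 obtain KD where KD: "KD > 0" "!!(M::'a set) w. minv n M w ==> norm (w 1) = 1 ==> 1 + ln (max 1 (ldet M)) + abs (ln (ldet M)) <= KD * Delta n d M w powr b"
  using Delta_log[OF d(1) e(2) b, where ?'a = 'a] by blast
 define D0 where "D0 = min 1 (cd / 2)"
 have D0: "0 < D0" "D0 <= 1" "D0 < cd" using cd by (auto simp: D0_def)
 \<comment> \<open>Large enough for both savings, \<open>D1 powr (- dlt)\<close> and
   \<open>D1 powr (- 1 / d)\<close>, to be at most \<open>ldet M powr (- d)\<close>.\<close>
 define kp where "kp = max (real d / dlt) (real d * real d)"
 let ?y = "real n * kp + real d"
 let ?x = "1 + real n * kp + real n * abs (ln D0)"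
 have kp: "0 < kp" "real d <= kp * dlt" "real d <= kp * (1 / real d)" using d C by (auto simp: kp_def pos_divide_le_eq[symmetric] pos_le_divide_eq less_max_iff_disj)
 define KN where "KN = (1 + real n * real d) * (2 * CN)"
 define KF where "KF = (2 + real n / dlt) * C"
 define K where "K = C1 * ?x + KN + KF + abs c * ?y"
 have KK: "0 < KN" "0 < KF" using CN C d by (auto simp: KN_def KF_def intro!: mult_pos_pos add_pos_nonneg)
 have K: "K > 0" unfolding K_def using C1 KK kp by (intro add_pos_nonneg add_pos_pos mult_pos_pos mult_nonneg_nonneg add_nonneg_nonneg) auto
 have "\<forall>\<^sub>F H in at_top. abs ((SUM B:dlev (good n e d M w) (H powr (1 / real n)). ldet B powr (- real n)) - c * ldet M powr (- real d) * ln (H / ldet M ^ d))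
   <= K * KD * (ldet M powr (- real d) * Delta n d M w powr b)" if M: "sep M" and w: "minv n M w" and w1: "norm (w 1) = 1" for M :: "'a set" and w
 proof -
  have lM: "latt M" "dim M = n" using w by (auto simp: minv_def)
  define G where "G = good n e d M w"
  define x where "x = ldet M powr (- real d)"
  define E where "E = max 1 (ldet M)"
  define D1 where "D1 = E powr kp"
  let ?a = "1 + real n * ln (D1 / D0)"
  define S where "S J = (SUM B:J. ldet B powr (- real n))" for J :: "'a set set"
  have dM: "ldet M > 0" by (rule det_pos[OF lM(1)])
  have x: "x > 0" using dM by (simp add: x_def)
  have E: "1 <= E" "ldet M <= E" by (auto simp: E_def)
  have D1: "1 <= D1" "0 < D1" "D0 <= D1" "0 < D1 / D0" using E kp D0 ge_one_powr_ge_zero[of E kp] by (auto simp: D1_def)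
  have Ed: "D1 powr (- q) <= x" if "real d <= kp * q" for q
  proof -
   have "D1 powr (- q) <= E powr (- real d)" unfolding D1_def powr_powr using that E by (intro powr_mono) auto
   also have "... <= x" unfolding x_def using E dM by (intro powr_mono2') auto
   finally show ?thesis .
  qed
  have fin: "finite (dlev J R)" if "J <= prim d M" for J R using that by (intro fin_prim[OF lM(1), of _ d R]) auto
  have G: "G <= prim d M" by (auto simp: G_def good_def)
  have low: "S (dlev G D1) <= C1 * x * ?a"
  proof -
   define J where "J = {B : prim d M. B Int layer M w (n - d) = {0}}"
   have "S (dlev G D1) <= (SUM B:dlay J D0 D1. 1 * ldet B powr (- real n))" unfolding S_def mult_1
   proof (rule sum_mono2)
    show "finite (dlay J D0 D1)" by (rule finite_subset[OF _ fin[of J D1]]) (auto simp: J_def)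
    show "(dlev G D1) <= (dlay J D0 D1)" using cd(2)[OF sep_prim[OF M] primD(2)] D0 by (fastforce simp: J_def G_def good_def)
   qed auto
   also have "... <= C1 * x * ?a"
   proof (intro abel_log_upper fin)
    fix r assume "D0 <= r"
    hence r: "r > 0" using D0 by simp
    have "csum J ldet (%_. 1) r = gcount d M (layer M w (n - d)) (layer M w (n - d)) r" unfolding csum_const gcount_def by (simp add: J_def conj_assoc)
    also have "... <= C1 * x * r powr real n" using C1(2)[OF w r] by (simp add: x_def powr_minus_divide)
    finally show "csum J ldet (%_. 1) r <= C1 * x * r powr real n" .
   qed (use C1 x D0 D1 in \<open>auto simp: J_def\<close>)
   finally show ?thesis .
  qed
  define Z where "Z = prim d M - G"
  have Z: "S (dlay Z D1 R) <= KN * x" if R: "D1 <= R" for R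
  proof -
   have dd: "real n - 1 / real d < real n" "0 <= real n - 1 / real d" "real n - ?z = 1 / real d"
   proof -
    have "1 / real d <= 1" "0 < 1 / real d" "1 <= real n" using d by auto
    thus "real n - 1 / real d < real n" "0 <= real n - 1 / real d" "real n - ?z = 1 / real d" by linarith+
   qed
   have "S (dlay Z D1 R) = (SUM B:dlay Z D1 R. 1 * ldet B powr (- real n))" by (simp add: S_def)
   also have "... <= (1 + real n / (real n - ?z)) * (2 * CN * D1 powr (?z - real n))"
   proof (intro abel_tail fin)
    fix r assume "D1 <= r"
    hence r: "r > 0" using D1 by simp
    let ?N = "%j. (dlev (nongen d M (layer M w j)) r)"
    have sp: "layer M w j <= span M" for j using span_superset[of M] by (auto simp: layer_def)
    have f: "finite (?N j)" for j by (intro fin) (auto simp: nongen_def)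
    have "card (dlev Z r) <= card (?N (n - d) Un ?N (n - e))" using not_good[OF w e] f by (intro card_mono) (auto simp: Z_def G_def)
    also have "... <= card (?N (n - d)) + card (?N (n - e))" by (rule card_Un_le)
    finally show "csum Z ldet (%_. 1) r <= 2 * CN * r powr ?z" unfolding csum_const using CN(2)[OF M lM(2) sp r, of "n - d"] CN(2)[OF M lM(2) sp r, of "n - e"] by linarith
   qed (use CN d dd D1 R in \<open>auto simp: Z_def\<close>)
   also have "... = KN * D1 powr (- (1 / real d))" unfolding dd(3) using d by (simp add: KN_def)
   also have "... <= KN * x" using KK Ed[OF kp(3)] by (intro mult_left_mono) auto
   finally show ?thesis .
  qed
  show ?thesis using eventually_ge_at_top[of "max 1 (D1 powr real n)"]
  proof eventually_elim
   case (elim H)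
   hence H: "1 <= H" "D1 powr real n <= H" by auto
   define R where "R = H powr (1 / real n)"
   have "(D1 powr real n) powr (1 / real n) <= R" unfolding R_def using H by (intro powr_mono2) auto
   hence R: "D1 <= R" "R > 0" using d D1 e by (auto simp: powr_powr)
   have lnR: "ln R = ln H / real n" using H by (simp add: R_def)
   define A where "A = (dlay (prim d M) D1 R)"
   have all: "abs (S A - c * x * real n * ln (R / D1)) <= KF * x"
   proof -
    have "abs (S A - c * x * real n * ln (R / D1)) <= (2 + real n / dlt) * (C * D1 powr (-dlt))"
     unfolding S_def A_def x_def by (rule det_sum_log[OF F d(1) e(2) M lM(2) D1(2) R(1)])
    also have "... = KF * D1 powr (-dlt)" by (simp add: KF_def)
    also have "... <= KF * x" using KK Ed[OF kp(2)] by (intro mult_left_mono) auto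
    finally show ?thesis .
   qed
   have fA: "finite (dlay J D1 R)" if "J <= prim d M" for J by (rule finite_subset[OF _ fin[OF that, of R]]) auto
   have "(dlev G R) = (dlev G D1) Un (dlay G D1 R)" using R by auto
   hence s1: "S (dlev G R) = S (dlev G D1) + S (dlay G D1 R)" unfolding S_def using fin[OF G, of D1] fA[OF G] by (subst sum.union_disjoint[symmetric]) auto
   have "A = (dlay G D1 R) Un (dlay Z D1 R)" using G by (auto simp: A_def Z_def)
   hence s2: "S A = S (dlay G D1 R) + S (dlay Z D1 R)" unfolding S_def using fA[OF G] fA[of Z] by (subst sum.union_disjoint[symmetric]) (auto simp: Z_def)
   have pos: "0 <= S J" for J unfolding S_def by (intro sum_nonneg) auto
   have lD: "ln (D1 / D0) = kp * ln E - ln D0" using D0 E by (simp add: D1_def ln_div)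
   have lR: "real n * ln (R / D1) = ln H - real n * (kp * ln E)" using R E d e by (simp add: D1_def ln_div lnR right_diff_distrib)
   have lH: "ln (H / ldet M ^ d) = ln H - real d * ln (ldet M)" using H dM by (simp add: ln_div ln_realpow)
   define Y where "Y = 1 + ln E + abs (ln (ldet M))"
   have E0: "0 <= ln E" using E by simp
   have "1 + real n * ln (D1 / D0) <= ?x * Y"
   proof -
    have "1 + real n * (kp * ln E - ln D0) <= 1 + real n * (kp * ln E) + real n * abs (ln D0)"
     using mult_left_mono[of "- ln D0" "abs (ln D0)" "real n"] by (simp add: right_diff_distrib)
    also have "... <= 1 * Y + (real n * kp) * Y + (real n * abs (ln D0)) * Y"
    proof -
     have "ln E <= Y" "1 <= Y" using E0 by (auto simp: Y_def)
     thus ?thesis using kp(1) mult_left_mono[of "ln E" Y "real n * kp"] mult_left_mono[of 1 Y "real n * abs (ln D0)"] by simp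
    qed
    finally show ?thesis unfolding lD by (simp add: distrib_right)
   qed
   hence "C1 * x * ?a <= C1 * x * (?x * Y)" using C1 x by (intro mult_left_mono) auto
   hence b1: "S (dlev G D1) <= C1 * x * (?x * Y)" using low by linarith
   have "1 <= Y" using E0 by (simp add: Y_def)
   hence b2: "KN * x <= KN * x * Y" "KF * x <= KF * x * Y" using KK x mult_left_mono[of 1 Y "KN * x"] mult_left_mono[of 1 Y "KF * x"] by auto
   have b3: "abs (c * x * real n * ln (R / D1) - c * x * ln (H / ldet M ^ d)) <= abs c * x * (?y * Y)"
   proof -
    have "c * x * real n * ln (R / D1) - c * x * ln (H / ldet M ^ d) = c * x * (real d * ln (ldet M) - real n * (kp * ln E))" unfolding lH mult.assoc lR by (simp add: algebra_simps)
    hence "abs (c * x * real n * ln (R / D1) - c * x * ln (H / ldet M ^ d)) = abs c * x * abs (real d * ln (ldet M) - real n * (kp * ln E))"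
     using x by (simp add: abs_mult)
    also have "... <= abs c * x * (?y * Y)"
    proof (rule mult_left_mono)
     have "abs (real d * ln (ldet M)) <= real d * Y" "real n * kp * ln E <= real n * kp * Y" "0 <= real n * kp * ln E"
      unfolding abs_mult using E0 kp(1) by (auto simp: Y_def intro!: mult_left_mono)
     thus "abs (real d * ln (ldet M) - real n * (kp * ln E)) <= ?y * Y" by (simp add: distrib_right mult.assoc)
    qed (use x in auto)
    finally show ?thesis .
   qed
   have "abs (S (dlev G R) - c * x * ln (H / ldet M ^ d)) <= C1 * x * (?x * Y) + KN * x * Y + KF * x * Y + abs c * x * (?y * Y)"
    using b1 b2 b3 all Z[OF R(1)] s1 s2 pos[of "(dlev G D1)"] pos[of "(dlay Z D1 R)"] by linarith
   also have "... = K * x * Y"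
   proof -
    have "C1 * x * (u * Y) + KN * x * Y + KF * x * Y + abs c * x * (v * Y) = (C1 * u + KN + KF + abs c * v) * x * Y" for u v by (simp add: algebra_simps)
    thus ?thesis unfolding K_def .
   qed
   also have "... <= K * x * (KD * Delta n d M w powr b)" using KD(2)[OF w w1] K x unfolding Y_def E_def by (intro mult_left_mono) auto
   finally show ?case by (simp only: S_def G_def R_def x_def mult_ac)
  qed
 qed
 moreover have "K * KD > 0" using K KD by simp
 ultimately show ?thesis by blast
qed

text \<open>The sharp average holds only beyond some \<open>T1\<close> depending on
  \<open>M\<close>. The finitely many \<open>B\<close> up to \<open>T1\<close> are left to
  \<open>flg_low\<close>, the others to \<open>flg_det_sum\<close>.\<close>

lemma thunder_sep:
 assumes I: "Inner TYPE('a::euclidean_space) e d c C ee" and F: "Fasymp TYPE('a) n d c' C' dlt" and e: "1 <= e" "e < d" "d < n" and b: "0 < b"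
 shows "EX K>0. ALL (M::'a set) v w. sep M --> minv n M w --> norm (w 1) = 1 --> (ALL B:prim d M. minv d B (v B)) --> (\<forall>\<^sub>F H in at_top.
  abs (rcard (flg n e d (good n e d M w) (%B. layer B (v B) (d - e)) (%B. B Int layer M w (n - e)) H) - c * c' * ldet M powr (- real d) * H * ln (H / ldet M ^ d))
   <= K * (ldet M powr (- real d) * Delta n d M w powr b) * H)"
proof -
 have C: "0 < C" "0 < ee" "ee < 1" using I by (auto simp: Inner_def)
 have d: "1 <= d" "2 <= d" "d <= n" using e by auto
 obtain K1 where K1: "K1 > 0" "!!(M::'a set) w. sep M ==> minv n M w ==> norm (w 1) = 1 ==> (\<forall>\<^sub>F H in at_top.
  abs ((SUM B:dlev (good n e d M w) (H powr (1 / real n)). ldet B powr (- real n)) - c' * ldet M powr (- real d) * ln (H / ldet M ^ d))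
   <= K1 * (ldet M powr (- real d) * Delta n d M w powr b))" using thunder_det_sum[OF F e(2,3) b] by blast
 obtain K2 where K2: "K2 > 0" "!!M::'a set. sep M ==> dim M = n ==>
  (\<forall>\<^sub>F T in at_top. csum (prim d M) ldet (wt d) T <= K2 * ldet M powr (- real d) * T powr real n)" using wt_bound_det[OF d(2,3), where ?'a = 'a] by blast
 obtain KD where KD: "KD > 0" "!!(M::'a set) w. minv n M w ==> norm (w 1) = 1 ==> 1 + ln (max 1 (ldet M)) + abs (ln (ldet M)) <= KD * Delta n d M w powr b"
  using Delta_log[OF d(1) e(3) b, where ?'a = 'a] by blast
 define K3 where "K3 = 1 + (2 + 2 / ee) * C * K2"
 have K3: "K3 > 0" using C K2 by (auto simp: K3_def intro!: add_pos_nonneg)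
 have "\<forall>\<^sub>F H in at_top.
  abs (rcard (flg n e d (good n e d M w) (%B. layer B (v B) (d - e)) (%B. B Int layer M w (n - e)) H) - c * c' * ldet M powr (- real d) * H * ln (H / ldet M ^ d))
   <= (K3 * KD + abs c * K1) * (ldet M powr (- real d) * Delta n d M w powr b) * H"
  if M: "sep M" and w: "minv n M w" and w1: "norm (w 1) = 1" and v: "ALL B:prim d M. minv d B (v B)" for M :: "'a set" and v w
 proof -
  have lM: "latt M" "dim M = n" using w by (auto simp: minv_def)
  define G where "G = good n e d M w"
  define x where "x = ldet M powr (- real d)"
  define y where "y = Delta n d M w powr b"
  have x: "x > 0" using det_pos[OF lM(1)] by (simp add: x_def)
  have "0 <= ln (max 1 (ldet M))" by simp
  hence y: "1 <= KD * y" using KD(2)[OF w w1] unfolding y_def by linarith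
  obtain T1 where T1: "!!T. T1 <= T ==> csum (prim d M) ldet (wt d) T <= K2 * x * T powr real n" using K2(2)[OF M lM(2)] unfolding eventually_at_top_linorder x_def by blast
  define J1 where "J1 = (dlev G T1)"
  define J2 where "J2 = {B : G. T1 < ldet B}"
  have G: "G <= prim d M" by (auto simp: G_def good_def)
  have J: "J1 <= prim d M" "J2 <= prim d M" "J1 Int J2 = {}" "G = J1 Un J2" "J1 <= G" "J2 <= G" using G by (auto simp: J1_def J2_def)
  have fin: "finite (dlev J R)" if "J <= prim d M" for J R using that by (intro fin_prim[OF lM(1), of _ d R]) auto
  have W: "B Int layer M w (n - e) : prim (d - e) B" if "B : G" for B
  proof -
   have B: "B : prim d M" "dim (B Int layer M w (n - e)) = d - e" using that by (auto simp: G_def good_def)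
   have "B Int layer M w (n - e) : prim (d - e) M" using prim_Int[OF B(1) minv_layer(1)[OF w, of "n - e"]] B(2) by simp
   thus ?thesis by (rule prim_down) (use primD(3)[OF B(1)] in auto)
  qed
  have vG: "minv d B (v B)" if "B : G" for B using v G that by blast
  have S2: "csum J2 ldet (wt d) r <= K2 * x * r powr real n" if "0 < r" for r
  proof (cases "T1 < r")
   case True
   have "csum J2 ldet (wt d) r <= csum (prim d M) ldet (wt d) r" unfolding csum_def using J(2) wt_nonneg[OF prim_latt[OF lM(1)] primD(2) d(1)] fin[OF order_refl] by (intro sum_mono2) auto
   thus ?thesis using T1[of r] True by linarith
  next
   case False
   hence e: "(dlev J2 r) = {}" by (auto simp: J2_def)
   show ?thesis unfolding csum_def e using K2 x by simp
  qed
  define S where "S J = (SUM B:J. ldet B powr (- real n))" for J :: "'a set set"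
  define N where "N J H = rcard (flg n e d J (%B. layer B (v B) (d - e)) (%B. B Int layer M w (n - e)) H)" for J H
  have "finite J1" using fin[OF G, of T1] by (simp add: J1_def)
  hence "\<forall>\<^sub>F H in at_top. abs (N J1 H - c * H * S J1) <= x * H" unfolding N_def S_def using J W vG x by (intro flg_low[OF I e M lM(2)]) auto
  thus ?thesis using K1(2)[OF M w w1] eventually_ge_at_top[of "max 1 (abs T1 powr real n)"]
  proof eventually_elim
   case (elim H)
   hence H: "1 <= H" "abs T1 powr real n <= H" by auto
   define R where "R = H powr (1 / real n)"
   have "(abs T1 powr real n) powr (1 / real n) <= R" unfolding R_def using H by (intro powr_mono2) auto
   hence R: "T1 <= R" using e by (simp add: powr_powr)
   have 1: "abs (N J2 H - c * H * S (dlev J2 R)) <= (2 + 2 / ee) * C * (K2 * x) * H" unfolding N_def S_def R_def using J W vG S2 K2 x H by (intro flg_det_sum[OF I e M lM(2)]) auto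
   have 2: "N G H = N J1 H + N J2 H" unfolding N_def J(4) using H by (intro flg_split[OF M lM(2) J(1-3) e]) auto
   have "(dlev G R) = J1 Un (dlev J2 R)" using R by (auto simp: J1_def J2_def)
   hence 3: "S (dlev G R) = S J1 + S (dlev J2 R)" unfolding S_def using \<open>finite J1\<close> fin[OF J(2), of R] J(3) by (subst sum.union_disjoint[symmetric]) auto
   have 4: "abs (N G H - c * H * S (dlev G R)) <= x * H + (2 + 2 / ee) * C * (K2 * x) * H" using elim(1) 1 unfolding 2 3 distrib_left by linarith
   have 5: "abs (c * H * S (dlev G R) - c * H * (c' * x * ln (H / ldet M ^ d))) <= abs c * H * (K1 * (x * y))"
   proof -
    have "abs (S (dlev G R) - c' * x * ln (H / ldet M ^ d)) <= K1 * (x * y)" using elim(2) by (simp only: S_def G_def R_def x_def y_def)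
    thus ?thesis using H unfolding right_diff_distrib[symmetric] abs_mult by (intro mult_mono) auto
   qed
   have "x * H + (2 + 2 / ee) * C * (K2 * x) * H = K3 * x * H" by (simp add: K3_def algebra_simps)
   also have "... <= K3 * x * H * (KD * y)" using mult_left_mono[OF y, of "K3 * x * H"] K3 x H by simp
   finally have "abs (N G H - c * H * (c' * x * ln (H / ldet M ^ d))) <= K3 * x * H * (KD * y) + abs c * H * (K1 * (x * y))" using 4 5 by linarith
   also have "... = (K3 * KD + abs c * K1) * (x * y) * H" by (simp add: algebra_simps)
   also have "c * H * (c' * x * ln (H / ldet M ^ d)) = c * c' * x * H * ln (H / ldet M ^ d)" by simp
   finally show ?case by (simp only: N_def G_def x_def y_def)
  qed
 qed
 moreover have "K3 * KD + abs c * K1 > 0" using K3 KD K1 by (intro add_pos_nonneg) auto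
 ultimately show ?thesis by blast
qed

section \<open>Rescaling to arbitrary lattices\<close>

lemma minv_chosen: "latt L ==> minv (dim L) L (chosen_minimal_vectors L)"
 unfolding chosen_minimal_vectors_def using minimal_vectors_minv[OF _ someI_ex[OF minimal_vectors_exist]] by blast

lemma minimal_sublattice_layer: "minimal_sublattice L i = layer L (chosen_minimal_vectors L) i" by (simp add: minimal_sublattice_def layer_def)

lemma counted_flags_flg:
 assumes L: "latt L" "dim L = n"
 shows "counted_flags e d L H = flg n e d (prim d L) (%B. minimal_sublattice B (d - e)) (%B. minimal_sublattice B (d - e)) H"
proof -
 have "(A, B) : flags e d L \<longleftrightarrow> B : prim d L & A : prim e B" for A B
 proof
  assume "(A, B) : flags e d L"
  hence "A : prim e L" "B : prim d L" "A <= B" using primitive_sublattice_iff[OF L(1)] by (auto simp: flags_def)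
  thus "B : prim d L & A : prim e B" using prim_down primD(3) by blast
 next
  assume a: "B : prim d L & A : prim e B"
  hence "A : prim e L" "A <= B" using prim_trans primD(3) by blast+
  thus "(A, B) : flags e d L" using a primitive_sublattice_iff[OF L(1)] unfolding flags_def by blast
 qed
 moreover have "twisted_height L (A, B) = ldet A ^ d * ldet B ^ (n - e)" if "B : prim d L & A : prim e B" for A B using that primD(2)[of A e B] primD(2)[of B d L] L(2) by simp
 ultimately show ?thesis unfolding counted_flags_def flg_def by auto
qed

text \<open>For \<open>A\<close> inside \<open>B\<close>, avoiding the layer of rank
  \<open>n - e\<close> means avoiding its trace on \<open>B\<close>. If this holds, the trace has
  rank at most \<open>d - e\<close>, and \<open>prim_inter_dim\<close> gives at least
  \<open>d - e\<close>.\<close>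

lemma thunder_flags_flg:
 assumes L: "latt L" "dim L = n" and e: "e < d" "d < n"
 shows "thunder_flags e d L H = flg n e d (good n e d L (chosen_minimal_vectors L)) (%B. minimal_sublattice B (d - e)) (%B. B Int minimal_sublattice L (n - e)) H"
proof -
 let ?w = "chosen_minimal_vectors L"
 have w: "minv n L ?w" using minv_chosen L by blast
 have *: "A Int layer L ?w (n - e) = {0} & B Int layer L ?w (n - d) = {0} \<longleftrightarrow> B : good n e d L ?w & A Int (B Int layer L ?w (n - e)) = {0}"
  if B: "B : prim d L" and A: "A : prim e B" for A B
 proof -
  have eq: "A Int (B Int layer L ?w (n - e)) = A Int layer L ?w (n - e)" using primD(3)[OF A] by auto
  have lB: "latt B" "dim B = d" using prim_latt[OF L(1) B] primD(2)[OF B] by auto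
  have "dim (B Int layer L ?w (n - e)) = d - e" if a: "A Int layer L ?w (n - e) = {0}"
  proof -
   have "B Int layer L ?w (n - e) : prim (dim (B Int layer L ?w (n - e))) B" by (rule prim_down[OF prim_Int[OF B minv_layer(1)[OF w]]]) (use primD(3)[OF B] in auto)
   from prim_inter_dim[OF lB(1) A this] have "e + dim (B Int layer L ?w (n - e)) <= d" unfolding eq a lB(2) by simp
   moreover have "d + (n - e) <= n + dim (B Int layer L ?w (n - e))" using prim_inter_dim[OF L(1) B minv_layer(1)[OF w, of "n - e"]] L(2) by simp
   ultimately show ?thesis using e by linarith
  qed
  thus ?thesis unfolding good_def eq using B by blast
 qed
 have "(A, B) : thunder_flags e d L H \<longleftrightarrow> (A, B) : flg n e d (good n e d L ?w) (%B. minimal_sublattice B (d - e)) (%B. B Int minimal_sublattice L (n - e)) H" for A B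
 proof (cases "B : prim d L & A : prim e B")
  case True
  have "((b & a & v & v & h) & p & q) = (g & a & v & r & h)" if "(p & q) = (g & r)" "b" "a" for a b p q g r v h using that by blast
  from this[OF * conjunct1[OF True] conjunct2[OF True]] True show ?thesis
   unfolding thunder_flags_def counted_flags_flg[OF L] L(2) flg_def minimal_sublattice_layer mem_Collect_eq case_prod_conv by simp
 next
  case False
  thus ?thesis unfolding thunder_flags_def counted_flags_flg[OF L] flg_def good_def by blast
 qed
 thus ?thesis by auto
qed

lemma layer_sc:
 assumes a: "a > 0" shows "layer (sc a (M::'a::euclidean_space set)) (%i. a *\<^sub>R v i) j = sc a (layer M v j)"
proof -
 have "(%i. a *\<^sub>R v i) ` {1..j} = sc a (v ` {1..j})" by (auto simp: sc_def)
 hence "span ((%i. a *\<^sub>R v i) ` {1..j}) = span (v ` {1..j})" using span_sc[OF a] by metis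
 moreover have "x : span S \<longleftrightarrow> (1 / a) *\<^sub>R x : span S" for x and S :: "'a set" using span_scale[of x S "1 / a"] span_scale[of "(1 / a) *\<^sub>R x" S a] a by auto
 ultimately show ?thesis by (auto simp: layer_def sc_iff[OF a])
qed

lemma minv_sc:
 assumes a: "a > 0" and v: "minv m M v" shows "minv m (sc a (M::'a::euclidean_space set)) (%i. a *\<^sub>R v i)"
proof -
 have inj: "inj_on v {1..m}" and ind: "independent (v ` {1..m})" using v by (auto simp: minv_def)
 have inj': "inj_on (%i. a *\<^sub>R v i) {1..m}" by (rule inj_onI) (use a in \<open>auto dest: inj_onD[OF inj]\<close>)
 have "linear (%x::'a. a *\<^sub>R x)" by (intro linearI) (auto simp: scaleR_add_right)
 moreover have "inj_on (%x::'a. a *\<^sub>R x) X" for X using a by (auto simp: inj_on_def)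
 ultimately have "independent ((%x::'a. a *\<^sub>R x) ` v ` {1..m})" using ind by (intro linear_independent_injective_image)
 hence "independent ((%i. a *\<^sub>R v i) ` {1..m})" unfolding image_image .
 moreover have "dim (sc a M Int cball 0 r) < i" if i: "i : {1..m}" and r: "r < norm (a *\<^sub>R v i)" for i r
 proof -
  have "sc a M Int cball 0 r = sc a (M Int cball 0 (r / a))" using a by (auto simp: sc_iff divide_le_cancel)
  moreover have "r / a < norm (v i)" using r a by (simp add: pos_divide_less_eq mult.commute)
  ultimately show ?thesis using v i by (simp add: minv_def dim_sc[OF a])
 qed
 ultimately show ?thesis using v inj' a latt_sc[OF a] dim_sc[OF a, of M] unfolding minv_def by (auto simp: sc_def)
qed

text \<open>The height of every flag scales by \<open>a ^ (n * d)\<close>, because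
  \<open>e * d + d * (n - e) = n * d\<close>.\<close>

lemma flg_sc:
 assumes a: "a > 0" and L: "latt L" and J: "J <= prim d L" and e: "e <= n"
  and VW: "!!B. B : J ==> V' (sc a B) = sc a (V B)" "!!B. B : J ==> W' (sc a B) = sc a (W B)"
 shows "card (flg n e d (sc a ` J) V' W' (a ^ (n * d) * H)) = card (flg n e d J V W H)"
proof -
 let ?f = "%(A, B). (sc a A, sc a B)"
 have *: "(sc a A, sc a B) : flg n e d (sc a ` J) V' W' (a ^ (n * d) * H) \<longleftrightarrow> (A, B) : flg n e d J V W H" if B: "B : J" for A B
 proof -
  have lB: "latt B" "dim B = d" using B J prim_latt[OF L] primD(2) by blast+
  have bij: "sc a A : prim e (sc a B) \<longleftrightarrow> A : prim e B" using prim_sc_bij[OF a, of e B] sc_inverse[OF a] by (metis (no_types, lifting) bij_betw_imp_surj_on image_iff)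
  have "ldet (sc a A) ^ d * ldet (sc a B) ^ (n - e) = a ^ (n * d) * (ldet A ^ d * ldet B ^ (n - e))" if A: "A : prim e B"
  proof -
   have "n * d = e * d + d * (n - e)" using e by (simp add: mult.commute[of d] distrib_right[symmetric])
   thus ?thesis using det_sc[OF a lB(1)] det_sc[OF a prim_latt[OF lB(1) A]] primD(2)[OF A] lB(2) by (simp add: power_mult_distrib power_add power_mult)
  qed
  thus ?thesis using B bij VW a by (auto simp: flg_def sc_Int_zero)
 qed
 have "flg n e d (sc a ` J) V' W' (a ^ (n * d) * H) = ?f ` flg n e d J V W H"
 proof (intro equalityI subsetI)
  fix x assume x: "x : flg n e d (sc a ` J) V' W' (a ^ (n * d) * H)"
  then obtain A B where AB: "x = (A, sc a B)" "B : J" by (auto simp: flg_def)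
  have "(sc a (sc (1 / a) A), sc a B) : flg n e d (sc a ` J) V' W' (a ^ (n * d) * H)" unfolding sc_inverse'[OF a] using x AB(1) by simp
  hence "(sc (1 / a) A, B) : flg n e d J V W H" using *[OF AB(2)] by blast
  hence "?f (sc (1 / a) A, B) : ?f ` flg n e d J V W H" by (rule imageI)
  thus "x : ?f ` flg n e d J V W H" unfolding AB(1) prod.case sc_inverse'[OF a] .
 next
  fix x assume "x : ?f ` flg n e d J V W H"
  then obtain A B where "x = (sc a A, sc a B)" "(A, B) : flg n e d J V W H" by auto
  thus "x : flg n e d (sc a ` J) V' W' (a ^ (n * d) * H)" using * by (auto simp: flg_def)
 qed
 moreover have "inj_on ?f (flg n e d J V W H)" by (rule inj_on_inverseI[where g = "%(A, B). (sc (1 / a) A, sc (1 / a) B)"]) (auto simp: sc_inverse[OF a])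
 ultimately show ?thesis by (simp add: card_image)
qed

lemma sc_Int: "a > 0 ==> sc a B Int sc a V = sc a (B Int V)" by (auto simp: sc_def)

lemma good_sc:
 assumes a: "a > 0" shows "good n e d (sc a M) (%i. a *\<^sub>R w i) = sc a ` good n e d M w"
proof -
 have "B : good n e d M w \<longleftrightarrow> sc a B : good n e d (sc a M) (%i. a *\<^sub>R w i)" if "B : prim d M" for B
 proof -
  have "sc a B : prim d (sc a M)" using prim_sc_bij[OF a] that by (auto simp: bij_betw_def)
  thus ?thesis using that unfolding good_def mem_Collect_eq layer_sc[OF a] sc_Int_zero[OF a] unfolding sc_Int[OF a] dim_sc[OF a] by simp
 qed
 moreover have "prim d (sc a M) = sc a ` prim d M" using prim_sc_bij[OF a] by (auto simp: bij_betw_def)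
 ultimately show ?thesis by (auto simp: good_def[of n e d "sc a M"] image_iff) (auto simp: good_def)
qed

lemma minv_norm_le:
 assumes v: "minv m M v" and x: "x : M" "x ~= 0" and m: "1 <= m" shows "norm (v 1) <= norm x"
proof (rule ccontr)
 assume "~ norm (v 1) <= norm x"
 moreover have "ALL i:{1..m}. ALL r<norm (v i). dim (M Int cball 0 r) < i" using v by (simp add: minv_def)
 ultimately have "dim (M Int cball 0 (norm x)) < 1" using m by (meson atLeastAtMost_iff not_le order_refl)
 thus False using x by auto
qed

text \<open>The vectors fixed for \<open>sc a B\<close> need not be the scaled vectors fixed for
  \<open>B\<close>, as both are arbitrary choices. The family \<open>v\<close> on the scaled lattice
  is therefore transported from the original one; for this reason the counts above allow any minimal
  vectors.\<close>

lemma normalised: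
 assumes L: "latt L" "dim L = n" and n: "1 <= n"
 defines "w == chosen_minimal_vectors L"
 defines "a == 1 / norm (w 1)"
 defines "v == %B i. a *\<^sub>R chosen_minimal_vectors (sc (1 / a) B) i"
 shows "minv n L w" "a > 0" "sep (sc a L)" "minv n (sc a L) (%i. a *\<^sub>R w i)" "norm (a *\<^sub>R w 1) = 1"
  "B : prim d (sc a L) ==> minv d B (v B)" "layer (sc a B) (v (sc a B)) j = sc a (minimal_sublattice B j)"
proof -
 show w: "minv n L w" using minv_chosen[OF L(1)] L(2) by (simp add: w_def)
 have p: "norm (w 1) > 0" using minv_norm_pos[OF w, of 1] n by simp
 thus a: "a > 0" by (simp add: a_def)
 show "sep (sc a L)" unfolding a_def using minv_norm_le[OF w _ _ n] by (intro sep_sc[OF p L(1)])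
 show "minv n (sc a L) (%i. a *\<^sub>R w i)" by (rule minv_sc[OF a w])
 show "norm (a *\<^sub>R w 1) = 1" using p by (simp add: a_def)
 show "minv d B (v B)" if B: "B : prim d (sc a L)" for B
 proof -
  have "latt B" using prim_latt[OF latt_sc[OF a L(1)] B] .
  hence "latt (sc (1 / a) B)" using a by (intro latt_sc) auto
  from minv_sc[OF a minv_chosen[OF this]] show ?thesis using a dim_sc[of "1 / a" B] primD(2)[OF B] by (simp add: v_def sc_inverse'[OF a])
 qed
 show "layer (sc a B) (v (sc a B)) j = sc a (minimal_sublattice B j)" for B unfolding v_def sc_inverse[OF a] layer_sc[OF a] minimal_sublattice_layer ..
qed

section \<open>Minimal determinants and the final estimates\<close>

lemma min_det_bounds:
 assumes i: "i <= n" and n: "1 <= n"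
 shows "EX c>0. EX C>0. ALL (L::'a::euclidean_space set) w. minv n L w --> (let m = min_det i L / norm (w 1) ^ i in c <= m & m <= C * (ldet L / norm (w 1) ^ n))"
proof -
 obtain c where c: "c > 0" "!!M::'a set. sep M ==> dim M = i ==> c <= ldet M" using sep_det_lower by blast
 obtain C where C: "C > 0" "!!(N::'a set) v j. minv n N v ==> j <= n ==> (\<Prod>i=1..j. norm (v i)) <= C * ldet (layer N v j)"
  using layer_det_ge[where ?'a = 'a] by blast
 have "c <= min_det i L / norm (w 1) ^ i & min_det i L / norm (w 1) ^ i <= C * (ldet L / norm (w 1) ^ n)" if w: "minv n L w" for L :: "'a set" and w
 proof -
  define l where "l = norm (w 1)"
  have l: "l > 0" using minv_norm_pos[OF w, of 1] n by (simp add: l_def)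
  define S where "S = {ldet X | X. sublattice X L & dim X = i}"
  have lo: "c * l ^ i <= ldet X" if X: "sublattice X L" "dim X = i" for X
  proof -
   have lX: "latt X" "X <= L" using X by (auto simp: sublattice_def latt_iff_is_lattice)
   have "sep (sc (1 / l) X)" using lX minv_norm_le[OF w _ _ n] by (intro sep_sc[OF l]) (auto simp: l_def)
   hence "c <= ldet (sc (1 / l) X)" using c(2) dim_sc[of "1 / l" X] l X(2) by simp
   also have "... = ldet X / l ^ i" using det_sc[of "1 / l" X] l lX X(2) by (simp add: power_divide)
   finally show ?thesis using l by (simp add: pos_le_divide_eq)
  qed
  have lay: "sublattice (layer L w i) L" "dim (layer L w i) = i" using minv_layer[OF w i] primD(2) by (auto simp: sublattice_def latt_iff_is_lattice layer_def)
  hence ne: "S ~= {}" by (auto simp: S_def)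
  have 1: "c * l ^ i <= min_det i L" unfolding min_det_def S_def[symmetric] using lo ne by (intro cInf_greatest) (auto simp: S_def)
  have "min_det i L <= ldet (layer L w i)" unfolding min_det_def using lay lo by (intro cInf_lower bdd_belowI[of _ "c * l ^ i"]) auto
  also have "... <= (\<Prod>i=1..i. norm (w i))" by (rule layer_det_le[OF w i])
  finally have "min_det i L * l ^ (n - i) <= (\<Prod>i=1..i. norm (w i)) * (\<Prod>j=i+1..n. l)" using l by (simp add: mult_right_mono)
  also have "... <= (\<Prod>i=1..i. norm (w i)) * (\<Prod>j=i+1..n. norm (w j))" using w l by (intro mult_left_mono prod_mono prod_nonneg) (auto simp: l_def minv_def)
  also have "... = (\<Prod>j=1..n. norm (w j))"
  proof -
   have "{1..n} = {1..i} Un {i+1..n}" using i by auto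
   thus ?thesis by (simp add: prod.union_disjoint)
  qed
  also have "... <= C * ldet L" using C(2)[OF w, of n] minv_layer_top[OF w] by simp
  finally have "min_det i L / l ^ i * l ^ n <= C * ldet L" using l i by (simp add: power_add[symmetric] power_diff)
  thus ?thesis using 1 l unfolding l_def[symmetric] by (simp add: pos_le_divide_eq)
 qed
 thus ?thesis using c(1) C(1) unfolding Let_def by blast
qed

text \<open>Applied to the determinant \<open>x\<close> after normalisation, which has a positive
  lower bound: a logarithm of \<open>x\<close> in the error is harmless next to the factor
  \<open>x powr (- d)\<close> of the main term.\<close>

lemma powr_ln_bound:
 fixes c0 :: real
 assumes c0: "0 < c0" and d: "1 <= d"
 shows "EX K>0. ALL x>=c0. x powr (- real d) * (1 + abs (ln x)) <= K"
proof -
 let ?x = "1 + abs (ln c0)"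
 have "x powr (- real d) * (1 + abs (ln x)) <= 2 + c0 powr (- real d) * ?x" if x: "c0 <= x" for x
 proof (cases "1 <= x")
  case True
  have "1 + abs (ln x) <= 2 * x" using True ln_bound[of x] by simp
  also have "x powr 1 <= x powr real d" using True d by (intro powr_mono) auto
  hence "2 * x <= 2 * x powr real d" using True by simp
  finally have "x powr (- real d) * (1 + abs (ln x)) <= x powr (- real d) * (2 * x powr real d)" by (intro mult_left_mono) auto
  also have "... = 2" using True by (simp add: powr_minus)
  finally have "x powr (- real d) * (1 + abs (ln x)) <= 2" .
  moreover have "0 <= c0 powr (- real d) * ?x" by (intro mult_nonneg_nonneg) auto
  ultimately show ?thesis by linarith
 next
  case False
  have "ln c0 <= ln x" "ln x <= 0" using False x c0 by auto
  hence "abs (ln x) <= abs (ln c0)" by linarith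
  hence "x powr (- real d) * (1 + abs (ln x)) <= c0 powr (- real d) * ?x" using x c0 by (intro mult_mono powr_mono2' add_mono add_nonneg_nonneg) auto
  thus ?thesis by simp
 qed
 thus ?thesis by (intro exI[of _ "2 + c0 powr (- real d) * ?x"]) (auto intro: add_pos_nonneg)
qed

abbreviation (input) "flag_error n e d a L H ==
 abs (rcard (counted_flags e d L H) - a * H / ldet L ^ d * ln (H / (min_det e L ^ d * min_det d L ^ (n - e))))"

text \<open>The right side is a multiple of the normalised bound \<open>H'\<close>. Changing the
  argument of the logarithm from \<open>H'\<close> to \<open>H' / P\<close> costs
  \<open>ln P\<close>, and \<open>P\<close> lies between a constant and a constant times a power of
  the normalised determinant, so \<open>powr_ln_bound\<close> applies.\<close>

lemma counted_flags_bound: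
 assumes I: "Inner TYPE('a::euclidean_space) e d c C ee" and F: "Fasymp TYPE('a) n d c' C' dlt" and e: "1 <= e" "e < d" "d < n"
 shows "EX K>0. ALL (L::'a set) H. is_lattice L --> dim L = n --> norm (chosen_minimal_vectors L 1) ^ (n * d) <= H -->
  flag_error n e d (c * c') L H
   <= K * (H / norm (chosen_minimal_vectors L 1) ^ (n * d))"
proof -
 obtain K1 where K1: "K1 > 0" "!!(M::'a set) v H. sep M ==> dim M = n ==> (ALL B:prim d M. minv d B (v B)) ==> 1 <= H ==>
  abs (rcard (flg n e d (prim d M) (%B. layer B (v B) (d - e)) (%B. layer B (v B) (d - e)) H) - c * c' * ldet M powr (- real d) * H * ln H) <= K1 * H"
  using flags_sep[OF I F e] by blast
 have n1: "1 <= n" "e <= n" "d <= n" "1 <= d" using e by auto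
 obtain ce Ce where ce: "ce > 0" "Ce > 0" "!!(L::'a set) w. minv n L w ==> ce <= min_det e L / norm (w 1) ^ e & min_det e L / norm (w 1) ^ e <= Ce * (ldet L / norm (w 1) ^ n)"
  using min_det_bounds[OF n1(2,1), where ?'a = 'a] unfolding Let_def by blast
 obtain cd Cd where cd: "cd > 0" "Cd > 0" "!!(L::'a set) w. minv n L w ==> cd <= min_det d L / norm (w 1) ^ d & min_det d L / norm (w 1) ^ d <= Cd * (ldet L / norm (w 1) ^ n)"
  using min_det_bounds[OF n1(3,1), where ?'a = 'a] unfolding Let_def by blast
 obtain cn where cn: "cn > 0" "!!M::'a set. sep M ==> dim M = n ==> cn <= ldet M" using sep_det_lower by blast
 obtain K2 where K2: "K2 > 0" "!!x. cn <= x ==> x powr (- real d) * (1 + abs (ln x)) <= K2" using powr_ln_bound[OF cn(1) n1(4)] by blast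
 define Q where "Q = real d * (1 + abs (ln ce) + abs (ln Ce)) + real (n - e) * (1 + abs (ln cd) + abs (ln Cd))"
 have Q: "Q >= 0" unfolding Q_def by (intro add_nonneg_nonneg mult_nonneg_nonneg) auto
 have "flag_error n e d (c * c') L H
   <= (K1 + abs (c * c') * (K2 * Q)) * (H / norm (chosen_minimal_vectors L 1) ^ (n * d))"
  if L: "is_lattice L" "dim L = n" and H: "norm (chosen_minimal_vectors L 1) ^ (n * d) <= H" for L :: "'a set" and H
 proof -
  have lL: "latt L" using L by (simp add: latt_iff_is_lattice)
  define w where "w = chosen_minimal_vectors L"
  define a where "a = 1 / norm (w 1)"
  define v where "v B = (%i. a *\<^sub>R chosen_minimal_vectors (sc (1 / a) B) i)" for B :: "'a set"
  note N = normalised[OF lL L(2) n1(1), folded w_def, folded a_def, folded v_def]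
  define M where "M = sc a L"
  define x where "x = ldet M"
  define H' where "H' = a ^ (n * d) * H"
  define l where "l = norm (w 1)"
  have l: "l > 0" using N(2) by (simp add: a_def l_def)
  have al: "a = 1 / l" by (simp add: a_def l_def)
  have H': "1 <= H'" "H' = H / l ^ (n * d)" using H l by (auto simp: H'_def al power_divide l_def w_def)
  have xl: "x = ldet L / l ^ n" unfolding x_def M_def using det_sc[OF N(2) lL] L(2) by (simp add: al power_divide)
  have x: "cn <= x" "x > 0" using cn N(3) dim_sc[OF N(2), of L] L(2) det_pos[OF latt_sc[OF N(2) lL]] by (auto simp: x_def M_def)
  have pM: "prim d M = sc a ` prim d L" using prim_sc_bij[OF N(2)] by (auto simp: bij_betw_def M_def)
  have "card (flg n e d (prim d M) (%B. layer B (v B) (d - e)) (%B. layer B (v B) (d - e)) H') = card (counted_flags e d L H)"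
   unfolding counted_flags_flg[OF lL L(2)] H'_def pM by (rule flg_sc[OF N(2) lL order_refl n1(2)]) (rule N(7))+
  hence 1: "abs (rcard (counted_flags e d L H) - c * c' * x powr (- real d) * H' * ln H') <= K1 * H'"
   using K1(2)[of M v H'] N(3,6) dim_sc[OF N(2), of L] L(2) H' unfolding M_def x_def by auto
  define me where "me = min_det e L / l ^ e"
  define md where "md = min_det d L / l ^ d"
  have me: "ce <= me" "me <= Ce * x" and md: "cd <= md" "md <= Cd * x" using ce(3)[OF N(1)] cd(3)[OF N(1)] by (auto simp: me_def md_def xl l_def)
  have lnb: "abs (ln m) <= (1 + abs (ln c1) + abs (ln C1)) * (1 + abs (ln x))" if m: "0 < c1" "c1 <= m" "m <= C1 * x" "0 < C1" for m c1 C1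
  proof -
   have "ln c1 <= ln m" "ln m <= ln (C1 * x)" using m by auto
   moreover have "ln (C1 * x) = ln C1 + ln x" using m x by (simp add: ln_mult)
   ultimately have "abs (ln m) <= abs (ln c1) + abs (ln C1) + abs (ln x)" by linarith
   also have "... <= (1 + abs (ln c1) + abs (ln C1)) * (1 + abs (ln x))" by (simp add: algebra_simps)
   finally show ?thesis .
  qed
  define P where "P = me ^ d * md ^ (n - e)"
  have mp: "me > 0" "md > 0" using me md ce cd by linarith+
  have P: "P > 0" unfolding P_def using mp by (intro mult_pos_pos zero_less_power)
  have "abs (ln P) <= real d * abs (ln me) + real (n - e) * abs (ln md)"
   using mp abs_triangle_ineq[of "real d * ln me" "real (n - e) * ln md"] by (simp add: P_def ln_mult ln_realpow abs_mult)
  also have "... <= real d * ((1 + abs (ln ce) + abs (ln Ce)) * (1 + abs (ln x))) + real (n - e) * ((1 + abs (ln cd) + abs (ln Cd)) * (1 + abs (ln x)))"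
   using lnb[OF ce(1) me ce(2)] lnb[OF cd(1) md cd(2)] by (intro add_mono mult_left_mono) auto
  also have "... = Q * (1 + abs (ln x))" by (simp only: Q_def distrib_right mult.assoc)
  finally have "x powr (- real d) * abs (ln P) <= x powr (- real d) * (Q * (1 + abs (ln x)))" by (rule mult_left_mono) auto
  also have "... = Q * (x powr (- real d) * (1 + abs (ln x)))" by simp
  also have "... <= Q * K2" using K2(2)[OF x(1)] Q by (intro mult_left_mono) auto
  finally have "abs (c * c') * H' * (x powr (- real d) * abs (ln P)) <= abs (c * c') * H' * (Q * K2)" using H'(1) by (intro mult_left_mono) auto
  moreover have "c * c' * x powr (- real d) * H' * ln H' - c * c' * x powr (- real d) * H' * ln (H' / P) = c * c' * x powr (- real d) * H' * ln P"
   using H'(1) P by (simp add: ln_div right_diff_distrib)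
  moreover have "abs (c * c' * x powr (- real d) * H' * ln P) = abs (c * c') * H' * (x powr (- real d) * abs (ln P))" using H'(1) by (simp add: abs_mult)
  ultimately have "abs (rcard (counted_flags e d L H) - c * c' * x powr (- real d) * H' * ln (H' / P)) <= K1 * H' + abs (c * c') * H' * (Q * K2)" using 1 by linarith
  also have "... = (K1 + abs (c * c') * (K2 * Q)) * H'" by (simp add: distrib_right)
  also have "c * c' * x powr (- real d) * H' = c * c' * H / ldet L ^ d" using l x by (simp add: powr_minus_divide powr_realpow H'(2) xl power_divide power_mult)
  also have "H' / P = H / (min_det e L ^ d * min_det d L ^ (n - e))"
  proof -
   have "n * d = e * d + d * (n - e)" using n1(2) by (simp add: mult.commute[of d] distrib_right[symmetric])
   thus ?thesis using l by (simp add: H'(2) P_def me_def md_def power_divide power_add power_mult)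
  qed
  finally show ?thesis unfolding H'(2) l_def w_def .
 qed
 moreover have "K1 + abs (c * c') * (K2 * Q) > 0" using K1 K2 Q by (intro add_pos_nonneg) auto
 ultimately show ?thesis by blast
qed

text \<open>\<open>Delta\<close>, the count and the argument of the logarithm are unchanged when
  \<open>H\<close> is scaled along with the lattice, so the formula passes from the normalised
  lattice to \<open>L\<close> with the same constant.\<close>

lemma thunder_flags_bound:
 assumes I: "Inner TYPE('a::euclidean_space) e d c C ee" and F: "Fasymp TYPE('a) n d c' C' dlt" and e: "1 <= e" "e < d" "d < n" and n: "n = DIM('a)"
 shows "thunder_asymptotics TYPE('a) d e (c * c')"
proof -
 define b where "b = b_const n d"
 let ?x = "real d - b * (real n - real d) / real n"
 have b: "b > 0" unfolding b_def b_const_def using e by (simp add: less_max_iff_disj)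
 obtain K where K: "K > 0" "!!(M::'a set) v w. sep M ==> minv n M w ==> norm (w 1) = 1 ==> (ALL B:prim d M. minv d B (v B)) ==> (\<forall>\<^sub>F H in at_top.
  abs (rcard (flg n e d (good n e d M w) (%B. layer B (v B) (d - e)) (%B. B Int layer M w (n - e)) H) - c * c' * ldet M powr (- real d) * H * ln (H / ldet M ^ d))
   <= K * (ldet M powr (- real d) * Delta n d M w powr b) * H)" using thunder_sep[OF I F e b] by blast
 have n1: "1 <= n" "e <= n" using e by auto
 have "\<forall>\<^sub>F H in at_top. abs (rcard (thunder_flags e d L H) - c * c' * H / ldet L ^ d * ln (H / ldet L ^ d))
   <= K * (H / (ldet L powr ?x * ldet (minimal_sublattice L (n - d)) powr b))" if L: "is_lattice L" "dim L = n" for L :: "'a set"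
 proof -
  have lL: "latt L" using L by (simp add: latt_iff_is_lattice)
  define w where "w = chosen_minimal_vectors L"
  define a where "a = 1 / norm (w 1)"
  define v where "v B = (%i. a *\<^sub>R chosen_minimal_vectors (sc (1 / a) B) i)" for B :: "'a set"
  note N = normalised[OF lL L(2) n1(1), folded w_def, folded a_def, folded v_def]
  define M where "M = sc a L"
  define w' where "w' = (%i. a *\<^sub>R w i)"
  let ?y = "ldet M powr (- real d) * Delta n d M w' powr b"
  define D where "D = ldet L"
  have D: "D > 0" using det_pos[OF lL] by (simp add: D_def)
  have x: "ldet M = a ^ n * D" unfolding M_def D_def using det_sc[OF N(2) lL] L(2) by simp
  have Dl: "Delta n d M w' = Delta n d L w"
  proof -
   have "ldet (layer M w' (n - d)) = a ^ (n - d) * ldet (layer L w (n - d))"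
    using det_sc[OF N(2) minv_layer(3)[OF N(1)], of "n - d"] primD(2)[OF minv_layer(1)[OF N(1)], of "n - d"] by (simp add: M_def w'_def layer_sc[OF N(2)])
   moreover have "(a ^ n * D) powr (real (n - d) / real n) = a ^ (n - d) * D powr (real (n - d) / real n)" using N(2) D e by (simp add: powr_mult powr_realpow[symmetric] powr_powr)
   ultimately show ?thesis using N(2) x by (simp add: Delta_def D_def)
  qed
  have "filterlim (%H. a ^ (n * d) * H) at_top at_top" using N(2) by (intro filterlim_tendsto_pos_mult_at_top[OF tendsto_const] filterlim_ident) auto
  moreover have "sep M" "minv n M w'" "norm (w' 1) = 1" "ALL B:prim d M. minv d B (v B)" using N by (auto simp: M_def w'_def)
  ultimately have ev: "\<forall>\<^sub>F H in at_top. abs (rcard (flg n e d (good n e d M w') (%B. layer B (v B) (d - e)) (%B. B Int layer M w' (n - e)) (a ^ (n * d) * H)) - c * c' * ldet M powr (- real d) * (a ^ (n * d) * H) * ln (a ^ (n * d) * H / ldet M ^ d))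
   <= K * ?y * (a ^ (n * d) * H)" using eventually_compose_filterlim[OF K(2)] by blast
  show ?thesis using ev
  proof eventually_elim
   case (elim H)
   have Mp: "ldet M ^ d = a ^ (n * d) * D ^ d" unfolding x by (simp add: power_mult_distrib power_mult)
   have xp: "ldet M powr (- real d) * (a ^ (n * d) * H) = H / D ^ d" using N(2) D Mp by (simp add: powr_minus_divide powr_realpow x power_mult_distrib power_mult)
   have 1: "a ^ (n * d) * H / ldet M ^ d = H / D ^ d" unfolding Mp using N(2) by simp
   have "card (flg n e d (good n e d M w') (%B. layer B (v B) (d - e)) (%B. B Int layer M w' (n - e)) (a ^ (n * d) * H)) = card (thunder_flags e d L H)"
    unfolding thunder_flags_flg[OF lL L(2) e(2,3)] M_def w'_def good_sc[OF N(2)] w_def[symmetric]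
   proof (rule flg_sc[OF N(2) lL _ n1(2)])
    show "good n e d L w <= prim d L" by (auto simp: good_def)
    show "layer (sc a B) (v (sc a B)) (d - e) = sc a (minimal_sublattice B (d - e))" for B by (rule N(7))
    show "sc a B Int layer (sc a L) (%i. a *\<^sub>R w i) (n - e) = sc a (B Int minimal_sublattice L (n - e))" for B
     unfolding layer_sc[OF N(2)] minimal_sublattice_layer w_def[symmetric] by (rule sc_Int[OF N(2)])
   qed
   moreover have "c * c' * ldet M powr (- real d) * (a ^ (n * d) * H) = c * c' * H / D ^ d" unfolding mult.assoc[of "c * c'"] xp by simp
   moreover have "K * ?y * (a ^ (n * d) * H) = K * (ldet M powr (- real d) * (a ^ (n * d) * H) * Delta n d M w' powr b)" by simp
   moreover have "H / D ^ d * Delta n d L w powr b = H / (D powr ?x * ldet (layer L w (n - d)) powr b)"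
   proof -
    have "real d - b * (real n - real d) / real n = real d - real (n - d) / real n * b" using e by (simp add: of_nat_diff mult.commute)
    hence "D powr ?x = D ^ d / D powr (real (n - d) / real n * b)" using D by (simp only: powr_diff powr_realpow)
    moreover have "Delta n d L w powr b = D powr (real (n - d) / real n * b) / ldet (layer L w (n - d)) powr b"
     using det_pos[OF minv_layer(3)[OF N(1)], of "n - d"] by (simp add: Delta_def D_def powr_divide powr_powr)
    ultimately show ?thesis by simp
   qed
   ultimately show ?case using elim unfolding 1 xp Dl by (simp only: D_def w_def minimal_sublattice_layer)
  qed
 qed
 thus ?thesis unfolding thunder_asymptotics_def Let_def n[symmetric] b_def[symmetric] using K(1) by blast
qed

text \<open>One lattice suffices, and the integer lattice is taken: two admissible constants differ
  by at most a multiple of the reciprocal of \<open>ln (H / D)\<close>, which tends to zero.\<close>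

lemma thunder_unique:
 assumes "thunder_asymptotics TYPE('a::euclidean_space) d e x" "thunder_asymptotics TYPE('a) d e y"
 shows "x = y"
proof -
 define L where "L = {SUM b:Basis. of_int (z b) *\<^sub>R b | z :: 'a => int. True}"
 have B: "lattice_basis Basis L" unfolding lattice_basis_def L_def using independent_Basis by blast
 hence L: "is_lattice L" unfolding is_lattice_def by blast
 have "dim L = DIM('a)" using lattice_basis_subset[OF B] by (metis dim_UNIV dim_span dim_subset dim_subset_UNIV le_antisym span_Basis)
 define D where "D = ldet L ^ d"
 have D: "D > 0" using det_pos[of L] L by (simp add: D_def latt_iff_is_lattice)
 have ev: "EX k. \<forall>\<^sub>F H in at_top. abs (rcard (thunder_flags e d L H) - a * H / D * ln (H / D)) <= k * H" if a: "thunder_asymptotics TYPE('a) d e a" for a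
 proof -
  from a obtain C p where "\<forall>\<^sub>F H in at_top. abs (rcard (thunder_flags e d L H) - a * H / D * ln (H / D)) <= C * (H / p)"
   using L \<open>dim L = DIM('a)\<close> unfolding thunder_asymptotics_def Let_def D_def by blast
  thus ?thesis by (intro exI[of _ "C / p"]) simp
 qed
 obtain k1 k2 where k: "\<forall>\<^sub>F H in at_top. abs (rcard (thunder_flags e d L H) - x * H / D * ln (H / D)) <= k1 * H"
  "\<forall>\<^sub>F H in at_top. abs (rcard (thunder_flags e d L H) - y * H / D * ln (H / D)) <= k2 * H" using ev assms by blast
 have "filterlim (%H. ln (H / D)) at_top at_top" using D by real_asymp
 hence "\<forall>\<^sub>F H in at_top. (k1 + k2 + 1) * D / abs (x - y) <= ln (H / D)" by (simp add: filterlim_at_top)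
 from eventually_happens'[OF trivial_limit_at_top_linorder eventually_conj[OF this eventually_conj[OF eventually_conj[OF k] eventually_gt_at_top[of 0]]]]
 obtain H where H: "(k1 + k2 + 1) * D / abs (x - y) <= ln (H / D)" "H > 0"
  "abs (rcard (thunder_flags e d L H) - x * H / D * ln (H / D)) <= k1 * H" "abs (rcard (thunder_flags e d L H) - y * H / D * ln (H / D)) <= k2 * H" by blast
 show ?thesis
 proof (rule ccontr)
  assume "x ~= y"
  hence "(k1 + k2 + 1) * D <= ln (H / D) * abs (x - y)" using H(1) by (simp add: pos_divide_le_eq)
  hence "H / D * ((k1 + k2 + 1) * D) <= H / D * (ln (H / D) * abs (x - y))" using H(2) D by (intro mult_left_mono) auto
  hence "(k1 + k2 + 1) * H <= abs (x - y) * (H / D * ln (H / D))" using D by (simp add: mult_ac)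
  also have "... <= abs ((x - y) * (H / D * ln (H / D)))" unfolding abs_mult[of "x - y"] by (rule mult_left_mono[OF abs_ge_self abs_ge_zero])
  also have "... = abs (x * H / D * ln (H / D) - y * H / D * ln (H / D))" by (simp add: algebra_simps diff_divide_distrib)
  also have "... <= k1 * H + k2 * H" using H(3,4) by linarith
  finally show False using H(2) by (simp add: distrib_right)
 qed
qed

text \<open>The bound on the last minimum is used only through
  \<open>norm (w 1) ^ (n * d) <= H\<close>. In the error \<open>norm (w 1)\<close> may be replaced
  by the determinant of the first layer, which is no larger and occurs with a negative
  exponent.\<close>

lemma counted_flags_asymp:
 assumes e: "1 <= e" "e < d" "d < n" and n: "n = DIM('a::euclidean_space)"
 shows "EX K>0. ALL (L::'a set) H. is_lattice L --> dim L = n --> 0 < H --> succ_min n L < H powr (1 / (real n * real d)) -->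
  flag_error n e d (thunder_const TYPE('a) d e) L H
   <= K * (ldet (minimal_sublattice L 1) powr (- (real d * real n)) * H)"
proof -
 let ?x = "- (real d * real n)"
 obtain c C ee where I: "Inner TYPE('a) e d c C ee" using Inner_exists[OF e(1,2)] by blast
 obtain c' C' dlt where F: "Fasymp TYPE('a) n d c' C' dlt" using Fasymp_exists[of d n] e by auto
 have th: "thunder_const TYPE('a) d e = c * c'" unfolding thunder_const_def using thunder_flags_bound[OF I F e n] thunder_unique by blast
 obtain K where K: "K > 0" "!!(L::'a set) H. is_lattice L ==> dim L = n ==> norm (chosen_minimal_vectors L 1) ^ (n * d) <= H ==>
  flag_error n e d (c * c') L H
   <= K * (H / norm (chosen_minimal_vectors L 1) ^ (n * d))" using counted_flags_bound[OF I F e] by blast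
 have "flag_error n e d (c * c') L H
   <= K * (ldet (minimal_sublattice L 1) powr ?x * H)" if L: "is_lattice L" "dim L = n" and H: "0 < H" "succ_min n L < H powr (1 / (real n * real d))" for L :: "'a set" and H
 proof -
  have lL: "latt L" using L by (simp add: latt_iff_is_lattice)
  define w where "w = chosen_minimal_vectors L"
  have mv: "minimal_vectors L w" unfolding w_def chosen_minimal_vectors_def by (rule someI_ex[OF minimal_vectors_exist[OF lL]])
  hence w: "minv n L w" using minimal_vectors_minv[OF lL] L(2) by simp
  have l: "norm (w 1) > 0" using minv_norm_pos[OF w] e by simp
  have "norm (w 1) <= norm (w n)" using w e unfolding minv_def by simp
  also have "norm (w n) = succ_min n L" using mv L(2) e by (simp add: minimal_vectors_def)
  finally have "norm (w 1) <= H powr (1 / (real n * real d))" using H by simp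
  hence "norm (w 1) powr real (n * d) <= (H powr (1 / (real n * real d))) powr real (n * d)" by (intro powr_mono2) auto
  also have "... = H" using H e by (simp add: powr_powr)
  finally have lH: "norm (w 1) ^ (n * d) <= H" using l by (simp only: powr_realpow)
  have d1: "ldet (minimal_sublattice L 1) > 0" "ldet (minimal_sublattice L 1) <= norm (w 1)"
   unfolding minimal_sublattice_layer w_def[symmetric] using det_pos[OF minv_layer(3)[OF w, of 1]] layer_det_le[OF w, of 1] e by auto
  have "H / norm (w 1) ^ (n * d) = norm (w 1) powr ?x * H" using l by (simp add: powr_minus_divide powr_realpow[symmetric] mult.commute)
  also have "... <= ldet (minimal_sublattice L 1) powr ?x * H" using d1 H by (intro mult_right_mono powr_mono2') auto
  finally have "K * (H / norm (w 1) ^ (n * d)) <= K * (ldet (minimal_sublattice L 1) powr ?x * H)" using K(1) by (intro mult_left_mono) auto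
  thus ?thesis using K(2)[OF L lH[unfolded w_def]] by (simp only: w_def)
 qed
 thus ?thesis using K(1) unfolding th by blast
qed

theorem corollary1p1:
  fixes n :: nat
  assumes "n = CARD('n::finite)" and "n \<ge> 3"
  shows "\<exists>c>0. \<exists>C>0. \<forall>e d. 1 \<le> e \<and> e < d \<and> d < n \<longrightarrow>
    (\<exists>(E :: nat set) (\<gamma> :: nat \<Rightarrow> real) (\<beta> :: nat \<Rightarrow> nat \<Rightarrow> real).
       finite E \<and> card E \<le> 3 * n ^ (3 * n + 1) \<and>
       (\<forall>j\<in>E. \<gamma> j \<ge> 0 \<and> (\<forall>i\<in>{1..n}. \<beta> j i \<ge> 0) \<and>
          (\<Sum>i=1..n. real i * \<beta> j i) = real d * real n * \<gamma> j) \<and>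
       (\<forall>(L :: (real ^ 'n) set) H. is_lattice L \<and> dim L = n \<and> H > 0 \<and>
            succ_min n L < c * H powr (1 / (real n * real d)) \<longrightarrow>
          \<bar>real (card (counted_flags e d L H))
             - thunder_const TYPE(real ^ 'n) d e * H / lattice_det L ^ d
               * ln (H / (min_det e L ^ d * min_det d L ^ (n - e)))\<bar>
          \<le> C * (\<Sum>j\<in>E. (\<Prod>i=1..n. lattice_det (minimal_sublattice L i) powr (- \<beta> j i))
                   * H powr \<gamma> j)) \<and>
       Max (\<gamma> ` E) = 1 \<and> \<gamma> ` E - {1} \<noteq> {} \<and>
       (let next_largest = Max (\<gamma> ` E - {1}) in
          (next_largest = 1 - b_const n d / real n \<or>
           next_largest = 1 - b_const d e * (real n - real e) / (real n * real d) \<or>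
           next_largest = 1 - 1 / real n * (1 - 2 * b_const d e / real d
                                + (1 - b_const d e) / (real n - real e))) \<and>
          (real d \<le> real n / 2 \<longrightarrow>
             next_largest = 1 - b_const n d / real n \<and>
             1 - b_const n d / real n = 1 - 1 / (real d * real n))))"
proof -
 have n: "n = DIM(real ^ 'n)" using assms(1) by simp
 define P where "P e d K \<longleftrightarrow> (ALL (L::(real ^ 'n) set) H. is_lattice L --> dim L = n --> 0 < H --> succ_min n L < H powr (1 / (real n * real d)) -->
  flag_error n e d (thunder_const TYPE(real ^ 'n) d e) L H
   <= K * (lattice_det (minimal_sublattice L 1) powr (- (real d * real n)) * H))" for e d K
 have "EX K>0. P e d K" if "1 <= e" "e < d" "d < n" for e d unfolding P_def by (rule counted_flags_asymp[OF that n])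
 then obtain K where K: "!!e d. 1 <= e ==> e < d ==> d < n ==> 0 < K e d & P e d (K e d)" by metis
 \<comment> \<open>The constant may depend on \<open>n\<close> only, so the finitely many constants
   for the pairs \<open>(e, d)\<close> are added up.\<close>
 define C where "C = 1 + (SUM (e, d):{..<n} \<times> {..<n}. abs (K e d))"
 have C: "C > 0" unfolding C_def by (intro add_pos_nonneg sum_nonneg) auto
 have KC: "K e d <= C" if "e < n" "d < n" for e d using member_le_sum[of "(e, d)" "{..<n} \<times> {..<n}" "%(e, d). abs (K e d)"] that by (auto simp: C_def)
 show ?thesis
 \<comment> \<open>The constant in the condition on \<open>succ_min\<close> can be taken to be one,
   the value built into \<open>P\<close>.\<close>
 proof (rule exI[of _ 1], rule conjI[OF zero_less_one], rule exI[of _ C], rule conjI[OF C], intro allI impI, goal_cases)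
  case (1 e d)
  note ed = 1
  define b where "b = b_const n d"
  have rn: "real d < real n" "1 <= real n - real d" "1 <= real d" "0 < real n" using ed by auto
  have b: "0 < b" "b <= 1" unfolding b_def b_const_def using rn by (auto simp: less_max_iff_disj)
  \<comment> \<open>Index \<open>0\<close> carries the actual error term, of exponent one. Index
    \<open>1\<close> adds a nonnegative term whose exponent is the prescribed second largest
    value.\<close>
  define ga where "ga j = (if j = 0 then 1 else 1 - b / real n)" for j :: nat
  \<comment> \<open>All weight is put on the first layer, so the weighted sum consists of the single
    term with \<open>i = 1\<close>.\<close>
  define be where "be j i = (if i = 1 then real d * real n * ga j else 0)" for j i :: nat
  have b1: "b / real n <= 1" "b / real n > 0" using b rn by auto
  have g: "ga ` {0, 1} = {1, 1 - b / real n}" by (auto simp: ga_def)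
  have g': "ga ` {0, 1} - {1} = {1 - b / real n}" unfolding g using b1 by auto
  have ga: "0 <= ga j" for j using b1 by (simp add: ga_def)
  have err: "flag_error n e d (thunder_const TYPE(real ^ 'n) d e) L H
     <= C * (SUM j:{0, 1}. (\<Prod>i=1..n. lattice_det (minimal_sublattice L i) powr (- be j i)) * H powr ga j)"
   if L: "is_lattice L & dim L = n & H > 0 & succ_min n L < 1 * H powr (1 / (real n * real d))" for L :: "(real ^ 'n) set" and H
  proof -
   define x where "x = lattice_det (minimal_sublattice L 1) powr (- (real d * real n)) * H"
   have lL: "latt L" using L by (simp add: latt_iff_is_lattice)
   have dl: "lattice_det (minimal_sublattice L i) > 0" if "i <= n" for i unfolding minimal_sublattice_layer by (rule det_pos, rule minv_layer(3)[OF minv_chosen[OF lL]]) (use that L in simp)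
   have "(\<Prod>i=1..n. lattice_det (minimal_sublattice L i) powr (- be 0 i)) = (\<Prod>i=1..n. if i = 1 then lattice_det (minimal_sublattice L 1) powr (- (real d * real n)) else 1)"
    using dl by (intro prod.cong refl) (auto simp: be_def ga_def less_imp_neq[THEN not_sym])
   also have "... = lattice_det (minimal_sublattice L 1) powr (- (real d * real n))" using ed by (simp add: prod.delta)
   finally have x: "(\<Prod>i=1..n. lattice_det (minimal_sublattice L i) powr (- be 0 i)) * H powr ga 0 = x" using L by (simp add: x_def ga_def)
   have x0: "0 <= x" using L by (simp add: x_def)
   have "flag_error n e d (thunder_const TYPE(real ^ 'n) d e) L H <= K e d * x" using K[of e d] ed L unfolding P_def x_def by simp
   also have "... <= C * x" using KC[of e d] ed x0 by (intro mult_right_mono) auto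
   also have "... <= C * (x + (\<Prod>i=1..n. lattice_det (minimal_sublattice L i) powr (- be 1 i)) * H powr ga 1)"
    using C by (intro mult_left_mono) (auto intro!: mult_nonneg_nonneg prod_nonneg)
   also have "... = C * (SUM j:{0, 1}. (\<Prod>i=1..n. lattice_det (minimal_sublattice L i) powr (- be j i)) * H powr ga j)" using x by simp
   finally show ?thesis .
  qed
  have card_2: "card {0, 1::nat} = 2" by simp
  have "(1::nat) <= n ^ (3 * n + 1)" using ed by simp
  hence card: "card {0, 1::nat} <= 3 * n ^ (3 * n + 1)" unfolding card_2 by linarith
  have sum: "(\<Sum>i=1..n. real i * be j i) = real d * real n * ga j" for j
  proof -
   have "(\<Sum>i=1..n. real i * be j i) = (\<Sum>i=1..n. if i = 1 then real d * real n * ga j else 0)" by (intro sum.cong) (auto simp: be_def)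
   thus ?thesis using ed by simp
  qed
  \<comment> \<open>In this range \<open>1 / d\<close> is the larger of the two entries in the
    maximum defining \<open>b_const n d\<close>.\<close>
  have half: "b = 1 / real d" if "real d <= real n / 2" unfolding b_def b_const_def using that rn by (intro max_absorb1 divide_left_mono) auto
  show ?case
  proof (intro exI[of _ "{0, 1}"] exI[of _ ga] exI[of _ be] conjI ballI allI impI)
   show "Max (ga ` {0, 1}) = 1" unfolding g using b1 by simp
   show "let next_largest = Max (ga ` {0, 1} - {1}) in
     (next_largest = 1 - b_const n d / real n |
     next_largest = 1 - b_const d e * (real n - real e) / (real n * real d) |
     next_largest = 1 - 1 / real n * (1 - 2 * b_const d e / real d
                + (1 - b_const d e) / (real n - real e))) &
     (real d <= real n / 2 -->
      next_largest = 1 - b_const n d / real n &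
      1 - b_const n d / real n = 1 - 1 / (real d * real n))" unfolding g' Let_def b_def[symmetric] using half by simp
   show "0 <= be j i" for j i using ga[of j] by (simp add: be_def)
  qed (use card g' ga sum err in auto)
 qed
qed

end
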